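(* Let $\bar p>2$. Assume the following. (1) Exponential family. (a) There exist continuous functions $\phi:\Theta\to\mathbb{R}$, $\psi:\Theta\to\mathbb{R}^d$ and $S:\mathbb{X}\times\mathbb{X}\times\mathbb{Y}\to\mathbb{R}^d$ such that $\log m_\theta(x,x')+\log g_\theta(x',y)=\phi(\theta)+\langle S(x,x',y),\psi(\theta)\rangle$ for all $\theta,x,x',y$. (b) There is an open set $\mathcal{S}\subset\mathbb{R}^d$ containing the convex hull of $S(\mathbb{X}\times\mathbb{X}\times\mathbb{Y})$. (c) There is a continuous function $\bar\theta:\mathcal{S}\to\Theta$ such that for every $s\in\mathcal{S}$, $\bar\theta(s)=\mathrm{argmax}_{\theta\in\Theta}\{\phi(\theta)+\langle s,\psi(\theta)\rangle\}$ (the maximizer being unique). (2) Strong mixing. There exist $\sigma_-,\sigma_+$ with $0<\sigma_-\le m_\theta(x,x')\le\sigma_+$ for all $(x,x')\in\mathbb{X}^2$, $\theta\in\Theta$. (3) Moments. $\mathbb{E}\big[\sup_{(x,x')\in\mathbb{X}^2}|S(x,x',Y_0)|^{\bar p}\big]<\infty$. (4) Observations. (a) $\mathbf{Y}$ is a $\beta$-mixing stationary sequence such that there exist $C_0\in[0,1)$ and $\beta\in(0,1)$ with $\beta^{\mathbf{Y}}(n)\le C_0\beta^n$ for all $n\ge0$, where $\beta^{\mathbf{Y}}(n)$ is the coefficient defined in the context. (b) $\mathbb{E}[|\log b_-(Y_0)|+|\log b_+(Y_0)|]<\infty$, where $b_-(y)=\inf_{\theta\in\Theta}\int g_\theta(x,y)\lambda(\mathrm{d}x)$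 and $b_+(y)=\sup_{\theta\in\Theta}\int g_\theta(x,y)\lambda(\mathrm{d}x)$. Let $\mathrm{R}(\theta)=\bar\theta(\bar{\mathrm S}(\theta))$, $\mathcal{L}=\{\theta\in\Theta:\mathrm{R}(\theta)=\theta\}$ and $\mathrm{W}(\theta)=\exp\{\ell(\theta)\}$, and assume in addition that $\mathrm{W}(\mathcal{L})$ has an empty interior. Then for any initial value $\check\theta_0\in\Theta$, there exists $w_\star$ such that the sequence defined by $\check\theta_k=\mathrm{R}(\check\theta_{k-1})$, $k\ge1$, converges to the set $\{\theta\in\mathcal{L}:\mathrm{W}(\theta)=w_\star\}$. If in addition there exist $c>0$ and $a>1$ with $\tau_n=\lfloor cn^a\rfloor$ for all $n\ge1$, and there exists $b\ge(a+1)/(2a)$ such that, for any $n\ge0$, $\|S_n-\widetilde S_n\|_{\bar p}=O(\tau_{n+1}^{-b})$, then the Monte Carlo BOEM sequence $\{\theta_n\}_{n\ge0}$ converges $\mathbb{P}$-a.s. to the same stationary points, i.e. to the set $\{\theta\in\mathcal{L}:\mathrm{W}(\theta)=w_\star\}$.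
   Context: Convergence of a sequence to a set means that the distance to the set tends to $0$. Model. $\Theta$ is a compact subset of $\mathbb{R}^{d_\theta}$; $(\mathbb{X},\mathcal{X})$ and $(\mathbb{Y},\mathcal{Y})$ are general state spaces with their $\sigma$-fields (and topologies, with respect to which continuity is understood); $\lambda$ is a finite measure on $(\mathbb{X},\mathcal{X})$ and $\mu$ a $\sigma$-finite measure on $(\mathbb{Y},\mathcal{Y})$. For $\theta\in\Theta$, $m_\theta(x,\cdot)$ is a Markov transition density with respect to $\lambda$ and $g_\theta(x,\cdot)$ is a transition density from $\mathbb{X}$ to $\mathbb{Y}$ with respect to $\mu$. Observations. $\mathbf{Y}=\{Y_k\}_{k\in\mathbb{Z}}$ is a $\mathbb{Y}$-valued process on a probability space $(\Omega,\mathcal{F},\mathbb{P})$, not necessarily the observation process of a hidden Markov model; $\mathbb{E}$ is expectation under $\mathbb{P}$ and $\|Z\|_p=(\mathbb{E}|Z|^p)^{1/p}$. With $\mathcal{F}^{\mathbf{Y}}_k=\sigma(Y_u,u\le k)$ and $\mathcal{G}^{\mathbf{Y}}_k=\sigma(Y_u,u\ge k)$, the mixing coefficients are $\beta^{\mathbf{Y}}(n)=\sup_{u\in\mathbb{Z}}\sup_{B\in\mathcal{G}^{\mathbf{Y}}_{u+n}}\mathbb{E}\big[|\mathbb{P}(B|\mathcal{F}^{\mathbf{Y}}_u)-\mathbb{P}(B)|\big]$, $n\ge0$. Smoothing. For a probability distribution $\chi$ on $\mathbb{X}$, integers $r<s\le t$, $\mathbf{y}\in\mathbb{Y}^{\mathbb{Z}}$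 and a function $h$ on $\mathbb{X}^2\times\mathbb{Y}$, $$\Phi^{\chi,r}_{\theta,s,t}(h,\mathbf{y})=\frac{\int\chi(\mathrm{d}x_r)\prod_{i=r}^{t-1}\{m_\theta(x_i,x_{i+1})g_\theta(x_{i+1},y_{i+1})\}\,h(x_{s-1},x_s,y_s)\,\lambda(\mathrm{d}x_{r+1:t})}{\int\chi(\mathrm{d}x_r)\prod_{i=r}^{t-1}\{m_\theta(x_i,x_{i+1})g_\theta(x_{i+1},y_{i+1})\}\,\lambda(\mathrm{d}x_{r+1:t})}.$$ For integers $T\ge 0$, $\tau\ge1$: $\bar S^{\chi,T}_\tau(\theta,\mathbf{Y})=\frac1\tau\sum_{t=T+1}^{T+\tau}\Phi^{\chi,T}_{\theta,t,T+\tau}(S,\mathbf{Y})$. Under the hypotheses, $\Phi^{\chi,-\tau-1}_{\theta,0,\tau}(S,\mathbf{Y})$ converges $\mathbb{P}$-a.s. as $\tau\to\infty$ to a random variable $\mathsf{S}(\theta,\mathbf{Y})$ not depending on $\chi$, and $\bar{\mathrm S}(\theta):=\mathbb{E}[\mathsf{S}(\theta,\mathbf{Y})]$. Limiting log-likelihood. For $m\ge0$ and a probability distribution $\chi$ on $\mathbb{X}$, $$p^\chi_\theta(Y_1|Y_{-m:0})=\frac{\int\chi(\mathrm{d}x_{-m})g_\theta(x_{-m},Y_{-m})\prod_{i=-m+1}^{1}\{m_\theta(x_{i-1},x_i)g_\theta(x_i,Y_i)\}\lambda(\mathrm{d}x_{-m+1:1})}{\int\chi(\mathrm{d}x_{-m})g_\theta(x_{-m},Y_{-m})\prod_{i=-m+1}^{0}\{m_\theta(x_{i-1},x_i)g_\theta(x_i,Y_i)\}\lambda(\mathrm{d}x_{-m+1:0})}.$$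 It is known (Douc, Moulines and Rydén, 2004) that under the hypotheses $\log p^\chi_\theta(Y_1|Y_{-m:0})$ converges a.s. as $m\to\infty$ to a random variable $\log p_\theta(Y_1|Y_{-\infty:0})$ not depending on $\chi$; $\ell(\theta):=\mathbb{E}[\log p_\theta(Y_1|Y_{-\infty:0})]$. Block Online EM (BOEM) algorithm with Monte Carlo approximation. $\{\tau_n\}_{n\ge1}$ is a sequence of positive integers tending to $+\infty$, $T_0=0$, $T_n=\sum_{k=1}^n\tau_k$, $\{\chi_n\}_{n\ge0}$ are probability distributions on $\mathbb{X}$. Given $\theta_0\in\Theta$, for $n\ge0$: $S_n=\bar S^{\chi_n,T_n}_{\tau_{n+1}}(\theta_n,\mathbf{Y})$, $\widetilde S_n$ is a Monte Carlo approximation of $S_n$, and $\theta_{n+1}=\bar\theta(\widetilde S_n)$. With $\mathcal{H}_{T_n}$ the $\sigma$-algebra generated by the random variables, independent of $\mathbf{Y}$, used to produce the Monte Carlo approximations of $S_0,\dots,S_{n-1}$, and $\widetilde{\mathcal F}_{T_n}=\sigma(\mathcal{F}^{\mathbf{Y}}_{T_n},\mathcal{H}_{T_n})$, $\theta_n$ is $\widetilde{\mathcal F}_{T_n}$-measurable and $\widetilde S_n$ is $\widetilde{\mathcal F}_{T_{n+1}}$-measurable.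
   Formalization: For the Monte Carlo BOEM sequence, the level w⋆ may be random and need not equal the w⋆ of the deterministic sequence; with the same w⋆ the claim fails when W takes several values on L. *)

theory Defs
  imports "HOL-Probability.Probability" "HOL-Library.Landau_Symbols"
begin

text \<open>
  Convergence of a sequence to a set. The distance to the empty set is infinite,
  whereas \<^const>\<open>infdist\<close> returns 0 there, hence the guard.
\<close>

definition converges_to_set :: "(nat \<Rightarrow> 'a::metric_space) \<Rightarrow> 'a set \<Rightarrow> bool" where
  "converges_to_set x A \<longleftrightarrow> A \<noteq> {} \<and> (\<lambda>n. infdist (x n) A) \<longlonglongrightarrow> 0"

definition Lp_norm :: "'w measure \<Rightarrow> real \<Rightarrow> ('w \<Rightarrow> 'a::real_normed_vector) \<Rightarrow> real" where
  "Lp_norm P p Z = (\<integral>\<omega>. norm (Z \<omega>) powr p \<partial>P) powr (1 / p)"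

text \<open>\<open>\<nu>\<close> stands for $\chi$ throughout, since the symbol chi is reserved for vector binders.\<close>

definition is_prob_on :: "'x measure \<Rightarrow> 'x measure \<Rightarrow> bool" where
  "is_prob_on lam \<nu> \<longleftrightarrow> prob_space \<nu> \<and> sets \<nu> = sets lam"

text \<open>The $\sigma$-field generated by the random elements \<open>Z i\<close>, \<open>i \<in> I\<close>, with \<open>Z i\<close> valued in \<open>N i\<close>.\<close>

definition gen_sigma ::
  "'w measure \<Rightarrow> ('i \<Rightarrow> 'a measure) \<Rightarrow> ('i \<Rightarrow> 'w \<Rightarrow> 'a) \<Rightarrow> 'i set \<Rightarrow> 'w measure" where
  "gen_sigma P N Z I = sigma (space P) {Z i -` A \<inter> space P | i A. i \<in> I \<and> A \<in> sets (N i)}"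

text \<open>
  The mixing coefficients. Each expectation lies in $[0,1]$, so the real suprema are
  over bounded nonempty sets.
\<close>

definition mixing_coeff :: "'w measure \<Rightarrow> 'y measure \<Rightarrow> (int \<Rightarrow> 'w \<Rightarrow> 'y) \<Rightarrow> nat \<Rightarrow> real" where
  "mixing_coeff P mu Y n =
     (SUP u. SUP B\<in>sets (gen_sigma P (\<lambda>_. mu) Y {u + int n..}).
        \<integral>\<omega>. \<bar>real_cond_exp P (gen_sigma P (\<lambda>_. mu) Y {..u}) (indicator B) \<omega> - measure P B\<bar> \<partial>P)"

definition stationary_process :: "'w measure \<Rightarrow> 'y measure \<Rightarrow> (int \<Rightarrow> 'w \<Rightarrow> 'y) \<Rightarrow> bool" where
  "stationary_process P mu Y \<longleftrightarrow>
     (\<forall>j. distr P (\<Pi>\<^sub>M k\<in>UNIV. mu) (\<lambda>\<omega> k. Y (k + j) \<omega>) =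
          distr P (\<Pi>\<^sub>M k\<in>UNIV. mu) (\<lambda>\<omega> k. Y k \<omega>))"

text \<open>The measure $\chi(\mathrm{d}x_r)\,\lambda(\mathrm{d}x_{r+1:t})$ on trajectories indexed by $r,\dots,t$.\<close>

definition path_measure :: "'x measure \<Rightarrow> 'x measure \<Rightarrow> int \<Rightarrow> int \<Rightarrow> (int \<Rightarrow> 'x) measure" where
  "path_measure lam \<nu> r t = (\<Pi>\<^sub>M i\<in>{r..t}. if i = r then \<nu> else lam)"

definition path_weight ::
  "('t \<Rightarrow> 'x \<Rightarrow> 'x \<Rightarrow> real) \<Rightarrow> ('t \<Rightarrow> 'x \<Rightarrow> 'y \<Rightarrow> real) \<Rightarrow> 't \<Rightarrow> int \<Rightarrow> int \<Rightarrow> (int \<Rightarrow> 'y) \<Rightarrow> (int \<Rightarrow> 'x) \<Rightarrow> real" where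
  "path_weight m g \<theta> r t y x = (\<Prod>i\<in>{r..<t}. m \<theta> (x i) (x (i + 1)) * g \<theta> (x (i + 1)) (y (i + 1)))"

text \<open>\<open>smooth lam m g h \<theta> \<nu> r s t y\<close> is $\Phi^{\chi,r}_{\theta,s,t}(h,\mathbf{y})$.\<close>

definition smooth ::
  "'x measure \<Rightarrow> ('t \<Rightarrow> 'x \<Rightarrow> 'x \<Rightarrow> real) \<Rightarrow> ('t \<Rightarrow> 'x \<Rightarrow> 'y \<Rightarrow> real)
    \<Rightarrow> ('x \<Rightarrow> 'x \<Rightarrow> 'y \<Rightarrow> 'd::euclidean_space) \<Rightarrow> 't \<Rightarrow> 'x measure \<Rightarrow> int \<Rightarrow> int \<Rightarrow> int \<Rightarrow> (int \<Rightarrow> 'y) \<Rightarrow> 'd" where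
  "smooth lam m g h \<theta> \<nu> r s t y =
     (\<integral>x. path_weight m g \<theta> r t y x *\<^sub>R h (x (s - 1)) (x s) (y s) \<partial>path_measure lam \<nu> r t)
       /\<^sub>R (\<integral>x. path_weight m g \<theta> r t y x \<partial>path_measure lam \<nu> r t)"

text \<open>\<open>block_stat lam m g S \<theta> \<nu> T k y\<close> is $\bar S^{\chi,T}_k(\theta,\mathbf{y})$.\<close>

definition block_stat ::
  "'x measure \<Rightarrow> ('t \<Rightarrow> 'x \<Rightarrow> 'x \<Rightarrow> real) \<Rightarrow> ('t \<Rightarrow> 'x \<Rightarrow> 'y \<Rightarrow> real)
    \<Rightarrow> ('x \<Rightarrow> 'x \<Rightarrow> 'y \<Rightarrow> 'd::euclidean_space) \<Rightarrow> 't \<Rightarrow> 'x measure \<Rightarrow> nat \<Rightarrow> nat \<Rightarrow> (int \<Rightarrow> 'y) \<Rightarrow> 'd" where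
  "block_stat lam m g S \<theta> \<nu> T k y =
     (\<Sum>t\<in>{T + 1..T + k}. smooth lam m g S \<theta> \<nu> (int T) (int t) (int (T + k)) y) /\<^sub>R real k"

text \<open>
  $\mathsf{S}(\theta,\mathbf{Y})$ is a version of the almost sure limit of
  $\Phi^{\chi,-\tau-1}_{\theta,0,\tau}(S,\mathbf{Y})$, common to all $\chi$. It is determined up to
  almost sure equality, so its expectation does not depend on the chosen version.
\<close>

definition limit_stat ::
  "'w measure \<Rightarrow> (int \<Rightarrow> 'w \<Rightarrow> 'y) \<Rightarrow> 'x measure \<Rightarrow> ('t \<Rightarrow> 'x \<Rightarrow> 'x \<Rightarrow> real) \<Rightarrow> ('t \<Rightarrow> 'x \<Rightarrow> 'y \<Rightarrow> real)
    \<Rightarrow> ('x \<Rightarrow> 'x \<Rightarrow> 'y \<Rightarrow> 'd::euclidean_space) \<Rightarrow> 't \<Rightarrow> 'w \<Rightarrow> 'd" where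
  "limit_stat P Y lam m g S \<theta> =
     (SOME Z. Z \<in> borel_measurable P \<and>
        (\<forall>\<nu>. is_prob_on lam \<nu> \<longrightarrow>
          (AE \<omega> in P. (\<lambda>n::nat. smooth lam m g S \<theta> \<nu> (- int n - 1) 0 (int n) (\<lambda>k. Y k \<omega>)) \<longlonglongrightarrow> Z \<omega>)))"

definition mean_stat ::
  "'w measure \<Rightarrow> (int \<Rightarrow> 'w \<Rightarrow> 'y) \<Rightarrow> 'x measure \<Rightarrow> ('t \<Rightarrow> 'x \<Rightarrow> 'x \<Rightarrow> real) \<Rightarrow> ('t \<Rightarrow> 'x \<Rightarrow> 'y \<Rightarrow> real)
    \<Rightarrow> ('x \<Rightarrow> 'x \<Rightarrow> 'y \<Rightarrow> 'd::euclidean_space) \<Rightarrow> 't \<Rightarrow> 'd" where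
  "mean_stat P Y lam m g S \<theta> = (\<integral>\<omega>. limit_stat P Y lam m g S \<theta> \<omega> \<partial>P)"

text \<open>
  The likelihood of $y_{-n:t}$ when $x_{-n}\sim\chi$ and $y_{-n}$ is also observed, and the predictive
  density $p^\chi_\theta(y_1|y_{-n:0})$.
\<close>

definition likelihood ::
  "'x measure \<Rightarrow> ('t \<Rightarrow> 'x \<Rightarrow> 'x \<Rightarrow> real) \<Rightarrow> ('t \<Rightarrow> 'x \<Rightarrow> 'y \<Rightarrow> real) \<Rightarrow> 't \<Rightarrow> 'x measure \<Rightarrow> nat \<Rightarrow> int \<Rightarrow> (int \<Rightarrow> 'y) \<Rightarrow> real" where
  "likelihood lam m g \<theta> \<nu> n t y =
     (\<integral>x. g \<theta> (x (- int n)) (y (- int n)) *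
          (\<Prod>i\<in>{- int n + 1..t}. m \<theta> (x (i - 1)) (x i) * g \<theta> (x i) (y i))
        \<partial>path_measure lam \<nu> (- int n) t)"

definition pred_density ::
  "'x measure \<Rightarrow> ('t \<Rightarrow> 'x \<Rightarrow> 'x \<Rightarrow> real) \<Rightarrow> ('t \<Rightarrow> 'x \<Rightarrow> 'y \<Rightarrow> real) \<Rightarrow> 't \<Rightarrow> 'x measure \<Rightarrow> nat \<Rightarrow> (int \<Rightarrow> 'y) \<Rightarrow> real" where
  "pred_density lam m g \<theta> \<nu> n y =
     likelihood lam m g \<theta> \<nu> n 1 y / likelihood lam m g \<theta> \<nu> n 0 y"

text \<open>A version of $\log p_\theta(Y_1|Y_{-\infty:0})$, chosen as in \<^const>\<open>limit_stat\<close>.\<close>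

definition limit_log_density ::
  "'w measure \<Rightarrow> (int \<Rightarrow> 'w \<Rightarrow> 'y) \<Rightarrow> 'x measure \<Rightarrow> ('t \<Rightarrow> 'x \<Rightarrow> 'x \<Rightarrow> real) \<Rightarrow> ('t \<Rightarrow> 'x \<Rightarrow> 'y \<Rightarrow> real)
    \<Rightarrow> 't \<Rightarrow> 'w \<Rightarrow> real" where
  "limit_log_density P Y lam m g \<theta> =
     (SOME Z. Z \<in> borel_measurable P \<and>
        (\<forall>\<nu>. is_prob_on lam \<nu> \<longrightarrow>
          (AE \<omega> in P. (\<lambda>n. ln (pred_density lam m g \<theta> \<nu> n (\<lambda>k. Y k \<omega>))) \<longlonglongrightarrow> Z \<omega>)))"

definition limit_loglik ::
  "'w measure \<Rightarrow> (int \<Rightarrow> 'w \<Rightarrow> 'y) \<Rightarrow> 'x measure \<Rightarrow> ('t \<Rightarrow> 'x \<Rightarrow> 'x \<Rightarrow> real) \<Rightarrow> ('t \<Rightarrow> 'x \<Rightarrow> 'y \<Rightarrow> real)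
    \<Rightarrow> 't \<Rightarrow> real" where
  "limit_loglik P Y lam m g \<theta> = (\<integral>\<omega>. limit_log_density P Y lam m g \<theta> \<omega> \<partial>P)"

definition b_minus :: "'x measure \<Rightarrow> ('t \<Rightarrow> 'x \<Rightarrow> 'y \<Rightarrow> real) \<Rightarrow> 't set \<Rightarrow> 'y \<Rightarrow> ennreal" where
  "b_minus lam g \<Theta> y = (INF \<theta>\<in>\<Theta>. \<integral>\<^sup>+x. ennreal (g \<theta> x y) \<partial>lam)"

definition b_plus :: "'x measure \<Rightarrow> ('t \<Rightarrow> 'x \<Rightarrow> 'y \<Rightarrow> real) \<Rightarrow> 't set \<Rightarrow> 'y \<Rightarrow> ennreal" where
  "b_plus lam g \<Theta> y = (SUP \<theta>\<in>\<Theta>. \<integral>\<^sup>+x. ennreal (g \<theta> x y) \<partial>lam)"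

definition block_end :: "(nat \<Rightarrow> nat) \<Rightarrow> nat \<Rightarrow> nat" where
  "block_end \<tau> n = (\<Sum>k=1..n. \<tau> k)"

text \<open>
  $\widetilde{\mathcal F}_{T_n}$: the random element \<open>U k\<close> collects all the random variables used to
  produce the Monte Carlo approximation of $S_k$, so $\mathcal{H}_{T_n}$ is generated by
  \<open>U k\<close>, \<open>k < n\<close>.
\<close>

definition boem_sigma ::
  "'w measure \<Rightarrow> 'y measure \<Rightarrow> (int \<Rightarrow> 'w \<Rightarrow> 'y) \<Rightarrow> (nat \<Rightarrow> 'u measure) \<Rightarrow> (nat \<Rightarrow> 'w \<Rightarrow> 'u)
    \<Rightarrow> (nat \<Rightarrow> nat) \<Rightarrow> nat \<Rightarrow> 'w measure" where
  "boem_sigma P mu Y N U \<tau> n =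
     sigma (space P) (sets (gen_sigma P (\<lambda>_. mu) Y {..int (block_end \<tau> n)}) \<union> sets (gen_sigma P N U {..<n}))"

text \<open>$S_n$, a function of the current value \<open>\<theta>n\<close> of the algorithm.\<close>

definition boem_stat ::
  "(int \<Rightarrow> 'w \<Rightarrow> 'y) \<Rightarrow> 'x measure \<Rightarrow> ('t \<Rightarrow> 'x \<Rightarrow> 'x \<Rightarrow> real) \<Rightarrow> ('t \<Rightarrow> 'x \<Rightarrow> 'y \<Rightarrow> real)
    \<Rightarrow> ('x \<Rightarrow> 'x \<Rightarrow> 'y \<Rightarrow> 'd::euclidean_space) \<Rightarrow> (nat \<Rightarrow> nat) \<Rightarrow> (nat \<Rightarrow> 'x measure) \<Rightarrow> (nat \<Rightarrow> 'w \<Rightarrow> 't)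
    \<Rightarrow> nat \<Rightarrow> 'w \<Rightarrow> 'd" where
  "boem_stat Y lam m g S \<tau> \<nu> \<theta>s n \<omega> =
     block_stat lam m g S (\<theta>s n \<omega>) (\<nu> n) (block_end \<tau> n) (\<tau> (n + 1)) (\<lambda>k. Y k \<omega>)"

text \<open>
  \<open>\<theta>s\<close> is a run of Monte Carlo BOEM with approximate statistics \<open>St\<close>. That \<open>St n\<close> takes its
  values in the domain \<open>Sset\<close> of the M-step \<open>\<theta>bar\<close> is what makes the recursion meaningful.
  How well \<open>St n\<close> approximates $S_n$ is not part of this definition.
\<close>

definition boem_run ::
  "'w measure \<Rightarrow> 'y measure \<Rightarrow> (int \<Rightarrow> 'w \<Rightarrow> 'y) \<Rightarrow> 'x measure
    \<Rightarrow> 't::euclidean_space set \<Rightarrow> 'd::euclidean_space set \<Rightarrow> ('d \<Rightarrow> 't)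
    \<Rightarrow> (nat \<Rightarrow> nat) \<Rightarrow> (nat \<Rightarrow> 'x measure) \<Rightarrow> (nat \<Rightarrow> 'u measure) \<Rightarrow> (nat \<Rightarrow> 'w \<Rightarrow> 'u)
    \<Rightarrow> (nat \<Rightarrow> 'w \<Rightarrow> 't) \<Rightarrow> (nat \<Rightarrow> 'w \<Rightarrow> 'd) \<Rightarrow> bool" where
  "boem_run P mu Y lam \<Theta> Sset \<theta>bar \<tau> \<nu> N U \<theta>s St \<longleftrightarrow>
     (\<forall>n\<ge>1. 0 < \<tau> n) \<and> filterlim \<tau> at_top sequentially \<and>
     (\<forall>n. is_prob_on lam (\<nu> n)) \<and>
     (\<forall>n. U n \<in> measurable P (N n)) \<and>
     prob_space.indep_set P (sets (gen_sigma P (\<lambda>_. mu) Y UNIV)) (sets (gen_sigma P N U UNIV)) \<and>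
     (\<exists>\<theta>0\<in>\<Theta>. \<forall>\<omega>\<in>space P. \<theta>s 0 \<omega> = \<theta>0) \<and>
     (\<forall>n. \<forall>\<omega>\<in>space P. St n \<omega> \<in> Sset \<and> \<theta>s (Suc n) \<omega> = \<theta>bar (St n \<omega>)) \<and>
     (\<forall>n. \<theta>s n \<in> borel_measurable (boem_sigma P mu Y N U \<tau> n)) \<and>
     (\<forall>n. St n \<in> borel_measurable (boem_sigma P mu Y N U \<tau> (Suc n)))"

end

theory Submission
  imports Defs
begin

text \<open>
  The limiting EM map increases \<open>\<ell>\<close> strictly off its fixed points: Jensen's inequality for the path weights
  bounds \<open>E log Z\<^sub>\<theta>\<^sub>'(0,n) - E log Z\<^sub>\<theta>(0,n)\<close> below by the increment of the intermediate quantity of EM,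
  and both sides grow linearly in \<open>n\<close>, with slopes given by \<open>\<ell>\<close> and by the mean limiting statistic. A sequence
  that follows a continuous map with a strict Lyapunov function up to a vanishing error has a convergent Lyapunov value as soon
  as the critical values have empty interior, because near a noncritical level the value eventually
  moves only upwards.

  So it remains to see that the block statistics are uniformly close to their mean limit. By the Doeblin condition a
  smoothed statistic depends, up to a geometrically small error, on a finite window of observations, and
  as a function of the window it is equicontinuous in \<open>\<theta>\<close> with an explicit modulus. For functions of a
  finite window with a moment of order \<open>p > 2\<close>, mixing gives block averages with variance \<open>O(1 / \<tau>\<^sub>n)\<close>,
  which is summable since \<open>a > 1\<close>.
\<close>

section \<open>Perturbed iterations with a Lyapunov function\<close>

text \<open>Three obstacles shape the proof. The current parameter of the algorithm is random and
  depends on the observations, so a law of large numbers for each fixed \<theta> is not enough;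
  uniformity over \<Theta> comes from a finite net together with a modulus of continuity that is
  itself averaged along the blocks. The statistic \<open>S\<close> is bounded only for each single
  observation, by a function \<open>M\<close> of it with a moment of order \<open>p\<close>; hence
  forgetting and perturbation estimates are deterministic, with \<open>M\<close> as an explicit
  factor, and expectations are taken afterwards. Finally, the M-step is continuous on an open set
  containing the convex hull of the values of \<open>S\<close>, while a limit of smoothed statistics
  is at once known to lie only in the closure of that hull; a lower bound for the smoothing law of
  two consecutive states, uniform in the window length, excludes limits outside the hull. In the EM
  inequality the errors stay bounded as \<open>n\<close> grows, so comparing multiples of
  \<open>n\<close> removes them, without any differentiation in \<theta>.\<close>

lemma converges_to_setI:
  fixes x :: "nat \<Rightarrow> 'a::metric_space"
  assumes K: "compact K" "\<And>n. x n \<in> K"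
    and acc: "\<And>r l. strict_mono (r :: nat \<Rightarrow> nat) \<Longrightarrow> l \<in> K \<Longrightarrow> (\<lambda>n. x (r n)) \<longlonglongrightarrow> l \<Longrightarrow> l \<in> A"
  shows "converges_to_set x A"
  unfolding converges_to_set_def
proof
  show "A \<noteq> {}"
  proof -
    obtain l r where "l \<in> K" "strict_mono (r :: nat \<Rightarrow> nat)" "(x \<circ> r) \<longlonglongrightarrow> l"
      using K compact_def by metis
    then show ?thesis using acc[of r l] by (auto simp: o_def)
  qed
  show "(\<lambda>n. infdist (x n) A) \<longlonglongrightarrow> 0"
  proof (rule ccontr)
    assume "\<not> ?thesis"
    then obtain e where e: "e > 0" "\<And>N. \<exists>n\<ge>N. e \<le> infdist (x n) A"
      unfolding lim_sequentially dist_real_def by (metis abs_of_nonneg diff_zero infdist_nonneg not_less)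
    \<comment> \<open>Indices at which the sequence stays at distance \<open>e\<close> from
      \<open>A\<close>. A convergent subsequence along them would have its limit in
      \<open>A\<close>, which contradicts that distance.\<close>
    define Q where "Q = {n. e \<le> infdist (x n) A}"
    have "infinite Q" unfolding infinite_nat_iff_unbounded_le Q_def using e(2) by auto
    then obtain s :: "nat \<Rightarrow> nat" where s: "strict_mono s" "\<And>n. s n \<in> Q"
      using infinite_enumerate by blast
    obtain l r where l: "l \<in> K" "strict_mono (r :: nat \<Rightarrow> nat)" "((\<lambda>n. x (s n)) \<circ> r) \<longlonglongrightarrow> l"
      using K compact_def[of K] by (metis (no_types, lifting))
    have "l \<in> A" using acc[of "s \<circ> r" l] l s by (auto simp: o_def strict_mono_def)
    have "eventually (\<lambda>n. dist (x (s (r n))) l < e) sequentially"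
      using l(3) e(1) by (auto simp: o_def tendsto_iff)
    then obtain n where n: "dist (x (s (r n))) l < e" by (auto simp: eventually_sequentially)
    moreover have "e \<le> infdist (x (s (r n))) A" using s(2) by (auto simp: Q_def)
    moreover have "infdist (x (s (r n))) A \<le> dist (x (s (r n))) l"
      using \<open>l \<in> A\<close> by (rule infdist_le)
    ultimately show False by simp
  qed
qed

text \<open>Every noncritical level is eventually left on one side for good, and such levels are
  dense because the critical ones have empty interior; so the values cannot oscillate and must
  converge. At an accumulation point the value is therefore unchanged by \<open>R\<close>, and
  strictness of the Lyapunov function makes it a fixed point.\<close>

lemma perturbed_lyapunov_converges:
  fixes x :: "nat \<Rightarrow> 'a::metric_space" and W :: "'a \<Rightarrow> real"
  assumes K: "compact K" "\<And>n. x n \<in> K"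
    and R: "continuous_on K R" "R ` K \<subseteq> K"
    and W: "continuous_on K W"
    and lyap: "\<And>\<theta>. \<theta> \<in> K \<Longrightarrow> W \<theta> \<le> W (R \<theta>)" "\<And>\<theta>. \<theta> \<in> K \<Longrightarrow> W (R \<theta>) = W \<theta> \<Longrightarrow> R \<theta> = \<theta>"
    and L: "L = {\<theta> \<in> K. R \<theta> = \<theta>}"
    and int: "interior (W ` L) = {}"
    and step: "(\<lambda>n. dist (x (Suc n)) (R (x n))) \<longlonglongrightarrow> 0"
  shows "\<exists>w. converges_to_set x {\<theta> \<in> L. W \<theta> = w}"
proof -
  define u where "u n = W (x n)" for n
  have WR: "continuous_on K (\<lambda>\<theta>. W (R \<theta>))"
    using continuous_on_compose2[OF W R(1) R(2)] .
  have d: "(\<lambda>n. u (Suc n) - W (R (x n))) \<longlonglongrightarrow> 0"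
  proof (rule metric_LIMSEQ_I)
    fix e :: real assume "0 < e"
    have "uniformly_continuous_on K W" using W K(1) by (rule compact_uniformly_continuous)
    then obtain d where "d > 0" and d: "\<And>a b. a \<in> K \<Longrightarrow> b \<in> K \<Longrightarrow> dist b a < d \<Longrightarrow> dist (W b) (W a) < e"
      using \<open>0 < e\<close> unfolding uniformly_continuous_on_def by metis
    from step \<open>d > 0\<close> obtain N where N: "\<And>n. n \<ge> N \<Longrightarrow> dist (x (Suc n)) (R (x n)) < d"
      unfolding lim_sequentially by (auto simp: dist_real_def)
    show "\<exists>N. \<forall>n\<ge>N. dist (u (Suc n) - W (R (x n))) 0 < e"
    proof (intro exI allI impI)
      fix n assume "n \<ge> N"
      then have "dist (W (x (Suc n))) (W (R (x n))) < e" using N K(2) R(2) by (intro d) auto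
      then show "dist (u (Suc n) - W (R (x n))) 0 < e" by (simp add: u_def dist_real_def)
    qed
  qed
  \<comment> \<open>The superlevel set \<open>B\<close> is compact, so the value after one step of
    \<open>R\<close> has a minimum over it. That minimum exceeds \<open>w\<close>: a point above the
    level is not moved down, and a point on the level is not fixed. Once the error is below this
    margin, the superlevel set can be entered but not left.\<close>
  have dich: "(\<forall>\<^sub>F n in sequentially. u n \<ge> w) \<or> (\<forall>\<^sub>F n in sequentially. u n < w)"
    if w: "w \<notin> W ` L" for w
  proof (cases "\<exists>\<theta>\<in>K. W \<theta> \<ge> w")
    case False
    then show ?thesis using K(2) by (auto simp: u_def not_le)
  next
    case True
    define B where "B = {\<theta> \<in> K. W \<theta> \<in> {w..}}"
    have "compact B"
    proof -
      have "closed B" unfolding B_def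
        using continuous_closed_preimage[OF W compact_imp_closed[OF K(1)], of "{w..}"]
        by (simp add: vimage_def Collect_conj_eq)
      then have "compact (K \<inter> B)" using K(1) by (rule compact_Int_closed[rotated])
      moreover have "K \<inter> B = B" by (auto simp: B_def)
      ultimately show ?thesis by simp
    qed
    moreover have "B \<noteq> {}" using True by (auto simp: B_def)
    moreover have "continuous_on B (\<lambda>\<theta>. W (R \<theta>))" using WR by (rule continuous_on_subset) (auto simp: B_def)
    ultimately obtain b where b: "b \<in> B" "\<And>\<theta>. \<theta> \<in> B \<Longrightarrow> W (R b) \<le> W (R \<theta>)"
      using continuous_attains_inf[of B "\<lambda>\<theta>. W (R \<theta>)"] by auto
    have "W (R b) > w"
    proof (cases "W b = w")
      case True
      then have "b \<notin> L" using w by auto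
      then have "R b \<noteq> b" using b(1) by (auto simp: L B_def)
      then show ?thesis using lyap[of b] b(1) True by (auto simp: B_def less_le)
    next
      case False
      then show ?thesis using b(1) lyap(1)[of b] by (auto simp: B_def)
    qed
    then obtain N where N: "\<And>n. n \<ge> N \<Longrightarrow> \<bar>u (Suc n) - W (R (x n))\<bar> < W (R b) - w"
      using d unfolding lim_sequentially dist_real_def by (metis diff_gt_0_iff_gt diff_zero)
    have st: "u (Suc n) \<ge> w" if "n \<ge> N" "u n \<ge> w" for n
    proof -
      have "x n \<in> B" using that K(2) by (auto simp: B_def u_def)
      then show ?thesis using b(2)[of "x n"] N[OF that(1)] by linarith
    qed
    show ?thesis
    proof (cases "\<exists>n\<ge>N. u n \<ge> w")
      case True
      then obtain n0 where n0: "n0 \<ge> N" "u n0 \<ge> w" by auto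
      have "u n \<ge> w" if "n \<ge> n0" for n
        using that by (induction n rule: dec_induct) (use n0 st in auto)
      then show ?thesis by (auto simp: eventually_sequentially)
    next
      case False
      then have "\<forall>\<^sub>F n in sequentially. u n < w"
        unfolding eventually_sequentially by (meson not_le)
      then show ?thesis ..
    qed
  qed
  have gap: "\<exists>w. w \<in> {a<..<b} \<and> w \<notin> W ` L" if "a < b" for a b
  proof (rule ccontr)
    assume "\<not> ?thesis"
    then have "{a<..<b} \<subseteq> W ` L" by blast
    then have "{a<..<b} \<subseteq> interior (W ` L)" by (rule interior_maximal) simp
    with int that show False by (auto dest: dense)
  qed
  \<comment> \<open>Compactness provides the candidate \<open>W l\<close> for the limit of the
    values; noncritical levels just below and just above it then trap the whole sequence.\<close>
  obtain l r where lr: "l \<in> K" "strict_mono (r :: nat \<Rightarrow> nat)" "(x \<circ> r) \<longlonglongrightarrow> l"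
    using K compact_def by metis
  have cW: "(\<lambda>n. W (y n)) \<longlonglongrightarrow> W k" if "\<And>n. y n \<in> K" "k \<in> K" "y \<longlonglongrightarrow> k" for y :: "nat \<Rightarrow> 'a" and k
    using continuous_on_tendsto_compose[OF W that(3,2)] that(1) by simp
  have ur: "(\<lambda>n. u (r n)) \<longlonglongrightarrow> W l"
    using cW[of "x \<circ> r" l] lr K(2) by (simp add: u_def)
  have u: "u \<longlonglongrightarrow> W l"
  proof (rule order_tendstoI)
    fix a assume "a < W l"
    then obtain w where w: "a < w" "w < W l" "w \<notin> W ` L" using gap[of a "W l"] by auto
    have "\<not> (\<forall>\<^sub>F n in sequentially. u n < w)"
    proof
      assume "\<forall>\<^sub>F n in sequentially. u n < w"
      then have "\<forall>\<^sub>F n in sequentially. u (r n) < w" using lr(2) by (rule eventually_subseq[rotated])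
      moreover have "\<forall>\<^sub>F n in sequentially. w < u (r n)" using ur w(2) by (simp add: order_tendsto_iff)
      ultimately have "\<forall>\<^sub>F n in sequentially. False" by eventually_elim simp
      then show False by simp
    qed
    with dich[OF w(3)] have "\<forall>\<^sub>F n in sequentially. w \<le> u n" by blast
    then show "\<forall>\<^sub>F n in sequentially. a < u n" by eventually_elim (use w in simp)
  next
    fix a assume "W l < a"
    then obtain w where w: "w < a" "W l < w" "w \<notin> W ` L" using gap[of "W l" a] by auto
    have "\<not> (\<forall>\<^sub>F n in sequentially. w \<le> u n)"
    proof
      assume "\<forall>\<^sub>F n in sequentially. w \<le> u n"
      then have "\<forall>\<^sub>F n in sequentially. w \<le> u (r n)" using lr(2) by (rule eventually_subseq[rotated])
      moreover have "\<forall>\<^sub>F n in sequentially. u (r n) < w" using ur w(2) by (simp add: order_tendsto_iff)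
      ultimately have "\<forall>\<^sub>F n in sequentially. False" by eventually_elim simp
      then show False by simp
    qed
    with dich[OF w(3)] have "\<forall>\<^sub>F n in sequentially. u n < w" by blast
    then show "\<forall>\<^sub>F n in sequentially. u n < a" by eventually_elim (use w in simp)
  qed
  have "converges_to_set x {\<theta> \<in> L. W \<theta> = W l}"
  proof (rule converges_to_setI[OF K])
    fix s :: "nat \<Rightarrow> nat" and k assume s: "strict_mono s" "k \<in> K" "(\<lambda>n. x (s n)) \<longlonglongrightarrow> k"
    have "(\<lambda>n. u (s n)) \<longlonglongrightarrow> W k" unfolding u_def using s K(2) by (intro cW) auto
    moreover have "(\<lambda>n. u (s n)) \<longlonglongrightarrow> W l" using LIMSEQ_subseq_LIMSEQ[OF u s(1)] by (simp add: o_def)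
    ultimately have Wk: "W k = W l" by (rule LIMSEQ_unique)
    \<comment> \<open>One sequence, two limits: \<open>W (R k)\<close> by continuity, and
      \<open>W l\<close> because it differs from the next value by a vanishing error.\<close>
    have "(\<lambda>n. W (R (x (s n)))) \<longlonglongrightarrow> W (R k)"
      using continuous_on_tendsto_compose[OF WR s(3,2)] K(2) by simp
    moreover have "(\<lambda>n. W (R (x (s n)))) \<longlonglongrightarrow> W l"
    proof -
      have "(\<lambda>n. u (Suc n) - (u (Suc n) - W (R (x n)))) \<longlonglongrightarrow> W l - 0"
        by (intro tendsto_diff d filterlim_compose[OF u] filterlim_Suc)
      then have "(\<lambda>n. W (R (x n))) \<longlonglongrightarrow> W l" by simp
      then show ?thesis using LIMSEQ_subseq_LIMSEQ[OF _ s(1)] by (simp add: o_def)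
    qed
    ultimately have "W (R k) = W l" by (rule LIMSEQ_unique)
    then have "R k = k" using lyap(2) Wk s(2) by simp
    then show "k \<in> {\<theta> \<in> L. W \<theta> = W l}" using s(2) Wk by (simp add: L)
  qed
  then show ?thesis by blast
qed

text \<open>The hypothesis on \<open>u\<close> is what the mean of \<open>f\<close> under a
  probability measure equivalent to \<open>Q\<close> satisfies: a half-space with that mean on its
  boundary can carry \<open>f\<close> almost everywhere only if the boundary does. It gives the hull
  itself and not just its closure, because supporting hyperplanes can be intersected until the
  dimension is exhausted.\<close>

lemma in_convex_hull_of_support:
  fixes f :: "'a \<Rightarrow> 'd::euclidean_space"
  assumes Q: "space Q \<notin> null_sets Q"
    and supp: "\<And>u. AE z in Q. inner (f z - s) u \<ge> 0 \<Longrightarrow> AE z in Q. inner (f z - s) u = 0"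
  shows "s \<in> convex hull (f ` space Q)"
proof (rule ccontr)
  assume s: "s \<notin> convex hull (f ` space Q)"
  have nonempty: "\<exists>z\<in>space Q. p z" if "AE z in Q. p z" for p
  proof (rule ccontr)
    assume "\<not> ?thesis"
    with that have "AE z in Q. False" by (auto elim!: AE_mp)
    then show False using Q by (auto simp: eventually_False AE_iff_null_sets)
  qed
  \<comment> \<open>Induction on the dimension of a subspace \<open>V\<close> that contains
    \<open>f z - s\<close> almost everywhere. As \<open>s\<close> is not in the hull, a supporting
    direction \<open>u\<close> can be found inside \<open>V\<close>; then \<open>f z - s\<close> is
    almost everywhere orthogonal to \<open>u\<close>, and the smaller subspace no longer contains
    \<open>u\<close>.\<close>
  have "False" if "subspace V" "AE z in Q. f z - s \<in> V" for V
    using that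
  proof (induction "dim V" arbitrary: V rule: less_induct)
    case less
    define D where "D = {d \<in> V. \<exists>z\<in>space Q. d = f z - s}"
    have "D \<noteq> {}" using nonempty[OF less.prems(2)] by (auto simp: D_def)
    have "0 \<notin> convex hull D"
    proof
      assume "0 \<in> convex hull D"
      then have "0 \<in> convex hull ((\<lambda>y. - s + y) ` (f ` space Q))"
        using hull_mono[of D "(\<lambda>y. - s + y) ` (f ` space Q)" convex] by (auto simp: D_def)
      then show False using s unfolding convex_hull_translation by auto
    qed
    then obtain u where u: "u \<in> span (convex hull D)" "u \<noteq> 0" "\<And>d. d \<in> convex hull D \<Longrightarrow> 0 \<le> inner u d"
      using separating_hyperplane_set_0_inspan[of "convex hull D"] \<open>D \<noteq> {}\<close> by auto
    have "convex hull D \<subseteq> V"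
      by (rule hull_minimal) (use less.prems(1) in \<open>auto simp: D_def subspace_imp_convex\<close>)
    then have uV: "u \<in> V" using u(1) less.prems(1) span_minimal by blast
    have "AE z in Q. inner (f z - s) u \<ge> 0"
      using less.prems(2)
    proof (rule AE_mp, intro AE_I2 impI)
      fix z assume "z \<in> space Q" "f z - s \<in> V"
      then have "f z - s \<in> D" by (auto simp: D_def)
      then show "inner (f z - s) u \<ge> 0" using u(3)[of "f z - s"] by (simp add: hull_inc inner_commute)
    qed
    from supp[OF this] have *: "AE z in Q. f z - s \<in> V \<inter> {v. inner v u = 0}"
      using less.prems(2) by eventually_elim auto
    have sub: "subspace (V \<inter> {v. inner v u = 0})"
      using less.prems(1) by (intro subspace_inter) (auto simp: subspace_def inner_left_distrib)
    have "u \<notin> {v. inner v u = 0}" using u(2) by simp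
    then have "V \<inter> {v. inner v u = 0} \<noteq> V" using uV by blast
    then have "dim (V \<inter> {v. inner v u = 0}) < dim V"
      using dim_psubset[of "V \<inter> {v. inner v u = 0}" V] less.prems(1) sub
      by (simp add: span_eq_iff[THEN iffD2] psubset_eq)
    from less.hyps[OF this sub *] show False .
  qed
  from this[of UNIV] show False by simp
qed

section \<open>Iterated kernels and path integrals\<close>

locale finite_state_measure = finite_measure lam for lam :: "'x measure" +
  assumes space_lam: "space lam = UNIV"
begin

text \<open>Boundedness is required at every point and not up to \<open>lam\<close>-null sets, since
  these functions are also integrated against arbitrary initial laws, Dirac masses included.\<close>

definition bfun :: "('x \<Rightarrow> real) \<Rightarrow> bool" where
  "bfun f \<longleftrightarrow> f \<in> borel_measurable lam \<and> (\<exists>c. \<forall>x. \<bar>f x\<bar> \<le> c)"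

definition bker :: "('x \<Rightarrow> 'x \<Rightarrow> real) \<Rightarrow> bool" where
  "bker \<kappa> \<longleftrightarrow> (\<lambda>(x, x'). \<kappa> x x') \<in> borel_measurable (lam \<Otimes>\<^sub>M lam) \<and> (\<exists>c. \<forall>x x'. \<bar>\<kappa> x x'\<bar> \<le> c)"

definition Kop :: "('x \<Rightarrow> 'x \<Rightarrow> real) \<Rightarrow> ('x \<Rightarrow> real) \<Rightarrow> 'x \<Rightarrow> real" where
  "Kop \<kappa> f x = (\<integral>x'. \<kappa> x x' * f x' \<partial>lam)"

text \<open>The kernel \<open>\<kappa> i\<close> leads from time \<open>i - 1\<close> to time
  \<open>i\<close>. Started at time \<open>r\<close>, the iteration is the backward recursion for an
  integral over the states at times \<open>r + 1\<close> to \<open>r + n\<close>, with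
  \<open>f\<close> evaluated at the last one.\<close>

primrec Kit :: "(int \<Rightarrow> 'x \<Rightarrow> 'x \<Rightarrow> real) \<Rightarrow> nat \<Rightarrow> int \<Rightarrow> ('x \<Rightarrow> real) \<Rightarrow> 'x \<Rightarrow> real" where
  "Kit \<kappa> 0 r f = f"
| "Kit \<kappa> (Suc n) r f = Kop (\<kappa> (r + 1)) (Kit \<kappa> n (r + 1) f)"

lemma bfunI: "f \<in> borel_measurable lam \<Longrightarrow> (\<And>x. \<bar>f x\<bar> \<le> c) \<Longrightarrow> bfun f"
  by (auto simp: bfun_def)

lemma bfun_const: "bfun (\<lambda>x. c)"
  by (auto simp: bfun_def)

lemma bfun_measurable: "bfun f \<Longrightarrow> f \<in> borel_measurable lam"
  by (simp add: bfun_def)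

lemma bfun_bound: "bfun f \<Longrightarrow> \<exists>c>0. \<forall>x. \<bar>f x\<bar> \<le> c"
  unfolding bfun_def by (meson linorder_not_le order_trans less_imp_le gt_ex)

lemma bker_bound: "bker f \<Longrightarrow> \<exists>c>0. \<forall>x x'. \<bar>f x x'\<bar> \<le> c"
  unfolding bker_def by (meson linorder_not_le order_trans less_imp_le gt_ex)

lemma bker_section: "bker \<kappa> \<Longrightarrow> \<kappa> x \<in> borel_measurable lam"
  unfolding bker_def using measurable_Pair2[of "\<lambda>(x, x'). \<kappa> x x'" lam lam borel x] by (simp add: space_lam)

lemma bfun_section:
  assumes "bker \<kappa>" "bfun f" shows "bfun (\<lambda>x'. \<kappa> x x' * f x')"
proof -
  obtain c d where "c > 0" "d > 0" "\<And>x x'. \<bar>\<kappa> x x'\<bar> \<le> c" "\<And>x. \<bar>f x\<bar> \<le> d"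
    using bker_bound[OF assms(1)] bfun_bound[OF assms(2)] by metis
  then have "\<bar>\<kappa> x x' * f x'\<bar> \<le> c * d" for x' by (simp add: abs_mult mult_mono)
  then show ?thesis using bker_section[OF assms(1)] assms(2) unfolding bfun_def by (blast intro: borel_measurable_times)
qed

lemma bfun_integrable: "finite_measure M \<Longrightarrow> sets M = sets lam \<Longrightarrow> bfun f \<Longrightarrow> integrable M f"
proof -
  assume *: "finite_measure M" "sets M = sets lam" "bfun f"
  obtain c where "\<And>x. \<bar>f x\<bar> \<le> c" using bfun_bound[OF *(3)] by blast
  moreover have "f \<in> borel_measurable M"
    using bfun_measurable[OF *(3)] measurable_cong_sets[OF *(2) refl] by blast
  ultimately show ?thesis using *(1) by (intro finite_measure.integrable_const_bound[where B = c]) auto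
qed

lemma bfun_integrable_lam: "bfun f \<Longrightarrow> integrable lam f"
  using bfun_integrable[of lam f] finite_measure_axioms by simp

lemma bfun_arith:
  assumes "bfun f" "bfun g"
  shows "bfun (\<lambda>x. f x + g x)" "bfun (\<lambda>x. f x - g x)" "bfun (\<lambda>x. c * f x)" "bfun (\<lambda>x. f x * g x)"
proof -
  obtain a b where ab: "\<And>x. \<bar>f x\<bar> \<le> a" "\<And>x. \<bar>g x\<bar> \<le> b" "a > 0"
    using bfun_bound assms by metis
  have "\<bar>f x + g x\<bar> \<le> a + b" "\<bar>f x - g x\<bar> \<le> a + b" for x using ab(1,2)[of x] by linarith+
  moreover have "\<bar>c * f x\<bar> \<le> \<bar>c\<bar> * a" "\<bar>f x * g x\<bar> \<le> a * b" for x
    using ab by (auto simp: abs_mult intro!: mult_left_mono mult_mono)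
  moreover have "f \<in> borel_measurable lam" "g \<in> borel_measurable lam" using assms by (auto simp: bfun_def)
  ultimately show "bfun (\<lambda>x. f x + g x)" "bfun (\<lambda>x. f x - g x)" "bfun (\<lambda>x. c * f x)" "bfun (\<lambda>x. f x * g x)"
    using bfunI[of "\<lambda>x. f x + g x" "a + b"] bfunI[of "\<lambda>x. f x - g x" "a + b"]
      bfunI[of "\<lambda>x. c * f x" "\<bar>c\<bar> * a"] bfunI[of "\<lambda>x. f x * g x" "a * b"] by simp_all
qed

lemma bker_mult:
  assumes "bker f" "bker g" shows "bker (\<lambda>x x'. f x x' * g x x')"
proof -
  obtain a b where ab: "\<And>x x'. \<bar>f x x'\<bar> \<le> a" "\<And>x x'. \<bar>g x x'\<bar> \<le> b" "a > 0"
    using bker_bound assms by metis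
  then have "\<bar>f x x' * g x x'\<bar> \<le> a * b" for x x' by (auto simp: abs_mult intro!: mult_mono)
  moreover have "(\<lambda>z. (case z of (x, x') \<Rightarrow> f x x') * (case z of (x, x') \<Rightarrow> g x x')) \<in> borel_measurable (lam \<Otimes>\<^sub>M lam)"
    using assms by (intro borel_measurable_times) (auto simp: bker_def)
  ultimately show ?thesis unfolding bker_def case_prod_beta by blast
qed

lemma bfun_Kop: assumes "bker \<kappa>" "bfun f" shows "bfun (Kop \<kappa> f)"
proof -
  obtain c d where cd: "c > 0" "d > 0" "\<And>x x'. \<bar>\<kappa> x x'\<bar> \<le> c" "\<And>x. \<bar>f x\<bar> \<le> d"
    using bker_bound[OF assms(1)] bfun_bound[OF assms(2)] by metis
  have "\<bar>Kop \<kappa> f x\<bar> \<le> c * d * measure lam UNIV" for x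
  proof -
    have "\<bar>Kop \<kappa> f x\<bar> \<le> (\<integral>x'. \<bar>\<kappa> x x' * f x'\<bar> \<partial>lam)" unfolding Kop_def by (rule integral_abs_bound)
    also have "\<dots> \<le> (\<integral>x'. c * d \<partial>lam)"
      using cd bfun_section[OF assms]
      by (intro integral_mono integrable_abs bfun_integrable_lam) (auto simp: abs_mult intro!: mult_mono bfun_integrable_lam bfun_const)
    finally show ?thesis by (simp add: space_lam mult_ac)
  qed
  moreover have "Kop \<kappa> f \<in> borel_measurable lam"
  proof -
    have [measurable]: "f \<in> borel_measurable lam" "(\<lambda>(x, x'). \<kappa> x x') \<in> borel_measurable (lam \<Otimes>\<^sub>M lam)"
      using assms by (auto simp: bfun_def bker_def)
    have "(\<lambda>z. (case z of (x, x') \<Rightarrow> \<kappa> x x') * f (snd z)) \<in> borel_measurable (lam \<Otimes>\<^sub>M lam)"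
      by measurable
    then have "(\<lambda>x. \<integral>x'. \<kappa> x x' * f x' \<partial>lam) \<in> borel_measurable lam"
      by (intro borel_measurable_lebesgue_integral) (simp add: case_prod_beta)
    then show ?thesis by (simp add: Kop_def[abs_def])
  qed
  ultimately show ?thesis unfolding bfun_def by blast
qed

lemma Kop_diff_scale:
  assumes "bker \<kappa>" "bfun f" "bfun g"
  shows "Kop \<kappa> (\<lambda>x. f x - c * g x) x = Kop \<kappa> f x - c * Kop \<kappa> g x"
proof -
  have "integrable lam (\<lambda>x'. \<kappa> x x' * f x')" "integrable lam (\<lambda>x'. \<kappa> x x' * g x')"
    using bfun_section assms bfun_integrable_lam by auto
  then have "(\<integral>x'. \<kappa> x x' * f x' - c * (\<kappa> x x' * g x') \<partial>lam) = Kop \<kappa> f x - c * Kop \<kappa> g x"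
    by (simp add: Kop_def)
  then show ?thesis by (simp add: Kop_def algebra_simps)
qed

lemma Kop_mono:
  assumes "bker \<kappa>" "bfun f" "bfun g" "\<And>x x'. 0 \<le> \<kappa> x x'" "\<And>x. f x \<le> g x"
  shows "Kop \<kappa> f x \<le> Kop \<kappa> g x"
  unfolding Kop_def using assms bfun_section bfun_integrable_lam
  by (intro integral_mono) (auto intro: mult_left_mono)

lemma bfun_Kit: "(\<And>i. bker (\<kappa> i)) \<Longrightarrow> bfun f \<Longrightarrow> bfun (Kit \<kappa> n r f)"
  by (induction n arbitrary: r) (auto intro: bfun_Kop)

lemma Kit_add: "Kit \<kappa> (n + k) r f = Kit \<kappa> n r (Kit \<kappa> k (r + int n) f)"
  by (induction n arbitrary: r) (auto simp: algebra_simps)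

lemma Kit_Suc_right: "Kit \<kappa> (Suc n) r f = Kit \<kappa> n r (Kop (\<kappa> (r + int n + 1)) f)"
  using Kit_add[of \<kappa> n 1 r f] by simp

lemma Kit_cong: "(\<And>i. i \<in> {r + 1..r + int n} \<Longrightarrow> \<kappa> i = \<kappa>' i) \<Longrightarrow> Kit \<kappa> n r f = Kit \<kappa>' n r f"
  by (induction n arbitrary: r) auto

lemma Kit_shift: "Kit (\<lambda>i. \<kappa> (i + j)) n r f = Kit \<kappa> n (r + j) f"
proof (induction n arbitrary: r)
  case (Suc n)
  show ?case unfolding Kit.simps Suc.IH by (simp add: ac_simps)
qed simp

lemma Kit_diff_scale:
  assumes "\<And>i. bker (\<kappa> i)" "bfun f" "bfun g"
  shows "Kit \<kappa> n r (\<lambda>x. f x - c * g x) = (\<lambda>x. Kit \<kappa> n r f x - c * Kit \<kappa> n r g x)"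
proof (induction n arbitrary: r)
  case (Suc n)
  show ?case by (simp add: Suc Kop_diff_scale assms bfun_Kit)
qed simp

lemma Kit_mono:
  assumes "\<And>i. bker (\<kappa> i)" "bfun f" "bfun g" "\<And>i x x'. 0 \<le> \<kappa> i x x'" "\<And>x. f x \<le> g x"
  shows "Kit \<kappa> n r f x \<le> Kit \<kappa> n r g x"
proof (induction n arbitrary: r x)
  case (Suc n)
  show ?case unfolding Kit.simps by (intro Kop_mono bfun_Kit assms Suc)
qed (simp add: assms(5))

lemma Kit_zero: "Kit \<kappa> n r (\<lambda>x. 0) = (\<lambda>x. 0)"
  by (induction n arbitrary: r) (auto simp: Kop_def)

lemma Kit_nonneg:
  assumes "\<And>i. bker (\<kappa> i)" "bfun f" "\<And>i x x'. 0 \<le> \<kappa> i x x'" "\<And>x. 0 \<le> f x"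
  shows "0 \<le> Kit \<kappa> n r f x"
  using Kit_mono[OF assms(1) bfun_const[of 0] assms(2,3,4)] by (simp add: Kit_zero)

lemma Kit_pos:
  assumes k: "\<And>i. bker (\<kappa> i)" and low: "\<And>i. \<exists>c>0. \<forall>x x'. c \<le> \<kappa> i x x'"
    and lam: "measure lam UNIV > 0" and f: "bfun f" "c0 > 0" "\<And>x. c0 \<le> f x"
  shows "\<exists>c>0. \<forall>x. c \<le> Kit \<kappa> n r f x"
proof (induction n arbitrary: r)
  case (Suc n)
  obtain c d where c: "c > 0" "\<And>x. c \<le> Kit \<kappa> n (r + 1) f x" and d: "d > 0" "\<And>x x'. d \<le> \<kappa> (r + 1) x x'"
    using Suc low by metis
  have "d * c * measure lam UNIV \<le> Kit \<kappa> (Suc n) r f x" for x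
  proof -
    have "(\<integral>x'. d * c \<partial>lam) \<le> (\<integral>x'. \<kappa> (r + 1) x x' * Kit \<kappa> n (r + 1) f x' \<partial>lam)"
      using c d less_imp_le order_trans[OF less_imp_le[OF d(1)] d(2)]
      by (intro integral_mono bfun_integrable_lam bfun_const bfun_section k bfun_Kit f mult_mono) auto
    then show ?thesis by (simp add: Kop_def space_lam mult_ac)
  qed
  then show ?case using c(1) d(1) lam by (intro exI[of _ "d * c * measure lam UNIV"]) auto
qed (use f(2,3) in \<open>auto intro!: exI[of _ c0]\<close>)

text \<open>One step of the Doeblin argument: a ratio \<open>u / v\<close> is replaced by one of its weighted averages,
  and all the weights dominate a common one.\<close>

lemma Kop_contract:
  assumes k: "bker \<kappa>" and w: "bfun w" "\<And>x. 0 \<le> w x"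
    and s: "0 < s1" "s1 \<le> s2" "\<And>x x'. s1 * w x' \<le> \<kappa> x x'" "\<And>x x'. \<kappa> x x' \<le> s2 * w x'"
    and u: "bfun u" and v: "bfun v" "\<And>x. 0 \<le> v x"
    and ab: "\<And>x. a * v x \<le> u x" "\<And>x. u x \<le> b * v x" "a \<le> b"
  shows "\<exists>a' b'. a \<le> a' \<and> a' \<le> b' \<and> b' \<le> b \<and> b' - a' = (1 - s1 / s2) * (b - a) \<and>
    (\<forall>x. a' * Kop \<kappa> v x \<le> Kop \<kappa> u x \<and> Kop \<kappa> u x \<le> b' * Kop \<kappa> v x)"
proof -
  define U V where "U = (\<integral>x. w x * u x \<partial>lam)" and "V = (\<integral>x. w x * v x \<partial>lam)"
  \<comment> \<open>The ratio under the common weight \<open>w\<close>. Every ratio of images equals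
    \<open>c\<close> with weight at least \<open>s1 / s2\<close>, so both ends of the interval move
    towards \<open>c\<close> by that fraction of their distance to it. If \<open>V\<close> vanishes,
    then so does \<open>U\<close>, and any value between \<open>a\<close> and \<open>b\<close> will
    do.\<close>
  define c where "c = (if V = 0 then a else U / V)"
  have iw: "integrable lam (\<lambda>x. w x * u x)" "integrable lam (\<lambda>x. w x * v x)"
    using w u v by (auto intro!: bfun_integrable_lam bfun_arith)
  have V0: "0 \<le> V" unfolding V_def using w v by simp
  have "a * V = (\<integral>x. w x * (a * v x) \<partial>lam)" by (simp add: V_def algebra_simps)
  also have "\<dots> \<le> U" unfolding U_def using w u v ab
    by (intro integral_mono bfun_integrable_lam bfun_arith) (auto intro: mult_left_mono)
  finally have aV: "a * V \<le> U" .
  have "U \<le> (\<integral>x. w x * (b * v x) \<partial>lam)" unfolding U_def using w u v ab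
    by (intro integral_mono bfun_integrable_lam bfun_arith) (auto intro: mult_left_mono)
  also have "\<dots> = b * V" by (simp add: V_def algebra_simps)
  finally have bV: "U \<le> b * V" .
  have c: "a \<le> c" "c \<le> b" "U = c * V"
    using aV bV V0 ab(3) by (auto simp: c_def field_simps)
  have kv: "Kop \<kappa> v x \<le> s2 * V" for x
  proof -
    have "Kop \<kappa> v x \<le> (\<integral>x'. s2 * (w x' * v x') \<partial>lam)"
      unfolding Kop_def using k w v s(4) mult_right_mono[OF s(4) v(2)]
      by (intro integral_mono bfun_integrable_lam bfun_section bfun_arith) (auto simp: mult.assoc)
    then show ?thesis by (simp add: V_def)
  qed
  have low: "s1 * (\<integral>x. w x * f x \<partial>lam) \<le> Kop \<kappa> f x" if f: "bfun f" "\<And>x. 0 \<le> f x" for f x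
  proof -
    have "(\<integral>x'. s1 * (w x' * f x') \<partial>lam) \<le> Kop \<kappa> f x"
      unfolding Kop_def using k w f s(3) mult_right_mono[OF s(3) f(2)]
      by (intro integral_mono bfun_integrable_lam bfun_section bfun_arith) (auto simp: mult.assoc)
    then show ?thesis by simp
  qed
  have "s1 / s2 * (c - a) * Kop \<kappa> v x \<le> Kop \<kappa> u x - a * Kop \<kappa> v x" for x
  proof -
    have "s1 * (\<integral>x. w x * (u x - a * v x) \<partial>lam) \<le> Kop \<kappa> (\<lambda>x. u x - a * v x) x"
      using ab u v by (intro low bfun_arith) auto
    moreover have "(\<integral>x. w x * (u x - a * v x) \<partial>lam) = U - a * V"
    proof -
      have "(\<integral>x. w x * u x - a * (w x * v x) \<partial>lam) = U - a * V" using iw by (simp add: U_def V_def)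
      then show ?thesis by (simp add: algebra_simps)
    qed
    moreover have "s1 / s2 * (c - a) * Kop \<kappa> v x \<le> s1 / s2 * (c - a) * (s2 * V)"
      using kv c s by (intro mult_left_mono) auto
    moreover have "s1 / s2 * (c - a) * (s2 * V) = s1 * (U - a * V)"
      using s(1,2) by (simp add: c(3) field_simps)
    ultimately show ?thesis unfolding Kop_diff_scale[OF k u v(1), of a x] by simp
  qed
  moreover have "s1 / s2 * (b - c) * Kop \<kappa> v x \<le> b * Kop \<kappa> v x - Kop \<kappa> u x" for x
  proof -
    have bf: "bfun (\<lambda>x. b * v x)" using v by (intro bfun_arith) auto
    have "s1 * (\<integral>x. w x * (b * v x - 1 * u x) \<partial>lam) \<le> Kop \<kappa> (\<lambda>x. b * v x - 1 * u x) x"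
      using ab u v bf by (intro low bfun_arith) auto
    moreover have "(\<integral>x. w x * (b * v x - 1 * u x) \<partial>lam) = b * V - U"
    proof -
      have "(\<integral>x. b * (w x * v x) - w x * u x \<partial>lam) = b * V - U" using iw by (simp add: U_def V_def)
      then show ?thesis by (simp add: algebra_simps)
    qed
    moreover have "s1 / s2 * (b - c) * Kop \<kappa> v x \<le> s1 / s2 * (b - c) * (s2 * V)"
      using kv c s by (intro mult_left_mono) auto
    moreover have "Kop \<kappa> (\<lambda>x. b * v x) x = b * Kop \<kappa> v x"
      using Kop_diff_scale[OF k bfun_const[of 0] v(1), of "- b" x] by (simp add: Kop_def)
    moreover have "s1 / s2 * (b - c) * (s2 * V) = s1 * (b * V - U)"
      using s(1,2) by (simp add: c(3) field_simps)
    ultimately show ?thesis unfolding Kop_diff_scale[OF k bf u, of 1 x] by simp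
  qed
  moreover have "s1 / s2 * (b - c) \<le> b - c" "s1 / s2 * (c - a) \<le> c - a" "0 \<le> s1 / s2 * (b - c)" "0 \<le> s1 / s2 * (c - a)"
  proof -
    have "s1 / s2 \<le> 1" "0 \<le> s1 / s2" using s by auto
    then show "s1 / s2 * (b - c) \<le> b - c" "s1 / s2 * (c - a) \<le> c - a" "0 \<le> s1 / s2 * (b - c)" "0 \<le> s1 / s2 * (c - a)"
      using c by (intro mult_left_le_one_le mult_nonneg_nonneg; simp)+
  qed
  ultimately show ?thesis
    by - (rule exI[of _ "a + s1 / s2 * (c - a)"], rule exI[of _ "b - s1 / s2 * (b - c)"], (simp add: algebra_simps diff_divide_distrib))
qed

text \<open>Positive operators preserve the signs of \<open>u - a * v\<close> and
  \<open>b * v - u\<close>. Bounds on a ratio, once reached, therefore survive any number of further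
  steps.\<close>

lemma Kit_ratio_bounds:
  assumes k: "\<And>i. bker (\<kappa> i)" "\<And>i x x'. 0 \<le> \<kappa> i x x'"
    and uv: "bfun u" "bfun v" "\<And>x. a * v x \<le> u x" "\<And>x. u x \<le> b * v x"
  shows "a * Kit \<kappa> n r v x \<le> Kit \<kappa> n r u x" "Kit \<kappa> n r u x \<le> b * Kit \<kappa> n r v x"
proof -
  have "0 \<le> Kit \<kappa> n r (\<lambda>x. u x - a * v x) x"
    using uv by (intro Kit_nonneg k bfun_arith) auto
  then show "a * Kit \<kappa> n r v x \<le> Kit \<kappa> n r u x"
    by (simp add: Kit_diff_scale[OF k(1) uv(1,2)])
  have "0 \<le> Kit \<kappa> n r (\<lambda>x. - u x - (- b) * v x) x"
    using uv bfun_arith(3)[OF uv(1,1), of "-1"] by (intro Kit_nonneg k bfun_arith) auto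
  moreover have "bfun (\<lambda>x. - u x)" using bfun_arith(3)[OF uv(1,1), of "-1"] by simp
  moreover have "Kit \<kappa> n r (\<lambda>x. - u x) x = - Kit \<kappa> n r u x"
    using Kit_diff_scale[OF k(1) bfun_const[of 0] uv(1), where c = 1] by (simp add: Kit_zero)
  ultimately show "Kit \<kappa> n r u x \<le> b * Kit \<kappa> n r v x"
    using Kit_diff_scale[OF k(1) _ uv(2), where f = "\<lambda>x. - u x" and c = "- b" and n = n and r = r] by simp
qed

text \<open>The dominating weight \<open>w i\<close> may change from step to step; only the ratio of
  the two constants enters the rate. In the applications \<open>w i\<close> is the emission density
  at the observation of time \<open>i\<close>, so the rate is the same for all observations.\<close>

lemma Kit_contract:
  assumes k: "\<And>i. bker (\<kappa> i)" and w: "\<And>i. bfun (w i)" "\<And>i x. 0 \<le> w i x"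
    and s: "0 < s1" "s1 \<le> s2" "\<And>i x x'. s1 * w i x' \<le> \<kappa> i x x'" "\<And>i x x'. \<kappa> i x x' \<le> s2 * w i x'"
    and u: "bfun u" and v: "bfun v" "\<And>x. 0 \<le> v x"
    and ab: "\<And>x. a * v x \<le> u x" "\<And>x. u x \<le> b * v x" "a \<le> b"
  shows "\<exists>a' b'. a \<le> a' \<and> a' \<le> b' \<and> b' \<le> b \<and> b' - a' = (1 - s1 / s2) ^ n * (b - a) \<and>
    (\<forall>x. a' * Kit \<kappa> n r v x \<le> Kit \<kappa> n r u x \<and> Kit \<kappa> n r u x \<le> b' * Kit \<kappa> n r v x)"
proof (induction n arbitrary: r)
  case 0
  show ?case using ab by - (rule exI[of _ a], rule exI[of _ b], auto)
next
  case (Suc n)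
  have pos: "0 \<le> \<kappa> i x x'" for i x x'
    using s(1) s(3)[of i x' x] w(2)[of i x'] by (meson mult_nonneg_nonneg less_imp_le order_trans)
  obtain a1 b1 where 1: "a \<le> a1" "a1 \<le> b1" "b1 \<le> b" "b1 - a1 = (1 - s1 / s2) ^ n * (b - a)"
    "\<And>x. a1 * Kit \<kappa> n (r + 1) v x \<le> Kit \<kappa> n (r + 1) u x" "\<And>x. Kit \<kappa> n (r + 1) u x \<le> b1 * Kit \<kappa> n (r + 1) v x"
    using Suc[of "r + 1"] by auto
  obtain a2 b2 where 2: "a1 \<le> a2" "a2 \<le> b2" "b2 \<le> b1" "b2 - a2 = (1 - s1 / s2) * (b1 - a1)"
    "\<forall>x. a2 * Kop (\<kappa> (r + 1)) (Kit \<kappa> n (r + 1) v) x \<le> Kop (\<kappa> (r + 1)) (Kit \<kappa> n (r + 1) u) x \<and>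
      Kop (\<kappa> (r + 1)) (Kit \<kappa> n (r + 1) u) x \<le> b2 * Kop (\<kappa> (r + 1)) (Kit \<kappa> n (r + 1) v) x"
    using Kop_contract[OF k[of "r + 1"] w(1)[of "r + 1"] w(2) s(1,2) s(3,4) bfun_Kit[OF k u] bfun_Kit[OF k v(1)]
        Kit_nonneg[OF k v(1) pos v(2)] 1(5,6,2)] by blast
  show ?case using 1 2 by - (rule exI[of _ a2], rule exI[of _ b2], (simp add: mult.assoc))
qed

section \<open>Integrals over trajectories as iterated kernels\<close>

lemma prob_on_measurable: "is_prob_on lam \<nu> \<Longrightarrow> borel_measurable \<nu> = borel_measurable lam"
  by (rule measurable_cong_sets) (auto simp: is_prob_on_def)

lemma prob_on_finite: "is_prob_on lam \<nu> \<Longrightarrow> finite_measure \<nu>"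
  unfolding is_prob_on_def using prob_space.finite_measure by blast

lemma prob_on_integrable: "is_prob_on lam \<nu> \<Longrightarrow> bfun f \<Longrightarrow> integrable \<nu> f"
  by (rule bfun_integrable) (auto simp: is_prob_on_def intro: prob_space.finite_measure)

lemma path_product_sigma_finite:
  assumes "is_prob_on lam \<nu>"
  shows "product_sigma_finite (\<lambda>i. if i = r then \<nu> else lam)"
  using prob_on_finite[OF assms] finite_measure_axioms
  by (auto simp: product_sigma_finite_def finite_measure.axioms)

lemma finite_path_measure:
  assumes "is_prob_on lam \<nu>" shows "finite_measure (path_measure lam \<nu> r t)"
proof
  interpret product_sigma_finite "\<lambda>i. if i = r then \<nu> else lam" by (rule path_product_sigma_finite[OF assms])
  have "emeasure (path_measure lam \<nu> r t) (space (path_measure lam \<nu> r t))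
      = (\<Prod>i\<in>{r..t}. emeasure (if i = r then \<nu> else lam) (space (if i = r then \<nu> else lam)))"
    unfolding path_measure_def space_PiM by (rule emeasure_PiM) auto
  moreover have "emeasure (if i = r then \<nu> else lam) (space (if i = r then \<nu> else lam)) \<noteq> \<infinity>" for i
    using finite_measure.emeasure_finite[OF prob_on_finite[OF assms]] emeasure_finite by auto
  ultimately show "emeasure (path_measure lam \<nu> r t) (space (path_measure lam \<nu> r t)) \<noteq> \<infinity>"
    by (simp add: ennreal_prod_eq_top)
qed

lemma path_component_measurable:
  assumes "is_prob_on lam \<nu>" "i \<in> {r..t}"
  shows "(\<lambda>x. x i) \<in> measurable (path_measure lam \<nu> r t) lam"
proof -
  have "(\<lambda>x. x i) \<in> measurable (path_measure lam \<nu> r t) (if i = r then \<nu> else lam)"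
    unfolding path_measure_def using assms(2) by (rule measurable_component_singleton)
  moreover have "sets (if i = r then \<nu> else lam) = sets lam" using assms(1) by (auto simp: is_prob_on_def)
  ultimately show ?thesis using measurable_cong_sets by blast
qed

lemma path_integrand:
  assumes \<nu>: "is_prob_on lam \<nu>" and \<kappa>: "\<And>i. bker (\<kappa> i)" and a: "bfun a" and f: "bfun f" and rt: "r \<le> t"
  shows "integrable (path_measure lam \<nu> r t) (\<lambda>x. a (x r) * (\<Prod>i\<in>{r..<t}. \<kappa> (i + 1) (x i) (x (i + 1))) * f (x t))"
proof -
  obtain A where A: "A > 0" "\<And>x. \<bar>a x\<bar> \<le> A" using bfun_bound[OF a] by auto
  obtain F where F: "F > 0" "\<And>x. \<bar>f x\<bar> \<le> F" using bfun_bound[OF f] by auto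
  obtain B where B: "\<And>i. B i > 0" "\<And>i x x'. \<bar>\<kappa> i x x'\<bar> \<le> B i" using bker_bound[OF \<kappa>] by metis
  have m1: "(\<lambda>x. a (x r)) \<in> borel_measurable (path_measure lam \<nu> r t)"
    "(\<lambda>x. f (x t)) \<in> borel_measurable (path_measure lam \<nu> r t)"
    using rt by (auto intro!: measurable_compose[OF path_component_measurable[OF \<nu>]] bfun_measurable a f)
  have m2: "(\<lambda>x. \<kappa> (i + 1) (x i) (x (i + 1))) \<in> borel_measurable (path_measure lam \<nu> r t)" if "i \<in> {r..<t}" for i
  proof -
    have "(\<lambda>x. (x i, x (i + 1))) \<in> measurable (path_measure lam \<nu> r t) (lam \<Otimes>\<^sub>M lam)"
      using that by (intro measurable_Pair path_component_measurable \<nu>) auto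
    moreover have "(\<lambda>(x, x'). \<kappa> (i + 1) x x') \<in> borel_measurable (lam \<Otimes>\<^sub>M lam)" using \<kappa> by (simp add: bker_def)
    ultimately show ?thesis by (auto dest: measurable_compose)
  qed
  have "\<bar>a (x r) * (\<Prod>i\<in>{r..<t}. \<kappa> (i + 1) (x i) (x (i + 1))) * f (x t)\<bar> \<le> A * (\<Prod>i\<in>{r..<t}. B (i + 1)) * F" for x
    unfolding abs_mult abs_prod using A F B
    by (intro mult_mono prod_mono mult_nonneg_nonneg prod_nonneg) (auto intro: less_imp_le)
  then show ?thesis
    using m1 m2 by (intro finite_measure.integrable_const_bound[OF finite_path_measure[OF \<nu>],
      where B = "A * (\<Prod>i\<in>{r..<t}. B (i + 1)) * F"] borel_measurable_times borel_measurable_prod) auto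
qed

text \<open>Fubini, removing the last coordinate: integrating out the state at time
  \<open>t + 1\<close> replaces \<open>f\<close> by its image under the last kernel, which is why
  \<open>f\<close> is generalized in the induction. The factor \<open>a\<close> at the initial time
  makes room for the emission density of the first state in \<open>likelihood\<close>. From here on
  product measures are needed only for perturbing weights and for Jensen's inequality.\<close>

lemma path_integral_eq_Kit:
  assumes \<nu>: "is_prob_on lam \<nu>" and \<kappa>: "\<And>i. bker (\<kappa> i)" and a: "bfun a" and f: "bfun f"
  shows "(\<integral>x. a (x r) * (\<Prod>i\<in>{r..<r + int n}. \<kappa> (i + 1) (x i) (x (i + 1))) * f (x (r + int n)) \<partial>path_measure lam \<nu> r (r + int n))
    = (\<integral>x. a x * Kit \<kappa> n r f x \<partial>\<nu>)"
  using f
proof (induction n arbitrary: f)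
  case 0
  interpret product_sigma_finite "\<lambda>i. if i = r then \<nu> else lam" by (rule path_product_sigma_finite[OF \<nu>])
  have "(\<lambda>x. a x * f x) \<in> borel_measurable \<nu>"
    using bfun_arith(4)[OF a 0] prob_on_measurable[OF \<nu>] by (auto simp: bfun_def)
  then show ?case
    using product_integral_singleton[of "\<lambda>x. a x * f x" r] by (simp add: path_measure_def)
next
  case (Suc n)
  interpret product_sigma_finite "\<lambda>i. if i = r then \<nu> else lam" by (rule path_product_sigma_finite[OF \<nu>])
  let ?M = "\<lambda>i. if i = r then \<nu> else lam"
  define t where "t = r + int n"
  have t: "r + int (Suc n) = t + 1" "r \<le> t" by (auto simp: t_def)
  have ins: "{r..t + 1} = insert (t + 1) {r..t}" using t by auto
  have ins': "{r..<t + 1} = insert t {r..<t}" using t by auto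
  let ?F = "\<lambda>x. a (x r) * (\<Prod>i\<in>{r..<t + 1}. \<kappa> (i + 1) (x i) (x (i + 1))) * f (x (t + 1))"
  have "integrable (path_measure lam \<nu> r (t + 1)) ?F"
    using t by (intro path_integrand \<nu> \<kappa> a Suc) auto
  then have "(\<integral>x. ?F x \<partial>path_measure lam \<nu> r (t + 1)) = (\<integral>x. (\<integral>y. ?F (x(t + 1 := y)) \<partial>?M (t + 1)) \<partial>PiM {r..t} ?M)"
    unfolding path_measure_def ins by (intro product_integral_insert) auto
  also have "\<dots> = (\<integral>x. a (x r) * (\<Prod>i\<in>{r..<t}. \<kappa> (i + 1) (x i) (x (i + 1))) * Kop (\<kappa> (t + 1)) f (x t) \<partial>PiM {r..t} ?M)"
  proof (rule Bochner_Integration.integral_cong[OF refl])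
    fix x
    have "(\<Prod>i\<in>{r..<t}. \<kappa> (i + 1) ((x(t + 1 := y)) i) ((x(t + 1 := y)) (i + 1))) = (\<Prod>i\<in>{r..<t}. \<kappa> (i + 1) (x i) (x (i + 1)))" for y
      by (rule prod.cong) auto
    then have *: "?F (x(t + 1 := y)) = a (x r) * (\<Prod>i\<in>{r..<t}. \<kappa> (i + 1) (x i) (x (i + 1))) * (\<kappa> (t + 1) (x t) y * f y)" for y
      using t(2) by (simp add: ins')
    then show "(\<integral>y. ?F (x(t + 1 := y)) \<partial>?M (t + 1)) = a (x r) * (\<Prod>i\<in>{r..<t}. \<kappa> (i + 1) (x i) (x (i + 1))) * Kop (\<kappa> (t + 1)) f (x t)"
      unfolding * Kop_def using t(2) by simp
  qed
  also have "\<dots> = (\<integral>x. a x * Kit \<kappa> n r (Kop (\<kappa> (t + 1)) f) x \<partial>\<nu>)"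
    using Suc.IH[OF bfun_Kop[OF \<kappa> Suc.prems], of "t + 1"] by (simp add: t_def path_measure_def)
  also have "\<dots> = (\<integral>x. a x * Kit \<kappa> (Suc n) r f x \<partial>\<nu>)"
    unfolding Kit_Suc_right t_def ..
  finally show ?case unfolding t .
qed

end

section \<open>Covariances under mixing\<close>

lemma space_gen_sigma [simp]: "space (gen_sigma P N Z I) = space P"
  by (simp add: gen_sigma_def space_measure_of_conv)

lemma sets_gen_sigma:
  "sets (gen_sigma P N Z I) = sigma_sets (space P) {Z i -` A \<inter> space P | i A. i \<in> I \<and> A \<in> sets (N i)}"
  unfolding gen_sigma_def by (rule sets_measure_of) auto

lemma measurable_gen_sigma:
  assumes "i \<in> I" "Z i \<in> measurable P (N i)"
  shows "Z i \<in> measurable (gen_sigma P N Z I) (N i)"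
proof (rule measurableI)
  show "Z i x \<in> space (N i)" if "x \<in> space (gen_sigma P N Z I)" for x
    using assms(2) that by (auto dest: measurable_space)
  show "Z i -` A \<inter> space (gen_sigma P N Z I) \<in> sets (gen_sigma P N Z I)" if "A \<in> sets (N i)" for A
    using assms(1) that by (auto simp: sets_gen_sigma intro!: sigma_sets.Basic)
qed

lemma subalgebra_gen_sigma:
  assumes "\<And>i. i \<in> I \<Longrightarrow> Z i \<in> measurable P (N i)"
  shows "subalgebra P (gen_sigma P N Z I)"
proof -
  have "sets (gen_sigma P N Z I) \<subseteq> sets P"
    unfolding sets_gen_sigma by (rule sets.sigma_sets_subset) (use assms in \<open>auto intro: measurable_sets\<close>)
  then show ?thesis by (simp add: subalgebra_def)
qed

text \<open>Layer-cake approximation: of the \<open>N\<close> equidistant levels in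
  \<open>(0, K]\<close>, those not above \<open>z\<close> are the lowest ones, and their number
  times the mesh is \<open>z\<close> up to one mesh. It carries covariance bounds from events to
  bounded functions.\<close>

lemma layer_approx:
  fixes z K :: real
  assumes "0 \<le> z" "z \<le> K" "0 < K" "0 < N"
  shows "\<bar>z - K / real N * (\<Sum>j=1..N. indicator {real j * K / real N..} z)\<bar> \<le> K / real N"
proof -
  define k where "k = nat \<lfloor>z * real N / K\<rfloor>"
  have nn: "0 \<le> z * real N / K" using assms by simp
  have "real k \<le> z * real N / K" "z * real N / K < real k + 1"
    using nn unfolding k_def by linarith+
  then have k: "real k * K / real N \<le> z" "z < (real k + 1) * K / real N"
    using assms by (auto simp: field_simps)
  have kN: "k \<le> N"
  proof -
    have "real k * K \<le> z * real N" using k(1) assms by (simp add: field_simps)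
    also have "\<dots> \<le> real N * K" using assms by (simp add: mult.commute mult_left_mono)
    finally have "real k * K \<le> real N * K" .
    then show ?thesis using assms by simp
  qed
  have "indicator {real j * K / real N..} z = (if j \<le> k then 1 else (0::real))" for j
  proof (cases "j \<le> k")
    case True
    then have "real j * K / real N \<le> real k * K / real N" using assms by (intro divide_right_mono mult_right_mono) auto
    then show ?thesis using True k by (auto simp: indicator_def)
  next
    case False
    then have "(real k + 1) * K / real N \<le> real j * K / real N" using assms by (intro divide_right_mono mult_right_mono) auto
    then show ?thesis using False k by (auto simp: indicator_def)
  qed
  then have "(\<Sum>j=1..N. indicator {real j * K / real N..} z) = (\<Sum>j=1..N. if j \<le> k then 1 else (0::real))" by simp
  also have "\<dots> = real (card ({1..N} \<inter> {j. j \<le> k}))" by (simp add: sum.If_cases)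
  also have "{1..N} \<inter> {j. j \<le> k} = {1..k}" using kN by auto
  finally have "K / real N * (\<Sum>j=1..N. indicator {real j * K / real N..} z) = real k * K / real N" by simp
  moreover have "(real k + 1) * K / real N = real k * K / real N + K / real N"
    by (simp add: add_divide_distrib distrib_right)
  moreover have "0 \<le> K / real N" using assms by simp
  ultimately show ?thesis using k by linarith
qed

locale observed_process = prob_space P for P :: "'w measure" +
  fixes mu :: "'y measure" and Y :: "int \<Rightarrow> 'w \<Rightarrow> 'y"
  assumes Y: "\<And>k. Y k \<in> measurable P mu"
begin

abbreviation "sig I \<equiv> gen_sigma P (\<lambda>_. mu) Y I"

lemma sig_subalg: "subalgebra P (sig I)"
  by (rule subalgebra_gen_sigma) (rule Y)

lemma sigma_finite_sig: "sigma_finite_subalgebra P (sig I)"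
  by (intro finite_measure_subalgebra_is_sigma_finite)
     (simp add: finite_measure_subalgebra_def finite_measure_subalgebra_axioms_def sig_subalg finite_measure_axioms)

lemma sig_borel: "f \<in> borel_measurable (sig I) \<Longrightarrow> f \<in> borel_measurable P"
  using measurable_from_subalg[OF sig_subalg] .

lemma bounded_integrable: "f \<in> borel_measurable P \<Longrightarrow> (\<And>\<omega>. \<bar>f \<omega>\<bar> \<le> K) \<Longrightarrow> integrable P (f :: 'w \<Rightarrow> real)"
  by (rule integrable_const_bound[where B = K]) auto

text \<open>Both suprema in the coefficient are taken over reals, so an upper bound is needed for
  each of them; it is 1, because a conditional probability and a probability both lie in the unit
  interval.\<close>

lemma integral_cond_exp_diff_le:
  assumes "B \<in> sets (sig {u + int n..})"
  shows "(\<integral>\<omega>. \<bar>real_cond_exp P (sig {..u}) (indicator B) \<omega> - measure P B\<bar> \<partial>P) \<le> mixing_coeff P mu Y n"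
proof -
  let ?f = "\<lambda>u B. \<integral>\<omega>. \<bar>real_cond_exp P (sig {..u}) (indicator B) \<omega> - measure P B\<bar> \<partial>P"
  have le2: "?f u B \<le> 1" if "B \<in> sets P" for u B
  proof -
    interpret sigma_finite_subalgebra P "sig {..u}" by (rule sigma_finite_sig)
    have i: "integrable P (indicator B :: 'w \<Rightarrow> real)" using that by (simp add: emeasure_eq_measure)
    have "AE \<omega> in P. real_cond_exp P (sig {..u}) (indicator B) \<omega> \<ge> 0"
      using real_cond_exp_ge_c[OF i, of 0] by simp
    moreover have "AE \<omega> in P. real_cond_exp P (sig {..u}) (indicator B) \<omega> \<le> 1"
      using real_cond_exp_le_c[OF i, of 1] by (simp add: indicator_def)
    ultimately have "AE \<omega> in P. \<bar>real_cond_exp P (sig {..u}) (indicator B) \<omega> - measure P B\<bar> \<le> 1"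
      by eventually_elim (use prob_le_1[of B] measure_nonneg[of P B] in linarith)
    then show ?thesis
      using real_cond_exp_int(1)[OF i] integral_mono_AE[of P "\<lambda>\<omega>. \<bar>real_cond_exp P (sig {..u}) (indicator B) \<omega> - measure P B\<bar>" "\<lambda>_. 1"]
      by (simp add: prob_space)
  qed
  have sub: "sets (sig I) \<subseteq> sets P" for I using sig_subalg by (auto simp: subalgebra_def)
  have "?f u B \<le> (SUP B\<in>sets (sig {u + int n..}). ?f u B)"
    using assms le2 sub by (intro cSUP_upper bdd_aboveI2[where M = 1]) auto
  also have "\<dots> \<le> mixing_coeff P mu Y n"
    unfolding mixing_coeff_def using le2 sub
    by (intro cSUP_upper bdd_aboveI2[where M = 1] cSUP_least) (auto intro: sets.top)
  finally show ?thesis .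
qed

text \<open>Conditioning on the past replaces the indicator of \<open>B\<close> by its conditional
  probability, so the covariance is the mean of \<open>X\<close> times the difference that the
  mixing coefficient measures.\<close>

lemma cov_indicator_le:
  assumes X: "X \<in> borel_measurable (sig {..u})" "\<And>\<omega>. \<bar>X \<omega>\<bar> \<le> K"
    and B: "B \<in> sets (sig {u + int n..})"
  shows "\<bar>(\<integral>\<omega>. X \<omega> * indicator B \<omega> \<partial>P) - (\<integral>\<omega>. X \<omega> \<partial>P) * measure P B\<bar> \<le> K * mixing_coeff P mu Y n"
proof -
  interpret sigma_finite_subalgebra P "sig {..u}" by (rule sigma_finite_sig)
  have BP: "B \<in> sets P" using B sig_subalg by (auto simp: subalgebra_def)
  have XP: "X \<in> borel_measurable P" using X(1) by (rule sig_borel)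
  have K: "0 \<le> K" using X(2) by (meson abs_ge_zero order_trans)
  have i: "integrable P (indicator B :: 'w \<Rightarrow> real)" using BP by (simp add: emeasure_eq_measure)
  have iX: "integrable P (\<lambda>\<omega>. X \<omega> * indicator B \<omega>)" using XP BP X(2) K
    by (intro bounded_integrable[where K = K]) (auto simp: indicator_def)
  note c = real_cond_exp_intg[OF iX X(1)] real_cond_exp_int[OF i]
  have m: "(indicator B :: 'w \<Rightarrow> real) \<in> borel_measurable P" using BP by simp
  have "(\<integral>\<omega>. X \<omega> * indicator B \<omega> \<partial>P) - (\<integral>\<omega>. X \<omega> \<partial>P) * measure P B
      = (\<integral>\<omega>. X \<omega> * real_cond_exp P (sig {..u}) (indicator B) \<omega> \<partial>P) - (\<integral>\<omega>. X \<omega> * measure P B \<partial>P)"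
    using c m by simp
  also have "\<dots> = (\<integral>\<omega>. X \<omega> * (real_cond_exp P (sig {..u}) (indicator B) \<omega> - measure P B) \<partial>P)"
    using c m bounded_integrable[OF XP X(2)] by (simp add: right_diff_distrib)
  finally have "\<bar>(\<integral>\<omega>. X \<omega> * indicator B \<omega> \<partial>P) - (\<integral>\<omega>. X \<omega> \<partial>P) * measure P B\<bar>
      \<le> (\<integral>\<omega>. \<bar>X \<omega> * (real_cond_exp P (sig {..u}) (indicator B) \<omega> - measure P B)\<bar> \<partial>P)"
    by (simp only: integral_abs_bound)
  also have "\<dots> \<le> (\<integral>\<omega>. K * \<bar>real_cond_exp P (sig {..u}) (indicator B) \<omega> - measure P B\<bar> \<partial>P)"
  proof (rule integral_mono)
    have "integrable P (\<lambda>\<omega>. X \<omega> * real_cond_exp P (sig {..u}) (indicator B) \<omega> - X \<omega> * measure P B)"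
      using c m bounded_integrable[OF XP X(2)] by simp
    then show "integrable P (\<lambda>\<omega>. \<bar>X \<omega> * (real_cond_exp P (sig {..u}) (indicator B) \<omega> - measure P B)\<bar>)"
      by (simp add: right_diff_distrib)
    show "integrable P (\<lambda>\<omega>. K * \<bar>real_cond_exp P (sig {..u}) (indicator B) \<omega> - measure P B\<bar>)" using c by simp
  qed (use X(2) in \<open>auto simp: abs_mult intro: mult_right_mono\<close>)
  also have "\<dots> \<le> K * mixing_coeff P mu Y n"
    using integral_cond_exp_diff_le[OF B] K by (simp add: mult_left_mono)
  finally show ?thesis .
qed

text \<open>\<open>Z\<close> is approximated by an average of indicators of its superlevel sets,
  which are events of the future. The \<open>N\<close> covariances carry weight
  \<open>K' / N\<close> each, so the bound does not grow with the number of levels, and the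
  approximation error vanishes as that number tends to infinity.\<close>

lemma cov_bounded_nonneg_le:
  assumes X: "X \<in> borel_measurable (sig {..u})" "\<And>\<omega>. \<bar>X \<omega>\<bar> \<le> K"
    and Z: "Z \<in> borel_measurable (sig {u + int n..})" "\<And>\<omega>. 0 \<le> Z \<omega>" "\<And>\<omega>. Z \<omega> \<le> K'" and K': "0 < K'"
  shows "\<bar>(\<integral>\<omega>. X \<omega> * Z \<omega> \<partial>P) - (\<integral>\<omega>. X \<omega> \<partial>P) * (\<integral>\<omega>. Z \<omega> \<partial>P)\<bar> \<le> K * K' * mixing_coeff P mu Y n"
proof -
  have XP: "X \<in> borel_measurable P" and ZP: "Z \<in> borel_measurable P" using X(1) Z(1) by (auto intro: sig_borel)
  have K: "0 \<le> K" using X(2) by (meson abs_ge_zero order_trans)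
  have bound: "\<bar>(\<integral>\<omega>. X \<omega> * Z \<omega> \<partial>P) - (\<integral>\<omega>. X \<omega> \<partial>P) * (\<integral>\<omega>. Z \<omega> \<partial>P)\<bar>
      \<le> K * K' * mixing_coeff P mu Y n + 2 * K * K' / real N" if N: "0 < N" for N
  proof -
    define B where "B j = {\<omega> \<in> space P. real j * K' / real N \<le> Z \<omega>}" for j
    have BF: "B j \<in> sets (sig {u + int n..})" for j
      using measurable_sets[OF Z(1), of "{real j * K' / real N..}"] by (simp add: B_def vimage_def Int_def conj_commute)
    then have BP: "B j \<in> sets P" for j using sig_subalg by (auto simp: subalgebra_def)
    define ZN where "ZN \<omega> = K' / real N * (\<Sum>j=1..N. indicator (B j) \<omega>)" for \<omega>
    have iI: "integrable P (\<lambda>\<omega>. X \<omega> * indicator (B j) \<omega>)" for j using XP BP X(2) K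
      by (intro bounded_integrable[where K = K]) (auto simp: indicator_def)
    have iB: "integrable P (indicator (B j) :: 'w \<Rightarrow> real)" for j using BP by (simp add: emeasure_eq_measure)
    have ZN: "ZN \<in> borel_measurable P"
      unfolding ZN_def by (intro borel_measurable_times borel_measurable_const borel_measurable_sum borel_measurable_indicator BP)
    have close: "\<bar>Z \<omega> - ZN \<omega>\<bar> \<le> K' / real N" if "\<omega> \<in> space P" for \<omega>
    proof -
      have "indicator (B j) \<omega> = (indicator {real j * K' / real N..} (Z \<omega>) :: real)" for j
        using that by (auto simp: B_def indicator_def)
      then show ?thesis using layer_approx[OF Z(2,3) K' N, of \<omega>] by (simp add: ZN_def)
    qed
    have iX: "integrable P X" by (rule bounded_integrable[OF XP X(2)])
    have iZ: "integrable P Z" by (rule bounded_integrable[OF ZP, where K = K']) (use Z in auto)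
    have iXZ: "integrable P (\<lambda>\<omega>. X \<omega> * Z \<omega>)" using XP ZP X(2) Z(2,3) K
      by (intro bounded_integrable[where K = "K * K'"]) (auto simp: abs_mult intro!: mult_mono)
    have iZN: "integrable P ZN" unfolding ZN_def using iB by (intro integrable_mult_right Bochner_Integration.integrable_sum)
    have eq: "(\<lambda>\<omega>. X \<omega> * ZN \<omega>) = (\<lambda>\<omega>. K' / real N * (\<Sum>j=1..N. X \<omega> * indicator (B j) \<omega>))"
      by (simp only: ZN_def sum_distrib_left mult_ac)
    have iXZN: "integrable P (\<lambda>\<omega>. X \<omega> * ZN \<omega>)" unfolding eq using iI
      by (intro integrable_mult_right Bochner_Integration.integrable_sum)
    have 1: "(\<integral>\<omega>. X \<omega> * ZN \<omega> \<partial>P) = K' / real N * (\<Sum>j=1..N. \<integral>\<omega>. X \<omega> * indicator (B j) \<omega> \<partial>P)"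
      unfolding eq integral_mult_right_zero by (subst Bochner_Integration.integral_sum) (use iI in auto)
    have 2: "(\<integral>\<omega>. ZN \<omega> \<partial>P) = K' / real N * (\<Sum>j=1..N. measure P (B j))"
      unfolding ZN_def using iB BP by (simp add: Bochner_Integration.integral_sum)
    have "\<bar>(\<integral>\<omega>. X \<omega> * ZN \<omega> \<partial>P) - (\<integral>\<omega>. X \<omega> \<partial>P) * (\<integral>\<omega>. ZN \<omega> \<partial>P)\<bar>
       = K' / real N * \<bar>\<Sum>j=1..N. (\<integral>\<omega>. X \<omega> * indicator (B j) \<omega> \<partial>P) - (\<integral>\<omega>. X \<omega> \<partial>P) * measure P (B j)\<bar>"
    proof -
      have "(\<integral>\<omega>. X \<omega> * ZN \<omega> \<partial>P) - (\<integral>\<omega>. X \<omega> \<partial>P) * (\<integral>\<omega>. ZN \<omega> \<partial>P)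
        = K' / real N * (\<Sum>j=1..N. (\<integral>\<omega>. X \<omega> * indicator (B j) \<omega> \<partial>P) - (\<integral>\<omega>. X \<omega> \<partial>P) * measure P (B j))"
        unfolding 1 2 by (simp add: sum_subtractf sum_distrib_left right_diff_distrib mult.left_commute)
      then show ?thesis using K' by (simp add: abs_mult)
    qed
    also have "\<dots> \<le> K' / real N * (\<Sum>j=1..N. K * mixing_coeff P mu Y n)"
      using K' cov_indicator_le[OF X BF] by (intro mult_left_mono order_trans[OF sum_abs] sum_mono) auto
    also have "\<dots> = K * K' * mixing_coeff P mu Y n" using N by simp
    finally have A: "\<bar>(\<integral>\<omega>. X \<omega> * ZN \<omega> \<partial>P) - (\<integral>\<omega>. X \<omega> \<partial>P) * (\<integral>\<omega>. ZN \<omega> \<partial>P)\<bar> \<le> K * K' * mixing_coeff P mu Y n" .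
    have "\<bar>(\<integral>\<omega>. X \<omega> * Z \<omega> \<partial>P) - (\<integral>\<omega>. X \<omega> * ZN \<omega> \<partial>P)\<bar> = \<bar>\<integral>\<omega>. X \<omega> * Z \<omega> - X \<omega> * ZN \<omega> \<partial>P\<bar>"
      using iXZ iXZN by simp
    also have "\<dots> \<le> (\<integral>\<omega>. \<bar>X \<omega> * Z \<omega> - X \<omega> * ZN \<omega>\<bar> \<partial>P)" by (rule integral_abs_bound)
    also have "\<dots> \<le> (\<integral>\<omega>. K * (K' / real N) \<partial>P)"
    proof (rule integral_mono)
      fix \<omega> assume "\<omega> \<in> space P"
      then have "\<bar>X \<omega>\<bar> * \<bar>Z \<omega> - ZN \<omega>\<bar> \<le> K * (K' / real N)" using X(2) close K by (intro mult_mono) auto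
      then show "\<bar>X \<omega> * Z \<omega> - X \<omega> * ZN \<omega>\<bar> \<le> K * (K' / real N)" by (simp add: abs_mult flip: right_diff_distrib)
    qed (use iXZ iXZN in auto)
    finally have B1: "\<bar>(\<integral>\<omega>. X \<omega> * Z \<omega> \<partial>P) - (\<integral>\<omega>. X \<omega> * ZN \<omega> \<partial>P)\<bar> \<le> K * K' / real N" by (simp add: prob_space)
    have "\<bar>(\<integral>\<omega>. Z \<omega> \<partial>P) - (\<integral>\<omega>. ZN \<omega> \<partial>P)\<bar> = \<bar>\<integral>\<omega>. Z \<omega> - ZN \<omega> \<partial>P\<bar>" using iZ iZN by simp
    also have "\<dots> \<le> (\<integral>\<omega>. \<bar>Z \<omega> - ZN \<omega>\<bar> \<partial>P)" by (rule integral_abs_bound)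
    also have "\<dots> \<le> (\<integral>\<omega>. K' / real N \<partial>P)" using iZ iZN close by (intro integral_mono) auto
    finally have Zd: "\<bar>(\<integral>\<omega>. Z \<omega> \<partial>P) - (\<integral>\<omega>. ZN \<omega> \<partial>P)\<bar> \<le> K' / real N" by (simp add: prob_space)
    have "\<bar>\<integral>\<omega>. X \<omega> \<partial>P\<bar> \<le> (\<integral>\<omega>. \<bar>X \<omega>\<bar> \<partial>P)" by (rule integral_abs_bound)
    also have "\<dots> \<le> (\<integral>\<omega>. K \<partial>P)" using iX X(2) by (intro integral_mono) auto
    finally have "\<bar>\<integral>\<omega>. X \<omega> \<partial>P\<bar> \<le> K" by (simp add: prob_space)
    then have "\<bar>\<integral>\<omega>. X \<omega> \<partial>P\<bar> * \<bar>(\<integral>\<omega>. Z \<omega> \<partial>P) - (\<integral>\<omega>. ZN \<omega> \<partial>P)\<bar> \<le> K * (K' / real N)"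
      using Zd K by (intro mult_mono) auto
    then have B2: "\<bar>(\<integral>\<omega>. X \<omega> \<partial>P) * (\<integral>\<omega>. Z \<omega> \<partial>P) - (\<integral>\<omega>. X \<omega> \<partial>P) * (\<integral>\<omega>. ZN \<omega> \<partial>P)\<bar> \<le> K * K' / real N"
      by (simp add: abs_mult flip: right_diff_distrib)
    show ?thesis using A B1 B2 by linarith
  qed
  have "(\<lambda>N. K * K' * mixing_coeff P mu Y n + 2 * K * K' / real (Suc N)) \<longlonglongrightarrow> K * K' * mixing_coeff P mu Y n + 2 * K * K' * 0"
    unfolding divide_inverse by (intro tendsto_intros LIMSEQ_inverse_real_of_nat)
  then have "\<bar>(\<integral>\<omega>. X \<omega> * Z \<omega> \<partial>P) - (\<integral>\<omega>. X \<omega> \<partial>P) * (\<integral>\<omega>. Z \<omega> \<partial>P)\<bar> \<le> K * K' * mixing_coeff P mu Y n + 2 * K * K' * 0"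
    by (rule LIMSEQ_le_const) (use bound[of "Suc _"] in auto)
  then show ?thesis by simp
qed

text \<open>Adding the constant \<open>K\<close> to \<open>Z\<close> makes it nonnegative and leaves
  the covariance unchanged; its range then has length \<open>2 * K\<close>, whence the factor
  2.\<close>

lemma cov_bounded_le:
  assumes X: "X \<in> borel_measurable (sig {..u})" "\<And>\<omega>. \<bar>X \<omega>\<bar> \<le> K"
    and Z: "Z \<in> borel_measurable (sig {u + int n..})" "\<And>\<omega>. \<bar>Z \<omega>\<bar> \<le> K" and K: "0 < K"
  shows "\<bar>(\<integral>\<omega>. X \<omega> * Z \<omega> \<partial>P) - (\<integral>\<omega>. X \<omega> \<partial>P) * (\<integral>\<omega>. Z \<omega> \<partial>P)\<bar> \<le> 2 * K\<^sup>2 * mixing_coeff P mu Y n"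
proof -
  have XP: "X \<in> borel_measurable P" and ZP: "Z \<in> borel_measurable P" using X(1) Z(1) by (auto intro: sig_borel)
  have iX: "integrable P X" by (rule bounded_integrable[OF XP X(2)])
  have iZ: "integrable P Z" by (rule bounded_integrable[OF ZP Z(2)])
  have iXZ: "integrable P (\<lambda>\<omega>. X \<omega> * Z \<omega>)" using XP ZP X(2) Z(2) K
    by (intro bounded_integrable[where K = "K * K"]) (auto simp: abs_mult intro!: mult_mono)
  have "\<bar>(\<integral>\<omega>. X \<omega> * (Z \<omega> + K) \<partial>P) - (\<integral>\<omega>. X \<omega> \<partial>P) * (\<integral>\<omega>. Z \<omega> + K \<partial>P)\<bar> \<le> K * (2 * K) * mixing_coeff P mu Y n"
  proof (rule cov_bounded_nonneg_le[OF X])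
    show "(\<lambda>\<omega>. Z \<omega> + K) \<in> borel_measurable (sig {u + int n..})" using Z(1) by simp
    show "0 \<le> Z \<omega> + K" "Z \<omega> + K \<le> 2 * K" for \<omega> using Z(2)[of \<omega>] by linarith+
  qed (use K in simp)
  moreover have "(\<integral>\<omega>. X \<omega> * (Z \<omega> + K) \<partial>P) = (\<integral>\<omega>. X \<omega> * Z \<omega> \<partial>P) + K * (\<integral>\<omega>. X \<omega> \<partial>P)"
    using iX iXZ by (simp add: distrib_left)
  moreover have "(\<integral>\<omega>. Z \<omega> + K \<partial>P) = (\<integral>\<omega>. Z \<omega> \<partial>P) + K" using iZ by (simp add: prob_space)
  ultimately show ?thesis by (simp add: algebra_simps power2_eq_square)
qed

end

text \<open>By monotone convergence the series of the variables has finite mean, so it converges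
  almost surely and its terms vanish. Every almost sure limit along the blocks goes through this
  argument.\<close>

lemma AE_tendsto_0_of_summable:
  fixes X :: "nat \<Rightarrow> 'w \<Rightarrow> real"
  assumes i: "\<And>n. integrable P (X n)" and nn: "\<And>n \<omega>. 0 \<le> X n \<omega>"
    and le: "\<And>n. (\<integral>\<omega>. X n \<omega> \<partial>P) \<le> c n" and c: "summable c"
  shows "AE \<omega> in P. (\<lambda>n. X n \<omega>) \<longlonglongrightarrow> 0"
proof -
  have [measurable]: "X n \<in> borel_measurable P" for n using i by auto
  have c0: "0 \<le> c n" for n by (rule order_trans[OF Bochner_Integration.integral_nonneg le]) (rule nn)
  have "(\<integral>\<^sup>+\<omega>. (\<Sum>n. ennreal (X n \<omega>)) \<partial>P) = (\<Sum>n. \<integral>\<^sup>+\<omega>. ennreal (X n \<omega>) \<partial>P)"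
    by (rule nn_integral_suminf) simp
  also have "\<dots> = (\<Sum>n. ennreal (\<integral>\<omega>. X n \<omega> \<partial>P))"
    using i nn by (simp add: nn_integral_eq_integral)
  also have "\<dots> \<le> (\<Sum>n. ennreal (c n))" using le by (intro suminf_le) (auto intro: ennreal_leI)
  also have "\<dots> < \<infinity>" using c c0 by (simp add: suminf_ennreal2 less_top[symmetric])
  finally have "AE \<omega> in P. (\<Sum>n. ennreal (X n \<omega>)) \<noteq> \<infinity>"
    by (intro nn_integral_PInf_AE) auto
  then show ?thesis
  proof eventually_elim
    case (elim \<omega>)
    then have "summable (\<lambda>n. X n \<omega>)" using nn by (intro summable_suminf_not_top) auto
    then show ?case by (rule summable_LIMSEQ_zero)
  qed
qed

section \<open>Truncation, tails and geometric sums\<close>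

definition truncate :: "real \<Rightarrow> real \<Rightarrow> real" where
  "truncate K x = max (- K) (min K x)"

lemma truncate_abs: "0 < K \<Longrightarrow> \<bar>truncate K x\<bar> \<le> K" "0 < K \<Longrightarrow> \<bar>truncate K x\<bar> \<le> \<bar>x\<bar>"
  "0 < K \<Longrightarrow> \<bar>x - truncate K x\<bar> \<le> \<bar>x\<bar>" "\<bar>x\<bar> \<le> K \<Longrightarrow> truncate K x = x"
  by (auto simp: truncate_def max_def min_def abs_if split: if_splits)

lemma abs_le_one_plus_powr: "1 \<le> p \<Longrightarrow> \<bar>x::real\<bar> \<le> 1 + \<bar>x\<bar> powr p"
proof (cases "\<bar>x\<bar> \<le> 1")
  case False
  assume "1 \<le> p"
  then have "\<bar>x\<bar> powr 1 \<le> \<bar>x\<bar> powr p" using False by (intro powr_mono) auto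
  then show ?thesis by simp
qed (auto intro: add_increasing2)

lemma square_le_one_plus_powr: "2 \<le> p \<Longrightarrow> x\<^sup>2 \<le> 1 + \<bar>x::real\<bar> powr p"
proof (cases "\<bar>x\<bar> \<le> 1")
  case True
  then show ?thesis by (simp add: abs_square_le_1 add_increasing2)
next
  case False
  assume "2 \<le> p"
  then have "\<bar>x\<bar> powr 2 \<le> \<bar>x\<bar> powr p" using False by (intro powr_mono) auto
  then show ?thesis using False by (simp add: powr_numeral)
qed

lemma powr_tail:
  fixes x :: real
  assumes "0 < K" "K < x" "q \<le> p"
  shows "x powr q \<le> K powr (q - p) * x powr p"
proof -
  have "x powr (q - p) \<le> K powr (q - p)" using assms by (intro powr_mono2') auto
  then have "x powr (q - p) * x powr p \<le> K powr (q - p) * x powr p" by (intro mult_right_mono) auto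
  then show ?thesis using assms by (simp flip: powr_add)
qed

text \<open>The rate is that of the second moment, although \<open>1 - p\<close> would be possible
  as an exponent: \<open>truncate_product_tail\<close> has the exponent \<open>2 - p\<close>, and
  with equal exponents the two errors combine into one term.\<close>

lemma truncate_tail:
  assumes "1 \<le> K" "2 < p"
  shows "\<bar>x - truncate K x\<bar> \<le> K powr (2 - p) * \<bar>x\<bar> powr p"
proof (cases "\<bar>x\<bar> \<le> K")
  case False
  have "\<bar>x - truncate K x\<bar> \<le> \<bar>x\<bar> powr 1" using assms truncate_abs(3)[of K x] by simp
  also have "\<dots> \<le> \<bar>x\<bar> powr 2" using False assms by (intro powr_mono) auto
  also have "\<dots> \<le> K powr (2 - p) * \<bar>x\<bar> powr p" using False assms by (intro powr_tail) auto
  finally show ?thesis .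
qed (use truncate_abs in simp)

text \<open>If truncation changes anything, the larger modulus exceeds \<open>K\<close>, and its
  square bounds both products. So a tail estimate for one variable suffices, whichever of the two is
  large.\<close>

lemma truncate_product_tail:
  assumes K: "1 \<le> K" and p: "2 < p"
  shows "\<bar>x * z - truncate K x * truncate K z\<bar> \<le> 2 * (K powr (2 - p) * (\<bar>x\<bar> powr p + \<bar>z\<bar> powr p))"
proof (cases "\<bar>x\<bar> \<le> K \<and> \<bar>z\<bar> \<le> K")
  case False
  define M where "M = max \<bar>x\<bar> \<bar>z\<bar>"
  have M: "K < M" "\<bar>x\<bar> \<le> M" "\<bar>z\<bar> \<le> M" using False by (auto simp: M_def)
  have "\<bar>x * z\<bar> \<le> M * M" unfolding abs_mult using M by (intro mult_mono) auto
  moreover have "\<bar>truncate K x * truncate K z\<bar> \<le> M * M"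
    unfolding abs_mult using M truncate_abs(2)[of K x] truncate_abs(2)[of K z] K by (intro mult_mono) auto
  moreover have "M * M = M powr 2" using M K by (simp add: powr_numeral power2_eq_square)
  moreover have "M powr 2 \<le> K powr (2 - p) * M powr p" using M K p by (intro powr_tail) auto
  moreover have "K powr (2 - p) * M powr p \<le> K powr (2 - p) * (\<bar>x\<bar> powr p + \<bar>z\<bar> powr p)"
    by (intro mult_left_mono) (auto simp: M_def max_def)
  ultimately show ?thesis by linarith
qed (auto simp: truncate_abs)

lemma sum_geometric_le:
  fixes r :: real and A :: "nat set"
  assumes "0 \<le> r" "r < 1" "finite A" "inj_on f A"
  shows "(\<Sum>t\<in>A. r ^ f t) \<le> 1 / (1 - r)"
proof -
  have "(\<Sum>t\<in>A. r ^ f t) = (\<Sum>j\<in>f ` A. r ^ j)" using assms by (simp add: sum.reindex)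
  also have "\<dots> \<le> (\<Sum>j. r ^ j)" using assms by (intro sum_le_suminf) auto
  also have "\<dots> = 1 / (1 - r)" using assms by (simp add: suminf_geometric)
  finally show ?thesis .
qed

lemma sum_geometric_dist_le:
  fixes r :: real and A :: "nat set"
  assumes r: "0 \<le> r" "r < 1" and A: "finite A"
  shows "(\<Sum>t\<in>A. r ^ nat \<bar>int s - int t\<bar>) \<le> 2 / (1 - r)"
proof -
  have "(\<Sum>t\<in>A. r ^ nat \<bar>int s - int t\<bar>) = (\<Sum>t\<in>A \<inter> {t. t \<le> s}. r ^ nat \<bar>int s - int t\<bar>) + (\<Sum>t\<in>A \<inter> - {t. t \<le> s}. r ^ nat \<bar>int s - int t\<bar>)"
    using A by (subst sum.union_disjoint[symmetric]) (auto intro: sum.cong)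
  also have "\<dots> \<le> 1 / (1 - r) + 1 / (1 - r)"
    using A r by (intro add_mono sum_geometric_le) (auto simp: inj_on_def)
  finally show ?thesis by simp
qed

context observed_process
begin

lemma moment_integrable:
  assumes "2 < p" "X \<in> borel_measurable P" "integrable P (\<lambda>\<omega>. \<bar>X \<omega>\<bar> powr p)"
  shows "integrable P (X :: 'w \<Rightarrow> real)" "integrable P (\<lambda>\<omega>. (X \<omega>)\<^sup>2)"
    "(\<integral>\<omega>. \<bar>X \<omega>\<bar> \<partial>P) \<le> 1 + (\<integral>\<omega>. \<bar>X \<omega>\<bar> powr p \<partial>P)"
    "(\<integral>\<omega>. (X \<omega>)\<^sup>2 \<partial>P) \<le> 1 + (\<integral>\<omega>. \<bar>X \<omega>\<bar> powr p \<partial>P)"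
proof -
  have i: "integrable P (\<lambda>\<omega>. 1 + \<bar>X \<omega>\<bar> powr p)" using assms by simp
  show iX: "integrable P X"
    using assms abs_le_one_plus_powr[of p] by (intro Bochner_Integration.integrable_bound[OF i]) (auto intro!: AE_I2)
  show iX2: "integrable P (\<lambda>\<omega>. (X \<omega>)\<^sup>2)"
    using assms square_le_one_plus_powr[of p] by (intro Bochner_Integration.integrable_bound[OF i]) (auto intro!: AE_I2)
  have "(\<integral>\<omega>. \<bar>X \<omega>\<bar> \<partial>P) \<le> (\<integral>\<omega>. 1 + \<bar>X \<omega>\<bar> powr p \<partial>P)"
    using assms iX i abs_le_one_plus_powr[of p] by (intro integral_mono) auto
  then show "(\<integral>\<omega>. \<bar>X \<omega>\<bar> \<partial>P) \<le> 1 + (\<integral>\<omega>. \<bar>X \<omega>\<bar> powr p \<partial>P)" using assms by (simp add: prob_space)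
  have "(\<integral>\<omega>. (X \<omega>)\<^sup>2 \<partial>P) \<le> (\<integral>\<omega>. 1 + \<bar>X \<omega>\<bar> powr p \<partial>P)"
    using assms iX2 i square_le_one_plus_powr[of p] by (intro integral_mono) auto
  then show "(\<integral>\<omega>. (X \<omega>)\<^sup>2 \<partial>P) \<le> 1 + (\<integral>\<omega>. \<bar>X \<omega>\<bar> powr p \<partial>P)" using assms by (simp add: prob_space)
qed

lemma integrable_product:
  fixes X Z :: "'w \<Rightarrow> real"
  assumes "X \<in> borel_measurable P" "Z \<in> borel_measurable P" "integrable P (\<lambda>\<omega>. (X \<omega>)\<^sup>2)" "integrable P (\<lambda>\<omega>. (Z \<omega>)\<^sup>2)"
  shows "integrable P (\<lambda>\<omega>. X \<omega> * Z \<omega>)"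
proof (rule Bochner_Integration.integrable_bound[of P "\<lambda>\<omega>. (X \<omega>)\<^sup>2 + (Z \<omega>)\<^sup>2"])
  have "\<bar>x * z\<bar> \<le> x\<^sup>2 + z\<^sup>2" for x z :: real
    using sum_squares_bound[of "\<bar>x\<bar>" "\<bar>z\<bar>"] zero_le_power2[of x] zero_le_power2[of z] mult_nonneg_nonneg[OF abs_ge_zero[of x] abs_ge_zero[of z]]
    unfolding abs_mult power2_abs by linarith
  then show "AE \<omega> in P. norm (X \<omega> * Z \<omega>) \<le> norm ((X \<omega>)\<^sup>2 + (Z \<omega>)\<^sup>2)" by simp
qed (use assms in auto)

text \<open>Davydov's covariance inequality, in a form with a free truncation level \<open>K\<close>.\<close>

lemma cov_moment_le:
  assumes p: "2 < p" and K: "1 \<le> K"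
    and X: "X \<in> borel_measurable (sig {..u})" "integrable P (\<lambda>\<omega>. \<bar>X \<omega>\<bar> powr p)" "(\<integral>\<omega>. \<bar>X \<omega>\<bar> powr p \<partial>P) \<le> B"
    and Z: "Z \<in> borel_measurable (sig {u + int n..})" "integrable P (\<lambda>\<omega>. \<bar>Z \<omega>\<bar> powr p)" "(\<integral>\<omega>. \<bar>Z \<omega>\<bar> powr p \<partial>P) \<le> B"
  shows "\<bar>(\<integral>\<omega>. X \<omega> * Z \<omega> \<partial>P) - (\<integral>\<omega>. X \<omega> \<partial>P) * (\<integral>\<omega>. Z \<omega> \<partial>P)\<bar>
    \<le> 2 * K\<^sup>2 * mixing_coeff P mu Y n + (4 * B + 2 * (1 + B) * B) * K powr (2 - p)"
proof -
  let ?k = "K powr (2 - p)"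
  have XP: "X \<in> borel_measurable P" and ZP: "Z \<in> borel_measurable P" using X(1) Z(1) by (auto intro: sig_borel)
  have B: "0 \<le> B" using X(3) by (rule order_trans[OF Bochner_Integration.integral_nonneg, rotated]) simp
  define X' Z' where "X' \<omega> = truncate K (X \<omega>)" and "Z' \<omega> = truncate K (Z \<omega>)" for \<omega>
  have cl: "truncate K \<in> borel_measurable borel"
    unfolding truncate_def[abs_def] by (intro borel_measurable_max borel_measurable_min borel_measurable_const measurable_ident_sets refl)
  have m': "X' \<in> borel_measurable (sig {..u})" "Z' \<in> borel_measurable (sig {u + int n..})"
    using measurable_compose[OF X(1) cl] measurable_compose[OF Z(1) cl] by (simp_all add: X'_def[abs_def] Z'_def[abs_def])
  have mP: "X' \<in> borel_measurable P" "Z' \<in> borel_measurable P" using m' by (auto intro: sig_borel)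
  have b': "\<bar>X' \<omega>\<bar> \<le> K" "\<bar>Z' \<omega>\<bar> \<le> K" for \<omega> using K by (simp_all add: X'_def Z'_def truncate_abs)
  note iX = moment_integrable[OF p XP X(2)] and iZ = moment_integrable[OF p ZP Z(2)]
  have iX': "integrable P X'" "integrable P Z'" by (rule bounded_integrable[OF mP(1) b'(1)], rule bounded_integrable[OF mP(2) b'(2)])
  have iXZ: "integrable P (\<lambda>\<omega>. X \<omega> * Z \<omega>)" by (rule integrable_product[OF XP ZP iX(2) iZ(2)])
  have iXZ': "integrable P (\<lambda>\<omega>. X' \<omega> * Z' \<omega>)" using mP b' K
    by (intro bounded_integrable[where K = "K * K"]) (auto simp: abs_mult intro!: mult_mono)
  have 1: "\<bar>(\<integral>\<omega>. X' \<omega> * Z' \<omega> \<partial>P) - (\<integral>\<omega>. X' \<omega> \<partial>P) * (\<integral>\<omega>. Z' \<omega> \<partial>P)\<bar> \<le> 2 * K\<^sup>2 * mixing_coeff P mu Y n"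
    using m' b' K by (intro cov_bounded_le) auto
  have "\<bar>(\<integral>\<omega>. X \<omega> * Z \<omega> \<partial>P) - (\<integral>\<omega>. X' \<omega> * Z' \<omega> \<partial>P)\<bar> = \<bar>\<integral>\<omega>. X \<omega> * Z \<omega> - X' \<omega> * Z' \<omega> \<partial>P\<bar>"
    using iXZ iXZ' by simp
  also have "\<dots> \<le> (\<integral>\<omega>. \<bar>X \<omega> * Z \<omega> - X' \<omega> * Z' \<omega>\<bar> \<partial>P)" by (rule integral_abs_bound)
  also have "\<dots> \<le> (\<integral>\<omega>. 2 * (?k * (\<bar>X \<omega>\<bar> powr p + \<bar>Z \<omega>\<bar> powr p)) \<partial>P)"
    using iXZ iXZ' X(2) Z(2) truncate_product_tail[OF K p] by (intro integral_mono) (auto simp: X'_def Z'_def)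
  also have "\<dots> = 2 * (?k * ((\<integral>\<omega>. \<bar>X \<omega>\<bar> powr p \<partial>P) + (\<integral>\<omega>. \<bar>Z \<omega>\<bar> powr p \<partial>P)))"
    using X(2) Z(2) by simp
  also have "\<dots> \<le> 2 * (?k * (B + B))"
    using X(3) Z(3) by (intro mult_left_mono add_mono) auto
  finally have 2: "\<bar>(\<integral>\<omega>. X \<omega> * Z \<omega> \<partial>P) - (\<integral>\<omega>. X' \<omega> * Z' \<omega> \<partial>P)\<bar> \<le> 4 * B * ?k" by (simp add: algebra_simps)
  have tail: "\<bar>(\<integral>\<omega>. V \<omega> \<partial>P) - (\<integral>\<omega>. truncate K (V \<omega>) \<partial>P)\<bar> \<le> B * ?k"
    if "integrable P V" "integrable P (\<lambda>\<omega>. truncate K (V \<omega>))" "integrable P (\<lambda>\<omega>. \<bar>V \<omega>\<bar> powr p)" "(\<integral>\<omega>. \<bar>V \<omega>\<bar> powr p \<partial>P) \<le> B" for V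
  proof -
    have "\<bar>(\<integral>\<omega>. V \<omega> \<partial>P) - (\<integral>\<omega>. truncate K (V \<omega>) \<partial>P)\<bar> = \<bar>\<integral>\<omega>. V \<omega> - truncate K (V \<omega>) \<partial>P\<bar>" using that by simp
    also have "\<dots> \<le> (\<integral>\<omega>. \<bar>V \<omega> - truncate K (V \<omega>)\<bar> \<partial>P)" by (rule integral_abs_bound)
    also have "\<dots> \<le> (\<integral>\<omega>. ?k * \<bar>V \<omega>\<bar> powr p \<partial>P)" using that truncate_tail[OF K p] by (intro integral_mono) auto
    also have "\<dots> \<le> ?k * B" using that by (simp add: mult_left_mono)
    finally show ?thesis by (simp add: mult.commute)
  qed
  have tX: "\<bar>(\<integral>\<omega>. X \<omega> \<partial>P) - (\<integral>\<omega>. X' \<omega> \<partial>P)\<bar> \<le> B * ?k" using tail[of X] iX' iX X by (simp add: X'_def[abs_def])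
  have tZ: "\<bar>(\<integral>\<omega>. Z \<omega> \<partial>P) - (\<integral>\<omega>. Z' \<omega> \<partial>P)\<bar> \<le> B * ?k" using tail[of Z] iX' iZ Z by (simp add: Z'_def[abs_def])
  have aX: "\<bar>\<integral>\<omega>. X \<omega> \<partial>P\<bar> \<le> 1 + B" using iX(3) X(3) integral_abs_bound[of P X] by linarith
  have aZ: "\<bar>\<integral>\<omega>. Z' \<omega> \<partial>P\<bar> \<le> 1 + B"
  proof -
    have "\<bar>\<integral>\<omega>. Z' \<omega> \<partial>P\<bar> \<le> (\<integral>\<omega>. \<bar>Z' \<omega>\<bar> \<partial>P)" by (rule integral_abs_bound)
    also have "\<dots> \<le> (\<integral>\<omega>. \<bar>Z \<omega>\<bar> \<partial>P)" using integrable_abs[OF iX'(2)] integrable_abs[OF iZ(1)] K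
      by (intro integral_mono) (simp_all add: Z'_def truncate_abs)
    finally show ?thesis using iZ(3) Z(3) by linarith
  qed
  have "(\<integral>\<omega>. X \<omega> \<partial>P) * (\<integral>\<omega>. Z \<omega> \<partial>P) - (\<integral>\<omega>. X' \<omega> \<partial>P) * (\<integral>\<omega>. Z' \<omega> \<partial>P)
     = (\<integral>\<omega>. X \<omega> \<partial>P) * ((\<integral>\<omega>. Z \<omega> \<partial>P) - (\<integral>\<omega>. Z' \<omega> \<partial>P)) + ((\<integral>\<omega>. X \<omega> \<partial>P) - (\<integral>\<omega>. X' \<omega> \<partial>P)) * (\<integral>\<omega>. Z' \<omega> \<partial>P)"
    by (simp add: algebra_simps)
  also have "\<bar>\<dots>\<bar> \<le> (1 + B) * (B * ?k) + (B * ?k) * (1 + B)"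
    using aX aZ tX tZ B by (intro order_trans[OF abs_triangle_ineq] add_mono) (auto simp: abs_mult intro!: mult_mono)
  finally have 3: "\<bar>(\<integral>\<omega>. X \<omega> \<partial>P) * (\<integral>\<omega>. Z \<omega> \<partial>P) - (\<integral>\<omega>. X' \<omega> \<partial>P) * (\<integral>\<omega>. Z' \<omega> \<partial>P)\<bar> \<le> 2 * (1 + B) * B * ?k"
    by (simp add: algebra_simps)
  have "(4 * B + 2 * (1 + B) * B) * ?k = 4 * B * ?k + 2 * (1 + B) * B * ?k" by (simp add: algebra_simps)
  then show ?thesis using 1 2 3 by linarith
qed

lemma sig_mono: "f \<in> borel_measurable (sig I) \<Longrightarrow> I \<subseteq> J \<Longrightarrow> f \<in> borel_measurable (sig J)"
  by (rule measurable_from_subalg[of _ "sig I"])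
     (auto simp: subalgebra_def sets_gen_sigma intro!: sigma_sets_mono' elim!: subsetD)

end

section \<open>Variances of sums over windows under geometric mixing\<close>

locale mixing_process = observed_process P mu Y
  for P :: "'w measure" and mu :: "'y measure" and Y +
  fixes \<beta> p :: real
  assumes beta: "0 < \<beta>" "\<beta> < 1" and mixing: "\<And>n. mixing_coeff P mu Y n \<le> \<beta> ^ n" and p: "2 < p"
begin

text \<open>With truncation level \<open>\<beta> powr (- n / 4)\<close> the mixing term of the
  covariance bound is of order \<open>\<beta> powr (n / 2)\<close> and the tail term of order
  \<open>\<beta> powr (n * (p - 2) / 4)\<close>. The slower of the two is the rate; it is below 1
  because \<open>p > 2\<close>.\<close>

definition rate :: real where "rate = max (\<beta> powr (1 / 2)) (\<beta> powr ((p - 2) / 4))"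

lemma rate: "0 < rate" "rate < 1"
  using beta p powr_less_mono2[of "1 / 2" \<beta> 1] powr_less_mono2[of "(p - 2) / 4" \<beta> 1]
  by (auto simp: rate_def less_max_iff_disj)

lemma cov_geometric_le:
  assumes X: "X \<in> borel_measurable (sig {..u})" "integrable P (\<lambda>\<omega>. \<bar>X \<omega>\<bar> powr p)" "(\<integral>\<omega>. \<bar>X \<omega>\<bar> powr p \<partial>P) \<le> B"
    and Z: "Z \<in> borel_measurable (sig {u + int n..})" "integrable P (\<lambda>\<omega>. \<bar>Z \<omega>\<bar> powr p)" "(\<integral>\<omega>. \<bar>Z \<omega>\<bar> powr p \<partial>P) \<le> B"
  shows "\<bar>(\<integral>\<omega>. X \<omega> * Z \<omega> \<partial>P) - (\<integral>\<omega>. X \<omega> \<partial>P) * (\<integral>\<omega>. Z \<omega> \<partial>P)\<bar> \<le> (2 + (4 * B + 2 * (1 + B) * B)) * rate ^ n"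
proof -
  have B: "0 \<le> B" using X(3) by (rule order_trans[OF Bochner_Integration.integral_nonneg, rotated]) simp
  \<comment> \<open>Any power of \<beta> to minus a fraction of \<open>n\<close> between 0 and
    \<open>n / 2\<close> would make both terms geometric; the fraction taken is
    \<open>n / 4\<close>.\<close>
  define K where "K = \<beta> powr (- real n / 4)"
  have K: "1 \<le> K" using beta by (simp add: K_def ge_one_powr_ge_zero powr_minus one_le_inverse_iff powr_le1 field_simps)
  have "2 * K\<^sup>2 * mixing_coeff P mu Y n \<le> 2 * K\<^sup>2 * \<beta> ^ n" using mixing[of n] by (intro mult_left_mono) auto
  also have "K\<^sup>2 * \<beta> ^ n = (\<beta> powr (1 / 2)) ^ n"
    using beta by (simp add: K_def powr_realpow[symmetric] powr_powr powr_add[symmetric] power2_eq_square field_simps)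
  then have "2 * K\<^sup>2 * \<beta> ^ n = 2 * (\<beta> powr (1 / 2)) ^ n" by (simp add: mult.assoc)
  also have "\<dots> \<le> 2 * rate ^ n" by (intro mult_left_mono power_mono) (auto simp: rate_def)
  finally have 1: "2 * K\<^sup>2 * mixing_coeff P mu Y n \<le> 2 * rate ^ n" .
  have "K powr (2 - p) = (\<beta> powr ((p - 2) / 4)) ^ n"
  proof -
    have "- real n / 4 * (2 - p) = (p - 2) / 4 * real n" by (simp add: field_simps)
    then show ?thesis using beta unfolding K_def powr_powr by (simp only: powr_realpow[symmetric] powr_powr powr_gt_zero)
  qed
  also have "\<dots> \<le> rate ^ n" by (intro power_mono) (auto simp: rate_def)
  finally have "(4 * B + 2 * (1 + B) * B) * K powr (2 - p) \<le> (4 * B + 2 * (1 + B) * B) * rate ^ n"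
    using B by (intro mult_left_mono) auto
  then show ?thesis using cov_moment_le[OF p K X Z] 1 by (simp add: distrib_right)
qed

context
  fixes f :: "int \<Rightarrow> 'w \<Rightarrow> real" and q :: nat and B e :: real
  assumes f: "\<And>t. f t \<in> borel_measurable (sig {t - int q..t + int q})"
    and fp: "\<And>t. integrable P (\<lambda>\<omega>. \<bar>f t \<omega>\<bar> powr p)" "\<And>t. (\<integral>\<omega>. \<bar>f t \<omega>\<bar> powr p \<partial>P) \<le> B"
    and e: "\<And>t. (\<integral>\<omega>. f t \<omega> \<partial>P) = e"
begin

text \<open>The numerator dominates the constant of the covariance inequality as well as the crude
  bound \<open>2 + 2 * B\<close> for overlapping windows. The denominator pays for the
  \<open>2 * q\<close> time units by which the windows around two times are closer than the times
  themselves.\<close>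

definition "cov_const = ((2 + (4 * B + 2 * (1 + B) * B)) + (2 + 2 * B) + (1 + B)\<^sup>2) / rate ^ (2 * q)"

lemma f_borel: "f t \<in> borel_measurable P" using f by (rule sig_borel)

lemma f_integrable: "integrable P (f t)" "integrable P (\<lambda>\<omega>. f s \<omega> * f t \<omega>)"
  using moment_integrable[OF p f_borel fp(1)] integrable_product[OF f_borel f_borel] by auto

lemma B_nonneg: "0 \<le> B" using fp(2)[of 0] by (rule order_trans[OF Bochner_Integration.integral_nonneg, rotated]) simp

lemma cov_le_ordered:
  assumes "s \<le> t"
  shows "(\<integral>\<omega>. f s \<omega> * f t \<omega> \<partial>P) - e * e \<le> cov_const * rate ^ nat (t - s)"
proof (cases "2 * int q \<le> t - s")
  case True
  define n where "n = nat (t - s - 2 * int q)"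
  have n: "s + int q + int n = t - int q" "nat (t - s) = n + 2 * q" using True by (auto simp: n_def)
  have "(\<integral>\<omega>. f s \<omega> * f t \<omega> \<partial>P) - e * e \<le> (2 + (4 * B + 2 * (1 + B) * B)) * rate ^ n"
    using cov_geometric_le[of "f s" "s + int q" B "f t" n] sig_mono[OF f[of s]] sig_mono[OF f[of t]] fp e n by auto
  also have "\<dots> \<le> ((2 + (4 * B + 2 * (1 + B) * B)) + (2 + 2 * B) + (1 + B)\<^sup>2) * rate ^ n"
    using B_nonneg rate by (intro mult_right_mono) auto
  also have "\<dots> = cov_const * rate ^ nat (t - s)"
    using rate by (simp add: cov_const_def n power_add)
  finally show ?thesis .
next
  case False
  \<comment> \<open>The windows are too close for mixing to help. Second moments bound the product,
    the nonnegative \<open>e * e\<close> is dropped, and the bound is still of the required form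
    since \<open>rate ^ (t - s)\<close> is at least \<open>rate ^ (2 * q)\<close>. Only upper bounds
    on covariances matter for a variance.\<close>
  have "(\<integral>\<omega>. f s \<omega> * f t \<omega> \<partial>P) \<le> (\<integral>\<omega>. (f s \<omega>)\<^sup>2 + (f t \<omega>)\<^sup>2 \<partial>P)"
  proof (rule integral_mono)
    show "f s \<omega> * f t \<omega> \<le> (f s \<omega>)\<^sup>2 + (f t \<omega>)\<^sup>2" for \<omega>
      using sum_squares_bound[of "f s \<omega>" "f t \<omega>"] zero_le_power2[of "f s \<omega>"] zero_le_power2[of "f t \<omega>"] by linarith
  qed (use f_integrable moment_integrable[OF p f_borel fp(1)] in auto)
  also have "\<dots> \<le> 2 + 2 * B"
  proof -
    have *: "integrable P (\<lambda>\<omega>. (f t \<omega>)\<^sup>2)" "(\<integral>\<omega>. (f t \<omega>)\<^sup>2 \<partial>P) \<le> 1 + B" for t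
      using moment_integrable(2,4)[OF p f_borel fp(1), of t] fp(2)[of t] by linarith+
    have "(\<integral>\<omega>. (f s \<omega>)\<^sup>2 \<partial>P) + (\<integral>\<omega>. (f t \<omega>)\<^sup>2 \<partial>P) \<le> 2 + 2 * B" using *(2)[of s] *(2)[of t] by linarith
    then show ?thesis using *(1) by simp
  qed
  also have "\<dots> \<le> ((2 + (4 * B + 2 * (1 + B) * B)) + (2 + 2 * B) + (1 + B)\<^sup>2) * 1"
    using B_nonneg by simp
  also have "\<dots> \<le> ((2 + (4 * B + 2 * (1 + B) * B)) + (2 + 2 * B) + (1 + B)\<^sup>2) * (rate ^ nat (t - s) / rate ^ (2 * q))"
  proof (intro mult_left_mono)
    have "rate ^ (2 * q) \<le> rate ^ nat (t - s)" using False assms rate by (intro power_decreasing) auto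
    then show "1 \<le> rate ^ nat (t - s) / rate ^ (2 * q)" using rate by simp
  qed (use B_nonneg in simp)
  finally show ?thesis by (simp add: cov_const_def)
     (smt (verit) zero_le_square)
qed

lemma cov_le: "(\<integral>\<omega>. f s \<omega> * f t \<omega> \<partial>P) - e * e \<le> cov_const * rate ^ nat \<bar>s - t\<bar>"
proof (cases "s \<le> t")
  case True
  then have "\<bar>s - t\<bar> = t - s" by simp
  then show ?thesis using cov_le_ordered[OF True] by simp
next
  case False
  then have "\<bar>s - t\<bar> = s - t" by simp
  then show ?thesis using cov_le_ordered[of t s] False by (simp add: mult.commute)
qed

lemma cov_const_nonneg: "0 \<le> cov_const"
  using B_nonneg rate by (simp add: cov_const_def)

text \<open>Expanding the square gives the sum of all covariances. Each row of it is dominated by a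
  two-sided geometric series in the time distance, so the total grows like the number of terms and
  not like its square.\<close>

lemma variance_sum_le:
  assumes A: "finite A"
  shows "(\<integral>\<omega>. (\<Sum>t\<in>A. f (int t) \<omega> - e)\<^sup>2 \<partial>P) \<le> cov_const * (2 / (1 - rate)) * real (card A)"
    "integrable P (\<lambda>\<omega>. (\<Sum>t\<in>A. f (int t) \<omega> - e)\<^sup>2)"
proof -
  have eq: "(\<lambda>\<omega>. (\<Sum>t\<in>A. f (int t) \<omega> - e)\<^sup>2) = (\<lambda>\<omega>. \<Sum>s\<in>A. \<Sum>t\<in>A. (f (int s) \<omega> * f (int t) \<omega> - e * f (int s) \<omega>) - (e * f (int t) \<omega> - e * e))"
    by (simp add: power2_eq_square sum_product algebra_simps)
  have i: "integrable P (\<lambda>\<omega>. (f (int s) \<omega> * f (int t) \<omega> - e * f (int s) \<omega>) - (e * f (int t) \<omega> - e * e))" for s t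
    using f_integrable by simp
  show "integrable P (\<lambda>\<omega>. (\<Sum>t\<in>A. f (int t) \<omega> - e)\<^sup>2)"
    unfolding eq using i by (intro Bochner_Integration.integrable_sum) auto
  have "(\<integral>\<omega>. (\<Sum>t\<in>A. f (int t) \<omega> - e)\<^sup>2 \<partial>P) = (\<Sum>s\<in>A. \<Sum>t\<in>A. (\<integral>\<omega>. f (int s) \<omega> * f (int t) \<omega> \<partial>P) - e * e)"
  proof -
    have "(\<integral>\<omega>. (f (int s) \<omega> * f (int t) \<omega> - e * f (int s) \<omega>) - (e * f (int t) \<omega> - e * e) \<partial>P)
      = (\<integral>\<omega>. f (int s) \<omega> * f (int t) \<omega> \<partial>P) - e * e" for s t
      using f_integrable by (simp add: e prob_space)
    then show ?thesis unfolding eq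
      by (subst Bochner_Integration.integral_sum, force intro: Bochner_Integration.integrable_sum i)
         (simp add: Bochner_Integration.integral_sum[OF i])
  qed
  also have "\<dots> \<le> (\<Sum>s\<in>A. \<Sum>t\<in>A. cov_const * rate ^ nat \<bar>int s - int t\<bar>)"
    by (intro sum_mono cov_le)
  also have "\<dots> = cov_const * (\<Sum>s\<in>A. \<Sum>t\<in>A. rate ^ nat \<bar>int s - int t\<bar>)" by (simp add: sum_distrib_left)
  also have "\<dots> \<le> cov_const * (\<Sum>s\<in>A. 2 / (1 - rate))"
    using rate A by (intro mult_left_mono sum_mono sum_geometric_dist_le cov_const_nonneg) auto
  finally show "(\<integral>\<omega>. (\<Sum>t\<in>A. f (int t) \<omega> - e)\<^sup>2 \<partial>P) \<le> cov_const * (2 / (1 - rate)) * real (card A)"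
    by (simp add: algebra_simps)
qed

text \<open>The average over a block of length \<open>k n\<close> has variance of order
  \<open>1 / k n\<close>, so the squared deviations have summable means. The position
  \<open>T n\<close> of the block does not enter the variance bound.\<close>

lemma block_average_tendsto:
  assumes k: "\<And>n. 0 < k n" "summable (\<lambda>n. 1 / real (k n))"
  shows "AE \<omega> in P. (\<lambda>n. (\<Sum>t\<in>{T n + 1..T n + k n}. f (int t) \<omega>) / real (k n)) \<longlonglongrightarrow> e"
proof -
  let ?X = "\<lambda>n \<omega>. ((\<Sum>t\<in>{T n + 1..T n + k n}. f (int t) \<omega> - e))\<^sup>2 / (real (k n))\<^sup>2"
  have "AE \<omega> in P. (\<lambda>n. ?X n \<omega>) \<longlonglongrightarrow> 0"
  proof (rule AE_tendsto_0_of_summable)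
    show "integrable P (?X n)" for n using variance_sum_le(2)[of "{T n + 1..T n + k n}"] by auto
    show "(\<integral>\<omega>. ?X n \<omega> \<partial>P) \<le> cov_const * (2 / (1 - rate)) * (1 / real (k n))" for n
    proof -
      have "(\<integral>\<omega>. ?X n \<omega> \<partial>P) = (\<integral>\<omega>. (\<Sum>t\<in>{T n + 1..T n + k n}. f (int t) \<omega> - e)\<^sup>2 \<partial>P) / (real (k n))\<^sup>2" by simp
      also have "\<dots> \<le> (cov_const * (2 / (1 - rate)) * real (k n)) / (real (k n))\<^sup>2"
        using variance_sum_le(1)[of "{T n + 1..T n + k n}"] by (intro divide_right_mono) auto
      finally show ?thesis using k(1)[of n] by (simp add: power2_eq_square)
    qed
    show "summable (\<lambda>n. cov_const * (2 / (1 - rate)) * (1 / real (k n)))" by (rule summable_mult[OF k(2)])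
  qed simp
  then show ?thesis
  proof eventually_elim
    case (elim \<omega>)
    have "(\<lambda>n. sqrt (?X n \<omega>)) \<longlonglongrightarrow> sqrt 0" using elim by (rule tendsto_real_sqrt)
    moreover have "sqrt (?X n \<omega>) = \<bar>(\<Sum>t\<in>{T n + 1..T n + k n}. f (int t) \<omega>) / real (k n) - e\<bar>" for n
    proof -
      have "(\<Sum>t\<in>{T n + 1..T n + k n}. f (int t) \<omega> - e) / real (k n) = (\<Sum>t\<in>{T n + 1..T n + k n}. f (int t) \<omega>) / real (k n) - e"
        using k(1)[of n] by (simp add: sum_subtractf diff_divide_distrib)
      moreover have "sqrt (?X n \<omega>) = \<bar>(\<Sum>t\<in>{T n + 1..T n + k n}. f (int t) \<omega> - e) / real (k n)\<bar>"
        by (simp flip: power_divide)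
      ultimately show ?thesis by simp
    qed
    ultimately have "(\<lambda>n. \<bar>(\<Sum>t\<in>{T n + 1..T n + k n}. f (int t) \<omega>) / real (k n) - e\<bar>) \<longlonglongrightarrow> 0" by simp
    then show ?case by (rule LIM_zero_cancel[OF tendsto_rabs_zero_cancel])
  qed
qed

end
end

section \<open>Forgetting of the smoothing distributions\<close>

text \<open>Total variation in disguise. If one weight lies between \<open>a\<close> and
  \<open>b\<close> times another, the normalized laws share the mass carried by \<open>a\<close>
  times the smaller weight, and only the fraction \<open>1 - a / b\<close> can differ. It serves
  both for a longer future and for a changed parameter.\<close>

lemma ratio_perturb:
  fixes N D N' D' a b c :: real
  assumes D: "0 < D" and a: "0 < a" and bd: "a * D \<le> D'" "D' \<le> b * D"
    and N: "\<bar>N\<bar> \<le> c * D" "\<bar>N' - a * N\<bar> \<le> c * (D' - a * D)"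
  shows "\<bar>N' / D' - N / D\<bar> \<le> 2 * c * (1 - a / b)"
proof -
  have D': "0 < D'" using D a bd(1) by (meson less_le_trans mult_pos_pos)
  have b: "0 < b" using D D' bd(2) by (metis less_le_trans zero_less_mult_pos2)
  have c: "0 \<le> c" using N(1) D by (metis abs_ge_zero order_trans zero_le_mult_iff not_less)
  have "N' / D' - N / D = (N' - a * N) / D' - (N / D) * ((D' - a * D) / D')"
    using D D' by (simp add: field_simps)
  also have "\<bar>\<dots>\<bar> \<le> \<bar>N' - a * N\<bar> / D' + \<bar>N / D\<bar> * ((D' - a * D) / D')"
    using D' bd by (intro order_trans[OF abs_triangle_ineq4]) (auto simp: abs_mult)
  also have "\<dots> \<le> c * (D' - a * D) / D' + c * ((D' - a * D) / D')"
    using N D D' bd by (intro add_mono divide_right_mono mult_right_mono) (auto simp: field_simps)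
  also have "\<dots> = 2 * c * (1 - a * D / D')" using D' by (simp add: field_simps)
  also have "\<dots> \<le> 2 * c * (1 - a / b)"
  proof -
    have "a / b \<le> a * D / D'" using a b D D' bd by (simp add: field_simps mult_left_mono)
    then show ?thesis using c by (intro mult_left_mono) auto
  qed
  finally show ?thesis .
qed

locale expfam_hmm = finite_state_measure lam for lam :: "'x measure" +
  fixes mu :: "'y measure" and \<Theta> :: "'t::euclidean_space set"
    and m :: "'t \<Rightarrow> 'x \<Rightarrow> 'x \<Rightarrow> real" and g :: "'t \<Rightarrow> 'x \<Rightarrow> 'y \<Rightarrow> real"
    and \<phi> :: "'t \<Rightarrow> real" and \<psi> :: "'t \<Rightarrow> 'd::euclidean_space"
    and S :: "'x \<Rightarrow> 'x \<Rightarrow> 'y \<Rightarrow> 'd"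
    and s1 s2 :: real and M :: "'y \<Rightarrow> real"
  assumes space_mu: "space mu = UNIV"
    and m_meas: "\<And>\<theta>. \<theta> \<in> \<Theta> \<Longrightarrow> (\<lambda>(x, x'). m \<theta> x x') \<in> borel_measurable (lam \<Otimes>\<^sub>M lam)"
    and m_int: "\<And>\<theta> x. \<theta> \<in> \<Theta> \<Longrightarrow> (\<integral>\<^sup>+x'. ennreal (m \<theta> x x') \<partial>lam) = 1"
    and g_meas: "\<And>\<theta>. \<theta> \<in> \<Theta> \<Longrightarrow> (\<lambda>(x, y). g \<theta> x y) \<in> borel_measurable (lam \<Otimes>\<^sub>M mu)"
    and S_meas: "(\<lambda>(x, x', y). S x x' y) \<in> borel_measurable (lam \<Otimes>\<^sub>M lam \<Otimes>\<^sub>M mu)"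
    and g_pos: "\<And>\<theta> x y. \<theta> \<in> \<Theta> \<Longrightarrow> 0 < g \<theta> x y"
    and expfam: "\<And>\<theta> x x' y. \<theta> \<in> \<Theta> \<Longrightarrow> m \<theta> x x' * g \<theta> x' y = exp (\<phi> \<theta> + inner (S x x' y) (\<psi> \<theta>))"
    and s1: "0 < s1" and m_bounds: "\<And>\<theta> x x'. \<theta> \<in> \<Theta> \<Longrightarrow> s1 \<le> m \<theta> x x'" "\<And>\<theta> x x'. \<theta> \<in> \<Theta> \<Longrightarrow> m \<theta> x x' \<le> s2"
    and Theta_ne: "\<Theta> \<noteq> {}"
begin

text \<open>A moment makes the supremum of \<open>S\<close> finite only for almost every
  observation. The deterministic estimates are stated for sequences of good observations, and almost
  every trajectory is such a sequence.\<close>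

definition good :: "'y \<Rightarrow> bool" where
  "good y \<longleftrightarrow> (\<forall>x x'. norm (S x x' y) \<le> M y)"

lemma goodD: "good y \<Longrightarrow> norm (S x x' y) \<le> M y"
  by (simp add: good_def)

lemma good_M: "good y \<Longrightarrow> 0 \<le> M y"
  using goodD[of y undefined undefined] norm_ge_zero order_trans by blast

definition ker :: "'t \<Rightarrow> (int \<Rightarrow> 'y) \<Rightarrow> int \<Rightarrow> 'x \<Rightarrow> 'x \<Rightarrow> real" where
  "ker \<theta> y i x x' = m \<theta> x x' * g \<theta> x' (y i)"

lemma s1_le: "s1 \<le> s2" "0 < s2"
proof -
  obtain \<theta> where "\<theta> \<in> \<Theta>" using Theta_ne by auto
  then show "s1 \<le> s2" using m_bounds[of \<theta> undefined undefined] by linarith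
  then show "0 < s2" using s1 by simp
qed

definition \<rho> :: real where "\<rho> = 1 - s1 / s2"

lemma rho: "0 \<le> \<rho>" "\<rho> < 1"
  using s1 s1_le by (auto simp: \<rho>_def)

text \<open>A measure of mass zero cannot carry a probability density.\<close>

lemma lam_pos: "0 < measure lam UNIV"
proof -
  obtain \<theta> where th: "\<theta> \<in> \<Theta>" using Theta_ne by auto
  have "emeasure lam (space lam) \<noteq> 0"
  proof
    assume "emeasure lam (space lam) = 0"
    then have "lam = null_measure lam" by (intro measure_eqI) (auto intro: emeasure_eq_0 dest: sets.sets_into_space)
    then have "(\<integral>\<^sup>+x'. ennreal (m \<theta> undefined x') \<partial>lam) = 0" by (metis nn_integral_null_measure)
    then show False using m_int[OF th] by simp
  qed
  then show ?thesis unfolding space_lam by (simp add: emeasure_eq_measure zero_less_measure_iff)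
qed

lemma g_sec: "\<theta> \<in> \<Theta> \<Longrightarrow> (\<lambda>x. g \<theta> x y) \<in> borel_measurable lam"
  using measurable_Pair1[OF g_meas, of \<theta> y] by (simp add: space_mu)

lemma S_sec: "(\<lambda>(x, x'). S x x' y) \<in> borel_measurable (lam \<Otimes>\<^sub>M lam)"
proof -
  have "(\<lambda>z. (fst z, snd z, y)) \<in> measurable (lam \<Otimes>\<^sub>M lam) (lam \<Otimes>\<^sub>M lam \<Otimes>\<^sub>M mu)"
    by (intro measurable_Pair measurable_fst measurable_snd measurable_const) (simp add: space_mu)
  from measurable_compose[OF this S_meas] show ?thesis by (simp add: case_prod_beta)
qed

lemma weight_bounds:
  assumes "\<theta> \<in> \<Theta>" "good y"
  shows "exp (\<phi> \<theta> - M y * norm (\<psi> \<theta>)) \<le> m \<theta> x x' * g \<theta> x' y" "m \<theta> x x' * g \<theta> x' y \<le> exp (\<phi> \<theta> + M y * norm (\<psi> \<theta>))"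
proof -
  have "\<bar>inner (S x x' y) (\<psi> \<theta>)\<bar> \<le> norm (S x x' y) * norm (\<psi> \<theta>)" by (rule Cauchy_Schwarz_ineq2)
  also have "\<dots> \<le> M y * norm (\<psi> \<theta>)" using goodD[OF assms(2)] by (intro mult_right_mono) auto
  finally show "exp (\<phi> \<theta> - M y * norm (\<psi> \<theta>)) \<le> m \<theta> x x' * g \<theta> x' y" "m \<theta> x x' * g \<theta> x' y \<le> exp (\<phi> \<theta> + M y * norm (\<psi> \<theta>))"
    using assms by (auto simp: expfam)
qed

lemma m_pos: "\<theta> \<in> \<Theta> \<Longrightarrow> 0 < m \<theta> x x'"
  using m_bounds(1) s1 by (rule less_le_trans[rotated])

text \<open>The exponential form bounds the product of transition and emission density; dividing by
  the lower bound \<open>s1\<close> of the transition density bounds the emission density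
  alone.\<close>

lemma g_bfun: assumes "\<theta> \<in> \<Theta>" "good y" shows "bfun (\<lambda>x. g \<theta> x y)"
proof (rule bfunI[OF g_sec[OF assms(1)]])
  fix x
  have "s1 * g \<theta> x y \<le> m \<theta> x x * g \<theta> x y" using m_bounds[OF assms(1)] g_pos[OF assms(1)] by (intro mult_right_mono) (auto intro: less_imp_le)
  also have "\<dots> \<le> exp (\<phi> \<theta> + M y * norm (\<psi> \<theta>))" by (rule weight_bounds[OF assms])
  finally show "\<bar>g \<theta> x y\<bar> \<le> exp (\<phi> \<theta> + M y * norm (\<psi> \<theta>)) / s1"
    using s1 g_pos[OF assms(1), of x y] by (simp add: field_simps)
qed

lemma ker_bker: assumes "\<theta> \<in> \<Theta>" "good (y i)" shows "bker (ker \<theta> y i)"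
  unfolding bker_def
proof
  have "(\<lambda>z. (case z of (x, x') \<Rightarrow> m \<theta> x x') * g \<theta> (snd z) (y i)) \<in> borel_measurable (lam \<Otimes>\<^sub>M lam)"
    by (intro borel_measurable_times m_meas assms measurable_compose[OF measurable_snd] g_sec)
  then show "(\<lambda>(x, x'). ker \<theta> y i x x') \<in> borel_measurable (lam \<Otimes>\<^sub>M lam)" by (simp add: ker_def case_prod_beta)
  have "\<bar>ker \<theta> y i x x'\<bar> \<le> exp (\<phi> \<theta> + M (y i) * norm (\<psi> \<theta>))" for x x'
    using weight_bounds[OF assms, of x x'] m_pos[OF assms(1), of x x'] g_pos[OF assms(1), of x' "y i"] by (simp add: ker_def)
  then show "\<exists>c. \<forall>x x'. \<bar>ker \<theta> y i x x'\<bar> \<le> c" by blast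
qed

lemma ker_nonneg: "\<theta> \<in> \<Theta> \<Longrightarrow> 0 \<le> ker \<theta> y i x x'"
  using m_pos[of \<theta> x x'] g_pos[of \<theta> x' "y i"] by (simp add: ker_def)

lemma ker_lower: "\<theta> \<in> \<Theta> \<Longrightarrow> good (y i) \<Longrightarrow> \<exists>c>0. \<forall>x x'. c \<le> ker \<theta> y i x x'"
  by (intro exI[of _ "exp (\<phi> \<theta> - M (y i) * norm (\<psi> \<theta>))"]) (simp add: ker_def weight_bounds)

lemma path_weight_ker: "path_weight m g \<theta> r t y x = (\<Prod>i\<in>{r..<t}. ker \<theta> y (i + 1) (x i) (x (i + 1)))"
  by (simp add: path_weight_def ker_def)

definition obs :: "('x \<Rightarrow> 'x \<Rightarrow> 'y \<Rightarrow> real) \<Rightarrow> bool" where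
  "obs h \<longleftrightarrow> (\<forall>y. (\<lambda>(x, x'). h x x' y) \<in> borel_measurable (lam \<Otimes>\<^sub>M lam))"

text \<open>The numerator of the smoothing functional is itself a path integral, for the
  kernel sequence modified at time \<open>s\<close> only.\<close>

definition hker :: "('x \<Rightarrow> 'x \<Rightarrow> 'y \<Rightarrow> real) \<Rightarrow> 't \<Rightarrow> (int \<Rightarrow> 'y) \<Rightarrow> int \<Rightarrow> int \<Rightarrow> 'x \<Rightarrow> 'x \<Rightarrow> real" where
  "hker h \<theta> y s i x x' = ker \<theta> y i x x' * (if i = s then h x x' (y s) else 1)"

lemma prod_hker:
  assumes "r < s" "s \<le> t"
  shows "(\<Prod>i\<in>{r..<t}. hker h \<theta> y s (i + 1) (x i) (x (i + 1))) = path_weight m g \<theta> r t y x * h (x (s - 1)) (x s) (y s)"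
proof -
  have "(\<Prod>i\<in>{r..<t}. if i + 1 = s then h (x i) (x (i + 1)) (y s) else 1) = (\<Prod>i\<in>{r..<t}. if i = s - 1 then h (x (s - 1)) (x s) (y s) else 1)"
    by (rule prod.cong) auto
  also have "\<dots> = h (x (s - 1)) (x s) (y s)" using assms by (subst prod.delta) auto
  finally show ?thesis by (simp add: hker_def path_weight_ker prod.distrib)
qed

lemma hker_bker:
  assumes "\<theta> \<in> \<Theta>" "good (y i)" "obs h" "\<And>x x'. \<bar>h x x' (y s)\<bar> \<le> c" shows "bker (hker h \<theta> y s i)"
proof -
  have "bker (\<lambda>x x'. if i = s then h x x' (y s) else 1)"
  proof (cases "i = s")
    case True
    then show ?thesis using assms(3,4) by (auto simp: bker_def obs_def)
  next
    case False
    then show ?thesis by (auto simp: bker_def intro!: exI[of _ 1])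
  qed
  then show ?thesis unfolding hker_def[abs_def] using ker_bker[where y = y and i = i, OF assms(1,2)] by (rule bker_mult[rotated])
qed

definition norm_const :: "'t \<Rightarrow> 'x measure \<Rightarrow> int \<Rightarrow> int \<Rightarrow> (int \<Rightarrow> 'y) \<Rightarrow> real" where
  "norm_const \<theta> \<nu> r t y = (\<integral>x. path_weight m g \<theta> r t y x \<partial>path_measure lam \<nu> r t)"

context
  fixes \<theta> :: 't and y :: "int \<Rightarrow> 'y"
  assumes th: "\<theta> \<in> \<Theta>" and y: "\<And>i. good (y i)"
begin

lemma bker_ker: "bker (ker \<theta> y i)" and ker_ge0: "0 \<le> ker \<theta> y i x x'" and ker_low: "\<exists>c>0. \<forall>x x'. c \<le> ker \<theta> y i x x'"
  using ker_bker[where \<theta> = \<theta> and y = y and i = i] ker_nonneg ker_lower[where \<theta> = \<theta> and y = y and i = i] th y by blast+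

lemma bker_hker: "obs h \<Longrightarrow> (\<And>x x'. \<bar>h x x' (y s)\<bar> \<le> c) \<Longrightarrow> bker (hker h \<theta> y s i)"
  by (rule hker_bker[where y = y and s = s and i = i and c = c, OF th y])

lemma ker_g_bounds: "bfun (\<lambda>x. g \<theta> x (y i))" "0 \<le> g \<theta> x (y i)" "s1 * g \<theta> x' (y i) \<le> ker \<theta> y i x x'" "ker \<theta> y i x x' \<le> s2 * g \<theta> x' (y i)"
  using g_bfun[OF th y[of i]] g_pos[OF th, of x "y i"] g_pos[OF th, of x' "y i"] m_bounds[OF th, of x x']
  by (auto simp: ker_def intro!: mult_right_mono)

text \<open>The backward function: as a function of the state at time \<open>r\<close>, the
  likelihood of the next \<open>n\<close> observations.\<close>

abbreviation "back n r \<equiv> Kit (ker \<theta> y) n r (\<lambda>x. 1)"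

lemma back_bfun: "bfun (back n r)" and back_nonneg: "0 \<le> back n r x"
  by (auto intro!: bfun_Kit bker_ker bfun_const Kit_nonneg ker_ge0)

lemma back_pos: "\<exists>c>0. \<forall>x. c \<le> back n r x"
  by (rule Kit_pos[OF bker_ker ker_low lam_pos bfun_const, of 1]) auto

lemma path_integrable:
  assumes "is_prob_on lam \<nu>" "r \<le> t"
  shows "integrable (path_measure lam \<nu> r t) (path_weight m g \<theta> r t y)"
  using path_integrand[where \<kappa> = "ker \<theta> y", OF assms(1) bker_ker bfun_const[of 1] bfun_const[of 1] assms(2)]
  by (simp add: path_weight_ker[abs_def])

lemma path_integrable_h:
  assumes "is_prob_on lam \<nu>" "r < s" "s \<le> t" "obs h" "\<And>x x'. \<bar>h x x' (y s)\<bar> \<le> c"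
  shows "integrable (path_measure lam \<nu> r t) (\<lambda>x. path_weight m g \<theta> r t y x * h (x (s - 1)) (x s) (y s))"
  using path_integrand[where \<kappa> = "hker h \<theta> y s", OF assms(1) bker_hker[OF assms(4,5)] bfun_const[of 1] bfun_const[of 1], of r t] assms(2,3)
  by (simp add: prod_hker)

lemma norm_const_Kit:
  assumes "is_prob_on lam \<nu>"
  shows "norm_const \<theta> \<nu> r (r + int n) y = (\<integral>x. back n r x \<partial>\<nu>)"
  using path_integral_eq_Kit[where \<kappa> = "ker \<theta> y", OF assms bker_ker bfun_const[of 1] bfun_const[of 1], of r n]
  by (simp add: path_weight_ker norm_const_def)

lemma prob_integral_ge:
  assumes "is_prob_on lam \<nu>" "bfun f" "\<And>x. c \<le> f x" shows "c \<le> (\<integral>x. f x \<partial>\<nu>)"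
proof -
  interpret nu: prob_space \<nu> using assms(1) by (simp add: is_prob_on_def)
  have "(\<integral>x. c \<partial>\<nu>) \<le> (\<integral>x. f x \<partial>\<nu>)" using assms by (intro integral_mono prob_on_integrable) (auto intro: bfun_const)
  then show ?thesis by (simp add: nu.prob_space)
qed

lemma norm_const_pos:
  assumes "is_prob_on lam \<nu>" "r \<le> t" shows "0 < norm_const \<theta> \<nu> r t y"
proof -
  define n where "n = nat (t - r)"
  obtain c where "c > 0" "\<And>x. c \<le> back n r x" using back_pos by blast
  then have "c \<le> (\<integral>x. back n r x \<partial>\<nu>)" by (intro prob_integral_ge[OF assms(1) back_bfun])
  moreover have "t = r + int n" using assms(2) by (simp add: n_def)
  ultimately show ?thesis using norm_const_Kit[OF assms(1), of r n] \<open>c > 0\<close> by simp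
qed

text \<open>Numerator and denominator for a chain started at time \<open>s - 1 - k\<close>, with terminal function \<open>f\<close> at time \<open>s\<close>.\<close>

definition "num_fun h s k f = Kit (ker \<theta> y) k (s - 1 - int k) (Kop (hker h \<theta> y s s) f)"
definition "den_fun s k f = Kit (ker \<theta> y) k (s - 1 - int k) (Kop (ker \<theta> y s) f)"

text \<open>A chain started at \<open>s - 1 - k\<close> makes \<open>k\<close> plain steps up to
  time \<open>s - 1\<close>, the step into time \<open>s\<close>, which is the only one where
  numerator and denominator differ, and \<open>n\<close> further steps summarized by the backward
  function. With the modified step isolated like this, past and future can be varied
  separately.\<close>

lemma smooth_ratio:
  assumes \<nu>: "is_prob_on lam \<nu>" and h: "obs h" "\<And>x x'. \<bar>h x x' (y s)\<bar> \<le> c"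
  shows "smooth lam m g h \<theta> \<nu> (s - 1 - int k) s (s + int n) y
    = (\<integral>x. num_fun h s k (back n s) x \<partial>\<nu>) / (\<integral>x. den_fun s k (back n s) x \<partial>\<nu>)"
proof -
  let ?r = "s - 1 - int k"
  have t: "?r + int (k + Suc n) = s + int n" "?r + int k + 1 = s" by auto
  have bker_h: "bker (hker h \<theta> y s i)" for i by (rule bker_hker[OF h])
  have "(\<integral>x. path_weight m g \<theta> ?r (s + int n) y x * h (x (s - 1)) (x s) (y s) \<partial>path_measure lam \<nu> ?r (s + int n))
    = (\<integral>x. Kit (hker h \<theta> y s) (k + Suc n) ?r (\<lambda>x. 1) x \<partial>\<nu>)"
    using path_integral_eq_Kit[where \<kappa> = "hker h \<theta> y s", OF \<nu> bker_h bfun_const[of 1] bfun_const[of 1], of ?r "k + Suc n"]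
    unfolding t by (simp add: prod_hker)
  also have "Kit (hker h \<theta> y s) (k + Suc n) ?r (\<lambda>x. 1) = num_fun h s k (back n s)"
  proof -
    have "Kit (hker h \<theta> y s) n s f = Kit (ker \<theta> y) n s f" for f by (rule Kit_cong) (auto simp: hker_def fun_eq_iff)
    moreover have "Kit (hker h \<theta> y s) k ?r f = Kit (ker \<theta> y) k ?r f" for f by (rule Kit_cong) (auto simp: hker_def fun_eq_iff)
    ultimately show ?thesis unfolding Kit_add num_fun_def by (simp add: t(2))
  qed
  finally have 1: "(\<integral>x. path_weight m g \<theta> ?r (s + int n) y x * h (x (s - 1)) (x s) (y s) \<partial>path_measure lam \<nu> ?r (s + int n))
    = (\<integral>x. num_fun h s k (back n s) x \<partial>\<nu>)" .
  have "back (k + Suc n) ?r = den_fun s k (back n s)"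
    unfolding Kit_add den_fun_def by (simp add: t(2))
  then have 2: "norm_const \<theta> \<nu> ?r (s + int n) y = (\<integral>x. den_fun s k (back n s) x \<partial>\<nu>)"
    using norm_const_Kit[OF \<nu>, of ?r "k + Suc n"] unfolding t by simp
  show ?thesis using 1 2 by (simp add: smooth_def norm_const_def divide_inverse mult.commute)
qed

lemma integral_ratio_bounds:
  assumes \<nu>: "is_prob_on lam \<nu>" and UV: "bfun U" "bfun V" and V: "0 < c0" "\<And>x. c0 \<le> V x"
    and ab: "\<And>x. a * V x \<le> U x" "\<And>x. U x \<le> b * V x"
  shows "a \<le> (\<integral>x. U x \<partial>\<nu>) / (\<integral>x. V x \<partial>\<nu>)" "(\<integral>x. U x \<partial>\<nu>) / (\<integral>x. V x \<partial>\<nu>) \<le> b" "0 < (\<integral>x. V x \<partial>\<nu>)"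
proof -
  have i: "integrable \<nu> U" "integrable \<nu> V" using \<nu> UV by (auto intro: prob_on_integrable)
  show pos: "0 < (\<integral>x. V x \<partial>\<nu>)" using prob_integral_ge[OF \<nu> UV(2) V(2)] V(1) by simp
  have "(\<integral>x. a * V x \<partial>\<nu>) \<le> (\<integral>x. U x \<partial>\<nu>)" using i ab by (intro integral_mono) auto
  then show "a \<le> (\<integral>x. U x \<partial>\<nu>) / (\<integral>x. V x \<partial>\<nu>)" using pos by (simp add: field_simps)
  have "(\<integral>x. U x \<partial>\<nu>) \<le> (\<integral>x. b * V x \<partial>\<nu>)" using i ab by (intro integral_mono) auto
  then show "(\<integral>x. U x \<partial>\<nu>) / (\<integral>x. V x \<partial>\<nu>) \<le> b" using pos by (simp add: field_simps)
qed

context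
  fixes h :: "'x \<Rightarrow> 'x \<Rightarrow> 'y \<Rightarrow> real" and s :: int and c :: real
  assumes h: "obs h" "\<And>x x'. \<bar>h x x' (y s)\<bar> \<le> c"
begin

lemma bker_h: "bker (hker h \<theta> y s i)"
  by (rule bker_hker[OF h])

lemma c_nonneg: "0 \<le> c"
  using h(2) abs_ge_zero order_trans by blast

lemma Kop_hker_bounds:
  assumes f: "bfun f" "\<And>x. 0 \<le> f x"
  shows "- c * Kop (ker \<theta> y s) f x \<le> Kop (hker h \<theta> y s s) f x" "Kop (hker h \<theta> y s s) f x \<le> c * Kop (ker \<theta> y s) f x"
proof -
  have i: "integrable lam (\<lambda>x'. ker \<theta> y s x x' * f x')" "integrable lam (\<lambda>x'. hker h \<theta> y s s x x' * f x')"
    using bfun_section[OF bker_ker f(1)] bfun_section[OF bker_h f(1)] by (auto intro: bfun_integrable_lam)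
  have b: "- c * (ker \<theta> y s x x' * f x') \<le> hker h \<theta> y s s x x' * f x'" "hker h \<theta> y s s x x' * f x' \<le> c * (ker \<theta> y s x x' * f x')" for x'
  proof -
    have "0 \<le> ker \<theta> y s x x' * f x'" using ker_ge0 f by simp
    then have "- c * (ker \<theta> y s x x' * f x') \<le> h x x' (y s) * (ker \<theta> y s x x' * f x')"
      "h x x' (y s) * (ker \<theta> y s x x' * f x') \<le> c * (ker \<theta> y s x x' * f x')"
      using h(2)[of x x'] by (intro mult_right_mono; simp)+
    then show "- c * (ker \<theta> y s x x' * f x') \<le> hker h \<theta> y s s x x' * f x'" "hker h \<theta> y s s x x' * f x' \<le> c * (ker \<theta> y s x x' * f x')"
      by (simp_all add: hker_def mult_ac)
  qed
  have "(\<integral>x'. - c * (ker \<theta> y s x x' * f x') \<partial>lam) \<le> Kop (hker h \<theta> y s s) f x"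
    unfolding Kop_def using i b by (intro integral_mono) auto
  then show "- c * Kop (ker \<theta> y s) f x \<le> Kop (hker h \<theta> y s s) f x" by (simp add: Kop_def)
  have "Kop (hker h \<theta> y s s) f x \<le> (\<integral>x'. c * (ker \<theta> y s x x' * f x') \<partial>lam)"
    unfolding Kop_def using i b by (intro integral_mono) auto
  then show "Kop (hker h \<theta> y s s) f x \<le> c * Kop (ker \<theta> y s) f x" by (simp add: Kop_def)
qed

lemma num_den_bfun: "bfun f \<Longrightarrow> bfun (num_fun h s k f)" "bfun f \<Longrightarrow> bfun (den_fun s k f)"
  unfolding num_fun_def den_fun_def using bker_ker bker_h by (auto intro!: bfun_Kit bfun_Kop)

lemma den_back_pos: "\<exists>c0>0. \<forall>x. c0 \<le> den_fun s k (back n s) x"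
proof -
  have "den_fun s k (back n s) = back (k + Suc n) (s - 1 - int k)"
    unfolding Kit_add den_fun_def by simp
  then show ?thesis using back_pos by metis
qed

lemma num_fun_bounds:
  assumes "bfun f" "\<And>x. 0 \<le> f x"
  shows "- c * den_fun s k f x \<le> num_fun h s k f x" "num_fun h s k f x \<le> c * den_fun s k f x"
  unfolding num_fun_def den_fun_def
  by (rule Kit_ratio_bounds[OF bker_ker ker_ge0 bfun_Kop[OF bker_h assms(1)] bfun_Kop[OF bker_ker assms(1)] Kop_hker_bounds[OF assms]])+

lemma smooth_bound:
  assumes "is_prob_on lam \<nu>" shows "\<bar>smooth lam m g h \<theta> \<nu> (s - 1 - int k) s (s + int n) y\<bar> \<le> c"
proof -
  obtain c0 where c0: "0 < c0" "\<And>x. c0 \<le> den_fun s k (back n s) x" using den_back_pos by blast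
  have "- c \<le> smooth lam m g h \<theta> \<nu> (s - 1 - int k) s (s + int n) y \<and> smooth lam m g h \<theta> \<nu> (s - 1 - int k) s (s + int n) y \<le> c"
    unfolding smooth_ratio[OF assms h]
    using integral_ratio_bounds[OF assms num_den_bfun(1)[OF back_bfun] num_den_bfun(2)[OF back_bfun] c0
        num_fun_bounds(1)[OF back_bfun back_nonneg] num_fun_bounds(2)[OF back_bfun back_nonneg]] by blast
  then show ?thesis by linarith
qed

text \<open>At time \<open>s - 1\<close> the ratio of numerator and denominator lies in an interval
  of length \<open>2 * c\<close>, and \<open>k\<close> contraction steps backwards shrink it by the
  factor \<open>\<rho> ^ k\<close>. Still earlier steps and the initial law only average, so one
  interval serves all initial laws and all earlier starting times together.\<close>

lemma smooth_left_forgetting: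
  "\<exists>a b. b - a = 2 * c * \<rho> ^ k \<and> (\<forall>\<nu> k'. is_prob_on lam \<nu> \<longrightarrow> k \<le> k' \<longrightarrow>
    a \<le> smooth lam m g h \<theta> \<nu> (s - 1 - int k') s (s + int n) y \<and> smooth lam m g h \<theta> \<nu> (s - 1 - int k') s (s + int n) y \<le> b)"
proof -
  let ?u = "Kop (hker h \<theta> y s s) (back n s)" and ?v = "Kop (ker \<theta> y s) (back n s)"
  have uv: "bfun ?u" "bfun ?v" using bker_ker bker_h back_bfun by (auto intro: bfun_Kop)
  have v0: "0 \<le> ?v x" for x
    using Kit_nonneg[OF bker_ker back_bfun ker_ge0 back_nonneg, where n = 1 and r = "s - 1"] by simp
  have "- c \<le> c" using c_nonneg by simp
  from Kit_contract[where \<kappa> = "ker \<theta> y" and w = "\<lambda>i x. g \<theta> x (y i)" and n = k and r = "s - 1 - int k",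
      OF bker_ker ker_g_bounds(1,2) s1 s1_le(1) ker_g_bounds(3,4) uv v0 Kop_hker_bounds[OF back_bfun back_nonneg] this]
  obtain a b where ab: "b - a = (1 - s1 / s2) ^ k * (c - - c)"
    "\<And>x. a * Kit (ker \<theta> y) k (s - 1 - int k) ?v x \<le> Kit (ker \<theta> y) k (s - 1 - int k) ?u x"
    "\<And>x. Kit (ker \<theta> y) k (s - 1 - int k) ?u x \<le> b * Kit (ker \<theta> y) k (s - 1 - int k) ?v x" by blast
  have "a \<le> smooth lam m g h \<theta> \<nu> (s - 1 - int k') s (s + int n) y \<and> smooth lam m g h \<theta> \<nu> (s - 1 - int k') s (s + int n) y \<le> b"
    if \<nu>: "is_prob_on lam \<nu>" and k': "k \<le> k'" for \<nu> k'
  proof -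
    \<comment> \<open>The steps before the last \<open>k\<close> ones; they keep the bounds already
      reached.\<close>
    define j where "j = k' - k"
    have j: "k' = j + k" "s - 1 - int k' + int j = s - 1 - int k" using k' by (auto simp: j_def)
    have nd: "num_fun h s k' (back n s) = Kit (ker \<theta> y) j (s - 1 - int k') (Kit (ker \<theta> y) k (s - 1 - int k) ?u)"
      "den_fun s k' (back n s) = Kit (ker \<theta> y) j (s - 1 - int k') (Kit (ker \<theta> y) k (s - 1 - int k) ?v)"
      unfolding num_fun_def den_fun_def j(2)[symmetric] using Kit_add[of "ker \<theta> y" j k "s - 1 - int k'"] by (simp_all add: j(1))
    have nb: "a * den_fun s k' (back n s) x \<le> num_fun h s k' (back n s) x" "num_fun h s k' (back n s) x \<le> b * den_fun s k' (back n s) x" for x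
      unfolding nd by (rule Kit_ratio_bounds[OF bker_ker ker_ge0 bfun_Kit[OF bker_ker uv(1)] bfun_Kit[OF bker_ker uv(2)] ab(2,3)])+
    obtain c0 where c0: "0 < c0" "\<And>x. c0 \<le> den_fun s k' (back n s) x" using den_back_pos by blast
    show ?thesis unfolding smooth_ratio[OF \<nu> h]
      by (intro conjI integral_ratio_bounds(1,2)[OF \<nu> num_den_bfun(1)[OF back_bfun] num_den_bfun(2)[OF back_bfun] c0 nb])
  qed
  moreover have "b - a = 2 * c * \<rho> ^ k" using ab(1) by (simp add: \<rho>_def)
  ultimately show ?thesis by blast
qed

lemma num_den_diff_scale:
  assumes "bfun f" "bfun f'"
  shows "num_fun h s k (\<lambda>x. f x - a * f' x) x = num_fun h s k f x - a * num_fun h s k f' x"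
    "den_fun s k (\<lambda>x. f x - a * f' x) x = den_fun s k f x - a * den_fun s k f' x"
proof -
  have "Kop (hker h \<theta> y s s) (\<lambda>x. f x - a * f' x) = (\<lambda>x. Kop (hker h \<theta> y s s) f x - a * Kop (hker h \<theta> y s s) f' x)"
    using Kop_diff_scale[OF bker_h assms] by blast
  then show "num_fun h s k (\<lambda>x. f x - a * f' x) x = num_fun h s k f x - a * num_fun h s k f' x"
    using assms bker_h by (simp add: num_fun_def Kit_diff_scale bker_ker bfun_Kop)
  have "Kop (ker \<theta> y s) (\<lambda>x. f x - a * f' x) = (\<lambda>x. Kop (ker \<theta> y s) f x - a * Kop (ker \<theta> y s) f' x)"
    using Kop_diff_scale[OF bker_ker assms] by blast
  then show "den_fun s k (\<lambda>x. f x - a * f' x) x = den_fun s k f x - a * den_fun s k f' x"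
    using assms by (simp add: den_fun_def Kit_diff_scale bker_ker bfun_Kop)
qed

text \<open>The kernel of the step that follows lies between \<open>s1\<close> and \<open>s2\<close>
  times a function of its target alone, so the backward function depends on its starting state only
  up to the factor \<open>s2 / s1\<close>. This needs at least one step, hence
  \<open>Suc j\<close>.\<close>

lemma back_Suc_bounds:
  "\<exists>G>0. \<forall>x. s1 * G \<le> back (Suc j) r x \<and> back (Suc j) r x \<le> s2 * G"
proof -
  define G where "G = (\<integral>x. g \<theta> x (y (r + 1)) * back j (r + 1) x \<partial>lam)"
  have i: "integrable lam (\<lambda>x'. g \<theta> x' (y (r + 1)) * back j (r + 1) x')"
    using ker_g_bounds(1) back_bfun by (intro bfun_integrable_lam bfun_arith) auto
  have ik: "integrable lam (\<lambda>x'. ker \<theta> y (r + 1) x x' * back j (r + 1) x')" for x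
    using bker_ker back_bfun by (intro bfun_integrable_lam bfun_section) auto
  have "s1 * G = (\<integral>x'. s1 * (g \<theta> x' (y (r + 1)) * back j (r + 1) x') \<partial>lam)" by (simp add: G_def)
  also have "\<dots> \<le> back (Suc j) r x" for x
    unfolding Kit.simps Kop_def using i ik mult_right_mono[OF ker_g_bounds(3)[of _ "r + 1" x] back_nonneg]
    by (intro integral_mono) (auto simp: mult.assoc)
  finally have 1: "s1 * G \<le> back (Suc j) r x" for x .
  have "back (Suc j) r x \<le> (\<integral>x'. s2 * (g \<theta> x' (y (r + 1)) * back j (r + 1) x') \<partial>lam)" for x
    unfolding Kit.simps Kop_def using i ik mult_right_mono[OF ker_g_bounds(4)[of "r + 1" x] back_nonneg]
    by (intro integral_mono) (auto simp: mult.assoc)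
  then have 2: "back (Suc j) r x \<le> s2 * G" for x by (simp add: G_def)
  obtain c1 where "c1 > 0" "\<And>x. c1 \<le> back (Suc j) r x" using back_pos by blast
  then have "0 < s2 * G" using 2[of undefined] by (meson less_le_trans)
  then have "G > 0" using s1_le(2) by (simp add: zero_less_mult_iff)
  then show ?thesis using 1 2 by blast
qed

text \<open>Observations after time \<open>s + n\<close> enter through a backward function that is
  constant up to the factor \<open>s2 / s1\<close>. Carried back over \<open>n\<close> contraction
  steps, it makes the longer backward function at time \<open>s\<close> almost proportional to the
  shorter one, and proportional terminal functions give the same ratio.\<close>

lemma smooth_right_forgetting:
  assumes \<nu>: "is_prob_on lam \<nu>" and n: "n \<le> n'"
  shows "\<bar>smooth lam m g h \<theta> \<nu> (s - 1 - int k) s (s + int n') y - smooth lam m g h \<theta> \<nu> (s - 1 - int k) s (s + int n) y\<bar>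
    \<le> 2 * c * (s2 / s1 * \<rho> ^ n)"
proof (cases "n' = n")
  case True
  then show ?thesis using c_nonneg rho s1 s1_le by simp
next
  case False
  \<comment> \<open>The longer future has at least one additional step, as
    \<open>back_Suc_bounds\<close> requires; that is why equal lengths were treated apart.\<close>
  define j where "j = n' - n - 1"
  have j: "n' = n + Suc j" using n False by (simp add: j_def)
  obtain G where G: "G > 0" "\<And>x. s1 * G \<le> back (Suc j) (s + int n) x" "\<And>x. back (Suc j) (s + int n) x \<le> s2 * G"
    using back_Suc_bounds by blast
  have "s1 * G \<le> s2 * G" using G(1) s1_le by (intro mult_right_mono) auto
  from Kit_contract[where \<kappa> = "ker \<theta> y" and w = "\<lambda>i x. g \<theta> x (y i)" and n = n and r = s and v = "\<lambda>x. 1" and a = "s1 * G" and b = "s2 * G",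
      OF bker_ker ker_g_bounds(1,2) s1 s1_le(1) ker_g_bounds(3,4) back_bfun[of "Suc j" "s + int n"] bfun_const _ _ _ this]
  obtain a b where ab: "s1 * G \<le> a" "a \<le> b" "b \<le> s2 * G" "b - a = (1 - s1 / s2) ^ n * (s2 * G - s1 * G)"
    "\<And>x. a * back n s x \<le> Kit (ker \<theta> y) n s (back (Suc j) (s + int n)) x"
    "\<And>x. Kit (ker \<theta> y) n s (back (Suc j) (s + int n)) x \<le> b * back n s x" using G by auto
  have B': "Kit (ker \<theta> y) n s (back (Suc j) (s + int n)) = back n' s" unfolding j Kit_add ..
  note ab = ab[unfolded B']
  have a: "0 < a" using ab(1) G(1) s1 by (meson less_le_trans mult_pos_pos)
  define N where "N f = (\<integral>x. num_fun h s k f x \<partial>\<nu>)" for f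
  define D where "D f = (\<integral>x. den_fun s k f x \<partial>\<nu>)" for f
  have iND: "integrable \<nu> (num_fun h s k f)" "integrable \<nu> (den_fun s k f)" if "bfun f" for f
    using that \<nu> by (auto intro: prob_on_integrable num_den_bfun)
  have ND: "\<bar>N f\<bar> \<le> c * D f" "0 \<le> D f" if "bfun f" "\<And>x. 0 \<le> f x" for f
  proof -
    have "N f \<le> (\<integral>x. c * den_fun s k f x \<partial>\<nu>)" unfolding N_def using that iND num_fun_bounds by (intro integral_mono) auto
    moreover have "(\<integral>x. - c * den_fun s k f x \<partial>\<nu>) \<le> N f" unfolding N_def using that iND num_fun_bounds by (intro integral_mono) auto
    ultimately show "\<bar>N f\<bar> \<le> c * D f" by (simp add: D_def abs_le_iff)
    have "0 \<le> den_fun s k f x" for x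
    proof -
      have "0 \<le> Kop (ker \<theta> y s) f x" for x
        unfolding Kop_def using ker_ge0 that(2) by (intro Bochner_Integration.integral_nonneg) simp
      then show ?thesis unfolding den_fun_def by (intro Kit_nonneg bker_ker bfun_Kop ker_ge0 that(1))
    qed
    then show "0 \<le> D f" by (simp add: D_def)
  qed
  have lin: "N (\<lambda>x. f x - t * f' x) = N f - t * N f'" "D (\<lambda>x. f x - t * f' x) = D f - t * D f'" if "bfun f" "bfun f'" for f f' t
  proof -
    have "num_fun h s k (\<lambda>x. f x - t * f' x) = (\<lambda>x. num_fun h s k f x - t * num_fun h s k f' x)"
      "den_fun s k (\<lambda>x. f x - t * f' x) = (\<lambda>x. den_fun s k f x - t * den_fun s k f' x)"
      by (intro ext num_den_diff_scale[OF that])+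
    then show "N (\<lambda>x. f x - t * f' x) = N f - t * N f'" "D (\<lambda>x. f x - t * f' x) = D f - t * D f'"
      unfolding N_def D_def using iND[OF that(1)] iND[OF that(2)] by simp_all
  qed
  obtain c0 where "c0 > 0" "\<And>x. c0 \<le> den_fun s k (back n s) x" using den_back_pos by blast
  then have D0: "0 < D (back n s)" unfolding D_def
    using prob_integral_ge[OF \<nu> num_den_bfun(2)[OF back_bfun], of c0] by (meson less_le_trans)
  have "\<bar>N (back n' s) / D (back n' s) - N (back n s) / D (back n s)\<bar> \<le> 2 * c * (1 - a / b)"
  proof (rule ratio_perturb[OF D0 a])
    have d1: "bfun (\<lambda>x. back n' s x - a * back n s x)" using back_bfun by (intro bfun_arith)
    note 1 = ND[OF d1] lin[OF back_bfun back_bfun, of n' s a n s]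
    show "\<bar>N (back n' s) - a * N (back n s)\<bar> \<le> c * (D (back n' s) - a * D (back n s))"
      using 1 ab(5) by simp
    show "a * D (back n s) \<le> D (back n' s)" using 1 ab(5) by simp
    have d2: "bfun (\<lambda>x. b * back n s x)" using back_bfun by (intro bfun_arith(3)) auto
    then have d3: "bfun (\<lambda>x. b * back n s x - 1 * back n' s x)" using back_bfun by (intro bfun_arith(2)) auto
    have "D (\<lambda>x. 0 - (- b) * back n s x) = D (\<lambda>x. 0) - (- b) * D (back n s)"
      by (rule lin(2)[OF bfun_const back_bfun])
    moreover have "D (\<lambda>x. 0) = 0" by (simp add: D_def den_fun_def Kop_def[abs_def] Kit_zero)
    ultimately have "D (\<lambda>x. b * back n s x) = b * D (back n s)" by simp
    moreover have "D (\<lambda>x. b * back n s x - 1 * back n' s x) = D (\<lambda>x. b * back n s x) - 1 * D (back n' s)"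
      by (rule lin(2)[OF d2 back_bfun])
    moreover have "0 \<le> D (\<lambda>x. b * back n s x - 1 * back n' s x)"
      using ab(6) by (intro ND(2)[OF d3]) simp
    ultimately show "D (back n' s) \<le> b * D (back n s)" by simp
    show "\<bar>N (back n s)\<bar> \<le> c * D (back n s)" using ND back_bfun back_nonneg by simp
  qed
  moreover have "1 - a / b \<le> s2 / s1 * \<rho> ^ n"
  proof -
    \<comment> \<open>The scale \<open>G\<close> of the additional future cancels: \<open>b\<close>
      is at least \<open>s1 * G\<close>, and the interval has length \<open>\<rho> ^ n\<close> times
      \<open>(s2 - s1) * G\<close>.\<close>
    have "1 - a / b = (b - a) / b" using a ab(2) by (simp add: diff_divide_distrib)
    also have "\<dots> \<le> (b - a) / (s1 * G)" using ab a G(1) s1 by (intro divide_left_mono) auto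
    also have "\<dots> = \<rho> ^ n * (s2 - s1) / s1" unfolding ab(4) using G(1) s1 by (simp add: \<rho>_def field_simps)
    also have "\<dots> \<le> \<rho> ^ n * s2 / s1" using s1 rho by (intro divide_right_mono mult_left_mono) auto
    finally show ?thesis by (simp add: mult.commute)
  qed
  ultimately show ?thesis unfolding smooth_ratio[OF \<nu> h] N_def D_def
    using c_nonneg by (meson mult_left_mono order_trans mult_nonneg_nonneg zero_le_numeral)
qed

text \<open>Both futures are cut down to the common length \<open>n\<close>, at the cost of one
  right estimate each; with equal futures both values lie in the interval for the past.\<close>

lemma smooth_forgetting:
  assumes \<nu>: "is_prob_on lam \<nu>1" "is_prob_on lam \<nu>2" and k: "k \<le> k1" "k \<le> k2" and n: "n \<le> n1" "n \<le> n2"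
  shows "\<bar>smooth lam m g h \<theta> \<nu>1 (s - 1 - int k1) s (s + int n1) y - smooth lam m g h \<theta> \<nu>2 (s - 1 - int k2) s (s + int n2) y\<bar>
    \<le> c * (2 * \<rho> ^ k + 4 * (s2 / s1) * \<rho> ^ n)"
proof -
  obtain a b where ab: "b - a = 2 * c * \<rho> ^ k" "\<And>\<nu> k'. is_prob_on lam \<nu> \<Longrightarrow> k \<le> k' \<Longrightarrow>
    a \<le> smooth lam m g h \<theta> \<nu> (s - 1 - int k') s (s + int n) y \<and> smooth lam m g h \<theta> \<nu> (s - 1 - int k') s (s + int n) y \<le> b"
    using smooth_left_forgetting[of k n] by blast
  have "c * (2 * \<rho> ^ k + 4 * (s2 / s1) * \<rho> ^ n) = 2 * c * \<rho> ^ k + 2 * c * (s2 / s1 * \<rho> ^ n) + 2 * c * (s2 / s1 * \<rho> ^ n)"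
    by (simp add: algebra_simps)
  then show ?thesis
    using smooth_right_forgetting[OF \<nu>(1) n(1), of k1] smooth_right_forgetting[OF \<nu>(2) n(2), of k2]
      ab(1) ab(2)[OF \<nu>(1) k(1)] ab(2)[OF \<nu>(2) k(2)] by linarith
qed

end

end

section \<open>Dependence of the smoothed quantities on the parameter\<close>

definition weight_osc :: "real \<Rightarrow> (int \<Rightarrow> 'y) \<Rightarrow> int \<Rightarrow> int \<Rightarrow> real" where
  "weight_osc d y r t = (\<Sum>i\<in>{r..<t}. d * (1 + M (y (i + 1))))"

lemma path_weight_nonneg: "\<theta> \<in> \<Theta> \<Longrightarrow> 0 \<le> path_weight m g \<theta> r t y x"
  unfolding path_weight_ker using ker_nonneg by (intro prod_nonneg) auto

text \<open>The parameter enters the logarithm of each factor only through \<open>\<phi>\<close>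
  and, linearly, through \<open>\<psi>\<close>. Moving both by at most \<open>d\<close> changes that
  logarithm by at most \<open>d * (1 + M (y i))\<close>, and \<open>weight_osc\<close> is the sum of
  these changes along the path.\<close>

lemma path_weight_perturb:
  assumes th: "\<theta> \<in> \<Theta>" "\<theta>' \<in> \<Theta>" and y: "\<And>i. good (y i)" and d: "0 \<le> d"
    and close: "\<bar>\<phi> \<theta>' - \<phi> \<theta>\<bar> \<le> d" "norm (\<psi> \<theta>' - \<psi> \<theta>) \<le> d"
  shows "path_weight m g \<theta>' r t y x \<le> exp (weight_osc d y r t) * path_weight m g \<theta> r t y x"
proof -
  have "ker \<theta>' y i a b \<le> exp (d * (1 + M (y i))) * ker \<theta> y i a b" for i a b
  proof -
    have "\<bar>inner (S a b (y i)) (\<psi> \<theta>' - \<psi> \<theta>)\<bar> \<le> norm (S a b (y i)) * norm (\<psi> \<theta>' - \<psi> \<theta>)"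
      by (rule Cauchy_Schwarz_ineq2)
    also have "\<dots> \<le> M (y i) * d" using goodD[OF y] close good_M[OF y] by (intro mult_mono) auto
    finally have "\<phi> \<theta>' + inner (S a b (y i)) (\<psi> \<theta>') \<le> d * (1 + M (y i)) + (\<phi> \<theta> + inner (S a b (y i)) (\<psi> \<theta>))"
      using close(1) by (simp add: inner_diff_right algebra_simps abs_le_iff)
    then show ?thesis using th by (simp add: ker_def expfam flip: exp_add)
  qed
  then have "path_weight m g \<theta>' r t y x \<le> (\<Prod>i\<in>{r..<t}. exp (d * (1 + M (y (i + 1)))) * ker \<theta> y (i + 1) (x i) (x (i + 1)))"
    unfolding path_weight_ker using ker_nonneg th by (intro prod_mono) auto
  then show ?thesis by (simp add: path_weight_ker prod.distrib weight_osc_def exp_sum)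
qed

lemma norm_const_perturb:
  assumes "\<theta> \<in> \<Theta>" "\<theta>' \<in> \<Theta>" and y: "\<And>i. good (y i)" and "0 \<le> d"
    and "\<bar>\<phi> \<theta>' - \<phi> \<theta>\<bar> \<le> d" "norm (\<psi> \<theta>' - \<psi> \<theta>) \<le> d" and \<nu>: "is_prob_on lam \<nu>" "r \<le> t"
  shows "norm_const \<theta>' \<nu> r t y \<le> exp (weight_osc d y r t) * norm_const \<theta> \<nu> r t y"
proof -
  have "norm_const \<theta>' \<nu> r t y \<le> (\<integral>x. exp (weight_osc d y r t) * path_weight m g \<theta> r t y x \<partial>path_measure lam \<nu> r t)"
    unfolding norm_const_def using path_integrable[of _ y] assms path_weight_perturb[of \<theta> \<theta>' y d]
    by (intro integral_mono integrable_mult_right) auto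
  then show ?thesis by (simp add: norm_const_def)
qed

lemma smooth_real:
  "smooth lam m g (h :: 'x \<Rightarrow> 'x \<Rightarrow> 'y \<Rightarrow> real) \<theta> \<nu> r s t y
    = (\<integral>x. path_weight m g \<theta> r t y x * h (x (s - 1)) (x s) (y s) \<partial>path_measure lam \<nu> r t) / norm_const \<theta> \<nu> r t y"
  by (simp add: smooth_def norm_const_def divide_inverse mult.commute)

text \<open>The two path weights agree up to the factor \<open>exp (weight_osc d y r t)\<close> in
  either direction. The form \<open>1 - exp (...)\<close> is kept and not linearized: it never
  exceeds 1, so the bound has the same moments as \<open>c\<close>, whereas the oscillation times
  \<open>c\<close> would contain products of values of \<open>M\<close>.\<close>

lemma smooth_perturb:
  assumes th: "\<theta> \<in> \<Theta>" "\<theta>' \<in> \<Theta>" and y: "\<And>i. good (y i)" and d: "0 \<le> d"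
    and close: "\<bar>\<phi> \<theta>' - \<phi> \<theta>\<bar> \<le> d" "norm (\<psi> \<theta>' - \<psi> \<theta>) \<le> d" and \<nu>: "is_prob_on lam \<nu>"
    and h: "obs h" "\<And>x x'. \<bar>h x x' (y s)\<bar> \<le> c" and rst: "r < s" "s \<le> t"
  shows "\<bar>smooth lam m g h \<theta>' \<nu> r s t y - smooth lam m g h \<theta> \<nu> r s t y\<bar> \<le> 2 * c * (1 - exp (- 2 * weight_osc d y r t))"
proof -
  let ?P = "path_measure lam \<nu> r t" and ?E = "exp (weight_osc d y r t)"
  let ?w = "\<lambda>\<theta> x. path_weight m g \<theta> r t y x" and ?h = "\<lambda>x. h (x (s - 1)) (x s) (y s)"
  have i: "integrable ?P (?w \<theta>)" "integrable ?P (?w \<theta>')" "integrable ?P (\<lambda>x. ?w \<theta> x * ?h x)" "integrable ?P (\<lambda>x. ?w \<theta>' x * ?h x)"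
    using path_integrable[of _ y] path_integrable_h[of _ y, OF _ y \<nu> rst h] th y \<nu> rst by auto
  have up: "?w \<theta>' x \<le> ?E * ?w \<theta> x" for x by (rule path_weight_perturb[OF th y d close])
  have "?w \<theta> x \<le> ?E * ?w \<theta>' x" for x
    using close by (intro path_weight_perturb[OF th(2,1) y d]) (auto simp: norm_minus_commute abs_minus_commute)
  then have low: "inverse ?E * ?w \<theta> x \<le> ?w \<theta>' x" for x by (simp add: field_simps)
  have "\<bar>(\<integral>x. ?w \<theta>' x * ?h x \<partial>?P) / norm_const \<theta>' \<nu> r t y - (\<integral>x. ?w \<theta> x * ?h x \<partial>?P) / norm_const \<theta> \<nu> r t y\<bar>
    \<le> 2 * c * (1 - inverse ?E / ?E)"
  proof (rule ratio_perturb)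
    show "0 < norm_const \<theta> \<nu> r t y" using norm_const_pos[of \<theta> y] th y \<nu> rst by auto
    have "(\<integral>x. inverse ?E * ?w \<theta> x \<partial>?P) \<le> (\<integral>x. ?w \<theta>' x \<partial>?P)" using i low by (intro integral_mono) auto
    then show "inverse ?E * norm_const \<theta> \<nu> r t y \<le> norm_const \<theta>' \<nu> r t y" by (simp add: norm_const_def)
    show "norm_const \<theta>' \<nu> r t y \<le> ?E * norm_const \<theta> \<nu> r t y"
      using rst by (intro norm_const_perturb[OF th y d close \<nu>]) simp
    have b: "\<bar>v * ?h x\<bar> \<le> c * v" if "0 \<le> v" for v x
      using mult_left_mono[OF h(2)[of "x (s - 1)" "x s"] that] that by (simp add: abs_mult mult.commute)
    have "\<bar>\<integral>x. ?w \<theta> x * ?h x \<partial>?P\<bar> \<le> (\<integral>x. \<bar>?w \<theta> x * ?h x\<bar> \<partial>?P)" by (rule integral_abs_bound)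
    also have "\<dots> \<le> (\<integral>x. c * ?w \<theta> x \<partial>?P)" using i b path_weight_nonneg[OF th(1)] by (intro integral_mono) auto
    finally show "\<bar>\<integral>x. ?w \<theta> x * ?h x \<partial>?P\<bar> \<le> c * norm_const \<theta> \<nu> r t y" by (simp add: norm_const_def)
    \<comment> \<open>The remaining weight after subtraction is nonnegative, so
      \<open>\<bar>h\<bar> \<le> c\<close> bounds the remainder of the numerator by \<open>c\<close>
      times that of the denominator.\<close>
    have eq: "(\<integral>x. ?w \<theta>' x * ?h x \<partial>?P) - inverse ?E * (\<integral>x. ?w \<theta> x * ?h x \<partial>?P) = (\<integral>x. (?w \<theta>' x - inverse ?E * ?w \<theta> x) * ?h x \<partial>?P)"
      using i by (simp add: left_diff_distrib mult.assoc)
    have "\<bar>\<integral>x. (?w \<theta>' x - inverse ?E * ?w \<theta> x) * ?h x \<partial>?P\<bar> \<le> (\<integral>x. \<bar>(?w \<theta>' x - inverse ?E * ?w \<theta> x) * ?h x\<bar> \<partial>?P)"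
      by (rule integral_abs_bound)
    also have "\<dots> \<le> (\<integral>x. c * (?w \<theta>' x - inverse ?E * ?w \<theta> x) \<partial>?P)"
    proof (rule integral_mono)
      have "integrable ?P (\<lambda>x. ?w \<theta>' x * ?h x - inverse ?E * (?w \<theta> x * ?h x))" using i by simp
      then show "integrable ?P (\<lambda>x. \<bar>(?w \<theta>' x - inverse ?E * ?w \<theta> x) * ?h x\<bar>)"
        by (intro integrable_abs) (simp add: left_diff_distrib mult.assoc)
      show "\<bar>(?w \<theta>' x - inverse ?E * ?w \<theta> x) * ?h x\<bar> \<le> c * (?w \<theta>' x - inverse ?E * ?w \<theta> x)" for x
        using low[of x] by (intro b) simp
    qed (use i in auto)
    also have "\<dots> = c * (norm_const \<theta>' \<nu> r t y - inverse ?E * norm_const \<theta> \<nu> r t y)"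
      using i by (simp add: norm_const_def)
    finally show "\<bar>(\<integral>x. ?w \<theta>' x * ?h x \<partial>?P) - inverse ?E * (\<integral>x. ?w \<theta> x * ?h x \<partial>?P)\<bar> \<le> c * (norm_const \<theta>' \<nu> r t y - inverse ?E * norm_const \<theta> \<nu> r t y)"
      unfolding eq .
  qed simp
  moreover have "inverse ?E / ?E = exp (- 2 * weight_osc d y r t)"
    by (simp add: exp_minus[symmetric] flip: exp_diff)
  ultimately show ?thesis by (simp add: smooth_real)
qed

text \<open>One more observation multiplies the likelihood by a ratio of the same kind as a
  smoothing ratio: the terminal function \<open>Kop (ker \<theta> y (t + 1)) (\<lambda>x. 1)\<close>
  against the constant 1. Contraction over \<open>k\<close> steps confines it to an interval that is
  short on the logarithmic scale, for all starting states and all longer pasts.\<close>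

lemma pred_ratio_bounds:
  assumes th: "\<theta> \<in> \<Theta>" and y: "\<And>i. good (y i)"
  shows "\<exists>a b. 0 < a \<and> a \<le> b \<and> ln b - ln a \<le> s2 / s1 * \<rho> ^ k \<and>
    - (\<bar>ln (measure lam UNIV)\<bar> + \<bar>\<phi> \<theta>\<bar> + M (y (t + 1)) * norm (\<psi> \<theta>)) \<le> ln a \<and>
    ln b \<le> \<bar>ln (measure lam UNIV)\<bar> + \<bar>\<phi> \<theta>\<bar> + M (y (t + 1)) * norm (\<psi> \<theta>) \<and>
    (\<forall>n\<ge>k. \<forall>x. a * Kit (ker \<theta> y) n (t - int n) (\<lambda>x. 1) x \<le> Kit (ker \<theta> y) (n + 1) (t - int n) (\<lambda>x. 1) x \<and>
      Kit (ker \<theta> y) (n + 1) (t - int n) (\<lambda>x. 1) x \<le> b * Kit (ker \<theta> y) n (t - int n) (\<lambda>x. 1) x)"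
proof -
  let ?L = "measure lam UNIV" and ?e = "M (y (t + 1)) * norm (\<psi> \<theta>)"
  let ?u = "Kop (ker \<theta> y (t + 1)) (\<lambda>x. 1)"
  note bker_ker = bker_ker[of _ y, OF th y] and ker_ge0 = ker_ge0[of _ y, OF th y] and ker_g_bounds = ker_g_bounds[of _ y, OF th y]
  have bu: "bfun ?u" using bker_ker bfun_const by (rule bfun_Kop)
  define G where "G = (\<integral>x. g \<theta> x (y (t + 1)) \<partial>lam)"
  have i: "integrable lam (\<lambda>x. g \<theta> x (y (t + 1)))" using ker_g_bounds(1) by (rule bfun_integrable_lam)
  have ik: "integrable lam (\<lambda>x'. ker \<theta> y (t + 1) x x')" for x
    using bfun_integrable_lam[OF bfun_section[OF bker_ker bfun_const[of 1]]] by simp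
  have low1: "s1 * G \<le> ?u x" and up1: "?u x \<le> s2 * G" for x
  proof -
    have "(\<integral>x'. s1 * g \<theta> x' (y (t + 1)) \<partial>lam) \<le> (\<integral>x'. ker \<theta> y (t + 1) x x' \<partial>lam)"
      using i ik ker_g_bounds by (intro integral_mono) auto
    then show "s1 * G \<le> ?u x" by (simp add: G_def Kop_def)
    have "(\<integral>x'. ker \<theta> y (t + 1) x x' \<partial>lam) \<le> (\<integral>x'. s2 * g \<theta> x' (y (t + 1)) \<partial>lam)"
      using i ik ker_g_bounds by (intro integral_mono) auto
    then show "?u x \<le> s2 * G" by (simp add: G_def Kop_def)
  qed
  have low2: "?L * exp (\<phi> \<theta> - ?e) \<le> ?u x" and up2: "?u x \<le> ?L * exp (\<phi> \<theta> + ?e)" for x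
  proof -
    have "(\<integral>x'. exp (\<phi> \<theta> - ?e) \<partial>lam) \<le> (\<integral>x'. ker \<theta> y (t + 1) x x' \<partial>lam)"
      using ik weight_bounds[OF th y] by (intro integral_mono) (auto simp: ker_def)
    then show "?L * exp (\<phi> \<theta> - ?e) \<le> ?u x" by (simp add: Kop_def space_lam)
    have "(\<integral>x'. ker \<theta> y (t + 1) x x' \<partial>lam) \<le> (\<integral>x'. exp (\<phi> \<theta> + ?e) \<partial>lam)"
      using ik weight_bounds[OF th y] by (intro integral_mono) (auto simp: ker_def)
    then show "?u x \<le> ?L * exp (\<phi> \<theta> + ?e)" by (simp add: Kop_def space_lam)
  qed
  \<comment> \<open>Two brackets for the same function. The one with \<open>G\<close> has ends in
    the bounded ratio \<open>s2 / s1\<close>, which controls the width; the other has logarithms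
    bounded linearly in \<open>M\<close>, which gives integrability. Their intersection has both
    properties.\<close>
  define a0 b0 where "a0 = max (s1 * G) (?L * exp (\<phi> \<theta> - ?e))" and "b0 = min (s2 * G) (?L * exp (\<phi> \<theta> + ?e))"
  have ab0: "a0 * 1 \<le> ?u x" "?u x \<le> b0 * 1" for x
    using low1[of x] low2[of x] up1[of x] up2[of x] unfolding a0_def b0_def by linarith+
  have "a0 \<le> b0" using ab0[of undefined] by linarith
  have "?L * exp (\<phi> \<theta> - ?e) \<le> s2 * G" using low2[of undefined] up1[of undefined] by linarith
  moreover have "0 < ?L * exp (\<phi> \<theta> - ?e)" using lam_pos by simp
  ultimately have "0 < s2 * G" by linarith
  then have G: "0 < G" using s1_le(2) by (simp add: zero_less_mult_iff)
  have a0: "0 < a0" unfolding a0_def using lam_pos by (intro less_max_iff_disj[THEN iffD2] disjI2 mult_pos_pos exp_gt_zero)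
  from Kit_contract[where \<kappa> = "ker \<theta> y" and w = "\<lambda>i x. g \<theta> x (y i)" and n = k and r = "t - int k" and v = "\<lambda>x. 1" and a = a0 and b = b0,
      OF bker_ker ker_g_bounds(1,2) s1 s1_le(1) ker_g_bounds(3,4) bu bfun_const _ ab0 \<open>a0 \<le> b0\<close>]
  obtain a b where ab: "a0 \<le> a" "a \<le> b" "b \<le> b0" "b - a = (1 - s1 / s2) ^ k * (b0 - a0)"
    "\<And>x. a * Kit (ker \<theta> y) k (t - int k) (\<lambda>x. 1) x \<le> Kit (ker \<theta> y) k (t - int k) ?u x"
    "\<And>x. Kit (ker \<theta> y) k (t - int k) ?u x \<le> b * Kit (ker \<theta> y) k (t - int k) (\<lambda>x. 1) x" by auto
  have a: "0 < a" using a0 ab(1) by simp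
  have "ln b - ln a = ln (b / a)" using a ab(2) by (simp add: ln_div)
  also have "\<dots> \<le> b / a - 1" using a ab(2) by (intro ln_le_minus_one) simp
  also have "\<dots> = (b - a) / a" using a by (simp add: diff_divide_distrib)
  also have "\<dots> \<le> (b - a) / (s1 * G)"
    using ab(1,2) a G s1 by (intro divide_left_mono) (auto simp: a0_def)
  also have "\<dots> \<le> \<rho> ^ k * (s2 * G) / (s1 * G)"
  proof (intro divide_right_mono)
    have "0 \<le> a0" "b0 \<le> s2 * G" using a0 by (auto simp: b0_def)
    then show "b - a \<le> \<rho> ^ k * (s2 * G)" unfolding ab(4) using rho by (intro mult_mono) (auto simp: \<rho>_def \<open>a0 \<le> b0\<close>)
  qed (use s1 G in simp)
  also have "\<dots> = s2 / s1 * \<rho> ^ k" using G by simp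
  finally have d: "ln b - ln a \<le> s2 / s1 * \<rho> ^ k" .
  have "ln ?L + (\<phi> \<theta> - ?e) = ln (?L * exp (\<phi> \<theta> - ?e))" using lam_pos by (simp add: ln_mult)
  also have "\<dots> \<le> ln a" using ab(1) a lam_pos by (subst ln_le_cancel_iff) (auto simp: a0_def)
  finally have la: "- (\<bar>ln ?L\<bar> + \<bar>\<phi> \<theta>\<bar> + ?e) \<le> ln a" by linarith
  have "ln b \<le> ln (?L * exp (\<phi> \<theta> + ?e))" using ab(2,3) a lam_pos by (subst ln_le_cancel_iff) (auto simp: b0_def)
  also have "\<dots> = ln ?L + (\<phi> \<theta> + ?e)" using lam_pos by (simp add: ln_mult)
  finally have incr_bound: "ln b \<le> \<bar>ln ?L\<bar> + \<bar>\<phi> \<theta>\<bar> + ?e" by linarith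
  have K: "a * Kit (ker \<theta> y) n (t - int n) (\<lambda>x. 1) x \<le> Kit (ker \<theta> y) (n + 1) (t - int n) (\<lambda>x. 1) x \<and>
      Kit (ker \<theta> y) (n + 1) (t - int n) (\<lambda>x. 1) x \<le> b * Kit (ker \<theta> y) n (t - int n) (\<lambda>x. 1) x" if "k \<le> n" for n x
  proof -
    define j where "j = n - k"
    have j: "n = j + k" "t - int n + int j = t - int k" using that by (auto simp: j_def)
    have 1: "Kit (ker \<theta> y) n (t - int n) f = Kit (ker \<theta> y) j (t - int n) (Kit (ker \<theta> y) k (t - int k) f)" for f
      unfolding j(2)[symmetric] using Kit_add[of "ker \<theta> y" j k "t - int n"] by (simp add: j(1))
    have 2: "Kit (ker \<theta> y) (n + 1) (t - int n) (\<lambda>x. 1) = Kit (ker \<theta> y) n (t - int n) ?u"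
      unfolding Kit_add by simp
    show ?thesis unfolding 2 1
      by (intro conjI Kit_ratio_bounds[OF bker_ker ker_ge0 bfun_Kit[OF bker_ker bu] bfun_Kit[OF bker_ker bfun_const] ab(5,6)])
  qed
  show ?thesis
    by (rule exI[of _ a], rule exI[of _ b], intro conjI allI impI)
      (fact a ab(2) d la incr_bound | (rule K[THEN conjunct1], assumption) | (rule K[THEN conjunct2], assumption))+
qed

text \<open>The increments of the log-likelihood started at \<open>t - n\<close> from \<open>\<nu>\<close>, without the factor
  \<open>g(x\<^sub>-\<^sub>n, y\<^sub>-\<^sub>n)\<close> of \<^const>\<open>likelihood\<close>: this makes them continuous in \<open>\<theta>\<close>.\<close>

definition log_incr :: "'t \<Rightarrow> 'x measure \<Rightarrow> nat \<Rightarrow> int \<Rightarrow> (int \<Rightarrow> 'y) \<Rightarrow> real" where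
  "log_incr \<theta> \<nu> n t y = ln (norm_const \<theta> \<nu> (t - int n) (t + 1) y) - ln (norm_const \<theta> \<nu> (t - int n) t y)"

lemma likelihood_Kit:
  assumes th: "\<theta> \<in> \<Theta>" and y: "\<And>i. good (y i)" and \<nu>: "is_prob_on lam \<nu>"
  shows "likelihood lam m g \<theta> \<nu> n (int k) y = (\<integral>x. g \<theta> x (y (- int n)) * Kit (ker \<theta> y) (n + k) (- int n) (\<lambda>x. 1) x \<partial>\<nu>)"
proof -
  have eq: "(\<Prod>i\<in>{- int n + 1..int k}. m \<theta> (x (i - 1)) (x i) * g \<theta> (x i) (y i))
    = (\<Prod>i\<in>{- int n..<int k}. ker \<theta> y (i + 1) (x i) (x (i + 1)))" for x
    by (rule prod.reindex_bij_witness[of _ "\<lambda>i. i + 1" "\<lambda>i. i - 1"]) (auto simp: ker_def)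
  show ?thesis unfolding likelihood_def eq
    using path_integral_eq_Kit[OF \<nu> bker_ker[of _ y, OF th y] g_bfun[OF th y] bfun_const[of 1], where r = "- int n" and n = "n + k"]
    by simp
qed

lemma log_bounds_of_ratio:
  fixes a b U V :: real
  assumes "0 < a" "a \<le> U / V" "U / V \<le> b" "0 < V"
  shows "ln a \<le> ln (U / V)" "ln (U / V) \<le> ln b" "ln (U / V) = ln U - ln V"
proof -
  have "0 < U / V" using assms by linarith
  then have "0 < U" using assms(4) by (simp add: zero_less_divide_iff)
  then show "ln (U / V) = ln U - ln V" using assms(4) by (simp add: ln_div)
  show "ln a \<le> ln (U / V)" "ln (U / V) \<le> ln b"
    using assms \<open>0 < U / V\<close> by (subst ln_le_cancel_iff; linarith)+
qed

text \<open>The bounds on the ratio hold for every starting state. The additional emission density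
  at the initial time only reweights the initial law, so the predictive density falls into the same
  interval as the increments without it.\<close>

lemma log_incr_forgetting:
  assumes th: "\<theta> \<in> \<Theta>" and y: "\<And>i. good (y i)"
  shows "\<exists>a b. b - a \<le> s2 / s1 * \<rho> ^ k \<and>
    - (\<bar>ln (measure lam UNIV)\<bar> + \<bar>\<phi> \<theta>\<bar> + M (y (t + 1)) * norm (\<psi> \<theta>)) \<le> a \<and>
    b \<le> \<bar>ln (measure lam UNIV)\<bar> + \<bar>\<phi> \<theta>\<bar> + M (y (t + 1)) * norm (\<psi> \<theta>) \<and>
    (\<forall>\<nu> n. is_prob_on lam \<nu> \<longrightarrow> k \<le> n \<longrightarrow> a \<le> log_incr \<theta> \<nu> n t y \<and> log_incr \<theta> \<nu> n t y \<le> b) \<and>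
    (t = 0 \<longrightarrow> (\<forall>\<nu> n. is_prob_on lam \<nu> \<longrightarrow> k \<le> n \<longrightarrow> a \<le> ln (pred_density lam m g \<theta> \<nu> n y) \<and> ln (pred_density lam m g \<theta> \<nu> n y) \<le> b))"
proof -
  note bker_ker = bker_ker[of _ y, OF th y] and ker_ge0 = ker_ge0[of _ y, OF th y] and ker_g_bounds = ker_g_bounds[of _ y, OF th y] and bb = back_bfun[of _ y, OF th y]
  obtain a b where ab: "0 < a" "a \<le> b" "ln b - ln a \<le> s2 / s1 * \<rho> ^ k"
    "- (\<bar>ln (measure lam UNIV)\<bar> + \<bar>\<phi> \<theta>\<bar> + M (y (t + 1)) * norm (\<psi> \<theta>)) \<le> ln a"
    "ln b \<le> \<bar>ln (measure lam UNIV)\<bar> + \<bar>\<phi> \<theta>\<bar> + M (y (t + 1)) * norm (\<psi> \<theta>)"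
    "\<And>n x. k \<le> n \<Longrightarrow> a * Kit (ker \<theta> y) n (t - int n) (\<lambda>x. 1) x \<le> Kit (ker \<theta> y) (n + 1) (t - int n) (\<lambda>x. 1) x"
    "\<And>n x. k \<le> n \<Longrightarrow> Kit (ker \<theta> y) (n + 1) (t - int n) (\<lambda>x. 1) x \<le> b * Kit (ker \<theta> y) n (t - int n) (\<lambda>x. 1) x"
    using pred_ratio_bounds[where y = y and k = k and t = t, OF th y] by blast
  have 1: "ln a \<le> log_incr \<theta> \<nu> n t y \<and> log_incr \<theta> \<nu> n t y \<le> ln b" if \<nu>: "is_prob_on lam \<nu>" and n: "k \<le> n" for \<nu> n
  proof -
    obtain c0 where c0: "0 < c0" "\<And>x. c0 \<le> Kit (ker \<theta> y) n (t - int n) (\<lambda>x. 1) x" using back_pos[of _ y, OF th y] by blast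
    have t: "t - int n + int (n + 1) = t + 1" "t - int n + int n = t" by auto
    have "norm_const \<theta> \<nu> (t - int n) (t + 1) y = (\<integral>x. Kit (ker \<theta> y) (n + 1) (t - int n) (\<lambda>x. 1) x \<partial>\<nu>)"
      "norm_const \<theta> \<nu> (t - int n) t y = (\<integral>x. Kit (ker \<theta> y) n (t - int n) (\<lambda>x. 1) x \<partial>\<nu>)"
      using norm_const_Kit[of _ y, OF th y \<nu>, of "t - int n" "n + 1"] norm_const_Kit[of _ y, OF th y \<nu>, of "t - int n" n] unfolding t by auto
    then show ?thesis unfolding log_incr_def
      using log_bounds_of_ratio[OF ab(1) integral_ratio_bounds[of _ y, OF th y \<nu> bb bb c0 ab(6)[OF n] ab(7)[OF n]]] by simp
  qed
  have 2: "ln a \<le> ln (pred_density lam m g \<theta> \<nu> n y) \<and> ln (pred_density lam m g \<theta> \<nu> n y) \<le> ln b"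
    if \<nu>: "is_prob_on lam \<nu>" and n: "k \<le> n" and t: "t = 0" for \<nu> n
  proof -
    let ?w = "\<lambda>x. g \<theta> x (y (- int n))"
    obtain c0 where c0: "0 < c0" "\<And>x. c0 \<le> Kit (ker \<theta> y) n (- int n) (\<lambda>x. 1) x" using back_pos[of _ y, OF th y] by blast
    define c1 where "c1 = exp (\<phi> \<theta> - M (y (- int n)) * norm (\<psi> \<theta>)) / s2"
    have c1: "0 < c1" "c1 \<le> ?w x" for x
    proof -
      show "0 < c1" using s1_le by (simp add: c1_def)
      have "exp (\<phi> \<theta> - M (y (- int n)) * norm (\<psi> \<theta>)) \<le> m \<theta> x x * ?w x" by (rule weight_bounds[OF th y])
      also have "\<dots> \<le> s2 * ?w x" using m_bounds(2)[OF th] g_pos[OF th] by (intro mult_right_mono) (auto intro: less_imp_le)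
      finally show "c1 \<le> ?w x" using s1_le by (simp add: c1_def field_simps)
    qed
    have bw: "bfun (\<lambda>x. ?w x * Kit (ker \<theta> y) k (- int n) (\<lambda>x. 1) x)" for k using ker_g_bounds(1) bb by (rule bfun_arith(4))
    have c: "0 < c1 * c0" "c1 * c0 \<le> ?w x * Kit (ker \<theta> y) n (- int n) (\<lambda>x. 1) x" for x
      using c0 c1 order_trans[OF less_imp_le[OF c1(1)] c1(2)] by (auto intro!: mult_mono)
    have w: "a * (?w x * Kit (ker \<theta> y) n (- int n) (\<lambda>x. 1) x) \<le> ?w x * Kit (ker \<theta> y) (n + 1) (- int n) (\<lambda>x. 1) x"
      "?w x * Kit (ker \<theta> y) (n + 1) (- int n) (\<lambda>x. 1) x \<le> b * (?w x * Kit (ker \<theta> y) n (- int n) (\<lambda>x. 1) x)" for x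
      using mult_left_mono[OF ab(6)[OF n, of x] ker_g_bounds(2)[of x "- int n"]] mult_left_mono[OF ab(7)[OF n, of x] ker_g_bounds(2)[of x "- int n"]] t by (simp_all add: mult_ac)
    have "pred_density lam m g \<theta> \<nu> n y = (\<integral>x. ?w x * Kit (ker \<theta> y) (n + 1) (- int n) (\<lambda>x. 1) x \<partial>\<nu>) / (\<integral>x. ?w x * Kit (ker \<theta> y) n (- int n) (\<lambda>x. 1) x \<partial>\<nu>)"
      unfolding pred_density_def using likelihood_Kit[OF th y \<nu>, of n 1] likelihood_Kit[OF th y \<nu>, of n 0] by simp
    then show ?thesis
      using log_bounds_of_ratio[OF ab(1) integral_ratio_bounds[of _ y, OF th y \<nu> bw bw c w]] by simp
  qed
  show ?thesis using ab(3,4,5) 1 2 by - (rule exI[of _ "ln a"], rule exI[of _ "ln b"], blast)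
qed

end

section \<open>Stationary observations\<close>

locale boem_model = expfam_hmm lam mu \<Theta> m g \<phi> \<psi> S s1 s2 M + mixing_process P mu Y \<beta> p
  for P :: "'w measure" and lam :: "'x measure" and mu :: "'y measure" and Y
    and \<Theta> :: "'t::euclidean_space set" and m g \<phi> and \<psi> :: "'t \<Rightarrow> 'd::euclidean_space" and S s1 s2 M \<beta> p +
  assumes stationary: "stationary_process P mu Y"
    and M_meas [measurable]: "M \<in> borel_measurable mu" and M_nonneg: "\<And>y. 0 \<le> M y"
    and M_moment: "integrable P (\<lambda>\<omega>. M (Y 0 \<omega>) powr p)"
    and good_sets: "{y. good y} \<in> sets mu" and good_AE: "AE \<omega> in P. good (Y 0 \<omega>)"
    and compact_Theta: "compact \<Theta>" and cont_phi: "continuous_on \<Theta> \<phi>" and cont_psi: "continuous_on \<Theta> \<psi>"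
begin

abbreviation "traj \<omega> \<equiv> \<lambda>k. Y k \<omega>"
abbreviation "seqs \<equiv> \<Pi>\<^sub>M k\<in>(UNIV::int set). mu"

lemma path_measurable: "(\<lambda>\<omega> k. Y (k + j) \<omega>) \<in> measurable P seqs"
  using measurable_space[OF Y] by (intro measurable_PiM_single') (auto intro: Y simp: space_mu)

lemma path_distr: "distr P seqs (\<lambda>\<omega> k. Y (k + j) \<omega>) = distr P seqs traj"
  using stationary by (simp add: stationary_process_def)

lemma stationary_integral:
  fixes F :: "(int \<Rightarrow> 'y) \<Rightarrow> 'e::euclidean_space"
  assumes "F \<in> borel_measurable seqs"
  shows "(\<integral>\<omega>. F (\<lambda>k. Y (k + j) \<omega>) \<partial>P) = (\<integral>\<omega>. F (traj \<omega>) \<partial>P)"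
    "integrable P (\<lambda>\<omega>. F (\<lambda>k. Y (k + j) \<omega>)) \<longleftrightarrow> integrable P (\<lambda>\<omega>. F (traj \<omega>))"
  using integral_distr[OF path_measurable[of j] assms] integral_distr[OF path_measurable[of 0] assms]
    integrable_distr_eq[OF path_measurable[of j] assms] integrable_distr_eq[OF path_measurable[of 0] assms]
  unfolding path_distr by simp_all

lemma stationary_AE:
  assumes "{y. Q y} \<in> sets mu" "AE \<omega> in P. Q (Y 0 \<omega>)" shows "AE \<omega> in P. Q (Y k \<omega>)"
proof -
  have m: "{x \<in> space seqs. Q (x 0)} \<in> sets seqs"
  proof -
    have "(\<lambda>x. x 0) -` {y. Q y} \<inter> space seqs \<in> sets seqs"
      using measurable_component_singleton[of 0 UNIV "\<lambda>_. mu"] assms(1) by (rule measurable_sets) simp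
    then show ?thesis by (simp add: vimage_def Int_def conj_commute)
  qed
  have "(AE x in distr P seqs (\<lambda>\<omega> i. Y (i + j) \<omega>). Q (x 0)) \<longleftrightarrow> (AE \<omega> in P. Q (Y j \<omega>))" for j
    using AE_distr_iff[OF path_measurable[of j] m] by simp
  from this[of k] this[of 0] show ?thesis using assms(2) unfolding path_distr by simp
qed

lemma all_good_AE: "AE \<omega> in P. \<forall>k. good (Y k \<omega>)"
  unfolding AE_all_countable using stationary_AE[OF good_sets good_AE] by blast

lemma component_measurable [measurable]: "(\<lambda>x. x k) \<in> measurable seqs mu"
  by (rule measurable_component_singleton) simp

lemma M_Y:
  "integrable P (\<lambda>\<omega>. M (Y k \<omega>))" "(\<integral>\<omega>. M (Y k \<omega>) \<partial>P) = (\<integral>\<omega>. M (Y 0 \<omega>) \<partial>P)"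
  "integrable P (\<lambda>\<omega>. \<bar>M (Y k \<omega>)\<bar> powr p)" "(\<integral>\<omega>. \<bar>M (Y k \<omega>)\<bar> powr p \<partial>P) = (\<integral>\<omega>. \<bar>M (Y 0 \<omega>)\<bar> powr p \<partial>P)"
proof -
  have mY: "(\<lambda>\<omega>. M (Y 0 \<omega>)) \<in> borel_measurable P" by (rule measurable_compose[OF Y M_meas])
  have i: "integrable P (\<lambda>\<omega>. \<bar>M (Y 0 \<omega>)\<bar> powr p)" using M_moment M_nonneg by simp
  have i1: "integrable P (\<lambda>\<omega>. M (Y 0 \<omega>))" using moment_integrable(1)[OF p mY i] .
  have b1: "(\<lambda>x. M (x (0::int))) \<in> borel_measurable seqs" by measurable
  have b2: "(\<lambda>x. \<bar>M (x (0::int))\<bar> powr p) \<in> borel_measurable seqs" by measurable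
  show "integrable P (\<lambda>\<omega>. M (Y k \<omega>))" "(\<integral>\<omega>. M (Y k \<omega>) \<partial>P) = (\<integral>\<omega>. M (Y 0 \<omega>) \<partial>P)"
    "integrable P (\<lambda>\<omega>. \<bar>M (Y k \<omega>)\<bar> powr p)" "(\<integral>\<omega>. \<bar>M (Y k \<omega>)\<bar> powr p \<partial>P) = (\<integral>\<omega>. \<bar>M (Y 0 \<omega>)\<bar> powr p \<partial>P)"
    using stationary_integral[OF b1, of k] stationary_integral[OF b2, of k] i i1 by simp_all
qed

definition "mean_M = (\<integral>\<omega>. M (Y 0 \<omega>) \<partial>P)"

lemma mean_M_nonneg: "0 \<le> mean_M"
  unfolding mean_M_def using M_nonneg by simp

text \<open>A reference initial law for windows. Any other law would serve as well, because of
  forgetting; a Dirac mass exists without further structure on the state space.\<close>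

definition \<nu>0 :: "'x measure" where "\<nu>0 = return lam undefined"

lemma nu0: "is_prob_on lam \<nu>0"
  by (auto simp: is_prob_on_def \<nu>0_def space_lam intro!: prob_space_return)

text \<open>The observations are an arbitrary family \<open>Z\<close> of measurable maps, required
  only at the times that occur. The instances are the coordinates of sequence space, the process
  itself, and the process on the \<sigma>-field generated by a finite window; the last one is what
  mixing needs.\<close>

lemma path_weight_measurable:
  assumes Z: "\<And>i. i \<in> {r + 1..t} \<Longrightarrow> Z i \<in> measurable N mu" and th: "\<theta> \<in> \<Theta>" and \<nu>: "is_prob_on lam \<nu>"
  shows "(\<lambda>(\<omega>, x). path_weight m g \<theta> r t (\<lambda>k. Z k \<omega>) x) \<in> borel_measurable (N \<Otimes>\<^sub>M path_measure lam \<nu> r t)"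
proof -
  have x: "(\<lambda>z. snd z i) \<in> measurable (N \<Otimes>\<^sub>M path_measure lam \<nu> r t) lam" if "i \<in> {r..t}" for i
    by (rule measurable_compose[OF measurable_snd path_component_measurable[OF \<nu> that]])
  have z: "(\<lambda>z. Z i (fst z)) \<in> measurable (N \<Otimes>\<^sub>M path_measure lam \<nu> r t) mu" if "i \<in> {r + 1..t}" for i
    by (rule measurable_compose[OF measurable_fst Z[OF that]])
  have "(\<lambda>z. (case (snd z i, snd z (i + 1)) of (a, b) \<Rightarrow> m \<theta> a b) * (case (snd z (i + 1), Z (i + 1) (fst z)) of (a, b) \<Rightarrow> g \<theta> a b))
      \<in> borel_measurable (N \<Otimes>\<^sub>M path_measure lam \<nu> r t)" if "i \<in> {r..<t}" for i
    using that by (intro borel_measurable_times measurable_compose[OF measurable_Pair m_meas[OF th]]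
        measurable_compose[OF measurable_Pair g_meas[OF th]] x z) auto
  then have "(\<lambda>z. \<Prod>i\<in>{r..<t}. m \<theta> (snd z i) (snd z (i + 1)) * g \<theta> (snd z (i + 1)) (Z (i + 1) (fst z)))
      \<in> borel_measurable (N \<Otimes>\<^sub>M path_measure lam \<nu> r t)" by (intro borel_measurable_prod) simp
  then show ?thesis by (simp add: path_weight_def case_prod_beta)
qed

lemma norm_const_measurable:
  assumes "\<And>i. i \<in> {r + 1..t} \<Longrightarrow> Z i \<in> measurable N mu" "\<theta> \<in> \<Theta>" and \<nu>: "is_prob_on lam \<nu>"
  shows "(\<lambda>\<omega>. norm_const \<theta> \<nu> r t (\<lambda>k. Z k \<omega>)) \<in> borel_measurable N"
proof -
  interpret path_fin: finite_measure "path_measure lam \<nu> r t" by (rule finite_path_measure[OF \<nu>])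
  show ?thesis unfolding norm_const_def
    by (intro path_fin.borel_measurable_lebesgue_integral path_weight_measurable assms) auto
qed

lemma smooth_measurable:
  fixes h :: "'x \<Rightarrow> 'x \<Rightarrow> 'y \<Rightarrow> 'e::euclidean_space"
  assumes Z: "\<And>i. i \<in> {r + 1..t} \<Longrightarrow> Z i \<in> measurable N mu" and th: "\<theta> \<in> \<Theta>" and \<nu>: "is_prob_on lam \<nu>"
    and h: "(\<lambda>(x, x', y). h x x' y) \<in> borel_measurable (lam \<Otimes>\<^sub>M lam \<Otimes>\<^sub>M mu)" and s: "r < s" "s \<le> t"
  shows "(\<lambda>\<omega>. smooth lam m g h \<theta> \<nu> r s t (\<lambda>k. Z k \<omega>)) \<in> borel_measurable N"
proof -
  interpret path_fin: finite_measure "path_measure lam \<nu> r t" by (rule finite_path_measure[OF \<nu>])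
  have x: "(\<lambda>z. snd z i) \<in> measurable (N \<Otimes>\<^sub>M path_measure lam \<nu> r t) lam" if "i \<in> {r..t}" for i
    by (rule measurable_compose[OF measurable_snd path_component_measurable[OF \<nu> that]])
  have z: "(\<lambda>z. Z s (fst z)) \<in> measurable (N \<Otimes>\<^sub>M path_measure lam \<nu> r t) mu"
    using s by (intro measurable_compose[OF measurable_fst Z]) auto
  have "(\<lambda>z. (snd z (s - 1), snd z s, Z s (fst z))) \<in> measurable (N \<Otimes>\<^sub>M path_measure lam \<nu> r t) (lam \<Otimes>\<^sub>M lam \<Otimes>\<^sub>M mu)"
    using s by (intro measurable_Pair x z) auto
  from measurable_compose[OF this h]
  have "(\<lambda>z. h (snd z (s - 1)) (snd z s) (Z s (fst z))) \<in> borel_measurable (N \<Otimes>\<^sub>M path_measure lam \<nu> r t)"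
    by simp
  from borel_measurable_scaleR[OF path_weight_measurable[OF Z th \<nu>] this]
  have "(\<lambda>(\<omega>, x). path_weight m g \<theta> r t (\<lambda>k. Z k \<omega>) x *\<^sub>R h (x (s - 1)) (x s) (Z s \<omega>)) \<in> borel_measurable (N \<Otimes>\<^sub>M path_measure lam \<nu> r t)"
    by (simp add: case_prod_beta)
  then have 1: "(\<lambda>\<omega>. \<integral>x. path_weight m g \<theta> r t (\<lambda>k. Z k \<omega>) x *\<^sub>R h (x (s - 1)) (x s) (Z s \<omega>) \<partial>path_measure lam \<nu> r t) \<in> borel_measurable N"
    by (intro path_fin.borel_measurable_lebesgue_integral)
  have 2: "(\<lambda>\<omega>. \<integral>x. path_weight m g \<theta> r t (\<lambda>k. Z k \<omega>) x \<partial>path_measure lam \<nu> r t) \<in> borel_measurable N"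
    using norm_const_measurable[OF Z th \<nu>] by (simp add: norm_const_def)
  show ?thesis unfolding smooth_def using 1 2 by (intro borel_measurable_scaleR borel_measurable_inverse)
qed

text \<open>Contraction brackets real ratios, so the vector statistic is tested against directions
  \<open>e\<close>. Taking the supremum over the unit ball recovers its norm without a factor for
  the dimension.\<close>

definition hS :: "'d \<Rightarrow> 'x \<Rightarrow> 'x \<Rightarrow> 'y \<Rightarrow> real" where "hS e x x' y = inner (S x x' y) e"

lemma hS_obs: "obs (hS e)"
  unfolding obs_def
proof
  fix y
  have "(\<lambda>z. inner (case z of (x, x') \<Rightarrow> S x x' y) e) \<in> borel_measurable (lam \<Otimes>\<^sub>M lam)"
    by (intro borel_measurable_inner S_sec borel_measurable_const)
  then show "(\<lambda>(x, x'). hS e x x' y) \<in> borel_measurable (lam \<Otimes>\<^sub>M lam)" by (simp add: hS_def case_prod_beta)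
qed

lemma hS_meas: "(\<lambda>(x, x', y). hS e x x' y) \<in> borel_measurable (lam \<Otimes>\<^sub>M lam \<Otimes>\<^sub>M mu)"
proof -
  have "(\<lambda>z. inner (case z of (x, x', y) \<Rightarrow> S x x' y) e) \<in> borel_measurable (lam \<Otimes>\<^sub>M lam \<Otimes>\<^sub>M mu)"
    by (intro borel_measurable_inner S_meas borel_measurable_const)
  then show ?thesis by (simp add: hS_def case_prod_beta)
qed

lemma hS_bound: "good y \<Longrightarrow> \<bar>hS e x x' y\<bar> \<le> M y * norm e"
  unfolding hS_def using Cauchy_Schwarz_ineq2[of "S x x' y" e] goodD[of y x x'] by (meson mult_right_mono norm_ge_zero order_trans)

lemma smooth_inner:
  assumes th: "\<theta> \<in> \<Theta>" and y: "\<And>i. good (y i)" and \<nu>: "is_prob_on lam \<nu>" and s: "r < s" "s \<le> t"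
  shows "inner (smooth lam m g S \<theta> \<nu> r s t y) e = smooth lam m g (hS e) \<theta> \<nu> r s t y"
proof -
  let ?P = "path_measure lam \<nu> r t" and ?w = "path_weight m g \<theta> r t y"
  have "(\<lambda>x. (x (s - 1), x s)) \<in> measurable ?P (lam \<Otimes>\<^sub>M lam)"
    using s by (intro measurable_Pair path_component_measurable \<nu>) auto
  from measurable_compose[OF this S_sec[of "y s"]]
  have Sm: "(\<lambda>x. S (x (s - 1)) (x s) (y s)) \<in> borel_measurable ?P" by simp
  have iw: "integrable ?P ?w" using path_integrable[of _ y, OF th y \<nu>] s by simp
  have nb: "norm (?w x *\<^sub>R S (x (s - 1)) (x s) (y s)) \<le> norm (M (y s) * ?w x)" for x
  proof -
    have "norm (?w x *\<^sub>R S (x (s - 1)) (x s) (y s)) = ?w x * norm (S (x (s - 1)) (x s) (y s))"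
      using path_weight_nonneg[OF th] by simp
    also have "\<dots> \<le> ?w x * M (y s)" by (intro mult_left_mono goodD y path_weight_nonneg th)
    also have "\<dots> \<le> norm (M (y s) * ?w x)" using abs_ge_self[of "M (y s) * ?w x"] by (simp add: mult.commute)
    finally show ?thesis .
  qed
  have "integrable ?P (\<lambda>x. ?w x *\<^sub>R S (x (s - 1)) (x s) (y s))"
    by (rule Bochner_Integration.integrable_bound[OF integrable_mult_right[OF iw, of "M (y s)"]
        borel_measurable_scaleR[OF borel_measurable_integrable[OF iw] Sm] AE_I2[OF nb]])
  from integral_inner_left[OF this, of e] show ?thesis
    by (simp add: smooth_def hS_def)
qed

lemma Kit_path_shift:
  "Kit (ker \<theta> (\<lambda>k. y (k + j))) n r f = Kit (ker \<theta> y) n (r + j) f"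
  using Kit_shift[of "ker \<theta> y" j n r f] by (simp add: ker_def[abs_def])

text \<open>Proved through iterated kernels, where a time shift merely moves the starting index; the
  product measures of the two sides live on different index sets.\<close>

lemma norm_const_shift:
  assumes th: "\<theta> \<in> \<Theta>" and y: "\<And>i. good (y i)" and \<nu>: "is_prob_on lam \<nu>" and "r \<le> t"
  shows "norm_const \<theta> \<nu> r t (\<lambda>k. y (k + j)) = norm_const \<theta> \<nu> (r + j) (t + j) y"
proof -
  define n where "n = nat (t - r)"
  have t: "t = r + int n" "t + j = (r + j) + int n" using assms(4) by (auto simp: n_def)
  show ?thesis unfolding t(2) unfolding t(1)
    using norm_const_Kit[of \<theta> "\<lambda>k. y (k + j)", OF th y \<nu>] norm_const_Kit[of \<theta> y, OF th y \<nu>]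
    by (simp add: Kit_path_shift)
qed

lemma smooth_shift:
  assumes th: "\<theta> \<in> \<Theta>" and y: "\<And>i. good (y i)" and \<nu>: "is_prob_on lam \<nu>" and h: "obs h" "\<And>x x'. \<bar>h x x' (y (s + j))\<bar> \<le> c"
  shows "smooth lam m g h \<theta> \<nu> (s - 1 - int k) s (s + int n) (\<lambda>k. y (k + j))
    = smooth lam m g h \<theta> \<nu> (s + j - 1 - int k) (s + j) (s + j + int n) y"
proof -
  have hk: "hker h \<theta> (\<lambda>k. y (k + j)) s s = hker h \<theta> y (s + j) (s + j)"
    "ker \<theta> (\<lambda>k. y (k + j)) s = ker \<theta> y (s + j)" by (auto simp: hker_def ker_def fun_eq_iff)
  have r: "s - 1 - int k + j = s + j - 1 - int k" by simp
  show ?thesis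
    using smooth_ratio[of \<theta> "\<lambda>k. y (k + j)" \<nu> h s c k n, OF th y \<nu> h] smooth_ratio[of \<theta> y \<nu> h "s + j" c k n, OF th y \<nu> h]
    by (simp add: num_fun_def[OF th y] den_fun_def[OF th y] Kit_path_shift hk r)
qed

section \<open>The limiting statistic\<close>

definition all_good :: "(int \<Rightarrow> 'y) \<Rightarrow> bool" where "all_good y \<longleftrightarrow> (\<forall>i. good (y i))"

lemma all_goodD: "all_good y \<Longrightarrow> good (y i)"
  by (simp add: all_good_def)

lemma traj_good: "AE \<omega> in P. all_good (traj \<omega>)"
  using all_good_AE by (simp add: all_good_def)

definition "c_forget = 2 + 4 * (s2 / s1)"

lemma c_forget_nonneg: "0 \<le> c_forget"
  using s1 s1_le by (simp add: c_forget_def)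

lemma smooth_hS_forgetting:
  assumes th: "\<theta> \<in> \<Theta>" and y: "all_good y" and \<nu>: "is_prob_on lam \<nu>1" "is_prob_on lam \<nu>2"
    and k: "k \<le> k1" "k \<le> k2" and n: "n \<le> n1" "n \<le> n2"
  shows "\<bar>smooth lam m g (hS e) \<theta> \<nu>1 (s - 1 - int k1) s (s + int n1) y - smooth lam m g (hS e) \<theta> \<nu>2 (s - 1 - int k2) s (s + int n2) y\<bar>
    \<le> c_forget * M (y s) * norm e * (\<rho> ^ k + \<rho> ^ n)"
proof -
  have b: "\<bar>hS e x x' (y s)\<bar> \<le> M (y s) * norm e" for x x' by (rule hS_bound[OF all_goodD[OF y]])
  have "2 * \<rho> ^ k + 4 * (s2 / s1) * \<rho> ^ n \<le> c_forget * (\<rho> ^ k + \<rho> ^ n)"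
  proof -
    have "0 \<le> 4 * (s2 / s1) * \<rho> ^ k" "0 \<le> 2 * \<rho> ^ n" using s1 s1_le rho by auto
    then show ?thesis by (simp add: c_forget_def algebra_simps)
  qed
  then have "M (y s) * norm e * (2 * \<rho> ^ k + 4 * (s2 / s1) * \<rho> ^ n) \<le> M (y s) * norm e * (c_forget * (\<rho> ^ k + \<rho> ^ n))"
    using M_nonneg by (intro mult_left_mono) auto
  then show ?thesis
    using smooth_forgetting[of \<theta> y "hS e" s "M (y s) * norm e" \<nu>1 \<nu>2 k k1 k2 n n1 n2, OF th all_goodD[OF y] hS_obs b \<nu> k n]
    by (simp add: mult_ac)
qed

lemma inner_sgn: "inner v (sgn v) = norm (v :: 'e::euclidean_space)"
  by (cases "v = 0") (simp_all add: sgn_div_norm power2_norm_eq_inner[symmetric] power2_eq_square)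

lemma norm_leI:
  assumes "\<And>e :: 'e::euclidean_space. norm e \<le> 1 \<Longrightarrow> \<bar>inner v e\<bar> \<le> c" shows "norm v \<le> c"
  using assms[of "sgn v"] inner_sgn[of v] by (simp add: norm_sgn split: if_splits)

lemma smooth_S_forgetting:
  assumes th: "\<theta> \<in> \<Theta>" and y: "all_good y" and \<nu>: "is_prob_on lam \<nu>1" "is_prob_on lam \<nu>2"
    and k: "k \<le> k1" "k \<le> k2" and n: "n \<le> n1" "n \<le> n2"
  shows "norm (smooth lam m g S \<theta> \<nu>1 (s - 1 - int k1) s (s + int n1) y - smooth lam m g S \<theta> \<nu>2 (s - 1 - int k2) s (s + int n2) y)
    \<le> c_forget * M (y s) * (\<rho> ^ k + \<rho> ^ n)"
proof (rule norm_leI)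
  fix e :: 'd assume e: "norm e \<le> 1"
  have "\<bar>inner (smooth lam m g S \<theta> \<nu>1 (s - 1 - int k1) s (s + int n1) y - smooth lam m g S \<theta> \<nu>2 (s - 1 - int k2) s (s + int n2) y) e\<bar>
    \<le> c_forget * M (y s) * norm e * (\<rho> ^ k + \<rho> ^ n)"
    using smooth_hS_forgetting[OF assms] smooth_inner[where y = y, OF th all_goodD[OF y]] \<nu> by (simp add: inner_diff_left)
  also have "\<dots> \<le> c_forget * M (y s) * 1 * (\<rho> ^ k + \<rho> ^ n)"
    using e c_forget_nonneg M_nonneg rho by (intro mult_right_mono mult_left_mono) auto
  finally show "\<bar>inner (smooth lam m g S \<theta> \<nu>1 (s - 1 - int k1) s (s + int n1) y - smooth lam m g S \<theta> \<nu>2 (s - 1 - int k2) s (s + int n2) y) e\<bar>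
    \<le> c_forget * M (y s) * (\<rho> ^ k + \<rho> ^ n)" by simp
qed

lemma smooth_hS_bound:
  assumes "\<theta> \<in> \<Theta>" "all_good y" "is_prob_on lam \<nu>"
  shows "\<bar>smooth lam m g (hS e) \<theta> \<nu> (s - 1 - int k) s (s + int n) y\<bar> \<le> M (y s) * norm e"
  by (rule smooth_bound[of \<theta> y, OF assms(1) all_goodD[OF assms(2)] hS_obs hS_bound[OF all_goodD[OF assms(2)]] assms(3)])

lemma smooth_S_bound:
  assumes th: "\<theta> \<in> \<Theta>" and y: "all_good y" and \<nu>: "is_prob_on lam \<nu>"
  shows "norm (smooth lam m g S \<theta> \<nu> (s - 1 - int k) s (s + int n) y) \<le> M (y s)"
proof (rule norm_leI)
  fix e :: 'd assume e: "norm e \<le> 1"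
  have "\<bar>inner (smooth lam m g S \<theta> \<nu> (s - 1 - int k) s (s + int n) y) e\<bar> \<le> M (y s) * norm e"
    using smooth_hS_bound[OF assms] smooth_inner[where y = y, OF th all_goodD[OF y] \<nu>] by simp
  also have "\<dots> \<le> M (y s) * 1" using e M_nonneg by (intro mult_left_mono) auto
  finally show "\<bar>inner (smooth lam m g S \<theta> \<nu> (s - 1 - int k) s (s + int n) y) e\<bar> \<le> M (y s)" by simp
qed

text \<open>Approximation of the limiting statistic by the observations at times \<open>- q\<close>
  to \<open>q\<close>. The end points are spelled out so as to match the pattern
  \<open>s - 1 - int k\<close>, \<open>s + int n\<close> of the forgetting lemmas at
  \<open>s = 0\<close>.\<close>

definition win :: "nat \<Rightarrow> 't \<Rightarrow> (int \<Rightarrow> 'y) \<Rightarrow> 'd" where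
  "win q \<theta> y = smooth lam m g S \<theta> \<nu>0 (0 - 1 - int q) 0 (0 + int q) y"

lemma win_measurable: "\<theta> \<in> \<Theta> \<Longrightarrow> win q \<theta> \<in> borel_measurable seqs"
  unfolding win_def[abs_def]
  by (rule smooth_measurable[where Z = "\<lambda>i x. x i", OF _ _ nu0 S_meas]) auto

lemma traj_measurable: "traj \<in> measurable P seqs"
  using path_measurable[of 0] by simp

lemma win_bound: "\<theta> \<in> \<Theta> \<Longrightarrow> all_good y \<Longrightarrow> norm (win q \<theta> y) \<le> M (y 0)"
  unfolding win_def by (rule smooth_S_bound[OF _ _ nu0])

lemma win_integrable: assumes "\<theta> \<in> \<Theta>" shows "integrable P (\<lambda>\<omega>. win q \<theta> (traj \<omega>))"
proof (rule Bochner_Integration.integrable_bound[OF M_Y(1)[of 0]])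
  show "(\<lambda>\<omega>. win q \<theta> (traj \<omega>)) \<in> borel_measurable P"
    by (rule measurable_compose[OF traj_measurable win_measurable[OF assms]])
  show "AE \<omega> in P. norm (win q \<theta> (traj \<omega>)) \<le> norm (M (Y 0 \<omega>))"
    using traj_good
  proof eventually_elim
    case (elim \<omega>)
    then show ?case using win_bound[OF assms elim, of q] M_nonneg by simp
  qed
qed

lemma win_alt: "win n \<theta> y = smooth lam m g S \<theta> \<nu>0 (- int n - 1) 0 (int n) y"
proof -
  have "0 - 1 - int n = - int n - 1" by simp
  then show ?thesis unfolding win_def by (simp only: add_0)
qed

lemma win_cauchy:
  assumes "\<theta> \<in> \<Theta>" "all_good y" "q \<le> n" "is_prob_on lam \<nu>"
  shows "norm (smooth lam m g S \<theta> \<nu> (- int n - 1) 0 (int n) y - win q \<theta> y) \<le> 2 * c_forget * M (y 0) * \<rho> ^ q"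
proof -
  have "0 - 1 - int n = - int n - 1" "0 - 1 - int q = - int q - 1" by simp_all
  moreover have "c_forget * M (y 0) * (\<rho> ^ q + \<rho> ^ q) = 2 * c_forget * M (y 0) * \<rho> ^ q" by simp
  ultimately show ?thesis
    using smooth_S_forgetting[OF assms(1,2,4) nu0 assms(3) order_refl assms(3) order_refl, where s = 0]
    unfolding win_alt by (simp only: add_0)
qed

lemma rho_power_tendsto: "(\<lambda>q. c * \<rho> ^ q) \<longlonglongrightarrow> 0"
  using tendsto_mult_right_zero[OF LIMSEQ_power_zero[of \<rho>]] rho by simp

lemma win_limit:
  assumes th: "\<theta> \<in> \<Theta>" and y: "all_good y" and \<nu>: "is_prob_on lam \<nu>"
  shows "(\<lambda>n. smooth lam m g S \<theta> \<nu> (- int n - 1) 0 (int n) y) \<longlonglongrightarrow> lim (\<lambda>n. win n \<theta> y)"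
proof -
  have "Cauchy (\<lambda>n. win n \<theta> y)"
  proof (rule metric_CauchyI)
    fix \<epsilon> :: real assume "0 < \<epsilon>"
    then have "\<forall>\<^sub>F N in sequentially. 2 * c_forget * M (y 0) * \<rho> ^ N < \<epsilon> / 2"
      by (intro order_tendstoD(2)[OF rho_power_tendsto]) simp
    then obtain N where N: "2 * c_forget * M (y 0) * \<rho> ^ N < \<epsilon> / 2"
      using eventually_happens' sequentially_bot by blast
    show "\<exists>N. \<forall>a\<ge>N. \<forall>b\<ge>N. dist (win a \<theta> y) (win b \<theta> y) < \<epsilon>"
    proof (intro exI allI impI)
      fix a b assume ab: "N \<le> a" "N \<le> b"
      have "norm (win a \<theta> y - win N \<theta> y) < \<epsilon> / 2" "norm (win b \<theta> y - win N \<theta> y) < \<epsilon> / 2"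
        using win_cauchy[OF th y ab(1) nu0] win_cauchy[OF th y ab(2) nu0] N unfolding win_alt[symmetric] by linarith+
      then show "dist (win a \<theta> y) (win b \<theta> y) < \<epsilon>"
        unfolding dist_norm[symmetric] by (rule dist_triangle_half_l)
    qed
  qed
  then have l: "(\<lambda>n. win n \<theta> y) \<longlonglongrightarrow> lim (\<lambda>n. win n \<theta> y)" by (simp add: Cauchy_convergent_iff convergent_LIMSEQ_iff)
  have "(\<lambda>n. smooth lam m g S \<theta> \<nu> (- int n - 1) 0 (int n) y - win n \<theta> y) \<longlonglongrightarrow> 0"
    by (rule Lim_null_comparison[OF always_eventually rho_power_tendsto[of "2 * c_forget * M (y 0)"]])
       (intro allI win_cauchy[OF th y order_refl \<nu>])
  from tendsto_add[OF this l] show ?thesis unfolding diff_add_cancel add_0 .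
qed

text \<open>The choice in the definition has a witness: on every good trajectory the windows form a
  Cauchy sequence whose limit is shared by all initial laws. The exceptional set, the trajectories
  that are not good, is the same for all laws.\<close>

lemma limit_stat:
  assumes th: "\<theta> \<in> \<Theta>"
  shows "limit_stat P Y lam m g S \<theta> \<in> borel_measurable P"
    "is_prob_on lam \<nu> \<Longrightarrow> AE \<omega> in P. (\<lambda>n. smooth lam m g S \<theta> \<nu> (- int n - 1) 0 (int n) (traj \<omega>)) \<longlonglongrightarrow> limit_stat P Y lam m g S \<theta> \<omega>"
proof -
  let ?Z = "\<lambda>\<omega>. lim (\<lambda>n. win n \<theta> (traj \<omega>))"
  have "\<exists>Z. Z \<in> borel_measurable P \<and> (\<forall>\<nu>. is_prob_on lam \<nu> \<longrightarrow>
          (AE \<omega> in P. (\<lambda>n::nat. smooth lam m g S \<theta> \<nu> (- int n - 1) 0 (int n) (\<lambda>k. Y k \<omega>)) \<longlonglongrightarrow> Z \<omega>))"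
  proof (rule exI[of _ ?Z], intro conjI allI impI)
    show "?Z \<in> borel_measurable P"
      by (intro borel_measurable_lim_metric measurable_compose[OF traj_measurable win_measurable[OF th]])
    show "AE \<omega> in P. (\<lambda>n::nat. smooth lam m g S \<theta> \<nu> (- int n - 1) 0 (int n) (\<lambda>k. Y k \<omega>)) \<longlonglongrightarrow> ?Z \<omega>"
      if "is_prob_on lam \<nu>" for \<nu>
      using traj_good by eventually_elim (use win_limit[OF th _ that] in simp)
  qed
  from someI_ex[OF this] show "limit_stat P Y lam m g S \<theta> \<in> borel_measurable P"
    "is_prob_on lam \<nu> \<Longrightarrow> AE \<omega> in P. (\<lambda>n. smooth lam m g S \<theta> \<nu> (- int n - 1) 0 (int n) (traj \<omega>)) \<longlonglongrightarrow> limit_stat P Y lam m g S \<theta> \<omega>"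
    unfolding limit_stat_def[symmetric] by auto
qed

lemma limit_stat_close:
  assumes th: "\<theta> \<in> \<Theta>"
  shows "AE \<omega> in P. norm (limit_stat P Y lam m g S \<theta> \<omega> - win q \<theta> (traj \<omega>)) \<le> 2 * c_forget * M (Y 0 \<omega>) * \<rho> ^ q"
    "AE \<omega> in P. norm (limit_stat P Y lam m g S \<theta> \<omega>) \<le> M (Y 0 \<omega>)"
proof -
  have *: "AE \<omega> in P. all_good (traj \<omega>) \<and> (\<lambda>n. win n \<theta> (traj \<omega>)) \<longlonglongrightarrow> limit_stat P Y lam m g S \<theta> \<omega>"
    using traj_good limit_stat(2)[OF th nu0] by eventually_elim (simp add: win_alt)
  show "AE \<omega> in P. norm (limit_stat P Y lam m g S \<theta> \<omega> - win q \<theta> (traj \<omega>)) \<le> 2 * c_forget * M (Y 0 \<omega>) * \<rho> ^ q"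
    using *
  proof eventually_elim
    case (elim \<omega>)
    have "(\<lambda>n. norm (win n \<theta> (traj \<omega>) - win q \<theta> (traj \<omega>))) \<longlonglongrightarrow> norm (limit_stat P Y lam m g S \<theta> \<omega> - win q \<theta> (traj \<omega>))"
      using elim by (intro tendsto_intros) auto
    moreover have "\<forall>n\<ge>q. norm (win n \<theta> (traj \<omega>) - win q \<theta> (traj \<omega>)) \<le> 2 * c_forget * M (Y 0 \<omega>) * \<rho> ^ q"
      using win_cauchy[OF th _ _ nu0, of "traj \<omega>" q] elim by (auto simp: win_alt)
    ultimately show ?case by (blast intro: LIMSEQ_le_const2)
  qed
  show "AE \<omega> in P. norm (limit_stat P Y lam m g S \<theta> \<omega>) \<le> M (Y 0 \<omega>)"
    using *
  proof eventually_elim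
    case (elim \<omega>)
    have "(\<lambda>n. norm (win n \<theta> (traj \<omega>))) \<longlonglongrightarrow> norm (limit_stat P Y lam m g S \<theta> \<omega>)"
      using elim by (intro tendsto_intros) auto
    moreover have "\<forall>n\<ge>0. norm (win n \<theta> (traj \<omega>)) \<le> M (Y 0 \<omega>)" using win_bound[OF th] elim by blast
    ultimately show ?case by (blast intro: LIMSEQ_le_const2)
  qed
qed

abbreviation "ms \<equiv> mean_stat P Y lam m g S"
definition "mean_win q \<theta> = (\<integral>\<omega>. win q \<theta> (traj \<omega>) \<partial>P)"

lemma limit_stat_integrable: "\<theta> \<in> \<Theta> \<Longrightarrow> integrable P (limit_stat P Y lam m g S \<theta>)"
  using limit_stat_close(2)[of \<theta>] M_nonneg limit_stat(1)[of \<theta>]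
  by (intro Bochner_Integration.integrable_bound[OF M_Y(1)[of 0]]) auto

lemma mean_stat_close:
  assumes th: "\<theta> \<in> \<Theta>" shows "norm (ms \<theta> - mean_win q \<theta>) \<le> 2 * c_forget * mean_M * \<rho> ^ q"
proof -
  have i: "integrable P (\<lambda>\<omega>. limit_stat P Y lam m g S \<theta> \<omega> - win q \<theta> (traj \<omega>))"
    using limit_stat_integrable[OF th] win_integrable[OF th] by (rule Bochner_Integration.integrable_diff)
  have "ms \<theta> - mean_win q \<theta> = (\<integral>\<omega>. limit_stat P Y lam m g S \<theta> \<omega> - win q \<theta> (traj \<omega>) \<partial>P)"
    using limit_stat_integrable[OF th] win_integrable[OF th] by (simp add: mean_stat_def mean_win_def)
  also have "norm \<dots> \<le> (\<integral>\<omega>. norm (limit_stat P Y lam m g S \<theta> \<omega> - win q \<theta> (traj \<omega>)) \<partial>P)" by (rule integral_norm_bound)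
  also have "\<dots> \<le> (\<integral>\<omega>. 2 * c_forget * M (Y 0 \<omega>) * \<rho> ^ q \<partial>P)"
    using i M_Y(1) limit_stat_close(1)[OF th] by (intro integral_mono_AE) auto
  finally show ?thesis using M_Y(1)[of 0] by (simp add: mean_M_def)
qed

text \<open>Pseudodistance pulled back through \<open>(\<phi>, \<psi>)\<close>, since the weights
  depend on the parameter only through this pair.\<close>

definition par_dist :: "'t \<Rightarrow> 't \<Rightarrow> real" where "par_dist \<theta> \<theta>' = max \<bar>\<phi> \<theta>' - \<phi> \<theta>\<bar> (norm (\<psi> \<theta>' - \<psi> \<theta>))"

lemma par_dist: "0 \<le> par_dist \<theta> \<theta>'" "\<bar>\<phi> \<theta>' - \<phi> \<theta>\<bar> \<le> par_dist \<theta> \<theta>'" "norm (\<psi> \<theta>' - \<psi> \<theta>) \<le> par_dist \<theta> \<theta>'"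
  by (auto simp: par_dist_def)

lemma par_dist_tendsto:
  assumes "\<And>n. x n \<in> \<Theta>" "\<theta> \<in> \<Theta>" "x \<longlonglongrightarrow> \<theta>" shows "(\<lambda>n. par_dist \<theta> (x n)) \<longlonglongrightarrow> 0"
proof -
  have "(\<lambda>n. \<phi> (x n)) \<longlonglongrightarrow> \<phi> \<theta>" "(\<lambda>n. \<psi> (x n)) \<longlonglongrightarrow> \<psi> \<theta>"
    using continuous_on_tendsto_compose[OF cont_phi assms(3,2)] continuous_on_tendsto_compose[OF cont_psi assms(3,2)] assms(1) by auto
  then have "(\<lambda>n. par_dist \<theta> (x n)) \<longlonglongrightarrow> max \<bar>\<phi> \<theta> - \<phi> \<theta>\<bar> (norm (\<psi> \<theta> - \<psi> \<theta>))"
    unfolding par_dist_def by (intro tendsto_intros)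
  then show ?thesis by simp
qed

lemma weight_osc_tendsto:
  assumes "d \<longlonglongrightarrow> 0" shows "(\<lambda>n. weight_osc (d n) y r t) \<longlonglongrightarrow> 0"
proof -
  have "(\<lambda>n. \<Sum>i\<in>{r..<t}. d n * (1 + M (y (i + 1)))) \<longlonglongrightarrow> (\<Sum>i\<in>{r..<t}. 0 * (1 + M (y (i + 1))))"
    by (intro tendsto_sum tendsto_mult_right assms)
  then show ?thesis by (simp add: weight_osc_def)
qed

text \<open>A modulus of continuity for windows that depends on the observations but not on the pair
  of parameters. It is again a function of a finite window and at most \<open>2 * M (y 0)\<close>,
  so its block averages obey the same law of large numbers as the windows.\<close>

definition win_osc :: "nat \<Rightarrow> real \<Rightarrow> (int \<Rightarrow> 'y) \<Rightarrow> real" where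
  "win_osc q d y = 2 * M (y 0) * (1 - exp (- 2 * weight_osc d y (- 1 - int q) (int q)))"

lemma win_perturb:
  assumes th: "\<theta> \<in> \<Theta>" "\<theta>' \<in> \<Theta>" and y: "all_good y"
    and d: "0 \<le> d" "\<bar>\<phi> \<theta>' - \<phi> \<theta>\<bar> \<le> d" "norm (\<psi> \<theta>' - \<psi> \<theta>) \<le> d"
  shows "norm (win q \<theta>' y - win q \<theta> y) \<le> win_osc q d y"
proof (rule norm_leI)
  fix e :: 'd assume e: "norm e \<le> 1"
  have s: "0 - 1 - int q < 0" "(0::int) \<le> 0 + int q" by auto
  have b: "\<bar>hS e x x' (y 0)\<bar> \<le> M (y 0)" for x x'
    using hS_bound[OF all_goodD[OF y, of 0], where e = e and x = x and x' = x'] e M_nonneg[of "y 0"] by (meson mult_left_le order_trans)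
  have "\<bar>inner (win q \<theta>' y - win q \<theta> y) e\<bar> \<le> 2 * M (y 0) * (1 - exp (- 2 * weight_osc d y (0 - 1 - int q) (0 + int q)))"
    unfolding win_def inner_diff_left smooth_inner[where y = y, OF th(1) all_goodD[OF y] nu0 s] smooth_inner[where y = y, OF th(2) all_goodD[OF y] nu0 s]
    by (rule smooth_perturb[where y = y, OF th all_goodD[OF y] d nu0 hS_obs b s])
  then show "\<bar>inner (win q \<theta>' y - win q \<theta> y) e\<bar> \<le> win_osc q d y" by (simp add: win_osc_def)
qed

lemma win_osc_tendsto: assumes "d \<longlonglongrightarrow> 0" shows "(\<lambda>n. win_osc q (d n) y) \<longlonglongrightarrow> 0"
proof -
  have "(\<lambda>n. win_osc q (d n) y) \<longlonglongrightarrow> 2 * M (y 0) * (1 - exp (- 2 * 0))"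
    unfolding win_osc_def by (intro tendsto_intros weight_osc_tendsto assms)
  then show ?thesis by simp
qed

lemma mean_win_continuous: "continuous_on \<Theta> (mean_win q)"
  unfolding continuous_on_sequentially
proof (intro ballI allI impI, elim conjE)
  fix x \<theta> assume th: "\<theta> \<in> \<Theta>" and x: "\<forall>n. x n \<in> \<Theta>" "x \<longlonglongrightarrow> \<theta>"
  have "(\<lambda>n. mean_win q (x n)) \<longlonglongrightarrow> mean_win q \<theta>" unfolding mean_win_def
  proof (rule integral_dominated_convergence)
    show "(\<lambda>\<omega>. win q \<theta> (traj \<omega>)) \<in> borel_measurable P" "\<And>n. (\<lambda>\<omega>. win q (x n) (traj \<omega>)) \<in> borel_measurable P"
      using win_integrable th x(1) by auto
    show "integrable P (\<lambda>\<omega>. M (Y 0 \<omega>))" by (rule M_Y)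
    show "AE \<omega> in P. norm (win q (x n) (traj \<omega>)) \<le> M (Y 0 \<omega>)" for n
      using traj_good by eventually_elim (use win_bound x(1) in blast)
    show "AE \<omega> in P. (\<lambda>n. win q (x n) (traj \<omega>)) \<longlonglongrightarrow> win q \<theta> (traj \<omega>)"
      using traj_good
    proof eventually_elim
      case (elim \<omega>)
      have "(\<lambda>n. win q (x n) (traj \<omega>) - win q \<theta> (traj \<omega>)) \<longlonglongrightarrow> 0"
        by (rule Lim_null_comparison[OF always_eventually win_osc_tendsto[OF par_dist_tendsto[OF _ th x(2)], of q "traj \<omega>"]])
           (use x(1) win_perturb[OF th _ elim par_dist] in auto)
      then show ?case by (rule LIM_zero_cancel)
    qed
  qed
  then show "(mean_win q \<circ> x) \<longlonglongrightarrow> mean_win q \<theta>" by (simp add: o_def)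
qed

text \<open>The means of windows are continuous by dominated convergence, and they converge at a
  geometric rate that does not depend on \<theta>.\<close>

lemma mean_stat_continuous: "continuous_on \<Theta> ms"
proof (rule uniform_limit_theorem[where F = sequentially and f = mean_win])
  show "uniform_limit \<Theta> mean_win ms sequentially"
  proof (rule uniform_limitI)
    fix \<epsilon> :: real assume "0 < \<epsilon>"
    then have "\<forall>\<^sub>F q in sequentially. 2 * c_forget * mean_M * \<rho> ^ q < \<epsilon>"
      using rho_power_tendsto[of "2 * c_forget * mean_M"] by (simp add: order_tendsto_iff)
    then show "\<forall>\<^sub>F q in sequentially. \<forall>\<theta>\<in>\<Theta>. dist (mean_win q \<theta>) (ms \<theta>) < \<epsilon>"
    proof eventually_elim
      case (elim q)
      show ?case
      proof
        fix \<theta> assume "\<theta> \<in> \<Theta>"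
        from mean_stat_close[OF this, of q] elim show "dist (mean_win q \<theta>) (ms \<theta>) < \<epsilon>"
          unfolding dist_norm by (simp only: norm_minus_commute)
      qed
    qed
  qed
qed (use mean_win_continuous in auto)

section \<open>The limiting log-likelihood\<close>

lemma all_good_shift: "all_good y \<Longrightarrow> all_good (\<lambda>k. y (k + j))"
  by (simp add: all_good_def)

definition incr_bound :: "'t \<Rightarrow> 'y \<Rightarrow> real" where
  "incr_bound \<theta> z = \<bar>ln (measure lam UNIV)\<bar> + \<bar>\<phi> \<theta>\<bar> + M z * norm (\<psi> \<theta>)"

lemma log_incr_close:
  assumes th: "\<theta> \<in> \<Theta>" and y: "all_good y" and \<nu>: "is_prob_on lam \<nu>1" "is_prob_on lam \<nu>2" and q: "q \<le> n1" "q \<le> n2"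
  shows "\<bar>log_incr \<theta> \<nu>1 n1 t y - log_incr \<theta> \<nu>2 n2 t y\<bar> \<le> s2 / s1 * \<rho> ^ q"
    "\<bar>log_incr \<theta> \<nu>1 n1 t y\<bar> \<le> incr_bound \<theta> (y (t + 1))"
    "t = 0 \<Longrightarrow> \<bar>ln (pred_density lam m g \<theta> \<nu>1 n1 y) - log_incr \<theta> \<nu>2 n2 t y\<bar> \<le> s2 / s1 * \<rho> ^ q"
proof -
  obtain a b where 1: "b - a \<le> s2 / s1 * \<rho> ^ q" and 2: "- incr_bound \<theta> (y (t + 1)) \<le> a" "b \<le> incr_bound \<theta> (y (t + 1))"
    and 3: "\<forall>\<nu> n. is_prob_on lam \<nu> \<longrightarrow> q \<le> n \<longrightarrow> a \<le> log_incr \<theta> \<nu> n t y \<and> log_incr \<theta> \<nu> n t y \<le> b"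
    and 4: "t = 0 \<longrightarrow> (\<forall>\<nu> n. is_prob_on lam \<nu> \<longrightarrow> q \<le> n \<longrightarrow> a \<le> ln (pred_density lam m g \<theta> \<nu> n y) \<and> ln (pred_density lam m g \<theta> \<nu> n y) \<le> b)"
    using log_incr_forgetting[where y = y and k = q and t = t, OF th all_goodD[OF y]] unfolding incr_bound_def by blast
  note i1 = 3[rule_format, OF \<nu>(1) q(1)] and i2 = 3[rule_format, OF \<nu>(2) q(2)]
  show "\<bar>log_incr \<theta> \<nu>1 n1 t y - log_incr \<theta> \<nu>2 n2 t y\<bar> \<le> s2 / s1 * \<rho> ^ q" using i1 i2 1 by linarith
  show "\<bar>log_incr \<theta> \<nu>1 n1 t y\<bar> \<le> incr_bound \<theta> (y (t + 1))" using i1 2 by linarith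
  show "\<bar>ln (pred_density lam m g \<theta> \<nu>1 n1 y) - log_incr \<theta> \<nu>2 n2 t y\<bar> \<le> s2 / s1 * \<rho> ^ q" if "t = 0"
    using 4[rule_format, OF that \<nu>(1) q(1)] i2 1 by linarith
qed

lemma log_incr_measurable:
  assumes "\<theta> \<in> \<Theta>" "is_prob_on lam \<nu>" shows "log_incr \<theta> \<nu> n t \<in> borel_measurable seqs"
  unfolding log_incr_def[abs_def]
  by (intro borel_measurable_diff borel_measurable_ln norm_const_measurable[where Z = "\<lambda>i x. x i"] assms) auto

lemma incr_bound_integrable: "integrable P (\<lambda>\<omega>. incr_bound \<theta> (Y k \<omega>))"
  unfolding incr_bound_def using M_Y(1)[of k] by simp

lemma log_incr_integrable:
  assumes "\<theta> \<in> \<Theta>" "is_prob_on lam \<nu>" shows "integrable P (\<lambda>\<omega>. log_incr \<theta> \<nu> n t (traj \<omega>))"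
proof (rule Bochner_Integration.integrable_bound[OF incr_bound_integrable[of \<theta> "t + 1"]])
  show "(\<lambda>\<omega>. log_incr \<theta> \<nu> n t (traj \<omega>)) \<in> borel_measurable P"
    by (rule measurable_compose[OF traj_measurable log_incr_measurable[OF assms]])
  show "AE \<omega> in P. norm (log_incr \<theta> \<nu> n t (traj \<omega>)) \<le> norm (incr_bound \<theta> (Y (t + 1) \<omega>))"
    using traj_good
  proof eventually_elim
    case (elim \<omega>)
    then show ?case using log_incr_close(2)[OF assms(1) elim assms(2) nu0 order_refl, of n n t] by (simp add: abs_ge_self order_trans)
  qed
qed

abbreviation "winlog q \<theta> \<equiv> log_incr \<theta> \<nu>0 q 0"
definition "mean_incr q \<theta> = (\<integral>\<omega>. winlog q \<theta> (traj \<omega>) \<partial>P)"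

lemma winlog_limit:
  assumes th: "\<theta> \<in> \<Theta>" and y: "all_good y" and \<nu>: "is_prob_on lam \<nu>"
  shows "(\<lambda>n. ln (pred_density lam m g \<theta> \<nu> n y)) \<longlonglongrightarrow> lim (\<lambda>n. winlog n \<theta> y)" "(\<lambda>n. winlog n \<theta> y) \<longlonglongrightarrow> lim (\<lambda>n. winlog n \<theta> y)"
proof -
  have "Cauchy (\<lambda>n. winlog n \<theta> y)"
  proof (rule metric_CauchyI)
    fix \<epsilon> :: real assume "0 < \<epsilon>"
    then have "\<forall>\<^sub>F N in sequentially. s2 / s1 * \<rho> ^ N < \<epsilon>"
      by (intro order_tendstoD(2)[OF rho_power_tendsto]) simp
    then obtain N where N: "s2 / s1 * \<rho> ^ N < \<epsilon>"
      using eventually_happens' sequentially_bot by blast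
    show "\<exists>N. \<forall>a\<ge>N. \<forall>b\<ge>N. dist (winlog a \<theta> y) (winlog b \<theta> y) < \<epsilon>"
    proof (intro exI allI impI)
      fix a b assume ab: "N \<le> a" "N \<le> b"
      show "dist (winlog a \<theta> y) (winlog b \<theta> y) < \<epsilon>"
        using log_incr_close(1)[OF th y nu0 nu0 ab, of 0] N unfolding dist_real_def by linarith
    qed
  qed
  then show l: "(\<lambda>n. winlog n \<theta> y) \<longlonglongrightarrow> lim (\<lambda>n. winlog n \<theta> y)" by (simp add: Cauchy_convergent_iff convergent_LIMSEQ_iff)
  have "(\<lambda>n. ln (pred_density lam m g \<theta> \<nu> n y) - winlog n \<theta> y) \<longlonglongrightarrow> 0"
    by (rule Lim_null_comparison[OF always_eventually rho_power_tendsto[of "s2 / s1"]])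
       (use log_incr_close(3)[OF th y \<nu> nu0 order_refl order_refl refl] in \<open>simp only: real_norm_def; blast\<close>)
  from tendsto_add[OF this l] show "(\<lambda>n. ln (pred_density lam m g \<theta> \<nu> n y)) \<longlonglongrightarrow> lim (\<lambda>n. winlog n \<theta> y)"
    unfolding diff_add_cancel add_0 .
qed

abbreviation "lld \<equiv> limit_log_density P Y lam m g"
abbreviation "ll \<equiv> limit_loglik P Y lam m g"

text \<open>The definition refers to the predictive density, which contains the emission density of
  the initial state. Forgetting gives the increments the same limit, and the later estimates use the
  increments.\<close>

lemma limit_log_density:
  assumes th: "\<theta> \<in> \<Theta>"
  shows "lld \<theta> \<in> borel_measurable P" "AE \<omega> in P. (\<lambda>n. winlog n \<theta> (traj \<omega>)) \<longlonglongrightarrow> lld \<theta> \<omega>"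
proof -
  let ?Z = "\<lambda>\<omega>. lim (\<lambda>n. winlog n \<theta> (traj \<omega>))"
  have "\<exists>Z. Z \<in> borel_measurable P \<and> (\<forall>\<nu>. is_prob_on lam \<nu> \<longrightarrow>
          (AE \<omega> in P. (\<lambda>n. ln (pred_density lam m g \<theta> \<nu> n (\<lambda>k. Y k \<omega>))) \<longlonglongrightarrow> Z \<omega>))"
  proof (rule exI[of _ ?Z], intro conjI allI impI)
    show "?Z \<in> borel_measurable P"
      by (intro borel_measurable_lim_metric measurable_compose[OF traj_measurable log_incr_measurable[OF th nu0]])
    show "AE \<omega> in P. (\<lambda>n. ln (pred_density lam m g \<theta> \<nu> n (\<lambda>k. Y k \<omega>))) \<longlonglongrightarrow> ?Z \<omega>"
      if "is_prob_on lam \<nu>" for \<nu>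
      using traj_good by eventually_elim (use winlog_limit(1)[OF th _ that] in simp)
  qed
  from someI_ex[OF this] have 1: "lld \<theta> \<in> borel_measurable P"
    "AE \<omega> in P. (\<lambda>n. ln (pred_density lam m g \<theta> \<nu>0 n (traj \<omega>))) \<longlonglongrightarrow> lld \<theta> \<omega>"
    unfolding limit_log_density_def[symmetric] using nu0 by auto
  show "lld \<theta> \<in> borel_measurable P" by (rule 1)
  show "AE \<omega> in P. (\<lambda>n. winlog n \<theta> (traj \<omega>)) \<longlonglongrightarrow> lld \<theta> \<omega>"
    using 1(2) traj_good
  proof eventually_elim
    case (elim \<omega>)
    then have "lld \<theta> \<omega> = lim (\<lambda>n. winlog n \<theta> (traj \<omega>))"
      using winlog_limit(1)[OF th elim(2) nu0] LIMSEQ_unique by blast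
    then show ?case using winlog_limit(2)[OF th elim(2) nu0] by simp
  qed
qed

lemma loglik_close:
  assumes th: "\<theta> \<in> \<Theta>" shows "\<bar>ll \<theta> - mean_incr q \<theta>\<bar> \<le> s2 / s1 * \<rho> ^ q"
proof -
  have close: "AE \<omega> in P. \<bar>lld \<theta> \<omega> - winlog q \<theta> (traj \<omega>)\<bar> \<le> s2 / s1 * \<rho> ^ q"
    using limit_log_density(2)[OF th] traj_good
  proof eventually_elim
    case (elim \<omega>)
    have "(\<lambda>n. \<bar>winlog n \<theta> (traj \<omega>) - winlog q \<theta> (traj \<omega>)\<bar>) \<longlonglongrightarrow> \<bar>lld \<theta> \<omega> - winlog q \<theta> (traj \<omega>)\<bar>"
      using elim by (intro tendsto_intros) auto
    moreover have "\<forall>n\<ge>q. \<bar>winlog n \<theta> (traj \<omega>) - winlog q \<theta> (traj \<omega>)\<bar> \<le> s2 / s1 * \<rho> ^ q"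
      using log_incr_close(1)[OF th elim(2) nu0 nu0 _ order_refl] by blast
    ultimately show ?case by (blast intro: LIMSEQ_le_const2)
  qed
  have iw: "integrable P (\<lambda>\<omega>. winlog q \<theta> (traj \<omega>))" by (rule log_incr_integrable[OF th nu0])
  \<comment> \<open>The limit differs from an integrable increment by a bounded variable; this
    yields the integrability of the limit itself.\<close>
  have id: "integrable P (\<lambda>\<omega>. lld \<theta> \<omega> - winlog q \<theta> (traj \<omega>))"
    by (rule integrable_const_bound[where B = "s2 / s1 * \<rho> ^ q"])
       (use close limit_log_density(1)[OF th] iw in auto)
  have il: "integrable P (lld \<theta>)" using Bochner_Integration.integrable_add[OF id iw] by simp
  have "ll \<theta> - mean_incr q \<theta> = (\<integral>\<omega>. lld \<theta> \<omega> - winlog q \<theta> (traj \<omega>) \<partial>P)"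
    using il iw by (simp add: limit_loglik_def mean_incr_def)
  then have "\<bar>ll \<theta> - mean_incr q \<theta>\<bar> \<le> (\<integral>\<omega>. \<bar>lld \<theta> \<omega> - winlog q \<theta> (traj \<omega>)\<bar> \<partial>P)" by (simp only: integral_abs_bound)
  also have "\<dots> \<le> (\<integral>\<omega>. s2 / s1 * \<rho> ^ q \<partial>P)" using id close by (intro integral_mono_AE) auto
  finally show ?thesis by (simp add: prob_space)
qed

lemma log_incr_perturb:
  assumes th: "\<theta> \<in> \<Theta>" "\<theta>' \<in> \<Theta>" and y: "all_good y" and \<nu>: "is_prob_on lam \<nu>"
    and d: "0 \<le> d" "\<bar>\<phi> \<theta>' - \<phi> \<theta>\<bar> \<le> d" "norm (\<psi> \<theta>' - \<psi> \<theta>) \<le> d"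
  shows "\<bar>log_incr \<theta>' \<nu> n t y - log_incr \<theta> \<nu> n t y\<bar> \<le> weight_osc d y (t - int n) (t + 1) + weight_osc d y (t - int n) t"
proof -
  have "\<bar>ln (norm_const \<theta>' \<nu> r u y) - ln (norm_const \<theta> \<nu> r u y)\<bar> \<le> weight_osc d y r u" if r: "r \<le> u" for r u
  proof -
    have p: "0 < norm_const \<theta> \<nu> r u y" "0 < norm_const \<theta>' \<nu> r u y"
      using norm_const_pos[where y = y, OF _ all_goodD[OF y] \<nu> r] th by auto
    have d': "\<bar>\<phi> \<theta> - \<phi> \<theta>'\<bar> \<le> d" "norm (\<psi> \<theta> - \<psi> \<theta>') \<le> d" using d by (auto simp: norm_minus_commute abs_minus_commute)
    have "norm_const \<theta>' \<nu> r u y \<le> exp (weight_osc d y r u) * norm_const \<theta> \<nu> r u y"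
      by (rule norm_const_perturb[where y = y, OF th all_goodD[OF y] d \<nu> r])
    then have 1: "ln (norm_const \<theta>' \<nu> r u y) \<le> ln (exp (weight_osc d y r u) * norm_const \<theta> \<nu> r u y)"
      using p by (subst ln_le_cancel_iff) auto
    have "norm_const \<theta> \<nu> r u y \<le> exp (weight_osc d y r u) * norm_const \<theta>' \<nu> r u y"
      by (rule norm_const_perturb[where y = y, OF th(2,1) all_goodD[OF y] d(1) d' \<nu> r])
    then have 2: "ln (norm_const \<theta> \<nu> r u y) \<le> ln (exp (weight_osc d y r u) * norm_const \<theta>' \<nu> r u y)"
      using p by (subst ln_le_cancel_iff) auto
    show ?thesis using 1 2 p by (simp add: ln_mult abs_le_iff)
  qed
  from this[of "t - int n" "t + 1"] this[of "t - int n" t] show ?thesis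
    unfolding log_incr_def by linarith
qed

lemma mean_incr_continuous: "continuous_on \<Theta> (mean_incr q)"
  unfolding continuous_on_sequentially
proof (intro ballI allI impI, elim conjE)
  fix x \<theta> assume th: "\<theta> \<in> \<Theta>" and x: "\<forall>n. x n \<in> \<Theta>" "x \<longlonglongrightarrow> \<theta>"
  have "bounded (\<phi> ` \<Theta>)" "bounded (\<psi> ` \<Theta>)"
    using compact_continuous_image compact_Theta cont_phi cont_psi compact_imp_bounded by blast+
  then obtain c1 c2 where c: "\<And>\<theta>. \<theta> \<in> \<Theta> \<Longrightarrow> \<bar>\<phi> \<theta>\<bar> \<le> c1" "\<And>\<theta>. \<theta> \<in> \<Theta> \<Longrightarrow> norm (\<psi> \<theta>) \<le> c2"
    unfolding bounded_iff by fastforce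
  have "(\<lambda>n. mean_incr q (x n)) \<longlonglongrightarrow> mean_incr q \<theta>" unfolding mean_incr_def
  proof (rule integral_dominated_convergence)
    show "(\<lambda>\<omega>. winlog q \<theta> (traj \<omega>)) \<in> borel_measurable P" "\<And>n. (\<lambda>\<omega>. winlog q (x n) (traj \<omega>)) \<in> borel_measurable P"
      using log_incr_integrable nu0 th x(1) by auto
    show "integrable P (\<lambda>\<omega>. \<bar>ln (measure lam UNIV)\<bar> + c1 + M (Y 1 \<omega>) * c2)" using M_Y(1)[of 1] by simp
    show "AE \<omega> in P. norm (winlog q (x n) (traj \<omega>)) \<le> \<bar>ln (measure lam UNIV)\<bar> + c1 + M (Y 1 \<omega>) * c2" for n
      using traj_good
    proof eventually_elim
      case (elim \<omega>)
      have "\<bar>winlog q (x n) (traj \<omega>)\<bar> \<le> incr_bound (x n) (Y 1 \<omega>)"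
        using log_incr_close(2)[OF x(1)[rule_format] elim nu0 nu0 order_refl order_refl, of n q 0] by simp
      also have "\<dots> \<le> \<bar>ln (measure lam UNIV)\<bar> + c1 + M (Y 1 \<omega>) * c2"
        unfolding incr_bound_def using c x(1) M_nonneg by (intro add_mono mult_left_mono) auto
      finally show ?case by simp
    qed
    show "AE \<omega> in P. (\<lambda>n. winlog q (x n) (traj \<omega>)) \<longlonglongrightarrow> winlog q \<theta> (traj \<omega>)"
      using traj_good
    proof eventually_elim
      case (elim \<omega>)
      let ?b = "\<lambda>n. weight_osc (par_dist \<theta> (x n)) (traj \<omega>) (0 - int q) (0 + 1) + weight_osc (par_dist \<theta> (x n)) (traj \<omega>) (0 - int q) 0"
      have "?b \<longlonglongrightarrow> 0 + 0"
        using x th by (intro tendsto_add weight_osc_tendsto par_dist_tendsto) auto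
      then have b: "?b \<longlonglongrightarrow> 0" by simp
      have "(\<lambda>n. winlog q (x n) (traj \<omega>) - winlog q \<theta> (traj \<omega>)) \<longlonglongrightarrow> 0"
        by (rule Lim_null_comparison[OF always_eventually b])
           (use log_incr_perturb[OF th x(1)[rule_format] elim nu0 par_dist, of _ q 0] in \<open>simp only: real_norm_def; blast\<close>)
      then show ?case by (rule LIM_zero_cancel)
    qed
  qed
  then show "(mean_incr q \<circ> x) \<longlonglongrightarrow> mean_incr q \<theta>" by (simp add: o_def)
qed

lemma loglik_continuous: "continuous_on \<Theta> ll"
proof (rule uniform_limit_theorem[where F = sequentially and f = mean_incr])
  show "uniform_limit \<Theta> mean_incr ll sequentially"
  proof (rule uniform_limitI)
    fix \<epsilon> :: real assume "0 < \<epsilon>"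
    then have "\<forall>\<^sub>F q in sequentially. s2 / s1 * \<rho> ^ q < \<epsilon>"
      by (intro order_tendstoD(2)[OF rho_power_tendsto]) simp
    then show "\<forall>\<^sub>F q in sequentially. \<forall>\<theta>\<in>\<Theta>. dist (mean_incr q \<theta>) (ll \<theta>) < \<epsilon>"
    proof eventually_elim
      case (elim q)
      show ?case
      proof
        fix \<theta> assume "\<theta> \<in> \<Theta>"
        from loglik_close[OF this, of q] elim show "dist (mean_incr q \<theta>) (ll \<theta>) < \<epsilon>"
          unfolding dist_real_def by linarith
      qed
    qed
  qed
qed (use mean_incr_continuous in auto)

section \<open>The EM inequality\<close>

text \<open>Jensen's inequality, in the form \<open>exp z \<ge> exp a * (1 + z - a)\<close> for the log-ratio \<open>z\<close> of the path weights
  and its smoothed mean \<open>a\<close>.\<close>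

lemma log_norm_const_ge:
  assumes th: "\<theta> \<in> \<Theta>" "\<theta>' \<in> \<Theta>" and y: "all_good y" and \<nu>: "is_prob_on lam \<nu>"
  shows "real n * (\<phi> \<theta>' - \<phi> \<theta>) + (\<Sum>s\<in>{1..n}. smooth lam m g (hS (\<psi> \<theta>' - \<psi> \<theta>)) \<theta> \<nu> 0 (int s) (int n) y)
    \<le> ln (norm_const \<theta>' \<nu> 0 (int n) y) - ln (norm_const \<theta> \<nu> 0 (int n) y)"
proof -
  let ?e = "\<psi> \<theta>' - \<psi> \<theta>" and ?t = "int n"
  let ?P = "path_measure lam \<nu> 0 ?t" and ?w = "path_weight m g \<theta> 0 ?t y" and ?w' = "path_weight m g \<theta>' 0 ?t y"
  let ?Z = "norm_const \<theta> \<nu> 0 ?t y" and ?Z' = "norm_const \<theta>' \<nu> 0 ?t y"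
  let ?H = "\<lambda>s x. hS ?e (x (int s - 1)) (x (int s)) (y (int s))"
  define A where "A x = real n * (\<phi> \<theta>' - \<phi> \<theta>) + (\<Sum>s\<in>{1..n}. ?H s x)" for x
  have reidx: "(\<Prod>i\<in>{0..<?t}. F (i + 1) (x i) (x (i + 1))) = (\<Prod>s\<in>{1..n}. F (int s) (x (int s - 1)) (x (int s)))" for F :: "int \<Rightarrow> 'x \<Rightarrow> 'x \<Rightarrow> real" and x
    by (rule prod.reindex_bij_witness[of _ "\<lambda>s. int s - 1" "\<lambda>i. nat (i + 1)"]) auto
  have ker_eq: "ker \<theta>' y i a b = ker \<theta> y i a b * exp (\<phi> \<theta>' - \<phi> \<theta> + hS ?e a b (y i))" for i a b
    using th by (simp add: ker_def expfam hS_def inner_diff_right flip: exp_add)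
  have w': "?w' x = ?w x * exp (A x)" for x
  proof -
    have "?w' x = (\<Prod>i\<in>{0..<?t}. ker \<theta> y (i + 1) (x i) (x (i + 1)) * exp (\<phi> \<theta>' - \<phi> \<theta> + hS ?e (x i) (x (i + 1)) (y (i + 1))))"
      unfolding path_weight_ker ker_eq ..
    also have "\<dots> = ?w x * (\<Prod>i\<in>{0..<?t}. exp (\<phi> \<theta>' - \<phi> \<theta> + hS ?e (x i) (x (i + 1)) (y (i + 1))))"
      unfolding path_weight_ker prod.distrib ..
    also have "(\<Prod>i\<in>{0..<?t}. exp (\<phi> \<theta>' - \<phi> \<theta> + hS ?e (x i) (x (i + 1)) (y (i + 1)))) = (\<Prod>s\<in>{1..n}. exp (\<phi> \<theta>' - \<phi> \<theta> + ?H s x))"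
      by (rule reidx[of "\<lambda>i a b. exp (\<phi> \<theta>' - \<phi> \<theta> + hS ?e a b (y i))"])
    also have "\<dots> = exp (A x)" by (simp add: A_def exp_sum[symmetric] sum.distrib)
    finally show ?thesis .
  qed
  have iw: "integrable ?P ?w" "integrable ?P ?w'"
    using path_integrable[where y = y, OF _ all_goodD[OF y] \<nu>] th by auto
  have iH: "integrable ?P (\<lambda>x. ?w x * ?H s x)" if "s \<in> {1..n}" for s
    using that by (intro path_integrable_h[where y = y and c = "M (y (int s)) * norm ?e", OF th(1) all_goodD[OF y] \<nu> _ _ hS_obs hS_bound[OF all_goodD[OF y]]]) auto
  have wA: "?w x * A x = real n * (\<phi> \<theta>' - \<phi> \<theta>) * ?w x + (\<Sum>s\<in>{1..n}. ?w x * ?H s x)" for x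
    by (simp add: A_def algebra_simps sum_distrib_left)
  have iA: "integrable ?P (\<lambda>x. ?w x * A x)" unfolding wA
    using iw iH by (intro Bochner_Integration.integrable_add Bochner_Integration.integrable_sum) auto
  have Z: "0 < ?Z" "0 < ?Z'" using norm_const_pos[where y = y, OF _ all_goodD[OF y] \<nu>] th by auto
  define a where "a = real n * (\<phi> \<theta>' - \<phi> \<theta>) + (\<Sum>s\<in>{1..n}. smooth lam m g (hS ?e) \<theta> \<nu> 0 (int s) ?t y)"
  have "(\<integral>x. ?w x * A x \<partial>?P) = real n * (\<phi> \<theta>' - \<phi> \<theta>) * ?Z + (\<Sum>s\<in>{1..n}. \<integral>x. ?w x * ?H s x \<partial>?P)"
    unfolding wA using iw iH by (subst Bochner_Integration.integral_add) (auto simp: norm_const_def intro!: Bochner_Integration.integral_sum)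
  also have "\<dots> = a * ?Z"
    using Z by (simp add: a_def smooth_real distrib_right sum_distrib_right)
  finally have mean: "(\<integral>x. ?w x * A x \<partial>?P) = a * ?Z" .
  \<comment> \<open>The integrand is the tangent line of the exponential at \<open>a\<close>,
    weighted by the old path weights. Since \<open>a\<close> is the smoothed mean of
    \<open>A\<close>, the linear part integrates to zero and only \<open>exp a * ?Z\<close> is
    left.\<close>
  have "exp a * ?Z = (\<integral>x. exp a * ((1 - a) * ?w x + ?w x * A x) \<partial>?P)"
  proof -
    have "(\<integral>x. (1 - a) * ?w x + ?w x * A x \<partial>?P) = (1 - a) * ?Z + a * ?Z"
      using iw iA mean by (simp add: norm_const_def)
    then have "(\<integral>x. (1 - a) * ?w x + ?w x * A x \<partial>?P) = ?Z" by (simp add: algebra_simps)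
    then show ?thesis by (simp only: integral_mult_right_zero)
  qed
  also have "\<dots> \<le> (\<integral>x. ?w' x \<partial>?P)"
  proof (rule integral_mono)
    show "integrable ?P (\<lambda>x. exp a * ((1 - a) * ?w x + ?w x * A x))" using iw iA by simp
    fix x
    have "exp a * (1 + (A x - a)) \<le> exp a * exp (A x - a)" by (intro mult_left_mono exp_ge_add_one_self) auto
    then have "exp a * (1 + (A x - a)) \<le> exp (A x)" by (simp flip: exp_add)
    then have "?w x * (exp a * (1 + (A x - a))) \<le> ?w x * exp (A x)" using path_weight_nonneg[OF th(1)] by (rule mult_left_mono)
    then show "exp a * ((1 - a) * ?w x + ?w x * A x) \<le> ?w' x" by (simp add: w' algebra_simps)
  qed (rule iw)
  finally have "exp a * ?Z \<le> ?Z'" by (simp add: norm_const_def)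
  then have "ln (exp a * ?Z) \<le> ln ?Z'" using Z by (subst ln_le_cancel_iff) auto
  then show ?thesis using Z by (simp add: ln_mult a_def)
qed

lemma log_incr_shift:
  assumes "\<theta> \<in> \<Theta>" "all_good y" "is_prob_on lam \<nu>"
  shows "log_incr \<theta> \<nu> n t (\<lambda>k. y (k + j)) = log_incr \<theta> \<nu> n (t + j) y"
proof -
  have r: "t - int n + j = t + j - int n" "t + 1 + j = t + j + 1" by auto
  show ?thesis
    using norm_const_shift[where y = y, OF assms(1) all_goodD[OF assms(2)] assms(3), of "t - int n" "t + 1" j]
      norm_const_shift[where y = y, OF assms(1) all_goodD[OF assms(2)] assms(3), of "t - int n" t j]
    unfolding r by (simp add: log_incr_def)
qed

lemma expected_log_incr:
  assumes th: "\<theta> \<in> \<Theta>" shows "(\<integral>\<omega>. log_incr \<theta> \<nu>0 n t (traj \<omega>) \<partial>P) = mean_incr n \<theta>"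
proof -
  have "(\<integral>\<omega>. log_incr \<theta> \<nu>0 n t (traj \<omega>) \<partial>P) = (\<integral>\<omega>. winlog n \<theta> (\<lambda>k. Y (k + t) \<omega>) \<partial>P)"
  proof (rule integral_cong_AE)
    show "(\<lambda>\<omega>. log_incr \<theta> \<nu>0 n t (traj \<omega>)) \<in> borel_measurable P" using log_incr_integrable[OF th nu0] by auto
    show "(\<lambda>\<omega>. winlog n \<theta> (\<lambda>k. Y (k + t) \<omega>)) \<in> borel_measurable P"
      by (rule measurable_compose[OF path_measurable log_incr_measurable[OF th nu0]])
    show "AE \<omega> in P. log_incr \<theta> \<nu>0 n t (traj \<omega>) = winlog n \<theta> (\<lambda>k. Y (k + t) \<omega>)"
      using traj_good by eventually_elim (use log_incr_shift[OF th _ nu0, of "traj _" n 0 t] in simp)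
  qed
  also have "\<dots> = mean_incr n \<theta>" unfolding mean_incr_def
    by (rule stationary_integral(1)[OF log_incr_measurable[OF th nu0]])
  finally show ?thesis .
qed

text \<open>Telescoping from a normalizing constant equal to 1. All chains start at time 0, so the
  increment at time \<open>j\<close> sees a past of length \<open>j\<close>.\<close>

lemma log_norm_const_sum:
  assumes th: "\<theta> \<in> \<Theta>" and y: "all_good y"
  shows "ln (norm_const \<theta> \<nu>0 0 (int n) y) = (\<Sum>j<n. log_incr \<theta> \<nu>0 j (int j) y)"
proof (induction n)
  case 0
  interpret nu: prob_space \<nu>0 using nu0 by (simp add: is_prob_on_def)
  have "norm_const \<theta> \<nu>0 0 (0 + int 0) y = 1"
    using norm_const_Kit[where y = y, OF th all_goodD[OF y] nu0, of 0 0] by (simp add: nu.prob_space)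
  then show ?case by simp
next
  case (Suc n)
  then show ?case by (simp add: log_incr_def add.commute)
qed

lemma power_sum_le: "(\<Sum>j<n. \<rho> ^ j) \<le> 1 / (1 - \<rho>)"
  using sum_geometric_le[of \<rho> "{..<n}" "\<lambda>j. j"] rho by simp

text \<open>By stationarity the increment with past \<open>j\<close> has mean
  \<open>mean_incr j \<theta>\<close>, which differs from the limit by a multiple of
  \<open>\<rho> ^ j\<close>. These errors are summable, so the deviation from linear growth stays
  bounded in \<open>n\<close>.\<close>

lemma expected_log_norm_const:
  assumes th: "\<theta> \<in> \<Theta>"
  shows "integrable P (\<lambda>\<omega>. ln (norm_const \<theta> \<nu>0 0 (int n) (traj \<omega>)))"
    "\<bar>(\<integral>\<omega>. ln (norm_const \<theta> \<nu>0 0 (int n) (traj \<omega>)) \<partial>P) - real n * ll \<theta>\<bar> \<le> s2 / s1 * (1 / (1 - \<rho>))"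
proof -
  let ?s = "\<lambda>\<omega>. \<Sum>j<n. log_incr \<theta> \<nu>0 j (int j) (traj \<omega>)"
  have m: "(\<lambda>\<omega>. ln (norm_const \<theta> \<nu>0 0 (int n) (traj \<omega>))) \<in> borel_measurable P"
    by (intro borel_measurable_ln norm_const_measurable Y th nu0)
  have ae: "AE \<omega> in P. ?s \<omega> = ln (norm_const \<theta> \<nu>0 0 (int n) (traj \<omega>))"
    using traj_good by eventually_elim (simp add: log_norm_const_sum[OF th])
  have i: "integrable P ?s" using log_incr_integrable[OF th nu0] by (intro Bochner_Integration.integrable_sum)
  show "integrable P (\<lambda>\<omega>. ln (norm_const \<theta> \<nu>0 0 (int n) (traj \<omega>)))"
    using integrable_cong_AE_imp[OF i m] ae by auto
  have "(\<integral>\<omega>. ln (norm_const \<theta> \<nu>0 0 (int n) (traj \<omega>)) \<partial>P) = (\<integral>\<omega>. ?s \<omega> \<partial>P)"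
    using ae m i by (intro integral_cong_AE) auto
  also have "\<dots> = (\<Sum>j<n. mean_incr j \<theta>)"
    using log_incr_integrable[OF th nu0] by (subst Bochner_Integration.integral_sum) (auto simp: expected_log_incr[OF th])
  finally have "\<bar>(\<integral>\<omega>. ln (norm_const \<theta> \<nu>0 0 (int n) (traj \<omega>)) \<partial>P) - real n * ll \<theta>\<bar> = \<bar>\<Sum>j<n. mean_incr j \<theta> - ll \<theta>\<bar>"
    by (simp add: sum_subtractf)
  also have "\<dots> \<le> (\<Sum>j<n. s2 / s1 * \<rho> ^ j)"
    using loglik_close[OF th] by (intro order_trans[OF sum_abs] sum_mono) (simp add: abs_minus_commute)
  also have "\<dots> \<le> s2 / s1 * (1 / (1 - \<rho>))"
    unfolding sum_distrib_left[symmetric] using s1 s1_le by (intro mult_left_mono power_sum_le) simp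
  finally show "\<bar>(\<integral>\<omega>. ln (norm_const \<theta> \<nu>0 0 (int n) (traj \<omega>)) \<partial>P) - real n * ll \<theta>\<bar> \<le> s2 / s1 * (1 / (1 - \<rho>))" .
qed

lemma hS_smooth_measurable:
  assumes "\<theta> \<in> \<Theta>" "is_prob_on lam \<nu>" "r < s" "s \<le> t"
  shows "smooth lam m g (hS e) \<theta> \<nu> r s t \<in> borel_measurable seqs"
  by (rule smooth_measurable[where Z = "\<lambda>i x. x i", OF _ assms(1,2) hS_meas assms(3,4)]) auto

lemma win_inner: "\<theta> \<in> \<Theta> \<Longrightarrow> all_good y \<Longrightarrow> inner (win q \<theta> y) e = smooth lam m g (hS e) \<theta> \<nu>0 (0 - 1 - int q) 0 (0 + int q) y"
  unfolding win_def by (rule smooth_inner[where y = y, OF _ _ nu0]) (auto dest: all_goodD)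

text \<open>Shifting time by \<open>s\<close> turns the smoothed value into a window around 0 with
  \<open>s - 1\<close> kernel steps before and \<open>n - s\<close> after. The factor 3 is 1 for the
  comparison with a full window of size \<open>n\<close> and 2 for that window against the mean
  limit. The error decays away from both ends, hence its sum over \<open>s\<close> is bounded in
  \<open>n\<close>.\<close>

lemma expected_smooth:
  assumes th: "\<theta> \<in> \<Theta>" and s: "s \<in> {1..n}"
  shows "integrable P (\<lambda>\<omega>. smooth lam m g (hS e) \<theta> \<nu>0 0 (int s) (int n) (traj \<omega>))"
    "\<bar>(\<integral>\<omega>. smooth lam m g (hS e) \<theta> \<nu>0 0 (int s) (int n) (traj \<omega>) \<partial>P) - inner (ms \<theta>) e\<bar>
      \<le> 3 * c_forget * mean_M * norm e * (\<rho> ^ (s - 1) + \<rho> ^ (n - s))"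
proof -
  define k l where "k = s - 1" and "l = n - s"
  have ker_low: "0 = int s - 1 - int k" "int n = int s + int l" "k \<le> n" "l \<le> n" using s by (auto simp: k_def l_def)
  have ks: "0 - 1 - int k + int s = 0" "0 + int l + int s = int n" using s by (auto simp: k_def l_def)
  let ?g = "smooth lam m g (hS e) \<theta> \<nu>0 0 (int s) (int n)"
  let ?f = "smooth lam m g (hS e) \<theta> \<nu>0 (0 - 1 - int k) 0 (0 + int l)"
  have fm: "?f \<in> borel_measurable seqs" by (rule hS_smooth_measurable[OF th nu0]) auto
  have gm: "?g \<in> borel_measurable seqs" using s by (intro hS_smooth_measurable[OF th nu0]) auto
  have gP: "(\<lambda>\<omega>. ?g (traj \<omega>)) \<in> borel_measurable P" by (rule measurable_compose[OF traj_measurable gm])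
  have fP: "(\<lambda>\<omega>. ?f (traj \<omega>)) \<in> borel_measurable P" by (rule measurable_compose[OF traj_measurable fm])
  have fi: "integrable P (\<lambda>\<omega>. ?f (traj \<omega>))"
  proof (rule Bochner_Integration.integrable_bound[OF integrable_mult_left[OF M_Y(1)[of 0], of "norm e"] fP])
    show "AE \<omega> in P. norm (?f (traj \<omega>)) \<le> norm (M (Y 0 \<omega>) * norm e)"
      using traj_good
    proof eventually_elim
      case (elim \<omega>)
      show ?case using smooth_hS_bound[OF th elim nu0, of e 0 k l] M_nonneg by simp
    qed
  qed
  have ae: "AE \<omega> in P. ?g (traj \<omega>) = ?f (\<lambda>k. Y (k + int s) \<omega>)"
    using traj_good
  proof eventually_elim
    case (elim \<omega>)
    have "?f (\<lambda>k. traj \<omega> (k + int s)) = smooth lam m g (hS e) \<theta> \<nu>0 (0 + int s - 1 - int k) (0 + int s) (0 + int s + int l) (traj \<omega>)"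
      by (rule smooth_shift[where y = "traj \<omega>" and s = 0 and j = "int s" and h = "hS e" and c = "M (traj \<omega> (0 + int s)) * norm e", OF th all_goodD[OF elim] nu0 hS_obs hS_bound[OF all_goodD[OF elim]]])
    moreover have "0 + int s - 1 - int k = 0" "0 + int s = int s" "0 + int s + int l = int n" using s by (auto simp: k_def l_def)
    ultimately show ?case by simp
  qed
  have fs: "integrable P (\<lambda>\<omega>. ?f (\<lambda>k. Y (k + int s) \<omega>))" using stationary_integral(2)[OF fm] fi by simp
  show gi: "integrable P (\<lambda>\<omega>. ?g (traj \<omega>))"
    using integrable_cong_AE[OF gP borel_measurable_integrable[OF fs] ae] fs by blast
  have "(\<integral>\<omega>. ?g (traj \<omega>) \<partial>P) = (\<integral>\<omega>. ?f (\<lambda>k. Y (k + int s) \<omega>) \<partial>P)"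
    using ae gP fs by (intro integral_cong_AE) auto
  also have "\<dots> = (\<integral>\<omega>. ?f (traj \<omega>) \<partial>P)" by (rule stationary_integral(1)[OF fm])
  finally have E: "(\<integral>\<omega>. ?g (traj \<omega>) \<partial>P) = (\<integral>\<omega>. ?f (traj \<omega>) \<partial>P)" .
  have iwin: "integrable P (\<lambda>\<omega>. inner (win n \<theta> (traj \<omega>)) e)" using win_integrable[OF th] by (rule integrable_inner_left)
  have mw: "inner (mean_win n \<theta>) e = (\<integral>\<omega>. inner (win n \<theta> (traj \<omega>)) e \<partial>P)"
    unfolding mean_win_def by (rule integral_inner_left[symmetric]) (rule win_integrable[OF th])
  have "\<bar>(\<integral>\<omega>. ?f (traj \<omega>) \<partial>P) - inner (mean_win n \<theta>) e\<bar> = \<bar>\<integral>\<omega>. ?f (traj \<omega>) - inner (win n \<theta> (traj \<omega>)) e \<partial>P\<bar>"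
    using fi iwin by (simp add: mw)
  also have "\<dots> \<le> (\<integral>\<omega>. \<bar>?f (traj \<omega>) - inner (win n \<theta> (traj \<omega>)) e\<bar> \<partial>P)" by (rule integral_abs_bound)
  also have "\<dots> \<le> (\<integral>\<omega>. c_forget * M (Y 0 \<omega>) * norm e * (\<rho> ^ k + \<rho> ^ l) \<partial>P)"
  proof (rule integral_mono_AE)
    show "AE \<omega> in P. \<bar>?f (traj \<omega>) - inner (win n \<theta> (traj \<omega>)) e\<bar> \<le> c_forget * M (Y 0 \<omega>) * norm e * (\<rho> ^ k + \<rho> ^ l)"
      using traj_good
    proof eventually_elim
      case (elim \<omega>)
      show ?case unfolding win_inner[OF th elim]
        by (rule smooth_hS_forgetting[OF th elim nu0 nu0 order_refl ker_low(3) order_refl ker_low(4)])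
    qed
  qed (use fi iwin M_Y(1)[of 0] in auto)
  also have "\<dots> = c_forget * mean_M * norm e * (\<rho> ^ k + \<rho> ^ l)" using M_Y(1)[of 0] by (simp add: mean_M_def)
  finally have 1: "\<bar>(\<integral>\<omega>. ?f (traj \<omega>) \<partial>P) - inner (mean_win n \<theta>) e\<bar> \<le> c_forget * mean_M * norm e * (\<rho> ^ k + \<rho> ^ l)" .
  have "\<bar>inner (ms \<theta> - mean_win n \<theta>) e\<bar> \<le> norm (ms \<theta> - mean_win n \<theta>) * norm e" by (rule Cauchy_Schwarz_ineq2)
  also have "\<dots> \<le> 2 * c_forget * mean_M * \<rho> ^ n * norm e" by (intro mult_right_mono mean_stat_close th) auto
  also have "\<dots> \<le> 2 * c_forget * mean_M * (\<rho> ^ k + \<rho> ^ l) * norm e"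
  proof (intro mult_right_mono mult_left_mono)
    have "\<rho> ^ n \<le> \<rho> ^ k" using rho ker_low(3) by (intro power_decreasing) auto
    then show "\<rho> ^ n \<le> \<rho> ^ k + \<rho> ^ l" using rho by (simp add: add_increasing2)
  qed (use c_forget_nonneg mean_M_nonneg in auto)
  finally have 2: "\<bar>inner (mean_win n \<theta>) e - inner (ms \<theta>) e\<bar> \<le> 2 * (c_forget * mean_M * norm e * (\<rho> ^ k + \<rho> ^ l))"
    by (simp add: inner_diff_left abs_minus_commute mult_ac)
  have "3 * c_forget * mean_M * norm e * (\<rho> ^ k + \<rho> ^ l) = c_forget * mean_M * norm e * (\<rho> ^ k + \<rho> ^ l) + 2 * (c_forget * mean_M * norm e * (\<rho> ^ k + \<rho> ^ l))"
    by simp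
  then show "\<bar>(\<integral>\<omega>. ?g (traj \<omega>) \<partial>P) - inner (ms \<theta>) e\<bar> \<le> 3 * c_forget * mean_M * norm e * (\<rho> ^ (s - 1) + \<rho> ^ (n - s))"
    unfolding k_def[symmetric] l_def[symmetric] E using 1 2 by linarith
qed

text \<open>Taking expectations in the finite-sample inequality gives, for every \<open>n\<close>,
  \<open>n\<close> times the desired inequality up to the constant \<open>C\<close>, which does not
  involve \<open>n\<close>. A positive excess would eventually outgrow \<open>C\<close>.\<close>

lemma em_inequality:
  assumes th: "\<theta> \<in> \<Theta>" "\<theta>' \<in> \<Theta>"
  shows "(\<phi> \<theta>' + inner (ms \<theta>) (\<psi> \<theta>')) - (\<phi> \<theta> + inner (ms \<theta>) (\<psi> \<theta>)) \<le> ll \<theta>' - ll \<theta>"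
proof -
  let ?e = "\<psi> \<theta>' - \<psi> \<theta>"
  define C where "C = 2 * (s2 / s1 * (1 / (1 - \<rho>))) + 3 * c_forget * mean_M * norm ?e * (2 / (1 - \<rho>))"
  define a where "a = (\<phi> \<theta>' - \<phi> \<theta> + inner (ms \<theta>) ?e) - (ll \<theta>' - ll \<theta>)"
  have bound: "real n * a \<le> C" for n
  proof -
    let ?L = "\<lambda>\<theta> \<omega>. ln (norm_const \<theta> \<nu>0 0 (int n) (traj \<omega>))"
    let ?s = "\<lambda>s \<omega>. smooth lam m g (hS ?e) \<theta> \<nu>0 0 (int s) (int n) (traj \<omega>)"
    note L = expected_log_norm_const[OF th(1), of n] expected_log_norm_const[OF th(2), of n]
    have isum: "integrable P (\<lambda>\<omega>. \<Sum>s\<in>{1..n}. ?s s \<omega>)"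
      using expected_smooth(1)[OF th(1)] by (intro Bochner_Integration.integrable_sum) auto
    have Es: "(\<integral>\<omega>. (\<Sum>s\<in>{1..n}. ?s s \<omega>) \<partial>P) = (\<Sum>s\<in>{1..n}. \<integral>\<omega>. ?s s \<omega> \<partial>P)"
      using expected_smooth(1)[OF th(1)] by (intro Bochner_Integration.integral_sum) auto
    have "real n * (\<phi> \<theta>' - \<phi> \<theta>) + (\<integral>\<omega>. (\<Sum>s\<in>{1..n}. ?s s \<omega>) \<partial>P) = (\<integral>\<omega>. real n * (\<phi> \<theta>' - \<phi> \<theta>) + (\<Sum>s\<in>{1..n}. ?s s \<omega>) \<partial>P)"
      using isum by (simp add: prob_space)
    also have "\<dots> \<le> (\<integral>\<omega>. ?L \<theta>' \<omega> - ?L \<theta> \<omega> \<partial>P)"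
    proof (rule integral_mono_AE)
      show "AE \<omega> in P. real n * (\<phi> \<theta>' - \<phi> \<theta>) + (\<Sum>s\<in>{1..n}. ?s s \<omega>) \<le> ?L \<theta>' \<omega> - ?L \<theta> \<omega>"
        using traj_good by eventually_elim (rule log_norm_const_ge[OF th _ nu0])
    qed (use isum L in auto)
    also have "\<dots> = (\<integral>\<omega>. ?L \<theta>' \<omega> \<partial>P) - (\<integral>\<omega>. ?L \<theta> \<omega> \<partial>P)" using L by simp
    finally have 1: "real n * (\<phi> \<theta>' - \<phi> \<theta>) + (\<Sum>s\<in>{1..n}. \<integral>\<omega>. ?s s \<omega> \<partial>P) \<le> (\<integral>\<omega>. ?L \<theta>' \<omega> \<partial>P) - (\<integral>\<omega>. ?L \<theta> \<omega> \<partial>P)"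
      unfolding Es .
    have "(\<Sum>s\<in>{1..n}. inner (ms \<theta>) ?e - (\<integral>\<omega>. ?s s \<omega> \<partial>P)) \<le> (\<Sum>s\<in>{1..n}. 3 * c_forget * mean_M * norm ?e * (\<rho> ^ (s - 1) + \<rho> ^ (n - s)))"
    proof (rule sum_mono)
      fix s assume "s \<in> {1..n}"
      from expected_smooth(2)[OF th(1) this, of ?e]
      show "inner (ms \<theta>) ?e - (\<integral>\<omega>. ?s s \<omega> \<partial>P) \<le> 3 * c_forget * mean_M * norm ?e * (\<rho> ^ (s - 1) + \<rho> ^ (n - s))" by linarith
    qed
    also have "\<dots> = 3 * c_forget * mean_M * norm ?e * ((\<Sum>s\<in>{1..n}. \<rho> ^ (s - 1)) + (\<Sum>s\<in>{1..n}. \<rho> ^ (n - s)))"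
      by (simp only: sum_distrib_left[symmetric] sum.distrib)
    also have "\<dots> \<le> 3 * c_forget * mean_M * norm ?e * (1 / (1 - \<rho>) + 1 / (1 - \<rho>))"
      using c_forget_nonneg mean_M_nonneg rho by (intro mult_left_mono add_mono sum_geometric_le) (auto simp: inj_on_def)
    finally have 2: "real n * inner (ms \<theta>) ?e - (\<Sum>s\<in>{1..n}. \<integral>\<omega>. ?s s \<omega> \<partial>P) \<le> 3 * c_forget * mean_M * norm ?e * (2 / (1 - \<rho>))"
      by (simp add: sum_subtractf)
    have 3: "(\<integral>\<omega>. ?L \<theta>' \<omega> \<partial>P) - (\<integral>\<omega>. ?L \<theta> \<omega> \<partial>P) \<le> real n * ll \<theta>' - real n * ll \<theta> + 2 * (s2 / s1 * (1 / (1 - \<rho>)))"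
      using L(2,4) by linarith
    have "real n * a = real n * (\<phi> \<theta>' - \<phi> \<theta>) + real n * inner (ms \<theta>) ?e - (real n * ll \<theta>' - real n * ll \<theta>)"
      by (simp add: a_def algebra_simps)
    then show ?thesis using 1 2 3 unfolding C_def by linarith
  qed
  have "a \<le> 0"
  proof (rule ccontr)
    assume "\<not> a \<le> 0"
    then have "0 < a" by simp
    then obtain n where "C < real n * a" using reals_Archimedean3 by blast
    with bound[of n] show False by simp
  qed
  then show ?thesis by (simp add: a_def inner_diff_right)
qed

section \<open>The limiting statistic lies in the domain of the M-step\<close>

lemma finite_lam: "finite_measure lam"
  using finite_state_measure_axioms by (simp add: finite_state_measure_def)

lemma sigma_finite_lam: "sigma_finite_measure lam"
  using finite_lam by (rule finite_measure.axioms(1))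

text \<open>Quotient of a lower bound for the numerator and an upper bound for the denominator over
  the steps at times -1 and 0: \<open>exp (- 2 * norm (\<psi> \<theta>) * M (y i))\<close> for each
  step, \<open>s1 / s2\<close> for the variation of the backward function, and one factor
  \<open>measure lam UNIV\<close> for each state integrated in the upper bound.\<close>

definition min_const :: "'t \<Rightarrow> (int \<Rightarrow> 'y) \<Rightarrow> real" where
  "min_const \<theta> y = s1 / (s2 * (measure lam UNIV)\<^sup>2) * exp (- 2 * norm (\<psi> \<theta>) * (M (y (- 1)) + M (y 0)))"

text \<open>The constant does not depend on the length of the window. This keeps the limit of the smoothed statistics inside the convex hull, not just inside its closure.\<close>

lemma smooth_minorization:
  assumes th: "\<theta> \<in> \<Theta>" and y: "all_good y" and \<nu>: "is_prob_on lam \<nu>" and h: "obs h" "\<And>x x'. \<bar>h x x' (y 0)\<bar> \<le> c"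
    and nn: "AE z in lam \<Otimes>\<^sub>M lam. 0 \<le> h (fst z) (snd z) (y 0)"
  shows "min_const \<theta> y * (\<integral>z. h (fst z) (snd z) (y 0) \<partial>(lam \<Otimes>\<^sub>M lam)) \<le> smooth lam m g h \<theta> \<nu> (0 - 1 - int (Suc k)) 0 (0 + int (Suc n)) y"
proof -
  interpret LL: pair_sigma_finite lam lam by (simp add: pair_sigma_finite_def sigma_finite_lam)
  interpret LL: finite_measure "lam \<Otimes>\<^sub>M lam" by (rule finite_measure_pair_measure; rule finite_lam)
  note y' = all_goodD[OF y]
  note bker_ker = bker_ker[where y = y, OF th y'] and ker_ge0 = ker_ge0[where y = y, OF th y'] and bb = back_bfun[where y = y, OF th y'] and bn = back_nonneg[where y = y, OF th y']
  note bker_h = bker_h[where y = y and h = h and s = 0 and c = c, OF th y' h]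
  let ?L = "measure lam UNIV"
  define B where "B = Kit (ker \<theta> y) (Suc n) 0 (\<lambda>x. 1)"
  have Bb: "bfun B" and Bn: "0 \<le> B x" for x unfolding B_def by (rule bb, rule bn)
  obtain G where G: "G > 0" "\<And>x. s1 * G \<le> B x" "\<And>x. B x \<le> s2 * G"
    using back_Suc_bounds[where y = y and h = h and s = 0 and c = c and j = n and r = 0, OF th y' h] unfolding B_def by blast
  define l u where "l i = exp (\<phi> \<theta> - M (y i) * norm (\<psi> \<theta>))" and "u i = exp (\<phi> \<theta> + M (y i) * norm (\<psi> \<theta>))" for i
  have lu: "0 < l i" "0 < u i" "l i \<le> ker \<theta> y i x x'" "ker \<theta> y i x x' \<le> u i" for i x x'
    using weight_bounds[OF th y'] by (auto simp: l_def u_def ker_def)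
  let ?h = "\<lambda>x x'. h x x' (y 0)"
  have hk: "bker ?h" unfolding bker_def using h by (auto simp: obs_def)
  define U V J where "U = Kop (hker h \<theta> y 0 0) B" and "V = Kop (ker \<theta> y 0) B" and "J = Kop ?h (\<lambda>x. 1)"
  have bUVJ: "bfun U" "bfun V" "bfun J"
    unfolding U_def V_def J_def using bker_h bker_ker hk Bb bfun_const by (auto intro: bfun_Kop)
  have UV: "- c * V x \<le> U x" "U x \<le> c * V x" for x
    unfolding U_def V_def by (rule Kop_hker_bounds[where y = y and h = h and s = 0 and c = c, OF th y' h Bb Bn])+
  define I where "I = (\<integral>z. h (fst z) (snd z) (y 0) \<partial>(lam \<Otimes>\<^sub>M lam))"
  have ih: "integrable (lam \<Otimes>\<^sub>M lam) (\<lambda>(x, x'). ?h x x')"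
    using hk h(2) by (intro LL.integrable_const_bound[where B = c]) (auto simp: bker_def)
  have "I = (\<integral>x. \<integral>x'. ?h x x' \<partial>lam \<partial>lam)"
    using LL.integral_fst[OF ih] by (simp add: I_def case_prod_unfold)
  then have I: "I = (\<integral>x. J x \<partial>lam)" by (simp add: J_def Kop_def)
  have I0: "0 \<le> I" unfolding I_def using nn by (rule integral_nonneg_AE)
  have nn2: "AE x in lam. AE x' in lam. 0 \<le> ?h x x'"
    using LL.AE_pair[OF nn] by simp
  have U_low: "AE x in lam. l 0 * (s1 * G) * J x \<le> U x"
    using nn2
  proof eventually_elim
    case (elim x)
    have "(\<integral>x'. l 0 * (s1 * G) * ?h x x' \<partial>lam) \<le> (\<integral>x'. hker h \<theta> y 0 0 x x' * B x' \<partial>lam)"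
    proof (rule integral_mono_AE)
      show "integrable lam (\<lambda>x'. l 0 * (s1 * G) * ?h x x')"
        using bfun_integrable_lam[OF bfun_section[OF hk bfun_const[of 1], of x]] by simp
      show "integrable lam (\<lambda>x'. hker h \<theta> y 0 0 x x' * B x')" by (intro bfun_integrable_lam bfun_section bker_h Bb)
      show "AE x' in lam. l 0 * (s1 * G) * ?h x x' \<le> hker h \<theta> y 0 0 x x' * B x'"
        using elim
      proof eventually_elim
        case (elim x')
        have "l 0 * (s1 * G) \<le> ker \<theta> y 0 x x' * B x'"
          using lu(1)[of 0] lu(3)[of 0 x x'] G s1 ker_ge0 by (intro mult_mono) auto
        then show ?case using elim mult_right_mono[of "l 0 * (s1 * G)" "ker \<theta> y 0 x x' * B x'" "?h x x'"]
          by (simp add: hker_def mult_ac)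
      qed
    qed
    then show ?case by (simp add: J_def U_def Kop_def)
  qed
  have V_up: "V x \<le> u 0 * (s2 * G) * ?L" for x
  proof -
    have "V x \<le> (\<integral>x'. u 0 * (s2 * G) \<partial>lam)" unfolding V_def Kop_def
      using lu(2,4)[of 0] G Bn ker_ge0 s1_le less_imp_le
      by (intro integral_mono bfun_integrable_lam bfun_section bker_ker Bb bfun_const mult_mono) auto
    then show ?thesis by (simp add: space_lam mult_ac)
  qed
  \<comment> \<open>The step into time -1 makes the law of that state dominate a multiple of
    \<open>lam\<close>, whatever happened before; with the step into time 0 the pair dominates a
    multiple of the product measure. Since \<open>h\<close> is nonnegative only almost everywhere,
    the comparison of the integrands is almost everywhere too.\<close>
  have N_low: "l (-1) * (l 0 * (s1 * G)) * I \<le> Kop (ker \<theta> y (-1)) U x" for x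
  proof -
    have "(\<integral>x'. l (-1) * (l 0 * (s1 * G)) * J x' \<partial>lam) \<le> (\<integral>x'. ker \<theta> y (-1) x x' * U x' \<partial>lam)"
    proof (rule integral_mono_AE)
      show "integrable lam (\<lambda>x'. l (-1) * (l 0 * (s1 * G)) * J x')" using bUVJ by (intro bfun_integrable_lam bfun_arith) auto
      show "integrable lam (\<lambda>x'. ker \<theta> y (-1) x x' * U x')" by (intro bfun_integrable_lam bfun_section bker_ker bUVJ)
      show "AE x' in lam. l (-1) * (l 0 * (s1 * G)) * J x' \<le> ker \<theta> y (-1) x x' * U x'"
        using U_low nn2
      proof eventually_elim
        case (elim x')
        have "0 \<le> J x'" using elim(2) by (simp add: J_def Kop_def integral_nonneg_AE)
        then have "l (-1) * (l 0 * (s1 * G) * J x') \<le> ker \<theta> y (-1) x x' * U x'"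
          using elim(1) lu(1)[of 0] lu(3)[of "-1" x x'] ker_ge0 G s1 by (intro mult_mono) auto
        then show ?case by (simp add: mult_ac)
      qed
    qed
    then show ?thesis by (simp add: I Kop_def)
  qed
  have D_up: "Kop (ker \<theta> y (-1)) V x \<le> u (-1) * (u 0 * (s2 * G) * ?L) * ?L" for x
  proof -
    have V0: "0 \<le> V x" for x unfolding V_def Kop_def using ker_ge0 Bn by (intro Bochner_Integration.integral_nonneg) simp
    have "Kop (ker \<theta> y (-1)) V x \<le> (\<integral>x'. u (-1) * (u 0 * (s2 * G) * ?L) \<partial>lam)" unfolding Kop_def
      using lu(2,4)[of "-1"] V_up V0 ker_ge0
      by (intro integral_mono bfun_integrable_lam bfun_section bker_ker bUVJ bfun_const mult_mono) (auto intro: less_imp_le)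
    then show ?thesis by (simp add: space_lam mult_ac)
  qed
  have const: "l (-1) * (l 0 * (s1 * G)) = min_const \<theta> y * (u (-1) * (u 0 * (s2 * G) * ?L) * ?L)"
  proof -
    have "exp (- 2 * norm (\<psi> \<theta>) * (M (y (-1)) + M (y 0))) * (u (-1) * u 0) = l (-1) * l 0"
      by (simp add: l_def u_def algebra_simps flip: exp_add)
    then have "min_const \<theta> y * (u (-1) * (u 0 * (s2 * G) * ?L) * ?L) = s1 / (s2 * ?L\<^sup>2) * (l (-1) * l 0) * (s2 * G) * ?L * ?L"
      by (simp add: min_const_def mult_ac)
    also have "\<dots> = l (-1) * (l 0 * (s1 * G))" using lam_pos s1_le by (simp add: power2_eq_square)
    finally show ?thesis ..
  qed
  have mc: "0 \<le> min_const \<theta> y" using s1 s1_le by (simp add: min_const_def)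
  have low: "(min_const \<theta> y * I) * Kop (ker \<theta> y (-1)) V x \<le> Kop (ker \<theta> y (-1)) U x" for x
  proof -
    have "(min_const \<theta> y * I) * Kop (ker \<theta> y (-1)) V x \<le> (min_const \<theta> y * I) * (u (-1) * (u 0 * (s2 * G) * ?L) * ?L)"
      using mc I0 D_up by (intro mult_left_mono) auto
    also have "\<dots> = l (-1) * (l 0 * (s1 * G)) * I" by (simp add: const)
    finally show ?thesis using N_low[of x] by linarith
  qed
  have up: "Kop (ker \<theta> y (-1)) U x \<le> c * Kop (ker \<theta> y (-1)) V x" for x
    using Kit_ratio_bounds(2)[where \<kappa> = "ker \<theta> y" and n = 1 and r = "-2" and b = c, OF bker_ker ker_ge0 bUVJ(1,2) UV] by simp
  let ?r = "0 - 1 - int (Suc k)"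
  have r: "?r + int k + 1 = -1" by simp
  have nf: "num_fun \<theta> y h 0 (Suc k) B = Kit (ker \<theta> y) k ?r (Kop (ker \<theta> y (-1)) U)"
    "den_fun \<theta> y 0 (Suc k) B = Kit (ker \<theta> y) k ?r (Kop (ker \<theta> y (-1)) V)"
    unfolding num_fun_def[where y = y, OF th y'] den_fun_def[where y = y, OF th y'] Kit_Suc_right r U_def V_def by auto
  have bK: "bfun (Kop (ker \<theta> y (-1)) U)" "bfun (Kop (ker \<theta> y (-1)) V)" using bker_ker bUVJ by (auto intro: bfun_Kop)
  obtain c0 where c0: "0 < c0" "\<And>x. c0 \<le> den_fun \<theta> y 0 (Suc k) B x"
    using den_back_pos[where y = y and h = h and s = 0 and c = c and k = "Suc k" and n = "Suc n", OF th y' h] unfolding B_def by blast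
  have "min_const \<theta> y * I \<le> (\<integral>x. num_fun \<theta> y h 0 (Suc k) B x \<partial>\<nu>) / (\<integral>x. den_fun \<theta> y 0 (Suc k) B x \<partial>\<nu>)"
    unfolding nf
    by (rule integral_ratio_bounds(1)[where y = y, OF th y' \<nu> bfun_Kit[OF bker_ker bK(1)] bfun_Kit[OF bker_ker bK(2)] c0[unfolded nf]
        Kit_ratio_bounds[OF bker_ker ker_ge0 bK low up]])
  then show ?thesis unfolding I_def[symmetric]
    using smooth_ratio[where y = y and h = h and s = 0 and c = c and k = "Suc k" and n = "Suc n", OF th y' \<nu> h] by (simp add: B_def)
qed

lemma smooth_diff_const:
  assumes th: "\<theta> \<in> \<Theta>" and y: "all_good y" and \<nu>: "is_prob_on lam \<nu>" and s: "r < s" "s \<le> t"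
  shows "smooth lam m g (\<lambda>x x' y. hS e x x' y - d) \<theta> \<nu> r s t y = smooth lam m g (hS e) \<theta> \<nu> r s t y - d"
proof -
  note y' = all_goodD[OF y]
  let ?P = "path_measure lam \<nu> r t" and ?w = "path_weight m g \<theta> r t y"
  have Z: "0 < norm_const \<theta> \<nu> r t y" using norm_const_pos[where y = y, OF th y' \<nu>] s by simp
  have i: "integrable ?P ?w" "integrable ?P (\<lambda>x. ?w x * hS e (x (s - 1)) (x s) (y s))"
    using path_integrable[where y = y, OF th y' \<nu>] s path_integrable_h[where y = y, OF th y' \<nu> s hS_obs hS_bound[OF y']] by auto
  have "(\<integral>x. ?w x * (hS e (x (s - 1)) (x s) (y s) - d) \<partial>?P) = (\<integral>x. ?w x * hS e (x (s - 1)) (x s) (y s) \<partial>?P) - d * norm_const \<theta> \<nu> r t y"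
    using i by (simp add: right_diff_distrib norm_const_def mult.commute[of d])
  then show ?thesis using Z by (simp add: smooth_real diff_divide_distrib)
qed

text \<open>The support lemma is applied to \<open>S x x' (Y 0 \<omega>)\<close> under the product
  of \<open>P\<close> and two copies of \<open>lam\<close>. If a half-space through the mean carries
  these values, the minorization bounds the mean excess from below by a positive factor times the
  excess under \<open>lam\<close>, uniformly in the window. The mean excess tends to zero, so the
  excess vanishes almost everywhere.\<close>

lemma mean_stat_in_hull:
  assumes th: "\<theta> \<in> \<Theta>"
  shows "ms \<theta> \<in> convex hull (range (\<lambda>(x, x', y). S x x' y))"
proof -
  interpret LL: finite_measure "lam \<Otimes>\<^sub>M lam" by (rule finite_measure_pair_measure; rule finite_lam)
  let ?LL = "lam \<Otimes>\<^sub>M lam" and ?Q = "P \<Otimes>\<^sub>M (lam \<Otimes>\<^sub>M lam)"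
  let ?f = "\<lambda>z. S (fst (snd z)) (snd (snd z)) (Y 0 (fst z))"
  interpret PQ: pair_sigma_finite P ?LL
    by (simp add: pair_sigma_finite_def sigma_finite_measure_axioms LL.sigma_finite_measure_axioms)
  have "ms \<theta> \<in> convex hull (?f ` space ?Q)"
  proof (rule in_convex_hull_of_support)
    have "emeasure ?Q (space ?Q) = emeasure P (space P) * (emeasure lam (space lam) * emeasure lam (space lam))"
      by (simp add: space_pair_measure LL.emeasure_pair_measure_Times sigma_finite_measure.emeasure_pair_measure_Times[OF sigma_finite_lam])
    moreover have "emeasure lam (space lam) \<noteq> 0" using lam_pos by (simp add: space_lam finite_measure.emeasure_eq_measure[OF finite_lam])
    ultimately have "emeasure ?Q (space ?Q) \<noteq> 0" by (simp add: emeasure_space_1)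
    then show "space ?Q \<notin> null_sets ?Q" by auto
  next
    fix u assume pos: "AE z in ?Q. 0 \<le> inner (?f z - ms \<theta>) u"
    \<comment> \<open>With this offset the limiting mean of \<open>?h\<close> is zero.\<close>
    define d where "d = inner (ms \<theta>) u"
    let ?h = "\<lambda>x x' y. hS u x x' y - d"
    have h_eq: "inner (?f z - ms \<theta>) u = ?h (fst (snd z)) (snd (snd z)) (Y 0 (fst z))" for z
      by (simp add: hS_def inner_diff_left d_def)
    have ho: "obs ?h" unfolding obs_def
    proof
      fix y
      have "(\<lambda>z. (case z of (x, x') \<Rightarrow> hS u x x' y) - d) \<in> borel_measurable ?LL"
        using hS_obs[of u] unfolding obs_def by (intro borel_measurable_diff borel_measurable_const) blast
      then show "(\<lambda>(x, x'). ?h x x' y) \<in> borel_measurable ?LL" by (simp add: case_prod_unfold)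
    qed
    have bker_h: "\<bar>?h x x' (y 0)\<bar> \<le> M (y 0) * norm u + \<bar>d\<bar>" if "all_good y" for x x' y
      using hS_bound[OF all_goodD[OF that, of 0], where e = u and x = x and x' = x'] by linarith
    have nn: "AE \<omega> in P. AE z in ?LL. 0 \<le> ?h (fst z) (snd z) (Y 0 \<omega>)"
      using PQ.AE_pair[OF pos] unfolding h_eq by simp
    define I where "I \<omega> = (\<integral>z. ?h (fst z) (snd z) (Y 0 \<omega>) \<partial>?LL)" for \<omega>
    have fm: "(\<lambda>z. (fst (snd z), snd (snd z), Y 0 (fst z))) \<in> measurable ?Q (lam \<Otimes>\<^sub>M lam \<Otimes>\<^sub>M mu)"
      by (intro measurable_Pair measurable_compose[OF measurable_snd] measurable_fst measurable_snd measurable_compose[OF measurable_fst Y])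
    have "(\<lambda>(\<omega>, z). ?h (fst z) (snd z) (Y 0 \<omega>)) \<in> borel_measurable ?Q"
      using measurable_compose[OF fm hS_meas[of u]] by (simp add: case_prod_beta)
    then have Im: "I \<in> borel_measurable P" unfolding I_def[abs_def] by (rule LL.borel_measurable_lebesgue_integral)
    have mcm: "(\<lambda>\<omega>. min_const \<theta> (traj \<omega>)) \<in> borel_measurable P"
      unfolding min_const_def using measurable_compose[OF Y M_meas] by (intro borel_measurable_times borel_measurable_exp borel_measurable_add borel_measurable_const) auto
    have mc: "0 < min_const \<theta> y" for y using s1 s1_le lam_pos by (simp add: min_const_def)
    \<comment> \<open>The left side does not depend on \<open>q\<close>, so the limit of the right
      side bounds it. As a nonnegative integral it needs no integrability proof for the product of
      \<open>min_const\<close> and \<open>I\<close>.\<close>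
    have le: "(\<integral>\<^sup>+\<omega>. ennreal (min_const \<theta> (traj \<omega>) * I \<omega>) \<partial>P) \<le> ennreal (inner (mean_win (Suc q) \<theta>) u - d)" for q
    proof -
      have iw: "integrable P (\<lambda>\<omega>. inner (win (Suc q) \<theta> (traj \<omega>)) u - d)"
        using integrable_inner_left[OF win_integrable[OF th]] by simp
      have ae: "AE \<omega> in P. 0 \<le> min_const \<theta> (traj \<omega>) * I \<omega> \<and> min_const \<theta> (traj \<omega>) * I \<omega> \<le> inner (win (Suc q) \<theta> (traj \<omega>)) u - d"
        using traj_good nn
      proof eventually_elim
        case (elim \<omega>)
        have "0 \<le> I \<omega>" unfolding I_def using elim(2) by (rule integral_nonneg_AE)
        moreover have "min_const \<theta> (traj \<omega>) * I \<omega> \<le> smooth lam m g ?h \<theta> \<nu>0 (0 - 1 - int (Suc q)) 0 (0 + int (Suc q)) (traj \<omega>)"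
          unfolding I_def using elim(2) by (intro smooth_minorization[OF th elim(1) nu0 ho bker_h[OF elim(1)]])
        ultimately show ?case using mc[of "traj \<omega>"]
          by (simp only: win_inner[OF th elim(1)] smooth_diff_const[OF th elim(1) nu0, of "0 - 1 - int (Suc q)" 0 "0 + int (Suc q)"]) auto
      qed
      have "(\<integral>\<^sup>+\<omega>. ennreal (min_const \<theta> (traj \<omega>) * I \<omega>) \<partial>P) \<le> (\<integral>\<^sup>+\<omega>. ennreal (inner (win (Suc q) \<theta> (traj \<omega>)) u - d) \<partial>P)"
        using ae by (intro nn_integral_mono_AE) (auto intro: ennreal_leI)
      also have "\<dots> = ennreal (\<integral>\<omega>. inner (win (Suc q) \<theta> (traj \<omega>)) u - d \<partial>P)"
        using ae by (intro nn_integral_eq_integral iw) auto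
      also have "(\<integral>\<omega>. inner (win (Suc q) \<theta> (traj \<omega>)) u - d \<partial>P) = inner (mean_win (Suc q) \<theta>) u - d"
        using integrable_inner_left[OF win_integrable[OF th]] win_integrable[OF th] by (simp add: mean_win_def prob_space)
      finally show ?thesis .
    qed
    have "(\<lambda>q. mean_win q \<theta> - ms \<theta>) \<longlonglongrightarrow> 0"
      by (rule Lim_null_comparison[OF always_eventually rho_power_tendsto[of "2 * c_forget * mean_M"]])
         (use mean_stat_close[OF th] in \<open>simp add: norm_minus_commute\<close>)
    from \<open>(\<lambda>q. mean_win q \<theta> - ms \<theta>) \<longlonglongrightarrow> 0\<close> have "(\<lambda>q. mean_win q \<theta>) \<longlonglongrightarrow> ms \<theta>" by (rule LIM_zero_cancel)
    then have "(\<lambda>q. mean_win (Suc q) \<theta>) \<longlonglongrightarrow> ms \<theta>" by (rule LIMSEQ_Suc)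
    then have "(\<lambda>q. inner (mean_win (Suc q) \<theta>) u - d) \<longlonglongrightarrow> inner (ms \<theta>) u - d" by (intro tendsto_intros)
    then have "(\<lambda>q. ennreal (inner (mean_win (Suc q) \<theta>) u - d)) \<longlonglongrightarrow> ennreal 0" by (intro tendsto_ennrealI) (simp add: d_def)
    then have "(\<integral>\<^sup>+\<omega>. ennreal (min_const \<theta> (traj \<omega>) * I \<omega>) \<partial>P) \<le> ennreal 0"
      by (rule LIMSEQ_le_const) (use le in auto)
    then have "(\<integral>\<^sup>+\<omega>. ennreal (min_const \<theta> (traj \<omega>) * I \<omega>) \<partial>P) = 0" by simp
    then have z: "AE \<omega> in P. ennreal (min_const \<theta> (traj \<omega>) * I \<omega>) = 0"
      using Im mcm by (subst (asm) nn_integral_0_iff_AE) auto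
    have "AE \<omega> in P. AE z in ?LL. ?h (fst z) (snd z) (Y 0 \<omega>) = 0"
      using z nn traj_good
    proof eventually_elim
      case (elim \<omega>)
      have m: "(\<lambda>z. ?h (fst z) (snd z) (Y 0 \<omega>)) \<in> borel_measurable ?LL" using ho by (simp add: obs_def case_prod_unfold)
      have i: "integrable ?LL (\<lambda>z. ?h (fst z) (snd z) (Y 0 \<omega>))"
        using bker_h[OF elim(3)] by (intro LL.integrable_const_bound[where B = "M (Y 0 \<omega>) * norm u + \<bar>d\<bar>"] m) auto
      have "0 \<le> I \<omega>" unfolding I_def using elim(2) by (rule integral_nonneg_AE)
      moreover have "min_const \<theta> (traj \<omega>) * I \<omega> \<le> 0" using elim(1) by (simp add: ennreal_eq_0_iff)
      ultimately have "I \<omega> = 0" using mc[of "traj \<omega>"] by (simp add: mult_le_0_iff not_le[symmetric] order_antisym)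
      then show ?case using integral_nonneg_eq_0_iff_AE[OF i elim(2)] by (simp add: I_def)
    qed
    then have "AE \<omega> in P. AE z in ?LL. inner (?f (\<omega>, z) - ms \<theta>) u = 0" unfolding h_eq by simp
    moreover have "{z \<in> space ?Q. inner (?f z - ms \<theta>) u = 0} \<in> sets ?Q"
      using measurable_compose[OF fm hS_meas[of u]] unfolding h_eq by (simp add: case_prod_beta)
    ultimately show "AE z in ?Q. inner (?f z - ms \<theta>) u = 0" by (subst PQ.AE_pair_iff[symmetric]) auto
  qed
  also have "\<dots> \<subseteq> convex hull (range (\<lambda>(x, x', y). S x x' y))"
  proof (rule hull_mono, rule image_subsetI)
    fix z :: "'w \<times> 'x \<times> 'x"
    show "?f z \<in> range (\<lambda>(x, x', y). S x x' y)"
      by (rule range_eqI[of _ _ "(fst (snd z), snd (snd z), Y 0 (fst z))"]) simp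
  qed
  finally show ?thesis .
qed

section \<open>Uniform law of large numbers along the blocks\<close>

definition "moment_M = (\<integral>\<omega>. \<bar>M (Y 0 \<omega>)\<bar> powr p \<partial>P)"

lemma moment_of_bound:
  assumes f: "f \<in> borel_measurable P" and b: "AE \<omega> in P. \<bar>f \<omega>\<bar> \<le> c * M (Y t \<omega>)" and c: "0 \<le> c"
  shows "integrable P (\<lambda>\<omega>. \<bar>f \<omega>\<bar> powr p)" "(\<integral>\<omega>. \<bar>f \<omega>\<bar> powr p \<partial>P) \<le> c powr p * moment_M"
proof -
  have ae: "AE \<omega> in P. \<bar>f \<omega>\<bar> powr p \<le> c powr p * \<bar>M (Y t \<omega>)\<bar> powr p"
    using b
  proof eventually_elim
    case (elim \<omega>)
    have "\<bar>f \<omega>\<bar> powr p \<le> (c * M (Y t \<omega>)) powr p" using elim p by (intro powr_mono2) auto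
    then show ?case using c M_nonneg by (simp add: powr_mult)
  qed
  have i: "integrable P (\<lambda>\<omega>. c powr p * \<bar>M (Y t \<omega>)\<bar> powr p)" using M_Y(3)[of t] by simp
  show i2: "integrable P (\<lambda>\<omega>. \<bar>f \<omega>\<bar> powr p)"
    using ae f by (intro Bochner_Integration.integrable_bound[OF i]) auto
  have "(\<integral>\<omega>. \<bar>f \<omega>\<bar> powr p \<partial>P) \<le> (\<integral>\<omega>. c powr p * \<bar>M (Y t \<omega>)\<bar> powr p \<partial>P)"
    using i i2 ae by (intro integral_mono_AE)
  then show "(\<integral>\<omega>. \<bar>f \<omega>\<bar> powr p \<partial>P) \<le> c powr p * moment_M" using M_Y(4)[of t] by (simp add: moment_M_def)
qed

lemma Y_sig: "i \<in> I \<Longrightarrow> Y i \<in> measurable (sig I) mu"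
  by (rule measurable_gen_sigma) (use Y in auto)

lemma win_shift:
  assumes th: "\<theta> \<in> \<Theta>" and y: "all_good y"
  shows "win q \<theta> (\<lambda>k. y (k + t)) = smooth lam m g S \<theta> \<nu>0 (t - 1 - int q) t (t + int q) y"
proof -
  have "inner (win q \<theta> (\<lambda>k. y (k + t))) e = inner (smooth lam m g S \<theta> \<nu>0 (t - 1 - int q) t (t + int q) y) e" for e
  proof -
    have "inner (win q \<theta> (\<lambda>k. y (k + t))) e = smooth lam m g (hS e) \<theta> \<nu>0 (0 + t - 1 - int q) (0 + t) (0 + t + int q) y"
      unfolding win_inner[OF th all_good_shift[OF y]]
      by (rule smooth_shift[where y = y and s = 0 and j = t and h = "hS e" and c = "M (y (0 + t)) * norm e",
          OF th all_goodD[OF y] nu0 hS_obs hS_bound[OF all_goodD[OF y]]])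
    also have "\<dots> = inner (smooth lam m g S \<theta> \<nu>0 (t - 1 - int q) t (t + int q) y) e"
      using smooth_inner[where y = y, OF th all_goodD[OF y] nu0, of "t - 1 - int q" t "t + int q" e] by simp
    finally show ?thesis .
  qed
  then show ?thesis by (rule vector_eq_rdot[THEN iffD1, OF allI])
qed

context
  fixes k T :: "nat \<Rightarrow> nat"
  assumes k: "\<And>n. 0 < k n" "summable (\<lambda>n. 1 / real (k n))"
begin

abbreviation "block n \<equiv> {T n + 1..T n + k n}"
abbreviation "avg n f \<equiv> (\<Sum>t\<in>block n. f t) /\<^sub>R real (k n)"

lemma M_average: "AE \<omega> in P. (\<lambda>n. avg n (\<lambda>t. M (Y (int t) \<omega>))) \<longlonglongrightarrow> mean_M"
proof -
  have m: "(\<lambda>\<omega>. M (Y t \<omega>)) \<in> borel_measurable (sig {t - int 0..t + int 0})" for t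
    by (rule measurable_compose[OF Y_sig M_meas]) simp
  have "AE \<omega> in P. (\<lambda>n. (\<Sum>t\<in>block n. M (Y (int t) \<omega>)) / real (k n)) \<longlonglongrightarrow> mean_M"
  proof (rule block_average_tendsto[where f = "\<lambda>t \<omega>. M (Y t \<omega>)" and q = 0 and B = moment_M, OF m])
    show "integrable P (\<lambda>\<omega>. \<bar>M (Y t \<omega>)\<bar> powr p)" "(\<integral>\<omega>. \<bar>M (Y t \<omega>)\<bar> powr p \<partial>P) \<le> moment_M" for t
      using M_Y(3,4)[of t] by (simp_all add: moment_M_def)
    show "(\<integral>\<omega>. M (Y t \<omega>) \<partial>P) = mean_M" for t using M_Y(2) by (simp add: mean_M_def)
  qed (rule k)+
  then show ?thesis by (simp add: divide_inverse mult.commute)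
qed

lemma win_osc_bounds: "0 \<le> d \<Longrightarrow> 0 \<le> win_osc q d y" "0 \<le> d \<Longrightarrow> win_osc q d y \<le> 2 * M (y 0)"
proof -
  assume d: "0 \<le> d"
  have "0 \<le> weight_osc d y (- 1 - int q) (int q)"
    unfolding weight_osc_def using d M_nonneg by (intro sum_nonneg mult_nonneg_nonneg) (auto intro: add_nonneg_nonneg)
  then have "0 \<le> 1 - exp (- 2 * weight_osc d y (- 1 - int q) (int q))" by simp
  then show "0 \<le> win_osc q d y" unfolding win_osc_def using M_nonneg by (intro mult_nonneg_nonneg) auto
  have "2 * M (y 0) * (1 - exp (- 2 * weight_osc d y (- 1 - int q) (int q))) \<le> 2 * M (y 0) * 1"
    using M_nonneg by (intro mult_left_mono) auto
  then show "win_osc q d y \<le> 2 * M (y 0)" by (simp add: win_osc_def)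
qed

lemma win_osc_measurable:
  assumes "\<And>i. i \<in> {- int q..int q} \<Longrightarrow> Z i \<in> measurable N mu"
  shows "(\<lambda>\<omega>. win_osc q d (\<lambda>i. Z i \<omega>)) \<in> borel_measurable N"
proof -
  have "(\<lambda>\<omega>. M (Z i \<omega>)) \<in> borel_measurable N" if "i \<in> {- int q..int q}" for i
    by (rule measurable_compose[OF assms[OF that] M_meas])
  then show ?thesis unfolding win_osc_def weight_osc_def
    by (intro borel_measurable_times borel_measurable_diff borel_measurable_exp borel_measurable_sum borel_measurable_add borel_measurable_const) auto
qed

definition "mean_osc q d = (\<integral>\<omega>. win_osc q d (traj \<omega>) \<partial>P)"

lemma win_osc_seqs: "win_osc q d \<in> borel_measurable seqs"
  using win_osc_measurable[where Z = "\<lambda>i x. x i" and N = seqs] by simp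

lemma win_osc_integrable: assumes "0 \<le> d" shows "integrable P (\<lambda>\<omega>. win_osc q d (traj \<omega>))"
proof (rule Bochner_Integration.integrable_bound[OF integrable_mult_right[OF M_Y(1)[of 0], of 2]])
  show "(\<lambda>\<omega>. win_osc q d (traj \<omega>)) \<in> borel_measurable P" by (rule measurable_compose[OF traj_measurable win_osc_seqs])
  show "AE \<omega> in P. norm (win_osc q d (traj \<omega>)) \<le> norm (2 * M (Y 0 \<omega>))"
  proof (rule AE_I2)
    fix \<omega>
    show "norm (win_osc q d (traj \<omega>)) \<le> norm (2 * M (Y 0 \<omega>))"
      using win_osc_bounds[OF assms, of q "traj \<omega>"] by simp
  qed
qed

lemma win_osc_average:
  assumes d: "0 \<le> d"
  shows "AE \<omega> in P. (\<lambda>n. avg n (\<lambda>t. win_osc q d (\<lambda>i. Y (i + int t) \<omega>))) \<longlonglongrightarrow> mean_osc q d"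
proof -
  let ?f = "\<lambda>t \<omega>. win_osc q d (\<lambda>i. Y (i + t) \<omega>)"
  have m: "?f t \<in> borel_measurable (sig {t - int q..t + int q})" for t
    by (rule win_osc_measurable) (intro Y_sig, auto)
  have mP: "?f t \<in> borel_measurable P" for t using m by (rule sig_borel)
  have b: "AE \<omega> in P. \<bar>?f t \<omega>\<bar> \<le> 2 * M (Y t \<omega>)" for t
  proof (rule AE_I2)
    fix \<omega> show "\<bar>?f t \<omega>\<bar> \<le> 2 * M (Y t \<omega>)"
      using win_osc_bounds[OF d, of q "\<lambda>i. Y (i + t) \<omega>"] by simp
  qed
  have "AE \<omega> in P. (\<lambda>n. (\<Sum>t\<in>block n. ?f (int t) \<omega>) / real (k n)) \<longlonglongrightarrow> mean_osc q d"
  proof (rule block_average_tendsto[where f = ?f and q = q and B = "2 powr p * moment_M", OF m])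
    show "integrable P (\<lambda>\<omega>. \<bar>?f t \<omega>\<bar> powr p)" "(\<integral>\<omega>. \<bar>?f t \<omega>\<bar> powr p \<partial>P) \<le> 2 powr p * moment_M" for t
      by (rule moment_of_bound[OF mP b], simp)+
    show "(\<integral>\<omega>. ?f t \<omega> \<partial>P) = mean_osc q d" for t unfolding mean_osc_def by (rule stationary_integral(1)[OF win_osc_seqs])
  qed (rule k)+
  then show ?thesis by (simp add: divide_inverse mult.commute)
qed

lemma mean_osc_tendsto:
  assumes d: "d \<longlonglongrightarrow> 0" "\<And>n. 0 \<le> d n" shows "(\<lambda>n. mean_osc q (d n)) \<longlonglongrightarrow> 0"
proof -
  have "(\<lambda>n. mean_osc q (d n)) \<longlonglongrightarrow> (\<integral>\<omega>. 0 \<partial>P)" unfolding mean_osc_def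
  proof (rule integral_dominated_convergence[where w = "\<lambda>\<omega>. 2 * M (Y 0 \<omega>)"])
    show "(\<lambda>\<omega>. win_osc q (d n) (traj \<omega>)) \<in> borel_measurable P" for n
      by (rule measurable_compose[OF traj_measurable win_osc_seqs])
    show "integrable P (\<lambda>\<omega>. 2 * M (Y 0 \<omega>))" using M_Y(1)[of 0] by simp
    show "AE \<omega> in P. (\<lambda>n. win_osc q (d n) (traj \<omega>)) \<longlonglongrightarrow> 0" by (intro AE_I2 win_osc_tendsto d)
    show "AE \<omega> in P. norm (win_osc q (d n) (traj \<omega>)) \<le> 2 * M (Y 0 \<omega>)" for n
    proof (rule AE_I2)
      fix \<omega> show "norm (win_osc q (d n) (traj \<omega>)) \<le> 2 * M (Y 0 \<omega>)"
        using win_osc_bounds[OF d(2), where q = q and y = "traj \<omega>"] by simp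
    qed
  qed simp
  then show ?thesis by simp
qed

lemma win_average:
  assumes th: "\<theta> \<in> \<Theta>"
  shows "AE \<omega> in P. (\<lambda>n. avg n (\<lambda>t. win q \<theta> (\<lambda>i. Y (i + int t) \<omega>))) \<longlonglongrightarrow> mean_win q \<theta>"
proof -
  have 1: "AE \<omega> in P. (\<lambda>n. avg n (\<lambda>t. inner (win q \<theta> (\<lambda>i. Y (i + int t) \<omega>)) b)) \<longlonglongrightarrow> inner (mean_win q \<theta>) b"
    if bB: "b \<in> Basis" for b
  proof -
    \<comment> \<open>\<open>?g\<close> is the window evaluated along a shifted trajectory, suited
      to stationarity. \<open>?f\<close> is almost surely the same variable, written so that its
      measurability with respect to the observations between \<open>t - q\<close> and
      \<open>t + q\<close> is visible.\<close>
    let ?g = "\<lambda>t \<omega>. inner (win q \<theta> (\<lambda>i. Y (i + t) \<omega>)) b"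
    let ?f = "\<lambda>t \<omega>. smooth lam m g (hS b) \<theta> \<nu>0 (t - 1 - int q) t (t + int q) (traj \<omega>)"
    have m: "?f t \<in> borel_measurable (sig {t - int q..t + int q})" for t
      by (rule smooth_measurable[OF _ th nu0 hS_meas]) (auto intro: Y_sig)
    have mP: "?f t \<in> borel_measurable P" for t using m by (rule sig_borel)
    have b: "AE \<omega> in P. \<bar>?f t \<omega>\<bar> \<le> 1 * M (Y t \<omega>)" for t
      using traj_good
    proof eventually_elim
      case (elim \<omega>)
      show ?case using smooth_hS_bound[OF th elim nu0, of b t q q] bB by simp
    qed
    have fg: "AE \<omega> in P. ?f t \<omega> = ?g t \<omega>" for t
      using traj_good
    proof eventually_elim
      case (elim \<omega>)
      show ?case unfolding win_shift[OF th elim]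
        by (rule smooth_inner[where y = "traj \<omega>", OF th all_goodD[OF elim] nu0, symmetric]) auto
    qed
    have gm: "(\<lambda>y. inner (win q \<theta> y) b) \<in> borel_measurable seqs"
      by (intro borel_measurable_inner win_measurable[OF th] borel_measurable_const)
    have gP: "?g t \<in> borel_measurable P" for t using measurable_compose[OF path_measurable gm] .
    have "AE \<omega> in P. (\<lambda>n. (\<Sum>t\<in>block n. ?f (int t) \<omega>) / real (k n)) \<longlonglongrightarrow> inner (mean_win q \<theta>) b"
    proof (rule block_average_tendsto[where f = ?f and q = q and B = "1 powr p * moment_M", OF m])
      show "integrable P (\<lambda>\<omega>. \<bar>?f t \<omega>\<bar> powr p)" "(\<integral>\<omega>. \<bar>?f t \<omega>\<bar> powr p \<partial>P) \<le> 1 powr p * moment_M" for t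
        by (rule moment_of_bound[OF mP b], simp)+
      show "(\<integral>\<omega>. ?f t \<omega> \<partial>P) = inner (mean_win q \<theta>) b" for t
      proof -
        have "(\<integral>\<omega>. ?f t \<omega> \<partial>P) = (\<integral>\<omega>. ?g t \<omega> \<partial>P)" by (rule integral_cong_AE[OF mP gP fg])
        also have "\<dots> = (\<integral>\<omega>. inner (win q \<theta> (traj \<omega>)) b \<partial>P)" by (rule stationary_integral(1)[OF gm])
        also have "\<dots> = inner (mean_win q \<theta>) b" unfolding mean_win_def by (rule integral_inner_left) (rule win_integrable[OF th])
        finally show ?thesis .
      qed
    qed (rule k)+
    moreover have "AE \<omega> in P. \<forall>t::nat. ?f (int t) \<omega> = ?g (int t) \<omega>" using fg by (simp add: AE_all_countable)
    ultimately show ?thesis by eventually_elim (simp add: divide_inverse mult.commute)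
  qed
  have "AE \<omega> in P. \<forall>b\<in>Basis. (\<lambda>n. avg n (\<lambda>t. inner (win q \<theta> (\<lambda>i. Y (i + int t) \<omega>)) b)) \<longlonglongrightarrow> inner (mean_win q \<theta>) b"
    using 1 by (intro AE_finite_allI) auto
  then show ?thesis
  proof eventually_elim
    case (elim \<omega>)
    show ?case
      by (subst tendsto_componentwise_iff) (use elim in \<open>simp add: inner_sum_left\<close>)
  qed
qed

text \<open>The weights near the two ends of a block sum to at most \<open>2 / (1 - \<rho>)\<close>,
  whatever its length. Hence the mean of the average is of order \<open>1 / k n\<close>, already
  summable, and first moments suffice.\<close>

lemma boundary_average:
  "AE \<omega> in P. (\<lambda>n. avg n (\<lambda>t. M (Y (int t) \<omega>) * (\<rho> ^ (t - T n - 1) + \<rho> ^ (T n + k n - t)))) \<longlonglongrightarrow> 0"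
proof (rule AE_tendsto_0_of_summable)
  let ?X = "\<lambda>n \<omega>. avg n (\<lambda>t. M (Y (int t) \<omega>) * (\<rho> ^ (t - T n - 1) + \<rho> ^ (T n + k n - t)))"
  show "integrable P (?X n)" for n using M_Y(1) by auto
  show "0 \<le> ?X n \<omega>" for n \<omega> using M_nonneg rho by (intro scaleR_nonneg_nonneg sum_nonneg mult_nonneg_nonneg) auto
  show "(\<integral>\<omega>. ?X n \<omega> \<partial>P) \<le> mean_M * (2 / (1 - \<rho>)) * (1 / real (k n))" for n
  proof -
    have "(\<integral>\<omega>. ?X n \<omega> \<partial>P) = (\<Sum>t\<in>block n. mean_M * (\<rho> ^ (t - T n - 1) + \<rho> ^ (T n + k n - t))) / real (k n)"
      using M_Y(1,2) by (simp add: mean_M_def[symmetric] divide_inverse mult.commute)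
    also have "\<dots> = mean_M * ((\<Sum>t\<in>block n. \<rho> ^ (t - T n - 1)) + (\<Sum>t\<in>block n. \<rho> ^ (T n + k n - t))) / real (k n)"
      by (simp only: sum_distrib_left[symmetric] sum.distrib)
    also have "\<dots> \<le> mean_M * (1 / (1 - \<rho>) + 1 / (1 - \<rho>)) / real (k n)"
      using rho mean_M_nonneg by (intro divide_right_mono mult_left_mono add_mono sum_geometric_le) (auto simp: inj_on_def)
    finally show ?thesis by simp
  qed
  show "summable (\<lambda>n. mean_M * (2 / (1 - \<rho>)) * (1 / real (k n)))" by (rule summable_mult[OF k(2)])
qed

lemma avg_norm_le:
  assumes "\<And>t. t \<in> block n \<Longrightarrow> norm (f t - f' t :: 'e::real_normed_vector) \<le> c t"
  shows "norm (avg n f - avg n f') \<le> avg n c"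
proof -
  have "avg n f - avg n f' = avg n (\<lambda>t. f t - f' t)" by (simp add: sum_subtractf scaleR_diff_right)
  then have "norm (avg n f - avg n f') = norm (\<Sum>t\<in>block n. f t - f' t) / real (k n)" by (simp add: divide_inverse mult.commute)
  also have "\<dots> \<le> (\<Sum>t\<in>block n. c t) / real (k n)" using assms by (intro divide_right_mono sum_norm_le) auto
  finally show ?thesis by (simp add: divide_inverse mult.commute)
qed

text \<open>The image of \<Theta> under \<open>(\<phi>, \<psi>)\<close> is compact and so totally
  bounded; the centres of a finite cover are pulled back to parameters.\<close>

lemma finite_net:
  assumes "0 < d" shows "\<exists>F. finite F \<and> F \<subseteq> \<Theta> \<and> (\<forall>\<theta>\<in>\<Theta>. \<exists>\<theta>'\<in>F. par_dist \<theta>' \<theta> \<le> d)"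
proof -
  let ?G = "\<lambda>\<theta>. (\<phi> \<theta>, \<psi> \<theta>)"
  have c: "compact (?G ` \<Theta>)" by (intro compact_continuous_image continuous_on_Pair cont_phi cont_psi compact_Theta)
  then obtain K where K: "finite K" "K \<subseteq> ?G ` \<Theta>" "?G ` \<Theta> \<subseteq> (\<Union>x\<in>K. ball x d)"
    using seq_compact_imp_totally_bounded[OF compact_imp_seq_compact[OF c], rule_format, OF \<open>0 < d\<close>] by auto
  obtain F where F: "F \<subseteq> \<Theta>" "finite F" "K = ?G ` F" using finite_subset_image[OF K(1,2)] by auto
  have "\<exists>\<theta>'\<in>F. par_dist \<theta>' \<theta> \<le> d" if "\<theta> \<in> \<Theta>" for \<theta>
  proof -
    have "?G \<theta> \<in> (\<Union>x\<in>K. ball x d)" using K(3) that by blast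
    then obtain \<theta>' where t: "\<theta>' \<in> F" "dist (?G \<theta>') (?G \<theta>) < d" unfolding F(3) by (auto simp: mem_ball)
    have "dist (\<phi> \<theta>') (\<phi> \<theta>) \<le> dist (?G \<theta>') (?G \<theta>)" "dist (\<psi> \<theta>') (\<psi> \<theta>) \<le> dist (?G \<theta>') (?G \<theta>)"
      using dist_fst_le[of "?G \<theta>'" "?G \<theta>"] dist_snd_le[of "?G \<theta>'" "?G \<theta>"] by simp_all
    then have "par_dist \<theta>' \<theta> \<le> d" using t(2) by (auto simp: par_dist_def dist_norm norm_minus_commute abs_minus_commute)
    then show ?thesis using t(1) by blast
  qed
  then show ?thesis using F(1,2) by blast
qed

context
  fixes \<nu> :: "nat \<Rightarrow> 'x measure"
  assumes \<nu>: "\<And>n. is_prob_on lam (\<nu> n)"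
begin

abbreviation "bs n \<theta> \<omega> \<equiv> block_stat lam m g S \<theta> (\<nu> n) (T n) (k n) (traj \<omega>)"

text \<open>At a time \<open>t\<close> of the block the available past and future end with the
  block, so forgetting starts from the smaller of \<open>q\<close> and the distance to the end.
  Estimating the power of a minimum by a sum of powers separates an interior error
  \<open>\<rho> ^ q\<close> from a boundary error.\<close>

lemma block_stat_win:
  assumes th: "\<theta> \<in> \<Theta>" and \<omega>: "all_good (traj \<omega>)"
  shows "norm (bs n \<theta> \<omega> - avg n (\<lambda>t. win q \<theta> (\<lambda>i. Y (i + int t) \<omega>)))
    \<le> 2 * c_forget * \<rho> ^ q * avg n (\<lambda>t. M (Y (int t) \<omega>)) + c_forget * avg n (\<lambda>t. M (Y (int t) \<omega>) * (\<rho> ^ (t - T n - 1) + \<rho> ^ (T n + k n - t)))"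
proof -
  have min: "\<rho> ^ min a b \<le> \<rho> ^ a + \<rho> ^ b" for a b using rho by (simp add: min_def)
  have "norm (bs n \<theta> \<omega> - avg n (\<lambda>t. win q \<theta> (\<lambda>i. Y (i + int t) \<omega>)))
    \<le> avg n (\<lambda>t. c_forget * M (Y (int t) \<omega>) * ((\<rho> ^ q + \<rho> ^ (t - T n - 1)) + (\<rho> ^ q + \<rho> ^ (T n + k n - t))))"
    unfolding block_stat_def
  proof (rule avg_norm_le)
    fix t assume t: "t \<in> block n"
    have eq: "int (T n) = int t - 1 - int (t - T n - 1)" "int (T n + k n) = int t + int (T n + k n - t)" using t by auto
    have "norm (smooth lam m g S \<theta> (\<nu> n) (int (T n)) (int t) (int (T n + k n)) (traj \<omega>) - win q \<theta> (\<lambda>i. Y (i + int t) \<omega>))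
      \<le> c_forget * M (Y (int t) \<omega>) * (\<rho> ^ min q (t - T n - 1) + \<rho> ^ min q (T n + k n - t))"
      unfolding win_shift[OF th \<omega>] unfolding eq
      using smooth_S_forgetting[OF th \<omega> \<nu> nu0, of "min q (t - T n - 1)" "t - T n - 1" q "min q (T n + k n - t)" "T n + k n - t" q n "int t"] by simp
    also have "\<dots> \<le> c_forget * M (Y (int t) \<omega>) * ((\<rho> ^ q + \<rho> ^ (t - T n - 1)) + (\<rho> ^ q + \<rho> ^ (T n + k n - t)))"
      using c_forget_nonneg M_nonneg by (intro mult_left_mono add_mono min) auto
    finally show "norm (smooth lam m g S \<theta> (\<nu> n) (int (T n)) (int t) (int (T n + k n)) (traj \<omega>) - win q \<theta> (\<lambda>i. Y (i + int t) \<omega>))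
      \<le> c_forget * M (Y (int t) \<omega>) * ((\<rho> ^ q + \<rho> ^ (t - T n - 1)) + (\<rho> ^ q + \<rho> ^ (T n + k n - t)))" .
  qed
  also have "\<dots> = 2 * c_forget * \<rho> ^ q * avg n (\<lambda>t. M (Y (int t) \<omega>)) + c_forget * avg n (\<lambda>t. M (Y (int t) \<omega>) * (\<rho> ^ (t - T n - 1) + \<rho> ^ (T n + k n - t)))"
  proof -
    have "(\<lambda>t. c_forget * M (Y (int t) \<omega>) * ((\<rho> ^ q + \<rho> ^ (t - T n - 1)) + (\<rho> ^ q + \<rho> ^ (T n + k n - t))))
      = (\<lambda>t. 2 * c_forget * \<rho> ^ q * M (Y (int t) \<omega>) + c_forget * (M (Y (int t) \<omega>) * (\<rho> ^ (t - T n - 1) + \<rho> ^ (T n + k n - t))))"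
      by (simp add: fun_eq_iff algebra_simps)
    then show ?thesis by (simp only: sum.distrib sum_distrib_left[symmetric] scaleR_add_right real_scaleR_def distrib_left) (simp add: algebra_simps)
  qed
  finally show ?thesis .
qed

text \<open>Pointwise convergence is used only at the finitely many points of the net. In between,
  the block averages of the modulus control the variation for all parameters at once, and they
  converge too.\<close>

lemma uniform_lln_aux:
  assumes d: "0 < d" and \<epsilon>: "4 * c_forget * mean_M * \<rho> ^ q + 2 * mean_osc q d < \<epsilon>"
  shows "AE \<omega> in P. \<forall>\<^sub>F n in sequentially. \<forall>\<theta>\<in>\<Theta>. norm (bs n \<theta> \<omega> - ms \<theta>) < \<epsilon>"
proof -
  obtain F where F: "finite F" "F \<subseteq> \<Theta>" "\<And>\<theta>. \<theta> \<in> \<Theta> \<Longrightarrow> \<exists>\<theta>'\<in>F. par_dist \<theta>' \<theta> \<le> d" using finite_net[OF d] by blast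
  have Fne: "F \<noteq> {}" using F(3) Theta_ne by blast
  have wF: "AE \<omega> in P. \<forall>\<theta>\<in>F. (\<lambda>n. avg n (\<lambda>t. win q \<theta> (\<lambda>i. Y (i + int t) \<omega>))) \<longlonglongrightarrow> mean_win q \<theta>"
    using F(1,2) win_average by (intro AE_finite_allI) auto
  show ?thesis
    using traj_good M_average boundary_average win_osc_average[OF less_imp_le[OF d], of q] wF
  proof eventually_elim
    case (elim \<omega>)
    let ?M = "\<lambda>n. avg n (\<lambda>t. M (Y (int t) \<omega>))" and ?B = "\<lambda>n. avg n (\<lambda>t. M (Y (int t) \<omega>) * (\<rho> ^ (t - T n - 1) + \<rho> ^ (T n + k n - t)))"
    let ?O = "\<lambda>n. avg n (\<lambda>t. win_osc q d (\<lambda>i. Y (i + int t) \<omega>))" and ?W = "\<lambda>\<theta> n. avg n (\<lambda>t. win q \<theta> (\<lambda>i. Y (i + int t) \<omega>))"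
    \<comment> \<open>A bound for the total error that does not mention \<theta>. In its limit
      \<open>2 * c_forget * mean_M * \<rho> ^ q\<close> occurs twice, for replacing block statistics
      by windows and for replacing the mean of windows by \<open>ms\<close>, and
      \<open>mean_osc q d\<close> occurs twice, for moving to the net inside the block average and
      inside the expectation.\<close>
    define r where "r n = (2 * c_forget * \<rho> ^ q * ?M n + c_forget * ?B n) + ?O n + (\<Sum>\<theta>\<in>F. norm (?W \<theta> n - mean_win q \<theta>)) + mean_osc q d + 2 * c_forget * mean_M * \<rho> ^ q" for n
    have "(\<lambda>n. \<Sum>\<theta>\<in>F. norm (?W \<theta> n - mean_win q \<theta>)) \<longlonglongrightarrow> (\<Sum>\<theta>\<in>F. 0)"
      using elim(5) by (intro tendsto_sum tendsto_norm_zero LIM_zero) auto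
    then have "r \<longlonglongrightarrow> (2 * c_forget * \<rho> ^ q * mean_M + c_forget * 0) + mean_osc q d + (\<Sum>\<theta>\<in>F. 0) + mean_osc q d + 2 * c_forget * mean_M * \<rho> ^ q"
      unfolding r_def using elim(2,3,4) by (intro tendsto_add tendsto_mult tendsto_const)
    moreover have "(2 * c_forget * \<rho> ^ q * mean_M + c_forget * 0) + mean_osc q d + (\<Sum>\<theta>\<in>F. 0) + mean_osc q d + 2 * c_forget * mean_M * \<rho> ^ q = 4 * c_forget * mean_M * \<rho> ^ q + 2 * mean_osc q d"
      by simp
    ultimately have "\<forall>\<^sub>F n in sequentially. r n < \<epsilon>" using \<epsilon> by (simp add: order_tendsto_iff)
    then show ?case
    proof eventually_elim
      case (elim n)
      show ?case
      proof
        fix \<theta> assume th: "\<theta> \<in> \<Theta>"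
        obtain \<theta>' where t: "\<theta>' \<in> F" "par_dist \<theta>' \<theta> \<le> d" using F(3)[OF th] by blast
        have th': "\<theta>' \<in> \<Theta>" using t F by auto
        have dd: "0 \<le> d" "\<bar>\<phi> \<theta> - \<phi> \<theta>'\<bar> \<le> d" "norm (\<psi> \<theta> - \<psi> \<theta>') \<le> d" using d t(2) by (auto simp: par_dist_def)
        have 1: "norm (bs n \<theta> \<omega> - ?W \<theta> n) \<le> 2 * c_forget * \<rho> ^ q * ?M n + c_forget * ?B n"
          by (rule block_stat_win[OF th \<open>all_good (traj \<omega>)\<close>])
        have 2: "norm (?W \<theta> n - ?W \<theta>' n) \<le> ?O n"
          by (intro avg_norm_le win_perturb[OF th' th all_good_shift[OF \<open>all_good (traj \<omega>)\<close>] dd])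
        have 3: "norm (?W \<theta>' n - mean_win q \<theta>') \<le> (\<Sum>\<theta>\<in>F. norm (?W \<theta> n - mean_win q \<theta>))"
          using F(1) t(1) by (intro member_le_sum) auto
        have 4: "norm (mean_win q \<theta>' - mean_win q \<theta>) \<le> mean_osc q d"
        proof -
          have "mean_win q \<theta> - mean_win q \<theta>' = (\<integral>\<omega>. win q \<theta> (traj \<omega>) - win q \<theta>' (traj \<omega>) \<partial>P)"
            using win_integrable[OF th] win_integrable[OF th'] by (simp add: mean_win_def)
          then have "norm (mean_win q \<theta> - mean_win q \<theta>') \<le> (\<integral>\<omega>. norm (win q \<theta> (traj \<omega>) - win q \<theta>' (traj \<omega>)) \<partial>P)"
            by (simp only: integral_norm_bound)
          also have "\<dots> \<le> mean_osc q d" unfolding mean_osc_def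
          proof (rule integral_mono_AE)
            show "AE \<omega> in P. norm (win q \<theta> (traj \<omega>) - win q \<theta>' (traj \<omega>)) \<le> win_osc q d (traj \<omega>)"
              using traj_good by eventually_elim (rule win_perturb[OF th' th _ dd])
          qed (use win_integrable[OF th] win_integrable[OF th'] win_osc_integrable[OF dd(1)] in auto)
          finally show ?thesis by (simp add: norm_minus_commute)
        qed
        have 5: "norm (mean_win q \<theta> - ms \<theta>) \<le> 2 * c_forget * mean_M * \<rho> ^ q"
          using mean_stat_close[OF th, of q] by (simp add: norm_minus_commute)
        have eq: "bs n \<theta> \<omega> - ms \<theta> = (bs n \<theta> \<omega> - ?W \<theta> n) + (?W \<theta> n - ?W \<theta>' n) + (?W \<theta>' n - mean_win q \<theta>') + (mean_win q \<theta>' - mean_win q \<theta>) + (mean_win q \<theta> - ms \<theta>)"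
          by simp
        have "norm (bs n \<theta> \<omega> - ms \<theta>) \<le> r n"
          unfolding r_def by (subst eq, intro norm_triangle_mono 1 2 3 4 5)
        then show "norm (bs n \<theta> \<omega> - ms \<theta>) < \<epsilon>" using elim by simp
      qed
    qed
  qed
qed

text \<open>The exceptional set must not depend on \<theta>, because the statement is later applied
  at the random parameter of the algorithm. Restricting the accuracy to reciprocals of integers
  keeps the number of exceptional sets countable.\<close>

lemma uniform_lln:
  "AE \<omega> in P. \<forall>\<epsilon>>0. \<forall>\<^sub>F n in sequentially. \<forall>\<theta>\<in>\<Theta>. norm (bs n \<theta> \<omega> - ms \<theta>) < \<epsilon>"
proof -
  have "AE \<omega> in P. \<forall>\<^sub>F n in sequentially. \<forall>\<theta>\<in>\<Theta>. norm (bs n \<theta> \<omega> - ms \<theta>) < 1 / real (Suc N)" for N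
  proof -
    define e where "e = 1 / real (Suc N)"
    have e: "0 < e" by (simp add: e_def)
    \<comment> \<open>The window size is fixed before the mesh of the net, since the oscillation of
      a window depends on its size.\<close>
    have "\<forall>\<^sub>F q in sequentially. 4 * c_forget * mean_M * \<rho> ^ q < e / 2"
      using e by (intro order_tendstoD(2)[OF rho_power_tendsto]) simp
    then obtain q where q: "4 * c_forget * mean_M * \<rho> ^ q < e / 2" using eventually_happens' sequentially_bot by blast
    have "(\<lambda>n. mean_osc q (inverse (real (Suc n)))) \<longlonglongrightarrow> 0" by (rule mean_osc_tendsto[OF LIMSEQ_inverse_real_of_nat]) simp
    then have "\<forall>\<^sub>F n in sequentially. mean_osc q (inverse (real (Suc n))) < e / 4" by (rule order_tendstoD(2)) (use e in simp)
    then obtain n where n: "mean_osc q (inverse (real (Suc n))) < e / 4" using eventually_happens' sequentially_bot by blast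
    show ?thesis unfolding e_def[symmetric]
    proof (rule uniform_lln_aux)
      show "0 < inverse (real (Suc n))" by simp
      show "4 * c_forget * mean_M * \<rho> ^ q + 2 * mean_osc q (inverse (real (Suc n))) < e" using q n by linarith
    qed
  qed
  then have "AE \<omega> in P. \<forall>N. \<forall>\<^sub>F n in sequentially. \<forall>\<theta>\<in>\<Theta>. norm (bs n \<theta> \<omega> - ms \<theta>) < 1 / real (Suc N)"
    by (simp only: AE_all_countable) blast
  then show ?thesis
  proof eventually_elim
    case (elim \<omega>)
    show ?case
    proof (intro allI impI)
      fix \<epsilon> :: real assume "0 < \<epsilon>"
      then obtain N where N: "1 / real (Suc N) < \<epsilon>" using nat_approx_posE by blast
      from elim[rule_format, of N] show "\<forall>\<^sub>F n in sequentially. \<forall>\<theta>\<in>\<Theta>. norm (bs n \<theta> \<omega> - ms \<theta>) < \<epsilon>"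
        by eventually_elim (use N in \<open>meson less_trans\<close>)
    qed
  qed
qed

end
end
end

section \<open>Convergence of the algorithm\<close>

text \<open>The perturbed points need not lie in \<open>K\<close>, and \<open>f\<close> need not be
  uniformly continuous on \<open>U\<close>. A closed neighbourhood of \<open>K\<close> inside
  \<open>U\<close> is still compact and contains all perturbed points from some index on. It is
  applied to the M-step near the compact set of mean statistics.\<close>

lemma continuous_near_compact:
  fixes f :: "'a::euclidean_space \<Rightarrow> 'b::metric_space"
  assumes K: "compact K" "K \<subseteq> U" "open U" and f: "continuous_on U f"
    and x: "\<And>n. x n \<in> U" and y: "\<And>n. y n \<in> K" and d: "(\<lambda>n. x n - y n) \<longlonglongrightarrow> 0"
  shows "(\<lambda>n. dist (f (x n)) (f (y n))) \<longlonglongrightarrow> 0"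
proof -
  have K0: "K \<noteq> {}" using y by blast
  obtain e where e: "0 < e" "{x. infdist x K \<le> e} \<subseteq> U" using compact_in_open_separated[OF K0 K(1,3,2)] by blast
  define K' where "K' = {x. infdist x K \<le> e}"
  have "compact K'" unfolding K'_def using K0 K(1) e(1) by (rule compact_infdist_le)
  then have u: "uniformly_continuous_on K' f"
    using f e(2) by (intro compact_uniformly_continuous) (auto simp: K'_def intro: continuous_on_subset)
  show ?thesis
  proof (rule tendstoI)
    fix r :: real assume "0 < r"
    then obtain \<delta> where \<delta>: "0 < \<delta>" "\<And>a b. a \<in> K' \<Longrightarrow> b \<in> K' \<Longrightarrow> dist b a < \<delta> \<Longrightarrow> dist (f b) (f a) < r"
      using u unfolding uniformly_continuous_on_def by metis
    have "\<forall>\<^sub>F n in sequentially. norm (x n - y n) < min e \<delta>"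
      using d e(1) \<delta>(1) by (intro order_tendstoD(2)[OF tendsto_norm_zero]) auto
    then show "\<forall>\<^sub>F n in sequentially. dist (dist (f (x n)) (f (y n))) 0 < r"
    proof eventually_elim
      case (elim n)
      have "infdist (x n) K \<le> dist (x n) (y n)" using y by (rule infdist_le)
      then have "x n \<in> K'" using elim by (simp add: K'_def dist_norm)
      moreover have "y n \<in> K'" using y e(1) by (simp add: K'_def)
      ultimately show ?case using \<delta>(2)[of "y n" "x n"] elim by (simp add: dist_norm)
    qed
  qed
qed

text \<open>The \<open>p\<close>-th power of the norm is the mean of the \<open>p\<close>-th power,
  so summable bounds on it give almost sure convergence. The bound holds only eventually, hence the
  shift by \<open>N\<close>.\<close>

lemma AE_tendsto_0_of_Lp_norm:
  fixes Z :: "nat \<Rightarrow> 'w \<Rightarrow> 'e::euclidean_space"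
  assumes p: "0 < p" and i: "\<And>n. integrable P (\<lambda>\<omega>. norm (Z n \<omega>) powr p)"
    and le: "\<forall>\<^sub>F n in sequentially. Lp_norm P p (Z n) powr p \<le> c n" and c: "summable c"
  shows "AE \<omega> in P. (\<lambda>n. Z n \<omega>) \<longlonglongrightarrow> 0"
proof -
  obtain N where N: "\<And>n. N \<le> n \<Longrightarrow> Lp_norm P p (Z n) powr p \<le> c n" using le by (auto simp: eventually_sequentially)
  have "AE \<omega> in P. (\<lambda>n. norm (Z (n + N) \<omega>) powr p) \<longlonglongrightarrow> 0"
  proof (rule AE_tendsto_0_of_summable)
    show "summable (\<lambda>n. c (n + N))" using c by (simp add: summable_iff_shift)
    show "(\<integral>\<omega>. norm (Z (n + N) \<omega>) powr p \<partial>P) \<le> c (n + N)" for n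
      using N[of "n + N"] p by (simp add: Lp_norm_def powr_powr)
  qed (use i in auto)
  then show ?thesis
  proof eventually_elim
    case (elim \<omega>)
    have "(\<lambda>n. (norm (Z (n + N) \<omega>) powr p) powr (1 / p)) \<longlonglongrightarrow> 0"
      by (rule tendsto_zero_powrI[OF elim tendsto_const]) (use p in auto)
    then have "(\<lambda>n. norm (Z (n + N) \<omega>)) \<longlonglongrightarrow> 0" using p by (simp add: powr_powr)
    then have "(\<lambda>n. norm (Z n \<omega>)) \<longlonglongrightarrow> 0" by (rule LIMSEQ_offset)
    then show ?case by (rule tendsto_norm_zero_cancel)
  qed
qed

text \<open>Rounding down costs at most a factor 2, because the block size is at least 1:
  \<open>c * n powr a < \<tau> n + 1 \<le> 2 * \<tau> n\<close>.\<close>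

lemma summable_inverse_block_size:
  fixes \<tau> :: "nat \<Rightarrow> nat"
  assumes \<tau>: "\<And>n. 1 \<le> n \<Longrightarrow> 0 < \<tau> n" "\<And>n. 1 \<le> n \<Longrightarrow> int (\<tau> n) = \<lfloor>c * real n powr a\<rfloor>" and c: "0 < c" and a: "1 < a"
  shows "summable (\<lambda>n. 1 / real (\<tau> (n + 1)))"
proof (rule summable_comparison_test')
  have "summable (\<lambda>n. real n powr (- a))" using a by (simp add: summable_real_powr_iff)
  then have "summable (\<lambda>n. real (Suc n) powr (- a))" by (subst summable_Suc_iff)
  then show "summable (\<lambda>n. 2 / c * real (Suc n) powr (- a))" by (rule summable_mult)
  fix n :: nat assume "0 \<le> n"
  have t: "1 \<le> real (\<tau> (n + 1))" using \<tau>(1)[of "n + 1"] by linarith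
  have "c * real (n + 1) powr a < real_of_int \<lfloor>c * real (n + 1) powr a\<rfloor> + 1" by linarith
  also have "real_of_int \<lfloor>c * real (n + 1) powr a\<rfloor> = real (\<tau> (n + 1))" using \<tau>(2)[of "n + 1"] by simp
  finally have "c * real (n + 1) powr a \<le> 2 * real (\<tau> (n + 1))" using t by linarith
  then show "norm (1 / real (\<tau> (n + 1))) \<le> 2 / c * real (Suc n) powr (- a)"
    using c t by (simp add: powr_minus field_simps add.commute)
qed

locale boem_algorithm = boem_model P lam mu Y \<Theta> m g \<phi> \<psi> S s1 s2 M \<beta> p
  for P :: "'w measure" and lam :: "'x measure" and mu :: "'y measure" and Y
    and \<Theta> :: "'t::euclidean_space set" and m g \<phi> and \<psi> :: "'t \<Rightarrow> 'd::euclidean_space" and S s1 s2 M \<beta> p +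
  fixes Sset :: "'d set" and \<theta>bar :: "'d \<Rightarrow> 't"
  assumes Sset: "open Sset" "convex hull (range (\<lambda>(x, x', y). S x x' y)) \<subseteq> Sset"
    and M_step_cont: "continuous_on Sset \<theta>bar"
    and M_step: "\<And>s. s \<in> Sset \<Longrightarrow>
        {\<theta>. is_arg_max (\<lambda>\<theta>. \<phi> \<theta> + inner s (\<psi> \<theta>)) (\<lambda>\<theta>. \<theta> \<in> \<Theta>) \<theta>} = {\<theta>bar s}"
    and no_interior: "interior ((\<lambda>\<theta>. exp (limit_loglik P Y lam m g \<theta>)) `
        {\<theta> \<in> \<Theta>. \<theta>bar (mean_stat P Y lam m g S \<theta>) = \<theta>}) = {}"
begin

abbreviation "em \<theta> \<equiv> \<theta>bar (ms \<theta>)"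
abbreviation "lik \<theta> \<equiv> exp (ll \<theta>)"

lemma mean_stat_Sset: "\<theta> \<in> \<Theta> \<Longrightarrow> ms \<theta> \<in> Sset"
  using mean_stat_in_hull Sset(2) by blast

lemma theta_bar:
  assumes "s \<in> Sset"
  shows "\<theta>bar s \<in> \<Theta>" "\<theta> \<in> \<Theta> \<Longrightarrow> \<phi> \<theta> + inner s (\<psi> \<theta>) \<le> \<phi> (\<theta>bar s) + inner s (\<psi> (\<theta>bar s))"
    "\<theta> \<in> \<Theta> \<Longrightarrow> \<phi> (\<theta>bar s) + inner s (\<psi> (\<theta>bar s)) \<le> \<phi> \<theta> + inner s (\<psi> \<theta>) \<Longrightarrow> \<theta>bar s = \<theta>"
proof -
  have max: "is_arg_max (\<lambda>\<theta>. \<phi> \<theta> + inner s (\<psi> \<theta>)) (\<lambda>\<theta>. \<theta> \<in> \<Theta>) (\<theta>bar s)" using M_step[OF assms] by blast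
  then show "\<theta>bar s \<in> \<Theta>" by (simp add: is_arg_max_def)
  show le: "\<phi> \<theta> + inner s (\<psi> \<theta>) \<le> \<phi> (\<theta>bar s) + inner s (\<psi> (\<theta>bar s))" if "\<theta> \<in> \<Theta>" for \<theta>
    using max that unfolding is_arg_max_def by (meson not_le)
  show "\<theta>bar s = \<theta>" if th: "\<theta> \<in> \<Theta>" "\<phi> (\<theta>bar s) + inner s (\<psi> (\<theta>bar s)) \<le> \<phi> \<theta> + inner s (\<psi> \<theta>)"
  proof -
    have "\<theta> \<in> {\<theta>. is_arg_max (\<lambda>\<theta>. \<phi> \<theta> + inner s (\<psi> \<theta>)) (\<lambda>\<theta>. \<theta> \<in> \<Theta>) \<theta>}"
      unfolding is_arg_max_def using th le by (auto simp: not_less intro: order_trans)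
    then show ?thesis unfolding M_step[OF assms] by simp
  qed
qed

lemma em_Theta: "\<theta> \<in> \<Theta> \<Longrightarrow> em \<theta> \<in> \<Theta>"
  by (intro theta_bar(1) mean_stat_Sset)

text \<open>The exact iteration, with \<open>s n = ms (x n)\<close>, and the algorithm are both
  instances. The likelihood is a strict Lyapunov function: if a step leaves it unchanged, the EM
  inequality makes the old parameter another maximizer in the M-step, and the maximizer is
  unique.\<close>

lemma perturbed_em_converges:
  assumes x: "\<And>n. x n \<in> \<Theta>" and s: "\<And>n. s n \<in> Sset" "\<And>n. x (Suc n) = \<theta>bar (s n)"
    and close: "(\<lambda>n. s n - ms (x n)) \<longlonglongrightarrow> 0"
  shows "\<exists>w. converges_to_set x {\<theta> \<in> {\<theta> \<in> \<Theta>. em \<theta> = \<theta>}. lik \<theta> = w}"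
proof (rule perturbed_lyapunov_converges[OF compact_Theta x])
  show "continuous_on \<Theta> em"
    by (rule continuous_on_compose2[OF M_step_cont mean_stat_continuous]) (use mean_stat_Sset in auto)
  show "em ` \<Theta> \<subseteq> \<Theta>" using em_Theta by auto
  show "continuous_on \<Theta> lik" by (intro continuous_on_exp loglik_continuous)
  fix \<theta> assume th: "\<theta> \<in> \<Theta>"
  note em = em_inequality[OF th em_Theta[OF th]] and tb = theta_bar[OF mean_stat_Sset[OF th]]
  show "lik \<theta> \<le> lik (em \<theta>)" using em tb(2)[OF th] by simp
  show "em \<theta> = \<theta>" if "lik (em \<theta>) = lik \<theta>"
    using em that by (intro tb(3)[OF th]) simp
next
  show "interior (lik ` {\<theta> \<in> \<Theta>. em \<theta> = \<theta>}) = {}" by (rule no_interior)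
  have "compact (ms ` \<Theta>)" by (rule compact_continuous_image[OF mean_stat_continuous compact_Theta])
  then show "(\<lambda>n. dist (x (Suc n)) (em (x n))) \<longlonglongrightarrow> 0"
    unfolding s(2) using x mean_stat_Sset by (intro continuous_near_compact[OF _ _ Sset(1) M_step_cont s(1) _ close]) auto
qed simp

lemma limiting_em_converges:
  assumes "\<theta> \<in> \<Theta>"
  shows "\<exists>w. converges_to_set (\<lambda>k. (em ^^ k) \<theta>) {\<theta> \<in> {\<theta> \<in> \<Theta>. em \<theta> = \<theta>}. lik \<theta> = w}"
proof -
  have x: "(em ^^ k) \<theta> \<in> \<Theta>" for k using assms by (induction k) (auto intro: em_Theta)
  show ?thesis
    by (rule perturbed_em_converges[where s = "\<lambda>k. ms ((em ^^ k) \<theta>)"]) (use x mean_stat_Sset in auto)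
qed

text \<open>The argument is pathwise, on the event where the uniform law of large numbers holds and
  the Monte Carlo errors vanish. The limiting level may therefore depend on the realization.\<close>

lemma boem_converges:
  fixes N :: "nat \<Rightarrow> 'u measure"
  assumes run: "boem_run P mu Y lam \<Theta> Sset \<theta>bar \<tau> \<nu> N U \<theta>s St"
    and \<tau>: "0 < c" "1 < a" "\<And>n. 1 \<le> n \<Longrightarrow> int (\<tau> n) = \<lfloor>c * real n powr a\<rfloor>" and b: "(a + 1) / (2 * a) \<le> b"
    and int: "\<And>n. integrable P (\<lambda>\<omega>. norm (boem_stat Y lam m g S \<tau> \<nu> \<theta>s n \<omega> - St n \<omega>) powr p)"
    and rate: "(\<lambda>n. Lp_norm P p (\<lambda>\<omega>. boem_stat Y lam m g S \<tau> \<nu> \<theta>s n \<omega> - St n \<omega>)) \<in> O(\<lambda>n. real (\<tau> (n + 1)) powr (- b))"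
  shows "AE \<omega> in P. \<exists>w. converges_to_set (\<lambda>n. \<theta>s n \<omega>) {\<theta> \<in> {\<theta> \<in> \<Theta>. em \<theta> = \<theta>}. lik \<theta> = w}"
proof -
  let ?D = "\<lambda>n \<omega>. boem_stat Y lam m g S \<tau> \<nu> \<theta>s n \<omega> - St n \<omega>"
  have pos: "0 < \<tau> n" if "1 \<le> n" for n using run that by (simp add: boem_run_def)
  have \<nu>: "is_prob_on lam (\<nu> n)" for n using run by (simp add: boem_run_def)
  have sum: "summable (\<lambda>n. 1 / real (\<tau> (n + 1)))" by (rule summable_inverse_block_size[OF pos \<tau>(3,1,2)])
  have lln: "AE \<omega> in P. \<forall>\<epsilon>>0. \<forall>\<^sub>F n in sequentially. \<forall>\<theta>\<in>\<Theta>.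
      norm (block_stat lam m g S \<theta> (\<nu> n) (block_end \<tau> n) (\<tau> (n + 1)) (traj \<omega>) - ms \<theta>) < \<epsilon>"
    using pos by (intro uniform_lln[where k = "\<lambda>n. \<tau> (n + 1)"] \<nu> sum) simp
  have mc: "AE \<omega> in P. (\<lambda>n. ?D n \<omega>) \<longlonglongrightarrow> 0"
  proof -
    obtain C where C: "C > 0" "\<forall>\<^sub>F n in sequentially. norm (Lp_norm P p (?D n)) \<le> C * norm (real (\<tau> (n + 1)) powr (- b))"
      using landau_o.bigE[OF rate] by blast
    \<comment> \<open>The threshold \<open>(a + 1) / (2 * a)\<close> exceeds 1/2 and
      \<open>p\<close> exceeds 2. So the \<open>p\<close>-th moments of the Monte Carlo errors are
      of order \<open>1 / \<tau> (n + 1)\<close>, the same summable sequence as for the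
      variances.\<close>
    have bp: "1 \<le> b * p"
    proof -
      have "1 / 2 \<le> (a + 1) / (2 * a)" using \<tau>(2) by (simp add: field_simps)
      then have "1 / 2 \<le> b" using b by linarith
      then have "1 / 2 * 2 \<le> b * p" using p by (intro mult_mono) auto
      then show ?thesis by simp
    qed
    show ?thesis
    proof (rule AE_tendsto_0_of_Lp_norm[OF _ int])
      show "summable (\<lambda>n. C powr p * (1 / real (\<tau> (n + 1))))" by (rule summable_mult[OF sum])
      show "\<forall>\<^sub>F n in sequentially. Lp_norm P p (?D n) powr p \<le> C powr p * (1 / real (\<tau> (n + 1)))"
        using C(2)
      proof eventually_elim
        case (elim n)
        have t: "1 \<le> real (\<tau> (n + 1))" using pos[of "n + 1"] by linarith
        have "Lp_norm P p (?D n) powr p \<le> (C * real (\<tau> (n + 1)) powr (- b)) powr p"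
          using elim p by (intro powr_mono2) (auto simp: Lp_norm_def)
        also have "\<dots> = C powr p * real (\<tau> (n + 1)) powr (- (b * p))" using C(1) by (simp add: powr_mult powr_powr)
        also have "\<dots> \<le> C powr p * real (\<tau> (n + 1)) powr (- 1)" using t bp by (intro mult_left_mono powr_mono) auto
        also have "\<dots> = C powr p * (1 / real (\<tau> (n + 1)))" using t by (simp add: powr_minus divide_inverse)
        finally show ?case .
      qed
    qed (use p in simp)
  qed
  show ?thesis
    using lln mc AE_space
  proof eventually_elim
    case (elim \<omega>)
    have St: "St n \<omega> \<in> Sset" "\<theta>s (Suc n) \<omega> = \<theta>bar (St n \<omega>)" for n
      using run elim(3) unfolding boem_run_def by blast+
    have th: "\<theta>s n \<omega> \<in> \<Theta>" for n
    proof (cases n)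
      case 0
      then show ?thesis using run elim(3) unfolding boem_run_def by auto
    next
      case (Suc n)
      then show ?thesis using theta_bar(1)[OF St(1)] St(2) by simp
    qed
    show ?case
    proof (rule perturbed_em_converges[where x = "\<lambda>n. \<theta>s n \<omega>" and s = "\<lambda>n. St n \<omega>", OF th St])
      have "(\<lambda>n. boem_stat Y lam m g S \<tau> \<nu> \<theta>s n \<omega> - ms (\<theta>s n \<omega>)) \<longlonglongrightarrow> 0"
      proof (rule tendstoI)
        fix \<epsilon> :: real assume "0 < \<epsilon>"
        from elim(1)[rule_format, OF this]
        show "\<forall>\<^sub>F n in sequentially. dist (boem_stat Y lam m g S \<tau> \<nu> \<theta>s n \<omega> - ms (\<theta>s n \<omega>)) 0 < \<epsilon>"
          by eventually_elim (use th in \<open>simp add: boem_stat_def\<close>)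
      qed
      from tendsto_diff[OF this elim(2)] show "(\<lambda>n. St n \<omega> - ms (\<theta>s n \<omega>)) \<longlonglongrightarrow> 0" by simp
    qed
  qed
qed

end

section \<open>Assembling the convergence statements from the model assumptions\<close>

theorem theorem4p4:
  fixes P :: "'w measure"
    and lam :: "'x::topological_space measure"
    and mu :: "'y::topological_space measure"
    and Y :: "int \<Rightarrow> 'w \<Rightarrow> 'y"
    and \<Theta> :: "'t::euclidean_space set"
    and m :: "'t \<Rightarrow> 'x \<Rightarrow> 'x \<Rightarrow> real"
    and g :: "'t \<Rightarrow> 'x \<Rightarrow> 'y \<Rightarrow> real"
    and \<phi> :: "'t \<Rightarrow> real"
    and \<psi> :: "'t \<Rightarrow> 'd::euclidean_space"
    and S :: "'x \<Rightarrow> 'x \<Rightarrow> 'y \<Rightarrow> 'd"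
    and Sset :: "'d set"
    and \<theta>bar :: "'d \<Rightarrow> 't"
    and R :: "'t \<Rightarrow> 't"
    and W :: "'t \<Rightarrow> real"
    and L :: "'t set"
    and p C0 \<beta> :: real
  assumes p: "p > 2"
    \<comment> \<open>model\<close>
    and Theta: "compact \<Theta>"
    and lam: "finite_measure lam" "space lam = UNIV"
    and mu: "sigma_finite_measure mu" "space mu = UNIV"
    and m_density: "\<And>\<theta>. \<theta> \<in> \<Theta> \<Longrightarrow> (\<lambda>(x, x'). m \<theta> x x') \<in> borel_measurable (lam \<Otimes>\<^sub>M lam)"
      "\<And>\<theta> x x'. \<theta> \<in> \<Theta> \<Longrightarrow> 0 \<le> m \<theta> x x'"
      "\<And>\<theta> x. \<theta> \<in> \<Theta> \<Longrightarrow> (\<integral>\<^sup>+x'. ennreal (m \<theta> x x') \<partial>lam) = 1"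
    and g_density: "\<And>\<theta>. \<theta> \<in> \<Theta> \<Longrightarrow> (\<lambda>(x, y). g \<theta> x y) \<in> borel_measurable (lam \<Otimes>\<^sub>M mu)"
      "\<And>\<theta> x y. \<theta> \<in> \<Theta> \<Longrightarrow> 0 \<le> g \<theta> x y"
      "\<And>\<theta> x. \<theta> \<in> \<Theta> \<Longrightarrow> (\<integral>\<^sup>+y. ennreal (g \<theta> x y) \<partial>mu) = 1"
    \<comment> \<open>observations\<close>
    and P: "prob_space P"
    and Y: "\<And>k. Y k \<in> measurable P mu"
    \<comment> \<open>exponential family\<close>
    and phi_psi: "continuous_on \<Theta> \<phi>" "continuous_on \<Theta> \<psi>"
    and S_cont: "continuous_on UNIV (\<lambda>(x, x', y). S x x' y)"
    and S_meas: "(\<lambda>(x, x', y). S x x' y) \<in> borel_measurable (lam \<Otimes>\<^sub>M lam \<Otimes>\<^sub>M mu)"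
    and exp_family: "\<And>\<theta> x x' y. \<theta> \<in> \<Theta> \<Longrightarrow> m \<theta> x x' > 0 \<and> g \<theta> x' y > 0 \<and>
        ln (m \<theta> x x') + ln (g \<theta> x' y) = \<phi> \<theta> + inner (S x x' y) (\<psi> \<theta>)"
    and Sset: "open Sset" "convex hull (range (\<lambda>(x, x', y). S x x' y)) \<subseteq> Sset"
    and M_step: "continuous_on Sset \<theta>bar"
      "\<And>s. s \<in> Sset \<Longrightarrow>
        {\<theta>. is_arg_max (\<lambda>\<theta>. \<phi> \<theta> + inner s (\<psi> \<theta>)) (\<lambda>\<theta>. \<theta> \<in> \<Theta>) \<theta>} = {\<theta>bar s}"
    \<comment> \<open>strong mixing\<close>
    and strong_mixing: "\<exists>\<sigma>1 \<sigma>2. 0 < \<sigma>1 \<and> (\<forall>\<theta>\<in>\<Theta>. \<forall>x x'. \<sigma>1 \<le> m \<theta> x x' \<and> m \<theta> x x' \<le> \<sigma>2)"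
    \<comment> \<open>moments\<close>
    and moments: "(\<lambda>y. SUP (x, x'). ennreal (norm (S x x' y) powr p)) \<in> borel_measurable mu"
      "(\<integral>\<^sup>+\<omega>. (SUP (x, x'). ennreal (norm (S x x' (Y 0 \<omega>)) powr p)) \<partial>P) < \<infinity>"
    \<comment> \<open>stationarity, mixing and integrability of the observations\<close>
    and stationary: "stationary_process P mu Y"
    and beta_mixing: "0 \<le> C0" "C0 < 1" "0 < \<beta>" "\<beta> < 1"
      "\<And>n. mixing_coeff P mu Y n \<le> C0 * \<beta> ^ n"
    and b_finite: "AE \<omega> in P. 0 < b_minus lam g \<Theta> (Y 0 \<omega>) \<and> b_plus lam g \<Theta> (Y 0 \<omega>) < \<infinity>"
    and b_log: "integrable P (\<lambda>\<omega>. \<bar>ln (enn2real (b_minus lam g \<Theta> (Y 0 \<omega>)))\<bar>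
                                  + \<bar>ln (enn2real (b_plus lam g \<Theta> (Y 0 \<omega>)))\<bar>)"
    \<comment> \<open>limiting EM\<close>
    and R_def: "\<And>\<theta>. R \<theta> = \<theta>bar (mean_stat P Y lam m g S \<theta>)"
    and L_def: "L = {\<theta> \<in> \<Theta>. R \<theta> = \<theta>}"
    and W_def: "\<And>\<theta>. W \<theta> = exp (limit_loglik P Y lam m g \<theta>)"
    and W_L: "interior (W ` L) = {}"
  shows "(\<forall>\<theta>0\<in>\<Theta>. \<exists>w. converges_to_set (\<lambda>k. (R ^^ k) \<theta>0) {\<theta> \<in> L. W \<theta> = w}) \<and>
    (\<forall>\<tau> \<nu> (N :: nat \<Rightarrow> 'u measure) U \<theta>s St.
       boem_run P mu Y lam \<Theta> Sset \<theta>bar \<tau> \<nu> N U \<theta>s St \<longrightarrow>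
       (\<exists>c>0. \<exists>a>1. (\<forall>n\<ge>1. int (\<tau> n) = \<lfloor>c * real n powr a\<rfloor>) \<and>
          (\<exists>b\<ge>(a + 1) / (2 * a).
             (\<forall>n. integrable P (\<lambda>\<omega>. norm (boem_stat Y lam m g S \<tau> \<nu> \<theta>s n \<omega> - St n \<omega>) powr p)) \<and>
             (\<lambda>n. Lp_norm P p (\<lambda>\<omega>. boem_stat Y lam m g S \<tau> \<nu> \<theta>s n \<omega> - St n \<omega>))
               \<in> O(\<lambda>n. real (\<tau> (n + 1)) powr (- b)))) \<longrightarrow>
       (AE \<omega> in P. \<exists>w. converges_to_set (\<lambda>n. \<theta>s n \<omega>) {\<theta> \<in> L. W \<theta> = w}))"
proof -
  obtain \<sigma>1 \<sigma>2 where \<sigma>: "0 < \<sigma>1" "\<And>\<theta> x x'. \<theta> \<in> \<Theta> \<Longrightarrow> \<sigma>1 \<le> m \<theta> x x'" "\<And>\<theta> x x'. \<theta> \<in> \<Theta> \<Longrightarrow> m \<theta> x x' \<le> \<sigma>2"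
    using strong_mixing by blast
  define Q where "Q y = (SUP (x, x'). ennreal (norm (S x x' y) powr p))" for y
  \<comment> \<open>The root makes the \<open>p\<close>-th moment of \<open>M\<close> the assumed
    one. Where the supremum is infinite, \<open>enn2real\<close> turns \<open>M\<close> into 0 and
    the domination of \<open>S\<close> fails; the good observations are thus exactly those with
    \<open>Q y < \<infinity>\<close>, a measurable set.\<close>
  define M where "M y = enn2real (Q y) powr (1 / p)" for y
  have Qm [measurable]: "Q \<in> borel_measurable mu" using moments(1) by (simp add: Q_def[abs_def])
  have good_iff: "(\<forall>x x'. norm (S x x' y) \<le> M y) \<longleftrightarrow> Q y < \<infinity>" for y
  proof
    assume *: "\<forall>x x'. norm (S x x' y) \<le> M y"
    have "Q y \<le> ennreal (M y powr p)" unfolding Q_def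
      using * p by (intro SUP_least) (auto intro!: ennreal_leI powr_mono2)
    then show "Q y < \<infinity>" by (rule le_less_trans) simp
  next
    assume fin: "Q y < \<infinity>"
    show "\<forall>x x'. norm (S x x' y) \<le> M y"
    proof (intro allI)
      fix x x'
      have "ennreal (norm (S x x' y) powr p) \<le> Q y"
        unfolding Q_def by (rule SUP_upper2[of "(x, x')"]) auto
      then have "norm (S x x' y) powr p \<le> enn2real (Q y)" 
        using enn2real_mono[of "ennreal (norm (S x x' y) powr p)" "Q y"] fin by simp
      then have "(norm (S x x' y) powr p) powr (1 / p) \<le> M y" unfolding M_def using p by (intro powr_mono2) auto
      then show "norm (S x x' y) \<le> M y" using p by (simp add: powr_powr)
    qed
  qed
  have Theta_ne: "\<Theta> \<noteq> {}"
  proof -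
    \<comment> \<open>Any value of \<open>S\<close> is in the domain of the M-step, whose value
      there is a point of \<Theta>.\<close>
    have "S undefined undefined undefined \<in> range (\<lambda>(x, x', y). S x x' y)"
      by (rule range_eqI[of _ _ "(undefined, undefined, undefined)"]) simp
    then have "S undefined undefined undefined \<in> Sset" by (intro subsetD[OF Sset(2)] hull_inc)
    then show ?thesis using M_step(2)[of "S undefined undefined undefined"] by (auto simp: is_arg_max_def)
  qed
  interpret prob_space P by (rule P)
  interpret hmm: expfam_hmm lam mu \<Theta> m g \<phi> \<psi> S \<sigma>1 \<sigma>2 M
  proof (intro expfam_hmm.intro finite_state_measure.intro finite_state_measure_axioms.intro expfam_hmm_axioms.intro)
    show "m \<theta> x x' * g \<theta> x' y = exp (\<phi> \<theta> + inner (S x x' y) (\<psi> \<theta>))" if "\<theta> \<in> \<Theta>" for \<theta> x x' y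
    proof -
      have "exp (ln (m \<theta> x x') + ln (g \<theta> x' y)) = m \<theta> x x' * g \<theta> x' y"
        unfolding exp_add using exp_family[OF that, of x x' y] by (simp del: exp_add)
      then show ?thesis using exp_family[OF that, of x x' y] by simp
    qed
    show "0 < g \<theta> x y" if "\<theta> \<in> \<Theta>" for \<theta> x y using exp_family[OF that, of x x y] by simp
  qed (use lam mu m_density g_density S_meas \<sigma> Theta_ne in auto)
  have good: "hmm.good y \<longleftrightarrow> Q y < \<infinity>" for y using good_iff by (simp add: hmm.good_def)
  have M0: "0 \<le> M y" for y by (simp add: M_def)
  have Mm [measurable]: "M \<in> borel_measurable mu" unfolding M_def[abs_def] by measurable
  interpret boem_algorithm P lam mu Y \<Theta> m g \<phi> \<psi> S \<sigma>1 \<sigma>2 M \<beta> p Sset \<theta>bar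
  proof (intro boem_algorithm.intro boem_model.intro mixing_process.intro observed_process.intro
      observed_process_axioms.intro mixing_process_axioms.intro boem_model_axioms.intro boem_algorithm_axioms.intro)
    show "mixing_coeff P mu Y n \<le> \<beta> ^ n" for n
    proof -
      have "C0 * \<beta> ^ n \<le> 1 * \<beta> ^ n" using beta_mixing(1-4) by (intro mult_right_mono) auto
      then show ?thesis using beta_mixing(5)[of n] by linarith
    qed
    show "{y. hmm.good y} \<in> sets mu"
    proof -
      have "{y \<in> space mu. Q y < \<infinity>} \<in> sets mu" by measurable
      then show ?thesis by (simp add: good mu(2))
    qed
    show "AE \<omega> in P. hmm.good (Y 0 \<omega>)"
    proof -
      have "AE \<omega> in P. Q (Y 0 \<omega>) \<noteq> \<infinity>"
        using moments(2) measurable_compose[OF Y Qm] by (intro nn_integral_PInf_AE) (auto simp: Q_def)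
      then show ?thesis by (simp add: good less_top)
    qed
    show "integrable P (\<lambda>\<omega>. M (Y 0 \<omega>) powr p)"
    proof (rule integrableI_bounded)
      have [measurable]: "(\<lambda>\<omega>. M (Y 0 \<omega>)) \<in> borel_measurable P" by (rule measurable_compose[OF Y Mm])
      show "(\<lambda>\<omega>. M (Y 0 \<omega>) powr p) \<in> borel_measurable P" by measurable
      have "(\<integral>\<^sup>+\<omega>. ennreal (norm (M (Y 0 \<omega>) powr p)) \<partial>P) \<le> (\<integral>\<^sup>+\<omega>. Q (Y 0 \<omega>) \<partial>P)"
        using p by (intro nn_integral_mono) (simp add: M_def powr_powr ennreal_enn2real_if)
      also have "\<dots> < \<infinity>" using moments(2) by (simp add: Q_def)
      finally show "(\<integral>\<^sup>+\<omega>. ennreal (norm (M (Y 0 \<omega>) powr p)) \<partial>P) < \<infinity>" .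
    qed
    show "interior ((\<lambda>\<theta>. exp (limit_loglik P Y lam m g \<theta>)) ` {\<theta> \<in> \<Theta>. \<theta>bar (mean_stat P Y lam m g S \<theta>) = \<theta>}) = {}"
      using W_L by (simp add: W_def[abs_def] L_def R_def)
  qed (use P Y beta_mixing p stationary Theta phi_psi Sset M_step Mm M0 hmm.expfam_hmm_axioms in auto)
  have R: "R = em" by (rule ext) (rule R_def)
  have L: "{\<theta> \<in> L. W \<theta> = w} = {\<theta> \<in> {\<theta> \<in> \<Theta>. em \<theta> = \<theta>}. lik \<theta> = w}" for w
    by (auto simp: L_def R W_def)
  show ?thesis
    unfolding L unfolding R
  proof (intro conjI ballI allI impI)
    show "\<exists>w. converges_to_set (\<lambda>k. (em ^^ k) \<theta>0) {\<theta> \<in> {\<theta> \<in> \<Theta>. em \<theta> = \<theta>}. lik \<theta> = w}" if "\<theta>0 \<in> \<Theta>" for \<theta>0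
      by (rule limiting_em_converges[OF that])
  next
    fix \<tau> \<nu> and N :: "nat \<Rightarrow> 'u measure" and U \<theta>s St
    let ?D = "\<lambda>n \<omega>. boem_stat Y lam m g S \<tau> \<nu> \<theta>s n \<omega> - St n \<omega>"
    assume run: "boem_run P mu Y lam \<Theta> Sset \<theta>bar \<tau> \<nu> N U \<theta>s St"
      and ex: "\<exists>c>0. \<exists>a>1. (\<forall>n\<ge>1. int (\<tau> n) = \<lfloor>c * real n powr a\<rfloor>) \<and>
          (\<exists>b\<ge>(a + 1) / (2 * a). (\<forall>n. integrable P (\<lambda>\<omega>. norm (?D n \<omega>) powr p)) \<and>
             (\<lambda>n. Lp_norm P p (?D n)) \<in> O(\<lambda>n. real (\<tau> (n + 1)) powr (- b)))"
    obtain c a b where c: "c > 0" "a > 1" "\<forall>n\<ge>1. int (\<tau> n) = \<lfloor>c * real n powr a\<rfloor>"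
      and b: "(a + 1) / (2 * a) \<le> b" "\<forall>n. integrable P (\<lambda>\<omega>. norm (?D n \<omega>) powr p)"
        "(\<lambda>n. Lp_norm P p (?D n)) \<in> O(\<lambda>n. real (\<tau> (n + 1)) powr (- b))"
      using ex by (elim exE conjE) (rule that; assumption)
    show "AE \<omega> in P. \<exists>w. converges_to_set (\<lambda>n. \<theta>s n \<omega>) {\<theta> \<in> {\<theta> \<in> \<Theta>. em \<theta> = \<theta>}. lik \<theta> = w}"
      by (rule boem_converges[OF run c(1,2) _ b(1) _ b(3)]) (use c(3) b(2) in blast)+
  qed
qed

end
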